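(* Assume $\phi\in L^2(\Omega)$ and conditions (S1), (S2), (F1), (F2) hold. Let $T>0$ and let $u$ be a weak solution of problem (P) on $[0,T]$. Set $$R=\sup_{0\le t\le T}\big(\|u(t)\|_6+\|u_t(t)\|\big)+\int_0^T\!\!\int_\Omega \sigma(u)u_t^2\,dx\,dt+1 .$$ Then $u\in L^{k+2}(0,T;L^{3k+6}(\Omega))$ and $$\|u\|_{L^{k+2}(0,T;L^{3k+6}(\Omega))}\le C\,(R^4T+R^5),$$ where the constant $C$ is independent of $u$ and of $T$.
   Context: Let $\Omega\subset\mathbb R^3$ be a bounded domain with smooth boundary and $\phi\in L^2(\Omega)$ independent of time. Problem (P) is: $u_{tt}+\sigma(u)u_t-\Delta u+f(u)=\phi$ in $(0,\infty)\times\Omega$, $u=0$ on $(0,\infty)\times\partial\Omega$, $u(0)=u_0$, $u_t(0)=u_1$ in $\Omega$. Assumptions: (S1) $\sigma\in C^1(\mathbb R)$ and $\sigma(s)\ge\sigma_0(1+|s|^r)>0$ for all $s$, with a constant $\sigma_0>0$; (S2) $|\sigma'(s)|\le c\,m|s|^{m-1}$ for $|s|\ge1$, where $0\le r\le m\le4$. (F1) $f\in C^2(\mathbb R)$, $f(0)=f'(0)=0$, $|f''(s)|\le c(1+|s|^{p-2})$ with $2\le p\le k+3$, where $k=\min\{r,4-m\}$; (F2) $\liminf_{|s|\to\infty}f(s)/s>-\lambda$, where $0<\lambda<\lambda_1$ and $\lambda_1$ is the first eigenvalue of $-\Delta$ with Dirichlet boundary condition on $\Omega$. Notation: $\|\cdot\|$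 is the $L^2(\Omega)$ norm, $\|\cdot\|_q$ the $L^q(\Omega)$ norm, $\mathcal H=H^1_0(\Omega)\times L^2(\Omega)$. Weak solution on $[0,T]$: a function $u$ with $(u,u_t)\in L^\infty(0,T;\mathcal H)$, $\sigma(u)|u_t|^2\in L^1((0,T)\times\Omega)$, and $\int_0^T\!\int_\Omega(-u_t\psi_t+\sigma(u)u_t\psi+\nabla u\cdot\nabla\psi+f(u)\psi)\,dx\,dt=\int_0^T\!\int_\Omega\phi\psi\,dx\,dt$ for all $\psi\in C_0^\infty((0,T)\times\Omega)$. *)

theory Defs
  imports "HOL-Analysis.Analysis" "HOL-Probability.Essential_Supremum"
begin

definition pd :: "'a::real_normed_vector \<Rightarrow> ('a \<Rightarrow> real) \<Rightarrow> 'a \<Rightarrow> real" where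
  "pd e psi x = deriv (\<lambda>s. psi (x + s *\<^sub>R e)) 0"

fun Ck :: "nat \<Rightarrow> ('a::euclidean_space \<Rightarrow> real) \<Rightarrow> bool" where
  "Ck 0 g = continuous_on UNIV g"
| "Ck (Suc n) g = (continuous_on UNIV g \<and>
     (\<forall>i\<in>Basis. \<exists>h. (\<forall>x. ((\<lambda>s. g (x + s *\<^sub>R i)) has_real_derivative h x) (at 0)) \<and> Ck n h))"

definition smooth :: "('a::euclidean_space \<Rightarrow> real) \<Rightarrow> bool" where
  "smooth g \<longleftrightarrow> (\<forall>n. Ck n g)"

definition tsupport :: "('a::real_normed_vector \<Rightarrow> real) \<Rightarrow> 'a set" where
  "tsupport g = closure {x. g x \<noteq> 0}"

definition test_fun :: "'a::euclidean_space set \<Rightarrow> ('a \<Rightarrow> real) \<Rightarrow> bool" where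
  "test_fun U g \<longleftrightarrow> smooth g \<and> compact (tsupport g) \<and> tsupport g \<subseteq> U"

(* bounded open set with C^\<infinity> boundary: locally, after a rigid motion, the subgraph of a smooth function *)
definition smooth_boundary :: "(real^3) set \<Rightarrow> bool" where
  "smooth_boundary \<Omega> \<longleftrightarrow> (\<forall>z\<in>frontier \<Omega>. \<exists>r>0. \<exists>A \<gamma>.
      orthogonal_transformation (A :: real^3 \<Rightarrow> real^3) \<and> smooth (\<gamma> :: real \<times> real \<Rightarrow> real) \<and>
      \<Omega> \<inter> ball z r = {x \<in> ball z r. (A (x - z)) $ 3 < \<gamma> ((A (x - z)) $ 1, (A (x - z)) $ 2)})"

definition grad3 :: "(real^3 \<Rightarrow> real) \<Rightarrow> real^3 \<Rightarrow> real^3" where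
  "grad3 g x = (\<chi> j. pd (axis j 1) g x)"

definition L2 :: "(real^3) set \<Rightarrow> (real^3 \<Rightarrow> real) \<Rightarrow> bool" where
  "L2 \<Omega> g \<longleftrightarrow> g \<in> borel_measurable (lebesgue_on \<Omega>) \<and> integrable (lebesgue_on \<Omega>) (\<lambda>x. (g x)^2)"

(* v \<in> H^1_0(\<Omega>) with weak gradient w: H^1-limit of C_0^\<infinity>(\<Omega>) functions *)
definition H10_grad :: "(real^3) set \<Rightarrow> (real^3 \<Rightarrow> real) \<Rightarrow> (real^3 \<Rightarrow> real^3) \<Rightarrow> bool" where
  "H10_grad \<Omega> v w \<longleftrightarrow> L2 \<Omega> v \<and> w \<in> borel_measurable (lebesgue_on \<Omega>) \<and>
     integrable (lebesgue_on \<Omega>) (\<lambda>x. (norm (w x))^2) \<and>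
     (\<exists>\<phi>s. (\<forall>n. test_fun \<Omega> (\<phi>s n)) \<and>
        (\<lambda>n. LINT x|lebesgue_on \<Omega>. (\<phi>s n x - v x)^2) \<longlonglongrightarrow> 0 \<and>
        (\<lambda>n. LINT x|lebesgue_on \<Omega>. (norm (grad3 (\<phi>s n) x - w x))^2) \<longlonglongrightarrow> 0)"

definition dirichlet_eigenvalue :: "(real^3) set \<Rightarrow> real \<Rightarrow> bool" where
  "dirichlet_eigenvalue \<Omega> \<mu> \<longleftrightarrow> (\<exists>v w. H10_grad \<Omega> v w \<and>
      (LINT x|lebesgue_on \<Omega>. (v x)^2) > 0 \<and>
      (\<forall>\<psi>. test_fun \<Omega> \<psi> \<longrightarrow>
         (LINT x|lebesgue_on \<Omega>. w x \<bullet> grad3 \<psi> x) = \<mu> * (LINT x|lebesgue_on \<Omega>. v x * \<psi> x)))"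

definition lambda1 :: "(real^3) set \<Rightarrow> real" where
  "lambda1 \<Omega> = Inf {\<mu>. dirichlet_eigenvalue \<Omega> \<mu>}"

definition cyl :: "real \<Rightarrow> (real^3) set \<Rightarrow> (real \<times> (real^3)) set" where
  "cyl T \<Omega> = {0<..<T} \<times> \<Omega>"

definition dt :: "(real \<times> (real^3) \<Rightarrow> real) \<Rightarrow> real \<times> (real^3) \<Rightarrow> real" where
  "dt \<psi> z = pd (1, 0) \<psi> z"

definition gradx :: "(real \<times> (real^3) \<Rightarrow> real) \<Rightarrow> real \<times> (real^3) \<Rightarrow> real^3" where
  "gradx \<psi> z = (\<chi> j. pd (0, axis j 1) \<psi> z)"

definition weak_dt :: "real \<Rightarrow> (real^3) set \<Rightarrow> (real \<Rightarrow> real^3 \<Rightarrow> real) \<Rightarrow> (real \<Rightarrow> real^3 \<Rightarrow> real) \<Rightarrow> bool" where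
  "weak_dt T \<Omega> u ut \<longleftrightarrow> (\<forall>\<psi>. test_fun (cyl T \<Omega>) \<psi> \<longrightarrow>
     (LINT z|lebesgue_on (cyl T \<Omega>). u (fst z) (snd z) * dt \<psi> z) =
     - (LINT z|lebesgue_on (cyl T \<Omega>). ut (fst z) (snd z) * \<psi> z))"

definition weak_solution :: "(real^3) set \<Rightarrow> (real \<Rightarrow> real) \<Rightarrow> (real \<Rightarrow> real) \<Rightarrow> (real^3 \<Rightarrow> real) \<Rightarrow> real
     \<Rightarrow> (real \<Rightarrow> real^3 \<Rightarrow> real) \<Rightarrow> (real \<Rightarrow> real^3 \<Rightarrow> real) \<Rightarrow> bool" where
  "weak_solution \<Omega> \<sigma> f \<phi> T u ut \<longleftrightarrow> (\<exists>gu :: real \<Rightarrow> real^3 \<Rightarrow> real^3.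
     (\<lambda>z. u (fst z) (snd z)) \<in> borel_measurable (lebesgue_on (cyl T \<Omega>)) \<and>
     (\<lambda>z. ut (fst z) (snd z)) \<in> borel_measurable (lebesgue_on (cyl T \<Omega>)) \<and>
     (\<lambda>z. gu (fst z) (snd z)) \<in> borel_measurable (lebesgue_on (cyl T \<Omega>)) \<and>
     weak_dt T \<Omega> u ut \<and>
     (AE t in lebesgue_on {0<..<T}. H10_grad \<Omega> (u t) (gu t) \<and> L2 \<Omega> (ut t)) \<and>
     (\<exists>M. AE t in lebesgue_on {0<..<T}.
        (LINT x|lebesgue_on \<Omega>. (u t x)^2 + (norm (gu t x))^2 + (ut t x)^2) \<le> M) \<and>
     integrable (lebesgue_on (cyl T \<Omega>)) (\<lambda>z. \<sigma> (u (fst z) (snd z)) * (ut (fst z) (snd z))^2) \<and>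
     (\<forall>\<psi>. test_fun (cyl T \<Omega>) \<psi> \<longrightarrow>
        (LINT z|lebesgue_on (cyl T \<Omega>).
            - ut (fst z) (snd z) * dt \<psi> z
            + \<sigma> (u (fst z) (snd z)) * ut (fst z) (snd z) * \<psi> z
            + gu (fst z) (snd z) \<bullet> gradx \<psi> z
            + f (u (fst z) (snd z)) * \<psi> z)
        = (LINT z|lebesgue_on (cyl T \<Omega>). \<phi> (snd z) * \<psi> z)))"

definition Lp_norm :: "real \<Rightarrow> (real^3) set \<Rightarrow> (real^3 \<Rightarrow> real) \<Rightarrow> real" where
  "Lp_norm q \<Omega> g = (LINT x|lebesgue_on \<Omega>. \<bar>g x\<bar> powr q) powr (1 / q)"

definition Rconst :: "(real^3) set \<Rightarrow> (real \<Rightarrow> real) \<Rightarrow> real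
     \<Rightarrow> (real \<Rightarrow> real^3 \<Rightarrow> real) \<Rightarrow> (real \<Rightarrow> real^3 \<Rightarrow> real) \<Rightarrow> real" where
  "Rconst \<Omega> \<sigma> T u ut =
     real_of_ereal (esssup (lebesgue_on {0..T}) (\<lambda>t. ereal (Lp_norm 6 \<Omega> (u t) + Lp_norm 2 \<Omega> (ut t))))
     + (LINT z|lebesgue_on (cyl T \<Omega>). \<sigma> (u (fst z) (snd z)) * (ut (fst z) (snd z))^2) + 1"

end

theory Submission imports Defs "HOL-Real_Asymp.Real_Asymp"
begin

text \<open>
  Test the equation with \<open>\<theta>(t) \<eta>(u)\<close>, where \<open>\<eta>'\<close> is a bounded truncation of \<open>(1 + u^2)^(k/2)\<close> and
  \<open>\<theta>\<close> is a cut-off in time. The kinetic term \<open>\<theta> \<eta>'(u) u_t^2\<close> is absorbed by the dissipation because \<open>k \<le> r\<close>;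
  the damping term is the time derivative of \<open>G(u)\<close> with \<open>G' = \<sigma> \<eta>\<close>, and \<open>G\<close> grows at most like the
  sixth power because \<open>m + k \<le> 4\<close>; the source term is controlled by the one-sided bound on \<open>f\<close>. What remains
  bounds the integral of \<open>(1 + u^2)^(k/2) |\<nabla>u|^2\<close> by a multiple of \<open>R^6 (1 + T)\<close>. The Sobolev inequality for
  a function of \<open>u\<close> growing like \<open>|u|^(k/2+1)\<close> turns this into a bound on the integral of
  \<open>\<parallel>u\<parallel>^(k+2)\<close> in the \<open>3k+6\<close> norm, and \<open>1/(k+2) \<le> 1/2\<close> gives the claimed powers of \<open>R\<close>.

  That \<open>\<theta> \<eta>(u)\<close> is an admissible test function is proved by mollifying in time only. For almost every \<open>x\<close> the
  solution is absolutely continuous in \<open>t\<close> with derivative \<open>u_t\<close>, and almost every time slice is a limit of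
  test functions, to which the chain rule applies.
\<close>

section \<open>Smooth functions and test functions\<close>

text \<open>The damping term \<sigma>(u) u_t is only known to be integrable: |u_t| <= u_t^2 + 1
  bounds it by the dissipation plus \<sigma>(u), and \<sigma>(u) by a multiple of 1 + u^6. A test
  function must therefore be bounded, and its gradient square integrable, which is why both \<eta>
  and \<eta>' are truncated. The truncation and the cut-off share one index n and are removed
  together by Fatou's lemma, as the bound on the weighted gradient is uniform in n. No second time
  derivative of u is ever formed. The weak equation in (t, x) is tested with a kernel centred at a
  time s, multiplied by \<theta>(s) \<eta>(u(s, x)), and then integrated over s. The derivative on
  the kernel is moved in s onto \<theta> \<eta>(u), where it becomes \<theta>' \<eta>(u) + \<theta>
  \<eta>'(u) u_t. What remains are mollified bilinear forms in functions of t and s, which converge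
  to integrals over the diagonal. The exponent 6 recurs because \<open>Rconst\<close> controls the
  sixth moment of u. Since k <= 2, both \<eta>(u)^2 and u \<eta>(u) stay within it. The product f(u)
  \<eta>(u) need not, so f may enter only through a one-sided bound.\<close>

lemma Ck_imp_continuous: "Ck n g \<Longrightarrow> continuous_on UNIV g"
  by (cases n) auto

lemma Ck_Suc_imp: "Ck (Suc n) g \<Longrightarrow> Ck n g"
proof (induction n arbitrary: g)
  case 0
  then show ?case by simp
next
  case (Suc n)
  show ?case
    unfolding Ck.simps(2)[of n]
  proof (intro conjI ballI)
    show "continuous_on UNIV g" using Suc.prems by simp
    fix i :: 'a assume "i \<in> Basis"
    then obtain h where h: "\<forall>x. ((\<lambda>s. g (x + s *\<^sub>R i)) has_real_derivative h x) (at 0)" "Ck (Suc n) h"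
      using Suc.prems unfolding Ck.simps(2)[of "Suc n"] by blast
    with Suc.IH[of h] show "\<exists>h. (\<forall>x. ((\<lambda>s. g (x + s *\<^sub>R i)) has_real_derivative h x) (at 0)) \<and> Ck n h"
      by blast
  qed
qed

lemma Ck_SucI:
  assumes "continuous_on UNIV g"
    and "\<And>i x. i \<in> Basis \<Longrightarrow> ((\<lambda>s. g (x + s *\<^sub>R i)) has_real_derivative h i x) (at 0)"
    and "\<And>i. i \<in> Basis \<Longrightarrow> Ck n (h i)"
  shows "Ck (Suc n) g"
  using assms by (auto simp del: )

lemma Ck_SucE:
  assumes "Ck (Suc n) g"
  obtains h where "continuous_on UNIV g"
    "\<And>i x. i \<in> Basis \<Longrightarrow> ((\<lambda>s. g (x + s *\<^sub>R i)) has_real_derivative h i x) (at 0)"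
    "\<And>i. i \<in> Basis \<Longrightarrow> Ck n (h i)"
proof -
  from assms have "\<forall>i\<in>Basis. \<exists>h. (\<forall>x. ((\<lambda>s. g (x + s *\<^sub>R i)) has_real_derivative h x) (at 0)) \<and> Ck n h"
    by simp
  then obtain h where "\<forall>i\<in>Basis. (\<forall>x. ((\<lambda>s. g (x + s *\<^sub>R i)) has_real_derivative h i x) (at 0)) \<and> Ck n (h i)"
    by (auto dest!: bchoice)
  with assms that[of h] show ?thesis by auto
qed

lemma Ck_const: "Ck n (\<lambda>x. c)"
proof (induction n arbitrary: c)
  case (Suc n)
  show ?case by (rule Ck_SucI[where h = "\<lambda>_ _. 0"]) (use Suc in auto)
qed simp

lemma Ck_linear: "bounded_linear L \<Longrightarrow> Ck n L"
proof (cases n)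
  case (Suc k)
  assume L: "bounded_linear L"
  interpret bounded_linear L by fact
  show ?thesis unfolding Suc
    by (rule Ck_SucI[where h = "\<lambda>i _. L i"])
      (auto simp: add scaleR Ck_const intro!: derivative_eq_intros linear_continuous_on L)
qed (simp add: linear_continuous_on)

lemma Ck_add: "Ck n f \<Longrightarrow> Ck n g \<Longrightarrow> Ck n (\<lambda>x. f x + g x)"
proof (induction n arbitrary: f g)
  case (Suc n)
  obtain f' where f: "continuous_on UNIV f"
    "\<And>i x. i \<in> Basis \<Longrightarrow> ((\<lambda>s. f (x + s *\<^sub>R i)) has_real_derivative f' i x) (at 0)"
    "\<And>i. i \<in> Basis \<Longrightarrow> Ck n (f' i)" using Ck_SucE[OF Suc.prems(1)] by metis
  obtain g' where g: "continuous_on UNIV g"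
    "\<And>i x. i \<in> Basis \<Longrightarrow> ((\<lambda>s. g (x + s *\<^sub>R i)) has_real_derivative g' i x) (at 0)"
    "\<And>i. i \<in> Basis \<Longrightarrow> Ck n (g' i)" using Ck_SucE[OF Suc.prems(2)] by metis
  show ?case
    by (rule Ck_SucI[where h = "\<lambda>i x. f' i x + g' i x"])
      (auto intro!: continuous_on_add f g DERIV_add Suc.IH)
qed (simp add: continuous_on_add)

lemma Ck_mult: "Ck n f \<Longrightarrow> Ck n g \<Longrightarrow> Ck n (\<lambda>x. f x * g x)"
proof (induction n arbitrary: f g)
  case (Suc n)
  obtain f' where f: "continuous_on UNIV f"
    "\<And>i x. i \<in> Basis \<Longrightarrow> ((\<lambda>s. f (x + s *\<^sub>R i)) has_real_derivative f' i x) (at 0)"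
    "\<And>i. i \<in> Basis \<Longrightarrow> Ck n (f' i)" using Ck_SucE[OF Suc.prems(1)] by metis
  obtain g' where g: "continuous_on UNIV g"
    "\<And>i x. i \<in> Basis \<Longrightarrow> ((\<lambda>s. g (x + s *\<^sub>R i)) has_real_derivative g' i x) (at 0)"
    "\<And>i. i \<in> Basis \<Longrightarrow> Ck n (g' i)" using Ck_SucE[OF Suc.prems(2)] by metis
  show ?case
  proof (rule Ck_SucI[where h = "\<lambda>i x. f' i x * g x + g' i x * f x"])
    fix i x :: 'a assume i: "i \<in> Basis"
    show "((\<lambda>s. f (x + s *\<^sub>R i) * g (x + s *\<^sub>R i)) has_real_derivative f' i x * g x + g' i x * f x) (at 0)"
      using DERIV_mult[OF f(2)[OF i, of x] g(2)[OF i, of x]] by simp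
    show "Ck n (\<lambda>x. f' i x * g x + g' i x * f x)"
      by (rule Ck_add[OF Suc.IH[OF f(3)[OF i] Ck_Suc_imp[OF Suc.prems(2)]]
            Suc.IH[OF g(3)[OF i] Ck_Suc_imp[OF Suc.prems(1)]]])
  qed (intro continuous_on_mult f g)
qed (simp add: continuous_on_mult)

text \<open>The only basis vector of the line is 1, so \<open>Ck\<close> reduces to ordinary
  derivatives, and differentiability already gives continuity. Antiderivatives and compositions are
  handled in this form.\<close>

lemma Ck_real_Suc:
  fixes g :: "real \<Rightarrow> real"
  shows "Ck (Suc n) g \<longleftrightarrow> (\<exists>h. (\<forall>x. (g has_real_derivative h x) (at x)) \<and> Ck n h)"
proof -
  have eq: "((\<lambda>s. g (x + s *\<^sub>R 1)) has_real_derivative d) (at 0) \<longleftrightarrow> (g has_real_derivative d) (at x)" for x d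
    using DERIV_shift[of g d 0 x] by (simp only: real_scaleR_def mult_1_right add.commute[of x] add_0_left)
  have c: "continuous_on UNIV g" if "\<forall>x. (g has_real_derivative h x) (at x)" for h
    using that DERIV_isCont continuous_at_imp_continuous_on by blast
  have "Ck (Suc n) g \<longleftrightarrow> continuous_on UNIV g \<and>
      (\<exists>h. (\<forall>x. (g has_real_derivative h x) (at x)) \<and> Ck n h)"
    by (simp only: Ck.simps Basis_real_def ball_simps eq simp_thms)
  with c show ?thesis by metis
qed

lemma Ck_compose:
  fixes g :: "real \<Rightarrow> real"
  shows "Ck n g \<Longrightarrow> Ck n f \<Longrightarrow> Ck n (\<lambda>x. g (f x))"
proof (induction n arbitrary: f g)
  case 0
  then show ?case by (auto intro: continuous_on_compose2)
next
  case (Suc n)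
  obtain f' where f: "continuous_on UNIV f"
    "\<And>i x. i \<in> Basis \<Longrightarrow> ((\<lambda>s. f (x + s *\<^sub>R i)) has_real_derivative f' i x) (at 0)"
    "\<And>i. i \<in> Basis \<Longrightarrow> Ck n (f' i)" using Ck_SucE[OF Suc.prems(2)] by metis
  obtain g' where g: "\<And>x. (g has_real_derivative g' x) (at x)" "Ck n g'"
    using Suc.prems(1) unfolding Ck_real_Suc by blast
  show ?case
  proof (rule Ck_SucI[where h = "\<lambda>i x. g' (f x) * f' i x"])
    show "continuous_on UNIV (\<lambda>x. g (f x))"
      using continuous_on_compose2[OF Ck_imp_continuous[OF Suc.prems(1)] f(1)] by simp
    fix i x :: 'a assume i: "i \<in> Basis"
    show "((\<lambda>s. g (f (x + s *\<^sub>R i))) has_real_derivative g' (f x) * f' i x) (at 0)"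
      using DERIV_chain2[OF g(1) f(2)[OF i, of x]] by simp
    show "Ck n (\<lambda>x. g' (f x) * f' i x)"
      by (rule Ck_mult[OF Suc.IH[OF g(2) Ck_Suc_imp[OF Suc.prems(2)]] f(3)[OF i]])
  qed
qed

text \<open>The induction has to vary the exponent, since differentiation lowers it by one;
  positivity of g keeps each of these powers differentiable.\<close>

lemma Ck_powr: "Ck n g \<Longrightarrow> (\<And>x. g x > 0) \<Longrightarrow> Ck n (\<lambda>x. g x powr a)"
proof (induction n arbitrary: a)
  case 0
  then have "continuous_on UNIV g" "\<And>x. g x \<noteq> 0" by (auto simp: less_imp_neq[symmetric])
  then show ?case by (simp add: continuous_on_powr)
next
  case (Suc n)
  obtain g' where g: "continuous_on UNIV g"
    "\<And>i x. i \<in> Basis \<Longrightarrow> ((\<lambda>s. g (x + s *\<^sub>R i)) has_real_derivative g' i x) (at 0)"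
    "\<And>i. i \<in> Basis \<Longrightarrow> Ck n (g' i)" using Ck_SucE[OF Suc.prems(1)] by metis
  show ?case
  proof (rule Ck_SucI[where h = "\<lambda>i x. (a * g x powr (a - 1)) * g' i x"])
    show "continuous_on UNIV (\<lambda>x. g x powr a)"
      using Suc.prems(2) by (intro continuous_intros g) (metis less_irrefl)
    fix i x :: 'a assume i: "i \<in> Basis"
    show "((\<lambda>s. g (x + s *\<^sub>R i) powr a) has_real_derivative (a * g x powr (a - 1)) * g' i x) (at 0)"
      using DERIV_fun_powr[OF g(2)[OF i, of x], of a] Suc.prems(2)[of x] by simp
    show "Ck n (\<lambda>x. a * g x powr (a - 1) * g' i x)"
      by (rule Ck_mult[OF Ck_mult[OF Ck_const Suc.IH[OF Ck_Suc_imp[OF Suc.prems(1)] Suc.prems(2)]] g(3)[OF i]])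
  qed
qed

text \<open>\<open>Ck_compose\<close> covers only an outer function of one real variable, so the
  projection onto the space variable needs its own induction. The tensor products in
  \<open>test_fun_product\<close> rely on it.\<close>

lemma Ck_snd: "Ck n g \<Longrightarrow> Ck n (\<lambda>z::'a::euclidean_space \<times> 'b::euclidean_space. g (snd z))"
proof (induction n arbitrary: g)
  case 0
  then have "continuous_on UNIV g" by simp
  then have "continuous_on UNIV (\<lambda>z::'a\<times>'b. g (snd z))"
    by (rule continuous_on_compose2) (auto intro: continuous_on_snd continuous_on_id)
  then show ?case by simp
next
  case (Suc n)
  obtain g' where g: "continuous_on UNIV g"
    "\<And>i x. i \<in> Basis \<Longrightarrow> ((\<lambda>s. g (x + s *\<^sub>R i)) has_real_derivative g' i x) (at 0)"
    "\<And>i. i \<in> Basis \<Longrightarrow> Ck n (g' i)" using Ck_SucE[OF Suc.prems(1)] by metis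
  show ?case
  \<comment> \<open>The second component of a basis vector of the product is 0 or a basis vector, so
    the derivative is 0 or a partial derivative of g.\<close>
  proof (rule Ck_SucI[where h = "\<lambda>i z. if snd i = 0 then 0 else g' (snd i) (snd z)"])
    show "continuous_on UNIV (\<lambda>z::'a\<times>'b. g (snd z))"
      by (rule continuous_on_compose2[OF g(1)]) (auto intro: continuous_on_snd continuous_on_id)
    fix i z :: "'a \<times> 'b" assume "i \<in> Basis"
    then show "((\<lambda>s. g (snd (z + s *\<^sub>R i))) has_real_derivative (if snd i = 0 then 0 else g' (snd i) (snd z))) (at 0)"
      using g(2)[of "snd i" "snd z"] by (auto simp: Basis_prod_def)
    show "Ck n (\<lambda>z::'a\<times>'b. if snd i = 0 then 0 else g' (snd i) (snd z))"
    proof (cases "snd i = 0")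
      case False
      then have "snd i \<in> Basis" using \<open>i \<in> Basis\<close> by (auto simp: Basis_prod_def)
      then show ?thesis using Suc.IH[OF g(3), of "snd i"] False by simp
    qed (simp add: Ck_const)
  qed
qed

lemma smooth_const: "smooth (\<lambda>x. c)"
  and smooth_linear: "bounded_linear L \<Longrightarrow> smooth L"
  and smooth_add: "smooth f \<Longrightarrow> smooth g \<Longrightarrow> smooth (\<lambda>x. f x + g x)"
  and smooth_mult: "smooth f \<Longrightarrow> smooth g \<Longrightarrow> smooth (\<lambda>x. f x * g x)"
  and smooth_compose: "smooth h \<Longrightarrow> smooth f \<Longrightarrow> smooth (\<lambda>x. h (f x))"
  and smooth_powr: "smooth f \<Longrightarrow> (\<And>x. f x > 0) \<Longrightarrow> smooth (\<lambda>x. f x powr a)"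
  and smooth_snd: "smooth k \<Longrightarrow> smooth (\<lambda>z::'c::euclidean_space \<times> 'd::euclidean_space. k (snd z))"
  by (auto simp: smooth_def Ck_const Ck_linear Ck_add Ck_mult Ck_compose Ck_powr Ck_snd)

lemma smooth_imp_continuous: "smooth g \<Longrightarrow> continuous_on UNIV g"
  using Ck_imp_continuous smooth_def by blast

section \<open>Partial derivatives, supports and test functions\<close>

lemma smooth_pd_deriv:
  assumes "smooth g" "i \<in> Basis"
  shows "((\<lambda>s. g (x + s *\<^sub>R i)) has_real_derivative pd i g x) (at 0)"
proof -
  have "Ck (Suc 0) g" using assms(1) by (auto simp: smooth_def simp del: Ck.simps)
  then obtain h where "\<And>x. ((\<lambda>s. g (x + s *\<^sub>R i)) has_real_derivative h x) (at 0)"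
    using assms(2) by (auto elim: Ck_SucE)
  then show ?thesis unfolding pd_def by (metis DERIV_imp_deriv)
qed

lemma smooth_pd:
  assumes "smooth g" "i \<in> Basis"
  shows "smooth (pd i g)"
  unfolding smooth_def
proof
  fix n
  have "Ck (Suc n) g" using assms(1) by (auto simp: smooth_def simp del: Ck.simps)
  then obtain h where h: "\<And>x. ((\<lambda>s. g (x + s *\<^sub>R i)) has_real_derivative h i x) (at 0)" "Ck n (h i)"
    using assms(2) by (metis Ck_SucE)
  have "h i = pd i g" by (rule ext) (rule DERIV_unique[OF h(1) smooth_pd_deriv[OF assms]])
  with h show "Ck n (pd i g)" by simp
qed

text \<open>The multipliers \<eta> and H, and the primitive P in \<open>ac_in_time\<close>, are
  given only through their derivatives; their smoothness comes from here.\<close>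

lemma smooth_antiderivative:
  fixes g :: "real \<Rightarrow> real"
  assumes "\<And>x. (g has_real_derivative h x) (at x)" "smooth h"
  shows "smooth g"
proof -
  have "Ck (Suc n) g" for n using assms by (auto simp only: Ck_real_Suc smooth_def)
  then show ?thesis unfolding smooth_def using Ck_Suc_imp by blast
qed

lemma smooth_real_deriv:
  fixes g :: "real \<Rightarrow> real"
  assumes "smooth g"
  shows "(g has_real_derivative deriv g x) (at x)" "smooth (deriv g)"
proof -
  have "Ck (Suc 0) g" using assms by (auto simp: smooth_def simp del: Ck.simps)
  then obtain h where h: "\<And>x. (g has_real_derivative h x) (at x)" unfolding Ck_real_Suc by blast
  have "deriv g = h" by (rule ext) (rule DERIV_imp_deriv[OF h])
  then show "(g has_real_derivative deriv g x) (at x)" for x using h by simp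
  note D = this
  have "pd 1 g = deriv g"
  proof
    fix x
    have "((\<lambda>s. g (x + s *\<^sub>R 1)) has_real_derivative deriv g x) (at 0)"
      using DERIV_shift[of g "deriv g x" 0 x] D[of x] by (simp add: add.commute)
    then show "pd 1 g x = deriv g x" unfolding pd_def by (rule DERIV_imp_deriv)
  qed
  then show "smooth (deriv g)" using smooth_pd[OF assms, of 1] by simp
qed

lemma tsupport_zero: "x \<notin> tsupport g \<Longrightarrow> g x = 0"
  using closure_subset[of "{x. g x \<noteq> 0}"] by (auto simp: tsupport_def)

lemma tsupport_mono: "(\<And>x. f x = 0 \<Longrightarrow> g x = 0) \<Longrightarrow> tsupport g \<subseteq> tsupport f"
  unfolding tsupport_def by (intro closure_mono) auto

lemma pd_zero_outside:
  assumes "x \<notin> tsupport g"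
  shows "pd i g x = 0"
proof -
  have "open (- tsupport g)" by (simp add: tsupport_def open_Compl)
  then obtain e where e: "e > 0" "ball x e \<subseteq> - tsupport g"
    using assms by (auto simp: open_contains_ball)
  have "eventually (\<lambda>s. x + s *\<^sub>R i \<in> ball x e) (nhds (0::real))"
  proof -
    have "((\<lambda>s. x + s *\<^sub>R i) \<longlongrightarrow> x + 0 *\<^sub>R i) (nhds (0::real))" by (intro tendsto_intros filterlim_ident)
    then show ?thesis using tendstoD[OF _ e(1)] by (auto simp: dist_commute)
  qed
  then have "eventually (\<lambda>s. g (x + s *\<^sub>R i) = 0) (nhds (0::real))"
    by eventually_elim (use e tsupport_zero in blast)
  then have "((\<lambda>s. g (x + s *\<^sub>R i)) has_real_derivative 0) (at 0)"
    by (subst DERIV_cong_ev[OF refl _ refl, where g = "\<lambda>_. 0"]) auto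
  then show ?thesis unfolding pd_def by (rule DERIV_imp_deriv)
qed

lemma tsupport_pd: "tsupport (pd i g) \<subseteq> tsupport g"
proof -
  have "{x. pd i g x \<noteq> 0} \<subseteq> tsupport g" using pd_zero_outside by blast
  then show ?thesis unfolding tsupport_def by (simp add: closure_minimal)
qed

lemma compact_tsupport:
  assumes "compact K" "tsupport g \<subseteq> K"
  shows "compact (tsupport g)"
proof -
  have "closed (tsupport g)" by (simp add: tsupport_def)
  then have "compact (K \<inter> tsupport g)" by (rule compact_Int_closed[OF assms(1)])
  then show ?thesis using assms(2) by (simp add: inf.absorb2)
qed

lemma test_fun_subsupport:
  "test_fun U f \<Longrightarrow> smooth g \<Longrightarrow> tsupport g \<subseteq> tsupport f \<Longrightarrow> test_fun U g"
  unfolding test_fun_def using compact_tsupport by blast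

lemma test_fun_pd: "test_fun U g \<Longrightarrow> i \<in> Basis \<Longrightarrow> test_fun U (pd i g)"
  using test_fun_subsupport smooth_pd tsupport_pd test_fun_def by metis

lemma test_fun_imp_smooth: "test_fun U g \<Longrightarrow> smooth g"
  by (simp add: test_fun_def)

lemma test_fun_outside: "test_fun U g \<Longrightarrow> x \<notin> U \<Longrightarrow> g x = 0"
  using tsupport_zero test_fun_def by blast

lemma test_fun_bounded:
  assumes "test_fun U g"
  obtains B where "B \<ge> 0" "\<And>x. \<bar>g x\<bar> \<le> B"
proof -
  have "compact (g ` tsupport g)"
    using assms by (intro compact_continuous_image) (auto simp: test_fun_def intro: continuous_on_subset smooth_imp_continuous)
  then obtain B where B: "\<And>x. x \<in> tsupport g \<Longrightarrow> \<bar>g x\<bar> \<le> B"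
    using compact_imp_bounded bounded_iff by (metis image_eqI real_norm_def)
  have "\<bar>g x\<bar> \<le> max 0 B" for x
    using B[of x] tsupport_zero[of x g] by (cases "x \<in> tsupport g") auto
  then show ?thesis using that[of "max 0 B"] by auto
qed

lemma test_fun_measurable [measurable_dest]: "test_fun U g \<Longrightarrow> g \<in> borel_measurable borel"
  by (intro borel_measurable_continuous_onI smooth_imp_continuous test_fun_imp_smooth)

lemma axis_Basis_real3: "axis j (1::real) \<in> (Basis :: (real^3) set)"
  by (auto simp: Basis_vec_def)

lemma grad3_nth [simp]: "grad3 g x $ j = pd (axis j 1) g x"
  by (simp add: grad3_def)

lemma test_fun_grad3_measurable [measurable_dest]:
  assumes "test_fun U g" shows "grad3 g \<in> borel_measurable borel"
proof (rule borel_measurable_euclidean_space[THEN iffD2], rule ballI)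
  fix i :: "real^3" assume "i \<in> Basis"
  then obtain j where "i = axis j 1" by (auto simp: Basis_vec_def)
  then have "(\<lambda>x. grad3 g x \<bullet> i) = pd (axis j 1) g" by (auto simp: inner_axis)
  then show "(\<lambda>x. grad3 g x \<bullet> i) \<in> borel_measurable borel"
    using test_fun_pd[OF assms axis_Basis_real3] by (simp add: test_fun_measurable)
qed

lemma norm_grad3_sq: "(norm (w::real^3))\<^sup>2 = (\<Sum>j\<in>UNIV. (w $ j)\<^sup>2)"
  by (simp add: norm_vec_def L2_set_def sum_nonneg)

lemma test_fun_grad3_bounded:
  assumes "test_fun U g"
  obtains B where "B \<ge> 0" "\<And>x. norm (grad3 g x) \<le> B"
proof -
  have "\<exists>B. \<forall>x. \<bar>pd (axis j 1) g x\<bar> \<le> B" for j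
    using test_fun_bounded[OF test_fun_pd[OF assms axis_Basis_real3]] by metis
  then obtain B where B: "\<And>j x. \<bar>pd (axis j 1) g x\<bar> \<le> B j" by metis
  have "norm (grad3 g x) \<le> (\<Sum>j\<in>UNIV. B j)" for x
    using norm_le_l1_cart[of "grad3 g x"] sum_mono[of UNIV "\<lambda>j. \<bar>grad3 g x $ j\<bar>" B] B
    by simp
  moreover have "0 \<le> (\<Sum>j\<in>UNIV. B j)" using B by (intro sum_nonneg) (meson abs_ge_zero order_trans)
  ultimately show ?thesis using that by blast
qed

lemma grad3_outside: "x \<notin> tsupport g \<Longrightarrow> grad3 g x = 0"
  by (simp add: vec_eq_iff pd_zero_outside)

text \<open>The condition \<open>h 0 = 0\<close> keeps the composite zero off the support of g. In
  this way nonlinear functions of the approximants of u remain admissible.\<close>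

lemma test_fun_compose:
  fixes h :: "real \<Rightarrow> real" and g :: "real^3 \<Rightarrow> real"
  assumes g: "test_fun U g" and h: "smooth h" "h 0 = 0"
  shows "test_fun U (\<lambda>x. h (g x))" "grad3 (\<lambda>x. h (g x)) x = deriv h (g x) *\<^sub>R grad3 g x"
proof -
  show "test_fun U (\<lambda>x. h (g x))"
    by (rule test_fun_subsupport[OF g smooth_compose[OF h(1) test_fun_imp_smooth[OF g]] tsupport_mono])
      (simp add: h(2))
  have "pd i (\<lambda>x. h (g x)) x = deriv h (g x) * pd i g x" if i: "i \<in> Basis" for i
  proof -
    have 1: "((\<lambda>s. g (x + s *\<^sub>R i)) has_real_derivative pd i g x) (at 0)"
      by (rule smooth_pd_deriv[OF test_fun_imp_smooth[OF g] i])
    have 2: "(h has_real_derivative deriv h (g x)) (at (g (x + 0 *\<^sub>R i)))"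
      using smooth_real_deriv(1)[OF h(1)] by simp
    have "((\<lambda>s. h (g (x + s *\<^sub>R i))) has_real_derivative deriv h (g x) * pd i g x) (at 0)"
      by (rule DERIV_chain2[OF 2 1])
    then show ?thesis unfolding pd_def[of _ "\<lambda>x. h (g x)"] by (rule DERIV_imp_deriv)
  qed
  then show "grad3 (\<lambda>x. h (g x)) x = deriv h (g x) *\<^sub>R grad3 g x"
    by (simp add: vec_eq_iff axis_Basis_real3)
qed

text \<open>The weak equation is only ever tested with tensor products. They keep the mollification
  in time apart from the approximation in space.\<close>

lemma test_fun_product:
  fixes \<rho> :: "real \<Rightarrow> real" and \<zeta> :: "real^3 \<Rightarrow> real"
  assumes \<rho>: "test_fun {0<..<T} \<rho>" and \<zeta>: "test_fun \<Omega> \<zeta>"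
  defines "\<psi> \<equiv> \<lambda>z. \<rho> (fst z) * \<zeta> (snd z)"
  shows "test_fun (cyl T \<Omega>) \<psi>" "dt \<psi> (t, x) = deriv \<rho> t * \<zeta> x" "gradx \<psi> (t, x) = \<rho> t *\<^sub>R grad3 \<zeta> x"
proof -
  have sm: "smooth \<psi>" unfolding \<psi>_def
    by (rule smooth_mult[OF smooth_compose[OF test_fun_imp_smooth[OF \<rho>] smooth_linear[OF bounded_linear_fst]]
          smooth_snd[OF test_fun_imp_smooth[OF \<zeta>]]])
  have sub: "tsupport \<psi> \<subseteq> tsupport \<rho> \<times> tsupport \<zeta>"
    unfolding tsupport_def closure_Times[symmetric] by (rule closure_mono) (auto simp: \<psi>_def)
  have "compact (tsupport \<rho> \<times> tsupport \<zeta>)" using \<rho> \<zeta> by (auto simp: test_fun_def intro: compact_Times)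
  then have "compact (tsupport \<psi>)" using sub by (rule compact_tsupport)
  moreover have "tsupport \<psi> \<subseteq> cyl T \<Omega>"
    using sub \<rho> \<zeta> unfolding test_fun_def cyl_def by blast
  ultimately show "test_fun (cyl T \<Omega>) \<psi>" using sm by (simp add: test_fun_def)
  have "((\<lambda>s. \<rho> (t + s)) has_real_derivative deriv \<rho> t) (at 0)"
    using DERIV_shift[of \<rho> "deriv \<rho> t" 0 t] smooth_real_deriv(1)[OF test_fun_imp_smooth[OF \<rho>], of t]
    by (simp add: add.commute)
  then have "((\<lambda>s. \<psi> ((t, x) + s *\<^sub>R (1, 0))) has_real_derivative deriv \<rho> t * \<zeta> x) (at 0)"
    unfolding \<psi>_def by (auto intro!: derivative_eq_intros)
  then show "dt \<psi> (t, x) = deriv \<rho> t * \<zeta> x" unfolding dt_def pd_def by (rule DERIV_imp_deriv)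
  have "pd (0, axis j 1) \<psi> (t, x) = \<rho> t * pd (axis j 1) \<zeta> x" for j
  proof -
    have "((\<lambda>s. \<psi> ((t, x) + s *\<^sub>R (0, axis j 1))) has_real_derivative \<rho> t * pd (axis j 1) \<zeta> x) (at 0)"
      unfolding \<psi>_def
      using DERIV_cmult[OF smooth_pd_deriv[OF test_fun_imp_smooth[OF \<zeta>] axis_Basis_real3], of "\<rho> t" x j]
      by simp
    then show ?thesis unfolding pd_def[of _ \<psi>] by (rule DERIV_imp_deriv)
  qed
  then show "gradx \<psi> (t, x) = \<rho> t *\<^sub>R grad3 \<zeta> x" by (simp add: vec_eq_iff gradx_def)
qed

subsection \<open>Bump functions\<close>

text \<open>Dividing by powers of x makes the family of flat functions closed under differentiation,
  up to linear combinations; the case j = 0 is the classical exp(-1/x).\<close>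

definition expbump :: "nat \<Rightarrow> real \<Rightarrow> real" where
  "expbump j x = (if x > 0 then exp (- 1 / x) / x ^ j else 0)"

text \<open>The substitution y = 1/x turns the right-hand limit into that of y^j / exp y at
  infinity.\<close>

lemma expbump_tendsto_0: "((\<lambda>x. expbump j x) \<longlongrightarrow> 0) (at 0)"
proof -
  have 1: "((\<lambda>x. expbump j x) \<longlongrightarrow> 0) (at_left 0)"
    by (rule tendsto_eventually) (auto simp: eventually_at_filter expbump_def)
  have "((\<lambda>x::real. x ^ j / exp x) \<longlongrightarrow> 0) at_top" by (rule tendsto_power_div_exp_0)
  then have "((\<lambda>x::real. inverse x ^ j / exp (inverse x)) \<longlongrightarrow> 0) (at_right 0)"
    by (rule filterlim_compose[OF _ filterlim_inverse_at_top_right])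
  moreover have "eventually (\<lambda>x::real. inverse x ^ j / exp (inverse x) = expbump j x) (at_right 0)"
    using eventually_at_right_less[of "0::real"]
    by eventually_elim (auto simp: expbump_def exp_minus field_simps)
  ultimately have 2: "((\<lambda>x. expbump j x) \<longlongrightarrow> 0) (at_right 0)" by (rule Lim_transform_eventually)
  show ?thesis using 1 2 by (simp add: filterlim_at_split)
qed

lemma expbump_deriv:
  "(expbump j has_real_derivative (expbump (j + 2) x - real j * expbump (j + 1) x)) (at x)"
proof -
  consider "x > 0" | "x < 0" | "x = 0" by linarith
  then show ?thesis
  proof cases
    case 1
    have "((\<lambda>x. exp (- 1 / x) / x ^ j) has_real_derivative (expbump (j + 2) x - real j * expbump (j + 1) x)) (at x)"
    proof (rule DERIV_cong)
      have "((\<lambda>x. exp (- 1 / x)) has_real_derivative exp (- 1 / x) * (1 / x\<^sup>2)) (at x)"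
        using 1 by (auto intro!: derivative_eq_intros simp: power2_eq_square)
      then show "((\<lambda>x. exp (- 1 / x) / x ^ j) has_real_derivative
          ((exp (- 1 / x) * (1 / x\<^sup>2)) * x ^ j - exp (- 1 / x) * (real j * x ^ (j - 1))) / (x ^ j * x ^ j)) (at x)"
        using 1 DERIV_pow[of j x] by (intro DERIV_divide) auto
      show "((exp (- 1 / x) * (1 / x\<^sup>2)) * x ^ j - exp (- 1 / x) * (real j * x ^ (j - 1))) / (x ^ j * x ^ j)
          = expbump (j + 2) x - real j * expbump (j + 1) x"
        using 1 by (cases j) (simp_all add: expbump_def field_simps power2_eq_square)
    qed
    moreover have "eventually (\<lambda>y. expbump j y = exp (- 1 / y) / y ^ j) (nhds x)"
      using eventually_nhds_in_open[of "{0<..}" x] 1 by (auto simp: expbump_def elim!: eventually_mono)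
    ultimately show ?thesis by (simp add: DERIV_cong_ev)
  next
    case 2
    have "eventually (\<lambda>y. expbump j y = 0) (nhds x)"
      using eventually_nhds_in_open[of "{..<0}" x] 2 by (auto simp: expbump_def elim!: eventually_mono)
    then have "(expbump j has_real_derivative 0) (at x)" by (subst DERIV_cong_ev[OF refl _ refl, where g = "\<lambda>_. 0"]) auto
    then show ?thesis using 2 by (simp add: expbump_def)
  next
    case 3
    \<comment> \<open>Since \<open>expbump j 0 = 0\<close>, the difference quotient at the origin is
      again a member of the family, with index j + 1.\<close>
    have "((\<lambda>h. (expbump j h - expbump j 0) / h) \<longlongrightarrow> 0) (at 0)"
    proof (rule Lim_transform_eventually[OF expbump_tendsto_0[of "Suc j"]])
      show "eventually (\<lambda>h. expbump (Suc j) h = (expbump j h - expbump j 0) / h) (at 0)"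
        by (auto simp: expbump_def eventually_at_filter)
    qed
    then show ?thesis using 3 by (simp add: DERIV_def expbump_def)
  qed
qed

lemma smooth_expbump: "smooth (expbump j)"
proof -
  have "Ck n (expbump j)" for n j
  proof (induction n arbitrary: j)
    case 0
    have "continuous_on UNIV (expbump j)"
      by (rule continuous_at_imp_continuous_on) (use DERIV_isCont[OF expbump_deriv] in blast)
    then show ?case by simp
  next
    case (Suc n)
    have "Ck n (\<lambda>x. expbump (j + 2) x + (- real j) * expbump (j + 1) x)"
      by (intro Ck_add Ck_mult Ck_const Suc)
    then show ?case using expbump_deriv unfolding Ck_real_Suc
      by (intro exI[of _ "\<lambda>x. expbump (j + 2) x + (- real j) * expbump (j + 1) x"]) auto
  qed
  then show ?thesis by (simp add: smooth_def)
qed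

lemma expbump_nonneg: "expbump j x \<ge> 0" by (simp add: expbump_def)
lemma expbump_le_1: "expbump 0 x \<le> 1" by (simp add: expbump_def)

text \<open>The steepness k leaves the support unchanged; as k grows, the bump tends to the
  indicator of the open interval.\<close>

definition bump :: "real \<Rightarrow> real \<Rightarrow> real \<Rightarrow> real \<Rightarrow> real" where
  "bump k a b t = expbump 0 (k * (t - a)) * expbump 0 (k * (b - t))"

lemma smooth_affine: "smooth (\<lambda>t::real. c * t + d)"
  by (intro smooth_add smooth_const smooth_linear bounded_linear_mult_right)

lemma smooth_bump: "smooth (bump k a b)"
proof -
  have "smooth (\<lambda>t. expbump 0 (k * t + (- k * a)) * expbump 0 (- k * t + k * b))"
    by (intro smooth_mult smooth_compose[OF smooth_expbump] smooth_affine)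
  also have "(\<lambda>t. expbump 0 (k * t + (- k * a)) * expbump 0 (- k * t + k * b)) = bump k a b"
    by (auto simp: bump_def algebra_simps)
  finally show ?thesis .
qed

lemma bump_nonneg: "bump k a b t \<ge> 0" by (simp add: bump_def expbump_nonneg)
lemma bump_le_1: "bump k a b t \<le> 1"
  unfolding bump_def by (intro mult_le_one expbump_nonneg expbump_le_1)
lemma bump_zero: "k > 0 \<Longrightarrow> t \<notin> {a<..<b} \<Longrightarrow> bump k a b t = 0"
  by (auto simp: bump_def expbump_def zero_less_mult_iff)
lemma bump_pos: "k > 0 \<Longrightarrow> t \<in> {a<..<b} \<Longrightarrow> bump k a b t > 0"
  by (auto simp: bump_def expbump_def)

lemma tsupport_bump:
  assumes "k > 0"
  shows "tsupport (bump k a b) \<subseteq> {a..b}"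
proof -
  have "t \<in> {a..b}" if "bump k a b t \<noteq> 0" for t
    using bump_zero[OF assms, of t a b] that by fastforce
  then show ?thesis unfolding tsupport_def by (intro closure_minimal) auto
qed

lemma test_fun_bump: "k > 0 \<Longrightarrow> {a..b} \<subseteq> U \<Longrightarrow> test_fun U (bump k a b)"
  unfolding test_fun_def using smooth_bump tsupport_bump compact_tsupport[OF compact_Icc] by blast

lemma bump_tendsto_indicator:
  "(\<lambda>n. bump (real (Suc n)) a b t) \<longlonglongrightarrow> indicator {a<..<b} t"
proof (cases "t \<in> {a<..<b}")
  case True
  have *: "(\<lambda>n. expbump 0 (real (Suc n) * c)) \<longlonglongrightarrow> 1" if "c > 0" for c
  proof -
    have "(\<lambda>n. exp (- 1 / c * inverse (real (Suc n)))) \<longlonglongrightarrow> exp (- 1 / c * 0)"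
      by (intro tendsto_intros LIMSEQ_inverse_real_of_nat)
    moreover have "expbump 0 (real (Suc n) * c) = exp (- 1 / c * inverse (real (Suc n)))" for n
      using that by (simp add: expbump_def field_simps del: of_nat_Suc)
    ultimately show ?thesis by simp
  qed
  have "(\<lambda>n. bump (real (Suc n)) a b t) \<longlonglongrightarrow> 1 * 1"
    unfolding bump_def using True by (intro tendsto_mult *) auto
  then show ?thesis using True by simp
qed (simp add: bump_zero)

section \<open>Approximation and mollification on the line\<close>

text \<open>For an indicator, regularity of the measure encloses the set between a closed and an
  open set, and a Urysohn function between them is wrong only on two thin layers. Sums and dominated
  limits then follow by induction over integrable functions.\<close>

lemma dense_L1:
  fixes f :: "'a::euclidean_space \<Rightarrow> real"
  assumes "integrable lborel f" "e > 0"
  shows "\<exists>g. continuous_on UNIV g \<and> integrable lborel g \<and> (LINT x|lborel. \<bar>f x - g x\<bar>) < e"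
  using assms
proof (induction arbitrary: e rule: integrable_induct)
  case (base A c)
  \<comment> \<open>Each of the two layers costs |c| d; the summand 1 allows c = 0 and makes the
    final inequality strict.\<close>
  define d where "d = e / (2 * (\<bar>c\<bar> + 1))"
  have d: "d > 0" using base.prems by (simp add: d_def)
  have A[measurable]: "A \<in> sets borel" using base.hyps by simp
  then have AL: "A \<in> sets lebesgue" by simp
  obtain T where T: "open T" "A \<subseteq> T" "emeasure lebesgue (T - A) < ennreal d"
    using sets_lebesgue_outer_open[OF AL d] by metis
  obtain F where F: "closed F" "F \<subseteq> A" "emeasure lebesgue (A - F) < ennreal d"
    using sets_lebesgue_inner_closed[OF AL d] by metis
  have [measurable]: "T \<in> sets borel" "F \<in> sets borel" using T F by auto
  obtain g :: "'a \<Rightarrow> real" where g: "continuous_on UNIV g" "\<And>x. g x \<in> closed_segment 0 1"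
    "\<And>x. x \<in> - T \<Longrightarrow> g x = 0" "\<And>x. x \<in> F \<Longrightarrow> g x = 1"
  proof (rule Urysohn[of "- T" F "0::real" 1])
    show "closed (- T)" "closed F" "- T \<inter> F = {}" using T F by auto
  qed blast
  have g01: "0 \<le> g x" "g x \<le> 1" for x using g(2)[of x] by (auto simp: closed_segment_eq_real_ivl)
  have [measurable]: "g \<in> borel_measurable borel" using g(1) by (rule borel_measurable_continuous_onI)
  have m1: "emeasure lborel (T - A) < ennreal d" "emeasure lborel (A - F) < ennreal d"
    using T(3) F(3) by auto
  then have mfin: "emeasure lborel (T - A) < \<infinity>" "emeasure lborel (A - F) < \<infinity>"
    by (auto simp: less_top[symmetric] top_unique)
  have i: "integrable lborel (indicator A :: 'a \<Rightarrow> real)" "integrable lborel (indicator (T - A) :: 'a \<Rightarrow> real)"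
     "integrable lborel (indicator (A - F) :: 'a \<Rightarrow> real)"
    using mfin base.hyps by (auto intro!: integrable_real_indicator)
  have ig: "integrable lborel g"
    by (rule Bochner_Integration.integrable_bound[OF Bochner_Integration.integrable_add[OF i(1,2)]])
      (use g01 g(3) T(2) in \<open>auto simp: indicator_def\<close>)
  have mm: "measure lborel (T - A) \<le> d" "measure lborel (A - F) \<le> d"
    using m1 d by (auto simp: measure_def intro!: enn2real_leI)
  have "(LINT x|lborel. \<bar>indicator A x *\<^sub>R c - c * g x\<bar>)
      \<le> (LINT x|lborel. \<bar>c\<bar> * (indicator (T - A) x + indicator (A - F) x))"
  proof (rule integral_mono)
    show "integrable lborel (\<lambda>x. \<bar>indicator A x *\<^sub>R c - c * g x\<bar>)" using ig i by auto
    show "integrable lborel (\<lambda>x. \<bar>c\<bar> * (indicator (T - A) x + indicator (A - F) x))" using i by auto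
    fix x
    have "\<bar>indicator A x - g x\<bar> \<le> indicator (T - A) x + indicator (A - F) x"
      using g01[of x] g(3,4)[of x] T(2) F(2) by (auto simp: indicator_def)
    then have "\<bar>c\<bar> * \<bar>indicator A x - g x\<bar> \<le> \<bar>c\<bar> * (indicator (T - A) x + indicator (A - F) x)"
      by (intro mult_left_mono) auto
    moreover have "indicator A x *\<^sub>R c - c * g x = c * (indicator A x - g x)" by (simp add: algebra_simps)
    ultimately show "\<bar>indicator A x *\<^sub>R c - c * g x\<bar> \<le> \<bar>c\<bar> * (indicator (T - A) x + indicator (A - F) x)"
      by (simp only: abs_mult)
  qed
  also have "\<dots> = \<bar>c\<bar> * (measure lborel (T - A) + measure lborel (A - F))"
    using i by simp
  also have "\<dots> \<le> \<bar>c\<bar> * (2 * d)" using mm by (intro mult_left_mono) auto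
  also have "\<dots> = e * (\<bar>c\<bar> / (\<bar>c\<bar> + 1))" by (simp add: d_def field_simps)
  also have "\<dots> < e * 1" using base.prems by (intro mult_strict_left_mono) (auto simp: field_simps)
  finally show ?case
    using ig g(1) by (intro exI[of _ "\<lambda>x. c * g x"]) (auto intro!: continuous_intros)
next
  case (add f g)
  obtain f' where f': "continuous_on UNIV f'" "integrable lborel f'" "(LINT x|lborel. \<bar>f x - f' x\<bar>) < e/2"
    using add.IH(1)[of "e/2"] add.prems by auto
  obtain g' where g': "continuous_on UNIV g'" "integrable lborel g'" "(LINT x|lborel. \<bar>g x - g' x\<bar>) < e/2"
    using add.IH(2)[of "e/2"] add.prems by auto
  have "(LINT x|lborel. \<bar>f x + g x - (f' x + g' x)\<bar>) \<le> (LINT x|lborel. \<bar>f x - f' x\<bar> + \<bar>g x - g' x\<bar>)"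
    using f' g' add.hyps by (intro integral_mono) auto
  also have "\<dots> < e" using f' g' add.hyps by (subst Bochner_Integration.integral_add) auto
  finally show ?case using f' g' by (intro exI[of _ "\<lambda>x. f' x + g' x"]) (auto intro!: continuous_intros)
next
  case (lim f s)
  note [measurable] = lim(4,5)
  have "(\<lambda>i. LINT x|lborel. \<bar>f x - s i x\<bar>) \<longlonglongrightarrow> (LINT x|(lborel::'a measure). 0)"
  proof (rule integral_dominated_convergence[where w = "\<lambda>x. 3 * \<bar>f x\<bar>"])
    show "AE x in lborel. (\<lambda>i. \<bar>f x - s i x\<bar>) \<longlonglongrightarrow> 0"
    proof (rule AE_I2)
      fix x
      have "(\<lambda>i. f x - s i x) \<longlonglongrightarrow> f x - f x" by (intro tendsto_intros lim(2)) simp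
      then show "(\<lambda>i. \<bar>f x - s i x\<bar>) \<longlonglongrightarrow> 0" by (intro tendsto_rabs_zero) simp
    qed
    show "AE x in lborel. norm \<bar>f x - s i x\<bar> \<le> 3 * \<bar>f x\<bar>" for i
    proof (rule AE_I2)
      fix x show "norm \<bar>f x - s i x\<bar> \<le> 3 * \<bar>f x\<bar>" using lim(3)[of x i] by auto
    qed
  qed (use lim in auto)
  then have "eventually (\<lambda>i. (LINT x|lborel. \<bar>f x - s i x\<bar>) < e / 2) sequentially"
    using lim.prems by (intro order_tendstoD(2)) auto
  then obtain i where i: "(LINT x|lborel. \<bar>f x - s i x\<bar>) < e / 2"
    using eventually_happens by fastforce
  obtain g where g: "continuous_on UNIV g" "integrable lborel g" "(LINT x|lborel. \<bar>s i x - g x\<bar>) < e/2"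
    using lim.IH[of "e/2" i] lim.prems by auto
  have "(LINT x|lborel. \<bar>f x - g x\<bar>) \<le> (LINT x|lborel. \<bar>f x - s i x\<bar> + \<bar>s i x - g x\<bar>)"
    using g lim.hyps by (intro integral_mono) auto
  also have "\<dots> < e" using g i lim.hyps by (subst Bochner_Integration.integral_add) auto
  finally show ?case using g by blast
qed

text \<open>Truncation at height M reduces this to density in L^1: two functions bounded by M
  satisfy |g - h|^2 <= 2 M |g - h|, and clipping the approximant at the same height does not
  increase the distance.\<close>

lemma dense_L2:
  fixes f :: "'a::euclidean_space \<Rightarrow> real"
  assumes f: "integrable lborel f" "integrable lborel (\<lambda>x. (f x)\<^sup>2)" and e: "e > 0"
  obtains g B where "continuous_on UNIV g" "\<And>x. \<bar>g x\<bar> \<le> B" "integrable lborel g" "integrable lborel (\<lambda>x. (g x)\<^sup>2)"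
    "(LINT x|lborel. (f x - g x)\<^sup>2) < e"
proof -
  define cl where "cl M y = max (- M) (min M y)" for M y :: real
  have cl: "\<bar>y - cl M y\<bar> \<le> \<bar>y\<bar>" "\<bar>cl M y\<bar> \<le> M" "\<bar>cl M y\<bar> \<le> \<bar>y\<bar>" "\<bar>cl M y - cl M z\<bar> \<le> \<bar>y - z\<bar>" if "M \<ge> 0" for M y z
    using that by (auto simp: cl_def)
  have [measurable]: "f \<in> borel_measurable borel" using f by auto
  have "(\<lambda>n. LINT x|lborel. (f x - cl (real n) (f x))\<^sup>2) \<longlonglongrightarrow> (LINT x|(lborel::'a measure). 0)"
  proof (rule integral_dominated_convergence[where w = "\<lambda>x. (f x)\<^sup>2"])
    show "AE x in lborel. (\<lambda>n. (f x - cl (real n) (f x))\<^sup>2) \<longlonglongrightarrow> 0"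
    proof (rule AE_I2)
      fix x
      have "\<forall>\<^sub>F n in sequentially. real n \<ge> \<bar>f x\<bar>"
        using real_arch_simple[of "\<bar>f x\<bar>"] eventually_sequentially by (meson le_trans of_nat_mono order_trans)
      then have "\<forall>\<^sub>F n in sequentially. (f x - cl (real n) (f x))\<^sup>2 = 0"
        by eventually_elim (auto simp: cl_def)
      then show "(\<lambda>n. (f x - cl (real n) (f x))\<^sup>2) \<longlonglongrightarrow> 0" by (rule tendsto_eventually)
    qed
    show "AE x in lborel. norm ((f x - cl (real n) (f x))\<^sup>2) \<le> (f x)\<^sup>2" for n
      using cl(1) by (auto simp: abs_le_square_iff[symmetric])
  qed (use f in \<open>auto simp: cl_def\<close>)
  then have "\<forall>\<^sub>F n in sequentially. (LINT x|lborel. (f x - cl (real n) (f x))\<^sup>2) < e / 4"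
    using e by (intro order_tendstoD(2)) auto
  then obtain n where n: "(LINT x|lborel. (f x - cl (real n) (f x))\<^sup>2) < e / 4" "n \<ge> 1"
    using eventually_happens[OF eventually_conj[OF _ eventually_ge_at_top[of 1]]] by fastforce
  define M where "M = real n"
  have M: "M \<ge> 1" using n by (simp add: M_def)
  \<comment> \<open>This error is later multiplied by 4 M and contributes e/4, while the truncation
    error enters twice with e/4.\<close>
  obtain g0 where g0: "continuous_on UNIV g0" "integrable lborel g0" "(LINT x|lborel. \<bar>f x - g0 x\<bar>) < e / (16 * M)"
    using dense_L1[OF f(1), of "e / (16 * M)"] e M by auto
  define g where "g x = cl M (g0 x)" for x
  have gc: "continuous_on UNIV g" unfolding g_def cl_def using g0(1) by (intro continuous_intros)
  have [measurable]: "g \<in> borel_measurable borel" "g0 \<in> borel_measurable borel"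
    using gc g0(1) by (auto intro: borel_measurable_continuous_onI)
  have gB: "\<bar>g x\<bar> \<le> M" for x using cl M by (simp add: g_def)
  have ig: "integrable lborel g"
    by (rule Bochner_Integration.integrable_bound[OF g0(2)]) (use cl(3) M in \<open>auto simp: g_def\<close>)
  have ig2: "integrable lborel (\<lambda>x. (g x)\<^sup>2)"
  proof (rule Bochner_Integration.integrable_bound[OF Bochner_Integration.integrable_mult_right[OF integrable_abs[OF ig], of M]])
    show "AE x in lborel. norm ((g x)\<^sup>2) \<le> norm (M * \<bar>g x\<bar>)"
    proof (rule AE_I2)
      fix x
      have "\<bar>g x\<bar> * \<bar>g x\<bar> \<le> M * \<bar>g x\<bar>" using gB[of x] by (intro mult_right_mono) auto
      then show "norm ((g x)\<^sup>2) \<le> norm (M * \<bar>g x\<bar>)" using M by (simp add: power2_eq_square abs_mult)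
    qed
  qed auto
  have i1: "integrable lborel (\<lambda>x. (f x - cl M (f x))\<^sup>2)"
    by (rule Bochner_Integration.integrable_bound[OF f(2)])
      (use cl(1)[of M] M in \<open>auto simp: abs_le_square_iff[symmetric] cl_def\<close>)
  have i2: "integrable lborel (\<lambda>x. \<bar>f x - g0 x\<bar>)" using f g0 by auto
  have b: "(f x - g x)\<^sup>2 \<le> 2 * (f x - cl M (f x))\<^sup>2 + 4 * M * \<bar>f x - g0 x\<bar>" for x
  proof -
    have "(cl M (f x) - g x)\<^sup>2 = \<bar>cl M (f x) - g x\<bar> * \<bar>cl M (f x) - g x\<bar>" by (simp add: power2_eq_square abs_mult[symmetric])
    also have "\<dots> \<le> (2 * M) * \<bar>f x - g0 x\<bar>"
      using cl(2)[of M "f x"] cl(4)[of M "f x" "g0 x"] gB[of x] M by (intro mult_mono) (auto simp: g_def)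
    finally have 1: "(cl M (f x) - g x)\<^sup>2 \<le> (2 * M) * \<bar>f x - g0 x\<bar>" .
    have "(f x - g x)\<^sup>2 \<le> 2 * (f x - cl M (f x))\<^sup>2 + 2 * (cl M (f x) - g x)\<^sup>2"
      using zero_le_power2[of "(f x - cl M (f x)) - (cl M (f x) - g x)"] by (simp add: power2_eq_square algebra_simps)
    with 1 show ?thesis by linarith
  qed
  have i3: "integrable lborel (\<lambda>x. (f x - g x)\<^sup>2)"
    by (rule Bochner_Integration.integrable_bound[where f = "\<lambda>x. 2 * (f x - cl M (f x))\<^sup>2 + 4 * M * \<bar>f x - g0 x\<bar>"])
      (use i1 i2 b in \<open>auto intro!: AE_I2 order_trans[OF b]\<close>)
  have "(LINT x|lborel. (f x - g x)\<^sup>2) \<le> (LINT x|lborel. 2 * (f x - cl M (f x))\<^sup>2 + 4 * M * \<bar>f x - g0 x\<bar>)"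
    using i1 i2 i3 b by (intro integral_mono) auto
  also have "\<dots> = 2 * (LINT x|lborel. (f x - cl M (f x))\<^sup>2) + 4 * M * (LINT x|lborel. \<bar>f x - g0 x\<bar>)"
    using i1 i2 by simp
  also have "\<dots> < 2 * (e / 4) + 4 * M * (e / (16 * M))"
    using n(1) g0(3) M by (intro add_strict_mono mult_strict_left_mono) (auto simp: M_def)
  also have "\<dots> \<le> e" using M e by (simp add: field_simps)
  finally show ?thesis using that[OF gc gB ig ig2] by blast
qed

section \<open>Mollifiers in time and the bilinear forms built from them\<close>

lemma test_fun_integrable:
  assumes "test_fun U g"
  shows "integrable lborel g"
proof -
  obtain B where B: "B \<ge> 0" "\<And>x. \<bar>g x\<bar> \<le> B" using test_fun_bounded[OF assms] by metis
  have c: "compact (tsupport g)" using assms by (simp add: test_fun_def)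
  have "integrable lborel (\<lambda>x. B * indicator (tsupport g) x)"
    using emeasure_bounded_finite[OF compact_imp_bounded[OF c]] compact_imp_closed[OF c]
    by (intro integrable_mult_right integrable_real_indicator) (auto intro: borel_closed)
  then show ?thesis
  proof (rule Bochner_Integration.integrable_bound)
    show "g \<in> borel_measurable lborel" using test_fun_measurable[OF assms] by simp
    show "AE x in lborel. norm (g x) \<le> norm (B * indicator (tsupport g) x)"
      using B tsupport_zero[of _ g] by (auto simp: indicator_def)
  qed
qed

definition moll_raw :: "nat \<Rightarrow> real \<Rightarrow> real" where
  "moll_raw n = bump 1 (- inverse (real (Suc n))) (inverse (real (Suc n)))"

definition moll :: "nat \<Rightarrow> real \<Rightarrow> real" where
  "moll n t = moll_raw n t / (LINT s|lborel. moll_raw n s)"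

lemma moll_raw_test: "test_fun UNIV (moll_raw n)"
  unfolding moll_raw_def by (rule test_fun_bump) auto

lemma moll_raw_integral_pos: "(LINT s|lborel. moll_raw n s) > 0"
proof -
  have nn: "moll_raw n s \<ge> 0" for s by (simp add: moll_raw_def bump_nonneg)
  have int: "integrable lborel (moll_raw n)" by (rule test_fun_integrable[OF moll_raw_test])
  have "(LINT s|lborel. moll_raw n s) \<noteq> 0"
  proof
    assume "(LINT s|lborel. moll_raw n s) = 0"
    then have "AE s in lborel. moll_raw n s = 0"
      using integral_nonneg_eq_0_iff_AE[OF int] nn by auto
    then have "AE s in lborel. s \<notin> {- inverse (real (Suc n))<..<inverse (real (Suc n))}"
    proof eventually_elim
      case (elim s)
      then show ?case using bump_pos[of 1 s] by (force simp: moll_raw_def)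
    qed
    then have "{- inverse (real (Suc n))<..<inverse (real (Suc n))} \<in> null_sets lborel"
      by (subst (asm) AE_iff_null_sets[symmetric]) auto
    moreover have "emeasure lborel {- inverse (real (Suc n))<..<inverse (real (Suc n))}
        = ennreal (inverse (real (Suc n)) - (- inverse (real (Suc n))))"
      by (rule emeasure_lborel_Ioo) simp
    ultimately show False by (simp add: ennreal_eq_0_iff not_le null_sets_def del: of_nat_Suc)
  qed
  moreover have "(LINT s|lborel. moll_raw n s) \<ge> 0" using nn by simp
  ultimately show ?thesis by linarith
qed

lemma moll_nonneg: "moll n t \<ge> 0"
  using moll_raw_integral_pos[of n] by (simp add: moll_def moll_raw_def bump_nonneg)

lemma smooth_moll: "smooth (moll n)"
proof -
  have "smooth (\<lambda>t. moll_raw n t * (1 / (LINT s|lborel. moll_raw n s)))"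
    by (intro smooth_mult smooth_const) (simp add: moll_raw_def smooth_bump)
  then show ?thesis by (simp add: moll_def[abs_def])
qed

lemma moll_zero: "\<bar>t\<bar> \<ge> inverse (real (Suc n)) \<Longrightarrow> moll n t = 0"
  using bump_zero[of 1 t "- inverse (real (Suc n))" "inverse (real (Suc n))"]
  by (auto simp: moll_def moll_raw_def abs_real_def simp del: of_nat_Suc split: if_splits)

lemma tsupport_moll: "tsupport (moll n) \<subseteq> {- inverse (real (Suc n))..inverse (real (Suc n))}"
proof -
  have "t \<in> {- inverse (real (Suc n))..inverse (real (Suc n))}" if "moll n t \<noteq> 0" for t
    using moll_zero[of n t] that unfolding atLeastAtMost_iff by linarith
  then show ?thesis unfolding tsupport_def by (intro closure_minimal) auto
qed

lemma moll_test: "test_fun UNIV (moll n)"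
  unfolding test_fun_def using smooth_moll compact_tsupport[OF compact_Icc tsupport_moll] by blast

lemma moll_integrable: "integrable lborel (moll n)"
  by (rule test_fun_integrable[OF moll_test])

lemma moll_measurable [measurable]: "moll n \<in> borel_measurable borel"
  using test_fun_measurable[OF moll_test] .

lemma moll_integral: "(LINT t|lborel. moll n t) = 1"
  using moll_raw_integral_pos[of n] test_fun_integrable[OF moll_raw_test, of n] by (simp add: moll_def)

lemma moll_shift: "integrable lborel (\<lambda>t. moll n (t - s))" "(LINT t|lborel. moll n (t - s)) = 1"
  "integrable lborel (\<lambda>t. moll n (s - t))" "(LINT t|lborel. moll n (s - t)) = 1"
  using lborel_integrable_real_affine[OF moll_integrable, of 1 n "-s"] lborel_integral_real_affine[of 1 "moll n" "-s"]
    lborel_integrable_real_affine[OF moll_integrable, of "-1" n "s"] lborel_integral_real_affine[of "-1" "moll n" "s"]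
    moll_integral[of n] by simp_all

lemma moll_bounded: obtains B where "B \<ge> 0" "\<And>t. moll n t \<le> B"
  using test_fun_bounded[OF moll_test, of n] by (metis abs_le_D1)

text \<open>The kernel has radius \<open>inverse (real (Suc n))\<close>; the bounds on s keep its
  support inside the open time interval, so that it may be used in the weak equation.\<close>

lemma moll_shift_test:
  assumes "inverse (real (Suc n)) < s" "s < T - inverse (real (Suc n))"
  shows "test_fun {0<..<T} (\<lambda>t. moll n (t - s))" "deriv (\<lambda>t. moll n (t - s)) t = deriv (moll n) (t - s)"
proof -
  have sm: "smooth (\<lambda>t. moll n (t - s))"
    using smooth_compose[OF smooth_moll[of n] smooth_affine[of 1 "- s"]] by simp
  have "t \<in> {s - inverse (real (Suc n))..s + inverse (real (Suc n))}" if "moll n (t - s) \<noteq> 0" for t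
    using moll_zero[of n "t - s"] that unfolding atLeastAtMost_iff by linarith
  then have sub: "tsupport (\<lambda>t. moll n (t - s)) \<subseteq> {s - inverse (real (Suc n))..s + inverse (real (Suc n))}"
    unfolding tsupport_def by (intro closure_minimal) auto
  have "tsupport (\<lambda>t. moll n (t - s)) \<subseteq> {0<..<T}"
    using sub assms by (force simp del: of_nat_Suc)
  then show "test_fun {0<..<T} (\<lambda>t. moll n (t - s))"
    unfolding test_fun_def using sm compact_tsupport[OF compact_Icc sub] by blast
  have "((\<lambda>t. moll n (t - s)) has_real_derivative deriv (moll n) (t - s) * 1) (at t)"
    by (rule DERIV_chain2[OF smooth_real_deriv(1)[OF smooth_moll]]) (auto intro!: derivative_eq_intros)
  then show "deriv (\<lambda>t. moll n (t - s)) t = deriv (moll n) (t - s)" by (simp add: DERIV_imp_deriv)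
qed

lemma moll_conv_pointwise:
  assumes b: "continuous_on UNIV b" "\<And>s. \<bar>b s\<bar> \<le> B"
  shows "(\<lambda>n. LINT s|lborel. moll n (t - s) * b s) \<longlonglongrightarrow> b t"
    "\<bar>LINT s|lborel. moll n (t - s) * b s\<bar> \<le> B"
    "integrable lborel (\<lambda>s. moll n (t - s) * b s)"
proof -
  have [measurable]: "b \<in> borel_measurable borel" using b(1) by (rule borel_measurable_continuous_onI)
  have B: "B \<ge> 0" using b(2)[of 0] by linarith
  have int: "integrable lborel (\<lambda>s. moll n (t - s) * b s)" for n
  proof (rule Bochner_Integration.integrable_bound[OF integrable_mult_right[OF moll_shift(3)[of n t], of B]])
    show "AE x in lborel. norm (moll n (t - x) * b x) \<le> norm (B * moll n (t - x))"
      using b(2) B moll_nonneg[of n] by (auto simp: abs_mult mult.commute[of _ "\<bar>b _\<bar>"] intro!: mult_right_mono)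
  qed simp
  then show "integrable lborel (\<lambda>s. moll n (t - s) * b s)" .
  have "\<bar>LINT s|lborel. moll n (t - s) * b s\<bar> \<le> (LINT s|lborel. moll n (t - s) * B)"
  proof (rule order_trans[OF integral_abs_bound integral_mono])
    fix x show "\<bar>moll n (t - x) * b x\<bar> \<le> moll n (t - x) * B"
      using b(2)[of x] moll_nonneg[of n "t - x"] by (simp add: abs_mult mult_left_mono)
  qed (use int moll_shift in auto)
  then show "\<bar>LINT s|lborel. moll n (t - s) * b s\<bar> \<le> B" using moll_shift(4)[of n t] moll_shift(3)[of n t] by simp
  show "(\<lambda>n. LINT s|lborel. moll n (t - s) * b s) \<longlonglongrightarrow> b t"
  proof (rule LIMSEQ_I)
    fix e :: real assume e: "e > 0"
    have "isCont b t" using b(1) by (simp add: continuous_on_eq_continuous_at)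
    then obtain d where d: "d > 0" "\<And>s. \<bar>s - t\<bar> < d \<Longrightarrow> \<bar>b s - b t\<bar> < e / 2"
      unfolding isCont_def LIM_eq using e by (metis abs_zero cancel_comm_monoid_add_class.diff_cancel half_gt_zero real_norm_def)
    obtain N where N: "inverse (real (Suc N)) < d" using reals_Archimedean[OF d(1)] by blast
    show "\<exists>no. \<forall>n\<ge>no. norm ((LINT s|lborel. moll n (t - s) * b s) - b t) < e"
    proof (intro exI allI impI)
      fix n assume n: "n \<ge> N"
      have nd: "inverse (real (Suc n)) < d"
        using N n by (smt (verit) inverse_le_iff_le of_nat_0_less_iff of_nat_le_iff Suc_le_mono zero_less_Suc)
      have "(LINT s|lborel. moll n (t - s) * b s) - b t = (LINT s|lborel. moll n (t - s) * b s - moll n (t - s) * b t)"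
        using int moll_shift[of n t] by simp
      also have "\<bar>\<dots>\<bar> \<le> (LINT s|lborel. moll n (t - s) * (e / 2))"
      proof (rule order_trans[OF integral_abs_bound integral_mono])
        fix x
        have "moll n (t - x) * \<bar>b x - b t\<bar> \<le> moll n (t - x) * (e / 2)"
        proof (cases "\<bar>x - t\<bar> < d")
          case True then show ?thesis using d(2)[of x] moll_nonneg[of n "t - x"] by (intro mult_left_mono) auto
        next
          case False
          then have "moll n (t - x) = 0" using nd by (intro moll_zero) auto
          then show ?thesis by simp
        qed
        then show "\<bar>moll n (t - x) * b x - moll n (t - x) * b t\<bar> \<le> moll n (t - x) * (e / 2)"
          using moll_nonneg[of n "t - x"] by (simp add: abs_mult right_diff_distrib[symmetric])
      qed (use int moll_shift in auto)
      also have "\<dots> = e / 2" using moll_shift[of n t] by simp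
      finally show "norm ((LINT s|lborel. moll n (t - s) * b s) - b t) < e" using e by simp
    qed
  qed
qed

text \<open>Meant for the pairing of the merely integrable term E with a bounded multiplier that is
  continuous in time; no square integrability of a is available there.\<close>

lemma moll_conv_L1:
  assumes a: "integrable lborel a" and b: "continuous_on UNIV b" "\<And>s. \<bar>b s\<bar> \<le> B"
  shows "(\<lambda>n. LINT t|lborel. LINT s|lborel. moll n (t - s) * (a t * b s)) \<longlonglongrightarrow> (LINT t|lborel. a t * b t)"
proof -
  have [measurable]: "b \<in> borel_measurable borel" using b(1) by (rule borel_measurable_continuous_onI)
  have [measurable]: "a \<in> borel_measurable borel" using a by auto
  have eq: "(LINT s|lborel. moll n (t - s) * (a t * b s)) = a t * (LINT s|lborel. moll n (t - s) * b s)" for n t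
    by (simp add: mult.left_commute[of _ "a t"])
  show ?thesis unfolding eq
  proof (rule integral_dominated_convergence[where w = "\<lambda>t. \<bar>a t\<bar> * B"])
    show "AE x in lborel. (\<lambda>n. a x * (LINT s|lborel. moll n (x - s) * b s)) \<longlonglongrightarrow> a x * b x"
      using moll_conv_pointwise(1)[OF b] by (auto intro!: tendsto_mult)
    show "AE x in lborel. norm (a x * (LINT s|lborel. moll n (x - s) * b s)) \<le> \<bar>a x\<bar> * B" for n
      using moll_conv_pointwise(2)[OF b] by (auto simp: abs_mult intro!: mult_left_mono)
  qed (use a in auto)
qed

lemma (in pair_sigma_finite) integrable_prod_mult:
  fixes a :: "'a \<Rightarrow> real" and b :: "'b \<Rightarrow> real"
  assumes "integrable M1 a" "integrable M2 b"
  shows "integrable (M1 \<Otimes>\<^sub>M M2) (\<lambda>z. a (fst z) * b (snd z))"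
proof (rule Fubini_integrable)
  have [measurable]: "a \<in> borel_measurable M1" "b \<in> borel_measurable M2" using assms by auto
  show "(\<lambda>z. a (fst z) * b (snd z)) \<in> borel_measurable (M1 \<Otimes>\<^sub>M M2)" by measurable
qed (use assms in \<open>auto simp: abs_mult\<close>)

lemma moll_prod_integrable:
  assumes "integrable lborel a" "integrable lborel b"
  shows "integrable (lborel \<Otimes>\<^sub>M lborel) (\<lambda>(t, s). moll n (t - s) * (a t * b s))"
proof -
  have [measurable]: "a \<in> borel_measurable borel" "b \<in> borel_measurable borel" using assms by auto
  obtain B where B: "B \<ge> 0" "\<And>t. moll n t \<le> B" using moll_bounded[of n] by metis
  show ?thesis
  proof (rule Bochner_Integration.integrable_bound[OF integrable_mult_right[OF lborel_pair.integrable_prod_mult[OF assms], of B]])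
    show "AE z in lborel \<Otimes>\<^sub>M lborel. norm (case z of (t, s) \<Rightarrow> moll n (t - s) * (a t * b s)) \<le> norm (B * (a (fst z) * b (snd z)))"
    proof (rule AE_I2)
      fix z :: "real \<times> real"
      have "moll n (fst z - snd z) * \<bar>a (fst z) * b (snd z)\<bar> \<le> B * \<bar>a (fst z) * b (snd z)\<bar>"
        using B by (intro mult_right_mono) auto
      then show "norm (case z of (t, s) \<Rightarrow> moll n (t - s) * (a t * b s)) \<le> norm (B * (a (fst z) * b (snd z)))"
        using B moll_nonneg[of n] by (simp add: abs_mult case_prod_beta)
    qed
  qed measurable
qed

lemma moll_smear_integral:
  assumes b: "integrable lborel b"
  shows "integrable lborel (\<lambda>t. LINT s|lborel. moll n (t - s) * b s)"
    "(LINT t|lborel. LINT s|lborel. moll n (t - s) * b s) = (LINT s|lborel. b s)"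
proof -
  have [measurable]: "b \<in> borel_measurable borel" using b by auto
  have "integrable (lborel \<Otimes>\<^sub>M lborel) (\<lambda>(s, t). moll n (t - s) * b s)"
  proof (rule lborel_pair.Fubini_integrable)
    have "(LINT y|lborel. norm (case (x, y) of (s, t) \<Rightarrow> moll n (t - s) * b s)) = \<bar>b x\<bar>" for x
      using moll_shift(2)[of n x] moll_nonneg[of n] by (simp add: abs_mult)
    then show "integrable lborel (\<lambda>x. LINT y|lborel. norm (case (x, y) of (s, t) \<Rightarrow> moll n (t - s) * b s))" using b by simp
  qed (use moll_shift in auto)
  note i = this
  show "integrable lborel (\<lambda>t. LINT s|lborel. moll n (t - s) * b s)"
    using lborel_pair.integrable_snd[OF i] .
  have "(LINT t|lborel. LINT s|lborel. moll n (t - s) * b s) = (LINT s|lborel. LINT t|lborel. moll n (t - s) * b s)"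
    using lborel_pair.Fubini_integral[OF i] by simp
  also have "\<dots> = (LINT s|lborel. b s)" using moll_shift(2)[of n] by simp
  finally show "(LINT t|lborel. LINT s|lborel. moll n (t - s) * b s) = (LINT s|lborel. b s)" .
qed

text \<open>Young's inequality with weight d, combined with the unit mass of the kernel in either
  variable, gives a bound uniform in n. The weight is kept free so that one of the two sides can be
  made small at will.\<close>

lemma moll_form_bound:
  assumes a: "integrable lborel a" "integrable lborel (\<lambda>t. (a t)\<^sup>2)"
    and b: "integrable lborel b" "integrable lborel (\<lambda>t. (b t)\<^sup>2)" and d: "d > 0"
  shows "\<bar>LINT t|lborel. LINT s|lborel. moll n (t - s) * (a t * b s)\<bar>
    \<le> d * (LINT t|lborel. (a t)\<^sup>2) + (LINT t|lborel. (b t)\<^sup>2) / d"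
proof -
  have [measurable]: "a \<in> borel_measurable borel" "b \<in> borel_measurable borel" using a b by auto
  have b2: "integrable lborel (\<lambda>s. moll n (t - s) * (b s)\<^sup>2)" for t
  proof -
    obtain B where B: "B \<ge> 0" "\<And>t. moll n t \<le> B" using moll_bounded[of n] by metis
    show ?thesis
      by (rule Bochner_Integration.integrable_bound[OF integrable_mult_right[OF b(2), of B]])
        (use B moll_nonneg[of n] in \<open>auto simp: abs_mult intro!: mult_right_mono\<close>)
  qed
  have b1: "integrable lborel (\<lambda>s. moll n (t - s) * (a t * b s))" for t
  proof -
    obtain B where B: "B \<ge> 0" "\<And>t. moll n t \<le> B" using moll_bounded[of n] by metis
    show ?thesis
      by (rule Bochner_Integration.integrable_bound[OF integrable_mult_right[OF integrable_mult_right[OF b(1), of "a t"], of B]])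
        (use B moll_nonneg[of n] in \<open>auto simp: abs_mult intro!: mult_right_mono\<close>)
  qed
  have pw: "\<bar>LINT s|lborel. moll n (t - s) * (a t * b s)\<bar> \<le> d * (a t)\<^sup>2 + (LINT s|lborel. moll n (t - s) * (b s)\<^sup>2) / d" for t
  proof -
    have "\<bar>LINT s|lborel. moll n (t - s) * (a t * b s)\<bar>
       \<le> (LINT s|lborel. moll n (t - s) * (d * (a t)\<^sup>2) + moll n (t - s) * (b s)\<^sup>2 / d)"
    proof (rule order_trans[OF integral_abs_bound integral_mono])
      fix s
      have "0 \<le> (d * \<bar>a t\<bar> - \<bar>b s\<bar>)\<^sup>2" by simp
      then have "2 * d * (\<bar>a t\<bar> * \<bar>b s\<bar>) \<le> d * d * (a t)\<^sup>2 + (b s)\<^sup>2"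
        by (simp add: power2_eq_square algebra_simps)
      moreover have "0 \<le> d * (\<bar>a t\<bar> * \<bar>b s\<bar>)" using d by simp
      ultimately have "d * (\<bar>a t\<bar> * \<bar>b s\<bar>) \<le> d * d * (a t)\<^sup>2 + (b s)\<^sup>2" by linarith
      then have "\<bar>a t\<bar> * \<bar>b s\<bar> \<le> d * (a t)\<^sup>2 + (b s)\<^sup>2 / d" using d by (simp add: field_simps)
      then show "\<bar>moll n (t - s) * (a t * b s)\<bar> \<le> moll n (t - s) * (d * (a t)\<^sup>2) + moll n (t - s) * (b s)\<^sup>2 / d"
        using mult_left_mono[OF _ moll_nonneg[of n "t - s"]] moll_nonneg[of n "t - s"]
        by (fastforce simp: abs_mult distrib_left)
    qed (use b1 b2 moll_shift[of n t] d in auto)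
    also have "\<dots> = d * (a t)\<^sup>2 + (LINT s|lborel. moll n (t - s) * (b s)\<^sup>2) / d"
      using b2 moll_shift[of n t] by simp
    finally show ?thesis .
  qed
  have "\<bar>LINT t|lborel. LINT s|lborel. moll n (t - s) * (a t * b s)\<bar>
    \<le> (LINT t|lborel. d * (a t)\<^sup>2 + (LINT s|lborel. moll n (t - s) * (b s)\<^sup>2) / d)"
  proof (rule order_trans[OF integral_abs_bound integral_mono])
    show "integrable lborel (\<lambda>t. \<bar>LINT s|lborel. moll n (t - s) * (a t * b s)\<bar>)"
      using lborel_pair.integrable_fst'[OF moll_prod_integrable[OF a(1) b(1), of n]] by simp
  qed (use a moll_smear_integral(1)[OF b(2)] pw in auto)
  also have "\<dots> = d * (LINT t|lborel. (a t)\<^sup>2) + (LINT t|lborel. (b t)\<^sup>2) / d"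
    using a moll_smear_integral[OF b(2)] by simp
  finally show ?thesis .
qed

text \<open>Replacing b by a bounded continuous g reduces the limit to \<open>moll_conv_L1\<close>;
  \<open>moll_form_bound\<close> controls the replacement error uniformly in n.\<close>

lemma moll_conv_L2:
  assumes a: "integrable lborel a" "integrable lborel (\<lambda>t. (a t)\<^sup>2)"
    and b: "integrable lborel b" "integrable lborel (\<lambda>t. (b t)\<^sup>2)"
  shows "(\<lambda>n. LINT t|lborel. LINT s|lborel. moll n (t - s) * (a t * b s)) \<longlonglongrightarrow> (LINT t|lborel. a t * b t)"
proof (rule LIMSEQ_I)
  fix e :: real assume e: "e > 0"
  define A where "A = (LINT t|lborel. (a t)\<^sup>2)"
  have A: "A \<ge> 0" by (simp add: A_def)
  \<comment> \<open>With this weight the norm of a contributes at most e/8, and an approximation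
    error below d (e/8) contributes e/8 after division by d.\<close>
  define d where "d = e / (8 * (A + 1))"
  have d: "d > 0" using e A by (simp add: d_def)
  have dA: "d * A \<le> e / 8"
  proof -
    have "d * A = e / 8 * (A / (A + 1))" by (simp add: d_def)
    also have "\<dots> \<le> e / 8 * 1" using e A by (intro mult_left_mono) (auto simp: field_simps)
    finally show ?thesis by simp
  qed
  obtain g B where g: "continuous_on UNIV g" "\<And>x. \<bar>g x\<bar> \<le> B" "integrable lborel g" "integrable lborel (\<lambda>x. (g x)\<^sup>2)"
    "(LINT x|lborel. (b x - g x)\<^sup>2) < d * (e / 8)"
    using dense_L2[OF b, of "d * (e / 8)"] d e by (auto simp del: times_divide_eq_right)
  have ab2: "integrable lborel (\<lambda>x. a x * c x)" if "integrable lborel (\<lambda>x. (c x)\<^sup>2)" "c \<in> borel_measurable borel" for c :: "real \<Rightarrow> real"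
  proof (rule Bochner_Integration.integrable_bound[OF Bochner_Integration.integrable_add[OF a(2) that(1)]])
    show "AE x in lborel. norm (a x * c x) \<le> norm ((a x)\<^sup>2 + (c x)\<^sup>2)"
    proof (rule AE_I2)
      fix x
      have "2 * \<bar>a x * c x\<bar> \<le> (a x)\<^sup>2 + (c x)\<^sup>2"
        using sum_squares_bound[of "\<bar>a x\<bar>" "\<bar>c x\<bar>"] by (simp add: abs_mult)
      then show "norm (a x * c x) \<le> norm ((a x)\<^sup>2 + (c x)\<^sup>2)" unfolding real_norm_def by linarith
    qed
  qed (use a that in auto)
  have [measurable]: "a \<in> borel_measurable borel" "b \<in> borel_measurable borel" "g \<in> borel_measurable borel"
    using a b g by auto
  have bg: "integrable lborel (\<lambda>x. b x - g x)" using b g by auto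
  have bg2: "integrable lborel (\<lambda>x. (b x - g x)\<^sup>2)"
  proof (rule Bochner_Integration.integrable_bound[OF Bochner_Integration.integrable_add[OF integrable_mult_right[OF b(2), of 2] integrable_mult_right[OF g(4), of 2]]])
    have "(b x - g x)\<^sup>2 \<le> 2 * (b x)\<^sup>2 + 2 * (g x)\<^sup>2" for x
      using zero_le_power2[of "b x + g x"] by (simp add: power2_eq_square algebra_simps)
    then show "AE x in lborel. norm ((b x - g x)\<^sup>2) \<le> norm (2 * (b x)\<^sup>2 + 2 * (g x)\<^sup>2)" by simp
  qed simp
  have abg: "integrable lborel (\<lambda>x. a x * b x)" "integrable lborel (\<lambda>x. a x * g x)" "integrable lborel (\<lambda>x. a x * (b x - g x))"
    by (rule ab2, use b g bg2 in measurable)+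
  have small: "\<bar>LINT t|lborel. LINT s|lborel. moll n (t - s) * (a t * (b s - g s))\<bar> \<le> e / 4" for n
  proof -
    have "(LINT x|lborel. (b x - g x)\<^sup>2) / d \<le> e / 8" using g(5) d by (simp add: field_simps)
    then show ?thesis using moll_form_bound[OF a bg bg2 d, of n] dA unfolding A_def by linarith
  qed
  have small2: "\<bar>LINT x|lborel. a x * (b x - g x)\<bar> \<le> e / 4"
  proof -
    have "\<bar>LINT x|lborel. a x * (b x - g x)\<bar> \<le> (LINT x|lborel. d * (a x)\<^sup>2 + (b x - g x)\<^sup>2 / d)"
    proof (rule order_trans[OF integral_abs_bound integral_mono])
      fix x
      have "0 \<le> (d * \<bar>a x\<bar> - \<bar>b x - g x\<bar>)\<^sup>2" "0 \<le> d * (\<bar>a x\<bar> * \<bar>b x - g x\<bar>)" using d by simp_all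
      then have "d * (\<bar>a x\<bar> * \<bar>b x - g x\<bar>) \<le> d * d * (a x)\<^sup>2 + (b x - g x)\<^sup>2"
        unfolding power2_diff by (simp add: power2_eq_square algebra_simps)
      then have "\<bar>a x * (b x - g x)\<bar> \<le> (d * d * (a x)\<^sup>2 + (b x - g x)\<^sup>2) / d"
        using d by (simp add: pos_le_divide_eq abs_mult mult.commute)
      also have "\<dots> = d * (a x)\<^sup>2 + (b x - g x)\<^sup>2 / d" using d by (simp add: add_divide_distrib)
      finally show "\<bar>a x * (b x - g x)\<bar> \<le> d * (a x)\<^sup>2 + (b x - g x)\<^sup>2 / d" .
    qed (use a abg bg2 in auto)
    also have "\<dots> = d * A + (LINT x|lborel. (b x - g x)\<^sup>2) / d" using a bg2 by (simp add: A_def)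
    also have "\<dots> \<le> e / 8 + e / 8" using g(5) d dA by (intro add_mono) (simp_all add: field_simps)
    finally show ?thesis by simp
  qed
  obtain N where N: "\<And>n. n \<ge> N \<Longrightarrow>
      \<bar>(LINT t|lborel. LINT s|lborel. moll n (t - s) * (a t * g s)) - (LINT t|lborel. a t * g t)\<bar> < e / 4"
    using LIMSEQ_D[OF moll_conv_L1[OF a(1) g(1,2)], of "e/4"] e by (auto simp: real_norm_def)
  show "\<exists>no. \<forall>n\<ge>no. norm ((LINT t|lborel. LINT s|lborel. moll n (t - s) * (a t * b s)) - (LINT t|lborel. a t * b t)) < e"
  proof (intro exI allI impI)
    fix n assume n: "N \<le> n"
    have lin: "(LINT t|lborel. LINT s|lborel. moll n (t - s) * (a t * c s)) = integral\<^sup>L (lborel \<Otimes>\<^sub>M lborel) (\<lambda>(t, s). moll n (t - s) * (a t * c s))"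
      if "integrable lborel c" for c
      using lborel_pair.integral_fst'[OF moll_prod_integrable[OF a(1) that, of n]] by simp
    have "(LINT t|lborel. LINT s|lborel. moll n (t - s) * (a t * (b s - g s)))
        = (LINT t|lborel. LINT s|lborel. moll n (t - s) * (a t * b s)) - (LINT t|lborel. LINT s|lborel. moll n (t - s) * (a t * g s))"
      unfolding lin[OF bg] lin[OF b(1)] lin[OF g(3)]
      using moll_prod_integrable[OF a(1) b(1), of n] moll_prod_integrable[OF a(1) g(3), of n]
      by (subst Bochner_Integration.integral_diff[symmetric]) (auto simp: right_diff_distrib case_prod_beta intro!: Bochner_Integration.integral_cong)
    moreover have "(LINT x|lborel. a x * (b x - g x)) = (LINT x|lborel. a x * b x) - (LINT x|lborel. a x * g x)"
      using abg by (simp add: right_diff_distrib)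
    ultimately show "norm ((LINT t|lborel. LINT s|lborel. moll n (t - s) * (a t * b s)) - (LINT t|lborel. a t * b t)) < e"
      using small[of n] small2 N[OF n] unfolding real_norm_def by linarith
  qed
qed

subsection \<open>Indefinite integrals and the chain rule\<close>

text \<open>Primitives are written as integrals over \<open>{..t}\<close> of functions on the whole
  line. No starting time has to be carried along, and two primitives differ by at most the L^1
  distance of the integrands, uniformly in t.\<close>

lemma indef_integrable: "integrable lborel V \<Longrightarrow> integrable lborel (\<lambda>s::real. indicator {..t} s * V s :: real)"
  by (rule Bochner_Integration.integrable_bound[of lborel V]) (auto simp: indicator_def)

lemma indef_diff_le:
  fixes V W :: "real \<Rightarrow> real"
  assumes "integrable lborel V" "integrable lborel W"
  shows "\<bar>(LINT s|lborel. indicator {..t} s * V s) - (LINT s|lborel. indicator {..t} s * W s)\<bar> \<le> (LINT s|lborel. \<bar>V s - W s\<bar>)"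
proof -
  have "(LINT s|lborel. indicator {..t} s * V s) - (LINT s|lborel. indicator {..t} s * W s) = (LINT s|lborel. indicator {..t} s * (V s - W s))"
    using indef_integrable[OF assms(1)] indef_integrable[OF assms(2)] by (simp add: right_diff_distrib)
  also have "\<bar>\<dots>\<bar> \<le> (LINT s|lborel. \<bar>V s - W s\<bar>)"
  proof (rule order_trans[OF integral_abs_bound integral_mono])
    show "integrable lborel (\<lambda>s. \<bar>indicator {..t} s * (V s - W s)\<bar>)"
      using indef_integrable[of "\<lambda>s. V s - W s" t] assms by auto
  qed (use assms in \<open>auto simp: indicator_def\<close>)
  finally show ?thesis .
qed

lemma indef_has_derivative:
  fixes V :: "real \<Rightarrow> real"
  assumes V: "integrable lborel V" "continuous_on UNIV V" and t: "t \<in> {a..b}"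
  shows "((\<lambda>t. LINT s|lborel. indicator {..t} s * V s) has_real_derivative V t) (at t within {a..b})"
proof -
  define A where "A = (LINT s|lborel. indicator {..<a} s * V s)"
  have eq: "(LINT s|lborel. indicator {..t} s * V s) = A + integral {a..t} V" if "t \<in> {a..b}" for t
  proof -
    have i: "integrable lborel (\<lambda>s. indicator {..<a} s * V s)" "integrable lborel (\<lambda>s. indicator {a..t} s * V s)"
      by (rule Bochner_Integration.integrable_bound[OF V(1)]; use V(1) in \<open>auto simp: indicator_def\<close>)+
    have "(LINT s|lborel. indicator {..t} s * V s) = (LINT s|lborel. indicator {..<a} s * V s + indicator {a..t} s * V s)"
      using that by (intro Bochner_Integration.integral_cong) (auto simp: indicator_def)
    also have "\<dots> = A + (LINT s|lborel. indicator {a..t} s * V s)" using i by (simp add: A_def)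
    also have "(LINT s|lborel. indicator {a..t} s * V s) = integral {a..t} V"
      using set_borel_integral_eq_integral(2)[of "{a..t}" V] i(2) by (simp add: set_integrable_def set_lebesgue_integral_def)
    finally show ?thesis .
  qed
  have "((\<lambda>t. A + integral {a..t} V) has_real_derivative 0 + V t) (at t within {a..b})"
    by (intro DERIV_add DERIV_const integral_has_real_derivative[OF continuous_on_subset[OF V(2)]] t) auto
  then show ?thesis
    unfolding has_field_derivative_def using has_derivative_transform[OF t eq] by simp
qed

text \<open>The primitives of continuous L^1 approximants are differentiable, hence continuous, and
  converge uniformly.\<close>

lemma indef_continuous:
  fixes V :: "real \<Rightarrow> real"
  assumes V: "integrable lborel V"
  shows "continuous_on UNIV (\<lambda>t. LINT s|lborel. indicator {..t} s * V s)"
proof -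
  have "\<exists>g. continuous_on UNIV g \<and> integrable lborel g \<and> (LINT x|lborel. \<bar>V x - g x\<bar>) < inverse (real (Suc n))" for n
    by (rule dense_L1[OF V]) simp
  then obtain g where g: "\<And>n. continuous_on UNIV (g n)" "\<And>n. integrable lborel (g n)"
    "\<And>n. (LINT x|lborel. \<bar>V x - g n x\<bar>) < inverse (real (Suc n))" by metis
  show ?thesis
  proof (rule uniform_limit_theorem)
    show "\<forall>\<^sub>F n in sequentially. continuous_on UNIV (\<lambda>t. LINT s|lborel. indicator {..t} s * g n s)"
    proof (rule always_eventually, rule allI, rule continuous_at_imp_continuous_on, rule ballI)
      fix n and t :: real
      have "((\<lambda>t. LINT s|lborel. indicator {..t} s * g n s) has_real_derivative g n t) (at t within {t-1..t+1})"
        by (rule indef_has_derivative[OF g(2,1)]) simp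
      then have "((\<lambda>t. LINT s|lborel. indicator {..t} s * g n s) has_real_derivative g n t) (at t)"
        by (subst (asm) at_within_interior) auto
      then show "isCont (\<lambda>t. LINT s|lborel. indicator {..t} s * g n s) t" by (rule DERIV_isCont)
    qed
    show "uniform_limit UNIV (\<lambda>n t. LINT s|lborel. indicator {..t} s * g n s) (\<lambda>t. LINT s|lborel. indicator {..t} s * V s) sequentially"
    proof (rule uniform_limitI)
      fix e :: real assume e: "e > 0"
      have "\<forall>\<^sub>F n in sequentially. inverse (real (Suc n)) < e"
        by (rule order_tendstoD(2)[OF LIMSEQ_inverse_real_of_nat e])
      then show "\<forall>\<^sub>F n in sequentially. \<forall>t\<in>UNIV. dist (LINT s|lborel. indicator {..t} s * g n s) (LINT s|lborel. indicator {..t} s * V s) < e"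
      proof eventually_elim
        case (elim n)
        show ?case
        proof
          fix t
          show "dist (LINT s|lborel. indicator {..t} s * g n s) (LINT s|lborel. indicator {..t} s * V s) < e"
            using indef_diff_le[OF V g(2)[of n], of t] g(3)[of n] elim by (simp add: dist_real_def abs_minus_commute)
        qed
      qed
    qed
  qed simp
qed

lemma continuous_bounded_on_interval:
  fixes h :: "real \<Rightarrow> real"
  assumes "continuous_on UNIV h"
  obtains B where "B \<ge> 0" "\<And>y. \<bar>y\<bar> \<le> K \<Longrightarrow> \<bar>h y\<bar> \<le> B"
proof -
  have "compact (h ` {-K..K})"
    using assms by (intro compact_continuous_image) (auto intro: continuous_on_subset)
  then obtain B where "\<And>y. y \<in> {-K..K} \<Longrightarrow> \<bar>h y\<bar> \<le> B"
    using compact_imp_bounded bounded_iff by (metis image_eqI real_norm_def)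
  then have "\<bar>h y\<bar> \<le> max 0 B" if "\<bar>y\<bar> \<le> K" for y using that by (auto simp: abs_le_iff le_max_iff_disj)
  then show ?thesis using that[of "max 0 B"] by simp
qed

text \<open>The chain rule for a function of an absolutely continuous U, in integrated form, so that
  no pointwise derivative of U is needed. For continuous V it is the fundamental theorem of calculus
  applied to \<kappa> \<eta>(U); L^1 approximation of V makes the primitives converge uniformly and
  carries the identity over.\<close>

lemma indef_chain_rule:
  fixes V :: "real \<Rightarrow> real" and A :: real
  assumes V: "integrable lborel V"
    and \<eta>: "\<And>y. (\<eta> has_real_derivative \<eta>' y) (at y)" "continuous_on UNIV \<eta>'"
    and \<kappa>: "\<And>t. (\<kappa> has_real_derivative \<kappa>' t) (at t)" "continuous_on UNIV \<kappa>'" "\<And>t. t \<notin> {a..b} \<Longrightarrow> \<kappa> t = 0"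
  defines "U \<equiv> \<lambda>t. A + (LINT s|lborel. indicator {..t} s * V s)"
  shows "integrable lborel (\<lambda>t. \<kappa>' t * \<eta> (U t))" "integrable lborel (\<lambda>t. \<kappa> t * (\<eta>' (U t) * V t))"
    "(LINT t|lborel. \<kappa>' t * \<eta> (U t)) = - (LINT t|lborel. \<kappa> t * (\<eta>' (U t) * V t))"
proof -
  have \<eta>c: "continuous_on UNIV \<eta>" and \<kappa>c: "continuous_on UNIV \<kappa>"
    using DERIV_isCont[OF \<eta>(1)] DERIV_isCont[OF \<kappa>(1)] continuous_at_imp_continuous_on by blast+
  have Uc: "continuous_on UNIV U" unfolding U_def by (intro continuous_intros indef_continuous[OF V])
  have \<kappa>'0: "\<kappa>' t = 0" if "t \<notin> {a..b}" for t
  proof -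
    have "\<forall>\<^sub>F s in nhds t. s \<in> - {a..b}" using that by (intro eventually_nhds_in_open) auto
    then have "\<forall>\<^sub>F s in nhds t. \<kappa> s = 0" by eventually_elim (use \<kappa>(3) in auto)
    then have "(\<kappa> has_real_derivative 0) (at t)" by (subst DERIV_cong_ev[OF refl _ refl, where g = "\<lambda>_. 0"]) auto
    then show ?thesis using \<kappa>(1) DERIV_unique by blast
  qed
  have "\<exists>g. continuous_on UNIV g \<and> integrable lborel g \<and> (LINT x|lborel. \<bar>V x - g x\<bar>) < inverse (real (Suc n))" for n
    by (rule dense_L1[OF V]) simp
  then obtain g where g: "\<And>n. continuous_on UNIV (g n)" "\<And>n. integrable lborel (g n)"
    "\<And>n. (LINT x|lborel. \<bar>V x - g n x\<bar>) < inverse (real (Suc n))" by metis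
  define Uk where "Uk n t = A + (LINT s|lborel. indicator {..t} s * g n s)" for n t
  have Ukc: "continuous_on UNIV (Uk n)" for n unfolding Uk_def by (intro continuous_intros indef_continuous[OF g(2)])
  have UkU: "\<bar>Uk n t - U t\<bar> \<le> inverse (real (Suc n))" for n t
    using indef_diff_le[OF V g(2)[of n], of t] g(3)[of n] by (simp add: Uk_def U_def abs_minus_commute)
  \<comment> \<open>The extra 1 leaves room for the approximants, which lie within distance 1 of U,
    so one compact interval bounds \<eta> and \<eta>' along all of them.\<close>
  define K where "K = \<bar>A\<bar> + (LINT s|lborel. \<bar>V s\<bar>) + 1"
  have UK: "\<bar>U t\<bar> \<le> K - 1" for t
    using indef_diff_le[OF V, of "\<lambda>_. 0" t] by (simp add: U_def K_def)
  have UkK: "\<bar>Uk n t\<bar> \<le> K" for n t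
  proof -
    have "inverse (real (Suc n)) \<le> 1" by (simp add: inverse_le_1_iff)
    then show ?thesis using UK[of t] UkU[of n t] by linarith
  qed
  have UK': "\<bar>U t\<bar> \<le> K" for t using UK[of t] by simp
  obtain B1 where B1: "B1 \<ge> 0" "\<And>y. \<bar>y\<bar> \<le> K \<Longrightarrow> \<bar>\<eta> y\<bar> \<le> B1" using continuous_bounded_on_interval[OF \<eta>c] by metis
  obtain B2 where B2: "B2 \<ge> 0" "\<And>y. \<bar>y\<bar> \<le> K \<Longrightarrow> \<bar>\<eta>' y\<bar> \<le> B2" using continuous_bounded_on_interval[OF \<eta>(2)] by metis
  obtain C1 where C1: "C1 \<ge> 0" "\<And>y. \<bar>y\<bar> \<le> max \<bar>a\<bar> \<bar>b\<bar> \<Longrightarrow> \<bar>\<kappa>' y\<bar> \<le> C1" using continuous_bounded_on_interval[OF \<kappa>(2)] by metis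
  obtain C2 where C2: "C2 \<ge> 0" "\<And>y. \<bar>y\<bar> \<le> max \<bar>a\<bar> \<bar>b\<bar> \<Longrightarrow> \<bar>\<kappa> y\<bar> \<le> C2" using continuous_bounded_on_interval[OF \<kappa>c] by metis
  have bd1: "\<bar>\<kappa>' t\<bar> \<le> C1 * indicator {a..b} t" for t
    using C1(2)[of t] \<kappa>'0[of t] by (auto simp: indicator_def)
  have bd2: "\<bar>\<kappa> t\<bar> \<le> C2" for t
    using C2(2)[of t] C2(1) \<kappa>(3)[of t] by (cases "t \<in> {a..b}") auto
  have [measurable]: "\<eta> \<in> borel_measurable borel" "\<eta>' \<in> borel_measurable borel" "\<kappa> \<in> borel_measurable borel"
    "\<kappa>' \<in> borel_measurable borel" "U \<in> borel_measurable borel" "\<And>n. Uk n \<in> borel_measurable borel"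
    "V \<in> borel_measurable borel" "\<And>n. g n \<in> borel_measurable borel"
    using \<eta>c \<eta>(2) \<kappa>c \<kappa>(2) Uc Ukc V g(2) by (auto intro: borel_measurable_continuous_onI)
  have iind: "integrable lborel (\<lambda>t. C1 * indicator {a..b} t * B1)"
    by (intro integrable_mult_left integrable_mult_right integrable_real_indicator) (auto simp: emeasure_lborel_Icc_eq)
  have bb1: "\<bar>\<kappa>' t * \<eta> y\<bar> \<le> C1 * indicator {a..b} t * B1" if "\<bar>y\<bar> \<le> K" for t y
    unfolding abs_mult using bd1[of t] B1 that C1(1) by (intro mult_mono) auto
  have bb2: "\<bar>\<kappa> t * (\<eta>' y * v)\<bar> \<le> C2 * (B2 * \<bar>v\<bar>)" if "\<bar>y\<bar> \<le> K" for t y v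
    unfolding abs_mult using bd2[of t] B2 that C2(1) by (intro mult_mono) auto
  have bb1': "\<bar>\<kappa>' t * \<eta> y\<bar> \<le> \<bar>C1 * indicator {a..b} t * B1\<bar>" if "\<bar>y\<bar> \<le> K" for t y
    using bb1[OF that, of t] by linarith
  have bb2': "\<bar>\<kappa> t * (\<eta>' y * v)\<bar> \<le> \<bar>C2 * (B2 * v)\<bar>" if "\<bar>y\<bar> \<le> K" for t y v
    using bb2[OF that, of t v] B2 C2 by (simp add: abs_mult)
  have i1: "integrable lborel (\<lambda>t. \<kappa>' t * \<eta> (W t))" if [measurable]: "W \<in> borel_measurable borel" and "\<And>t. \<bar>W t\<bar> \<le> K" for W
    by (rule Bochner_Integration.integrable_bound[OF iind]) (use bb1'[OF that(2)] in auto)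
  have i2: "integrable lborel (\<lambda>t. \<kappa> t * (\<eta>' (W t) * v t))"
    if [measurable]: "W \<in> borel_measurable borel" and "\<And>t. \<bar>W t\<bar> \<le> K" "integrable lborel v" for W v
    by (rule Bochner_Integration.integrable_bound[OF integrable_mult_right[OF integrable_mult_right[OF that(3)], of C2 B2]])
      (use bb2'[OF that(2)] that(3) in auto)
  show "integrable lborel (\<lambda>t. \<kappa>' t * \<eta> (U t))" "integrable lborel (\<lambda>t. \<kappa> t * (\<eta>' (U t) * V t))"
    using i1[of U] i2[of U V] UK' V by auto
  have zero: "(LINT t|lborel. \<kappa>' t * \<eta> (Uk n t)) + (LINT t|lborel. \<kappa> t * (\<eta>' (Uk n t) * g n t)) = 0" for n
  proof -
    define F where "F t = \<kappa>' t * \<eta> (Uk n t) + \<kappa> t * (\<eta>' (Uk n t) * g n t)" for t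
    \<comment> \<open>The interval reaches one unit beyond the support of \<kappa>, and
      \<open>max a b\<close> covers the case b < a; the boundary terms therefore vanish.\<close>
    have D: "((\<lambda>t. \<kappa> t * \<eta> (Uk n t)) has_real_derivative F t) (at t within {a-1..max a b+1})" if "t \<in> {a-1..max a b+1}" for t
    proof -
      have "((\<lambda>t. A + (LINT s|lborel. indicator {..t} s * g n s)) has_real_derivative 0 + g n t) (at t within {a-1..max a b+1})"
        by (intro DERIV_add DERIV_const indef_has_derivative g that)
      then have "(Uk n has_real_derivative g n t) (at t within {a-1..max a b+1})" by (simp add: Uk_def[abs_def])
      then have "((\<lambda>t. \<eta> (Uk n t)) has_real_derivative \<eta>' (Uk n t) * g n t) (at t within {a-1..max a b+1})"
        by (rule DERIV_chain2[OF \<eta>(1)])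
      from DERIV_mult[OF has_field_derivative_at_within[OF \<kappa>(1)] this] show ?thesis by (simp add: F_def algebra_simps)
    qed
    have Fc: "continuous_on {a-1..max a b+1} F" unfolding F_def
      by (intro continuous_intros continuous_on_compose2[OF \<eta>c] continuous_on_compose2[OF \<eta>(2)]
          continuous_on_subset[OF \<kappa>c] continuous_on_subset[OF \<kappa>(2)] continuous_on_subset[OF g(1)] continuous_on_subset[OF Ukc]) auto
    have "(LINT t|lborel. indicator {a-1..max a b+1} t *\<^sub>R F t) = \<kappa> (max a b+1) * \<eta> (Uk n (max a b+1)) - \<kappa> (a-1) * \<eta> (Uk n (a-1))"
    proof (rule integral_FTC_Icc)
      show "((\<lambda>t. \<kappa> t * \<eta> (Uk n t)) has_vector_derivative F x) (at x within {a-1..max a b+1})" if "a - 1 \<le> x" "x \<le> max a b + 1" for x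
        using D[of x] that by (simp add: has_real_derivative_iff_has_vector_derivative)
    qed (use Fc in auto)
    also have "\<dots> = 0" using \<kappa>(3)[of "a-1"] \<kappa>(3)[of "max a b+1"] by (auto simp: max_def not_le)
    also have "(LINT t|lborel. indicator {a-1..max a b+1} t *\<^sub>R F t) = (LINT t|lborel. F t)"
    proof (intro Bochner_Integration.integral_cong refl)
      fix t
      have "F t = 0" if "t \<notin> {a-1..max a b+1}"
      proof -
        have "t \<notin> {a..b}" using that by (auto simp: max_def split: if_splits)
        then show ?thesis using \<kappa>'0 \<kappa>(3) by (simp add: F_def)
      qed
      then show "indicator {a-1..max a b+1} t *\<^sub>R F t = F t" by (auto simp: indicator_def)
    qed
    finally show ?thesis using i1[of "Uk n"] i2[of "Uk n" "g n"] UkK g(2) by (simp add: F_def)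
  qed
  have UkT: "(\<lambda>n. Uk n t) \<longlonglongrightarrow> U t" for t
  proof (rule LIM_zero_cancel, rule Lim_null_comparison)
    show "\<forall>\<^sub>F n in sequentially. norm (Uk n t - U t) \<le> inverse (real (Suc n))" using UkU by auto
  qed (rule LIMSEQ_inverse_real_of_nat)
  have T1: "(\<lambda>n. LINT t|lborel. \<kappa>' t * \<eta> (Uk n t)) \<longlonglongrightarrow> (LINT t|lborel. \<kappa>' t * \<eta> (U t))"
  proof (rule integral_dominated_convergence[OF _ _ iind])
    show "AE t in lborel. (\<lambda>n. \<kappa>' t * \<eta> (Uk n t)) \<longlonglongrightarrow> \<kappa>' t * \<eta> (U t)"
      by (intro AE_I2 tendsto_mult tendsto_const isCont_tendsto_compose[OF DERIV_isCont[OF \<eta>(1)]] UkT)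
  qed (use bb1 UkK in auto)
  have iV: "integrable lborel (\<lambda>t. C2 * (B2 * \<bar>V t\<bar>))" using V by auto
  have T2: "(\<lambda>n. LINT t|lborel. \<kappa> t * (\<eta>' (Uk n t) * V t)) \<longlonglongrightarrow> (LINT t|lborel. \<kappa> t * (\<eta>' (U t) * V t))"
  proof (rule integral_dominated_convergence[OF _ _ iV])
    have "isCont \<eta>' y" for y using \<eta>(2) by (simp add: continuous_on_eq_continuous_at)
    then show "AE t in lborel. (\<lambda>n. \<kappa> t * (\<eta>' (Uk n t) * V t)) \<longlonglongrightarrow> \<kappa> t * (\<eta>' (U t) * V t)"
      by (intro AE_I2 tendsto_mult tendsto_const isCont_tendsto_compose[where g = \<eta>'] UkT)
  qed (use bb2 UkK in auto)
  have T3: "(\<lambda>n. (LINT t|lborel. \<kappa> t * (\<eta>' (Uk n t) * g n t)) - (LINT t|lborel. \<kappa> t * (\<eta>' (Uk n t) * V t))) \<longlonglongrightarrow> 0"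
  proof (rule Lim_null_comparison)
    have "norm ((LINT t|lborel. \<kappa> t * (\<eta>' (Uk n t) * g n t)) - (LINT t|lborel. \<kappa> t * (\<eta>' (Uk n t) * V t))) \<le> C2 * (B2 * inverse (real (Suc n)))" for n
    proof -
      have gV: "integrable lborel (\<lambda>t. g n t - V t)" using g V by auto
      have "(LINT t|lborel. \<kappa> t * (\<eta>' (Uk n t) * g n t)) - (LINT t|lborel. \<kappa> t * (\<eta>' (Uk n t) * V t))
         = (LINT t|lborel. \<kappa> t * (\<eta>' (Uk n t) * (g n t - V t)))"
        using i2[of "Uk n" "g n"] i2[of "Uk n" V] UkK g(2) V by (simp add: right_diff_distrib)
      also have "norm \<dots> \<le> (LINT t|lborel. C2 * (B2 * \<bar>g n t - V t\<bar>))"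
        unfolding real_norm_def
        by (rule order_trans[OF integral_abs_bound integral_mono]) (use i2[of "Uk n" "\<lambda>t. g n t - V t"] UkK gV bb2 in auto)
      also have "\<dots> = C2 * (B2 * (LINT t|lborel. \<bar>V t - g n t\<bar>))" by (simp add: abs_minus_commute)
      also have "\<dots> \<le> C2 * (B2 * inverse (real (Suc n)))"
        using g(3)[of n] B2 C2 by (intro mult_left_mono) auto
      finally show ?thesis .
    qed
    then show "\<forall>\<^sub>F n in sequentially. norm ((LINT t|lborel. \<kappa> t * (\<eta>' (Uk n t) * g n t)) - (LINT t|lborel. \<kappa> t * (\<eta>' (Uk n t) * V t))) \<le> C2 * (B2 * inverse (real (Suc n)))"
      by simp
    show "(\<lambda>n. C2 * (B2 * inverse (real (Suc n)))) \<longlonglongrightarrow> 0"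
      by (intro tendsto_mult_right_zero LIMSEQ_inverse_real_of_nat)
  qed
  \<comment> \<open>The last summand replaces V by \<open>g n\<close> in the middle one, so each
    member of this sequence is the identity for an approximant and equals 0.\<close>
  have "(\<lambda>n. (LINT t|lborel. \<kappa>' t * \<eta> (Uk n t)) + ((LINT t|lborel. \<kappa> t * (\<eta>' (Uk n t) * V t))
      + ((LINT t|lborel. \<kappa> t * (\<eta>' (Uk n t) * g n t)) - (LINT t|lborel. \<kappa> t * (\<eta>' (Uk n t) * V t)))))
     \<longlonglongrightarrow> (LINT t|lborel. \<kappa>' t * \<eta> (U t)) + ((LINT t|lborel. \<kappa> t * (\<eta>' (U t) * V t)) + 0)"
    by (intro tendsto_add T1 T2 T3)
  then have "(\<lambda>n. 0::real) \<longlonglongrightarrow> (LINT t|lborel. \<kappa>' t * \<eta> (U t)) + (LINT t|lborel. \<kappa> t * (\<eta>' (U t) * V t))"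
    using zero by simp
  then have "(LINT t|lborel. \<kappa>' t * \<eta> (U t)) + (LINT t|lborel. \<kappa> t * (\<eta>' (U t) * V t)) = 0"
    by (simp add: LIMSEQ_const_iff)
  then show "(LINT t|lborel. \<kappa>' t * \<eta> (U t)) = - (LINT t|lborel. \<kappa> t * (\<eta>' (U t) * V t))" by simp
qed

section \<open>The Sobolev inequality in dimension three\<close>

definition vec3 :: "real \<Rightarrow> real \<Rightarrow> real \<Rightarrow> real^3" where
  "vec3 a b c = vector [a, b, c]"

lemma vec3_nth [simp]: "vec3 a b c $ 1 = a" "vec3 a b c $ 2 = b" "vec3 a b c $ 3 = c"
  by (simp_all add: vec3_def)

lemma vec3_measurable [measurable]:
  assumes [measurable]: "f \<in> borel_measurable M" "g \<in> borel_measurable M" "h \<in> borel_measurable M"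
  shows "(\<lambda>p. vec3 (f p) (g p) (h p)) \<in> borel_measurable M"
proof (rule borel_measurable_euclidean_space[THEN iffD2], rule ballI)
  fix i :: "real^3" assume "i \<in> Basis"
  then obtain j :: 3 where j: "i = axis j 1" by (auto simp: Basis_vec_def)
  have "(\<lambda>p. vec3 (f p) (g p) (h p) $ j) \<in> borel_measurable M"
    using exhaust_3[of j] by auto
  then show "(\<lambda>p. vec3 (f p) (g p) (h p) \<bullet> i) \<in> borel_measurable M" by (simp add: j inner_axis)
qed

text \<open>Lebesgue measure is determined by the volumes of boxes, and these factor into three
  lengths. The point is to obtain iterated integrals over coordinate lines.\<close>

lemma lborel_real3:
  "(lborel :: (real^3) measure) = distr (lborel \<Otimes>\<^sub>M (lborel \<Otimes>\<^sub>M lborel)) borel (\<lambda>p. vec3 (fst p) (fst (snd p)) (snd (snd p)))"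
proof (rule lborel_eqI)
  let ?T = "\<lambda>p::real\<times>real\<times>real. vec3 (fst p) (fst (snd p)) (snd (snd p))"
  fix l u :: "real^3" assume lu: "\<And>b. b \<in> Basis \<Longrightarrow> l \<bullet> b \<le> u \<bullet> b"
  have le: "l $ i \<le> u $ i" for i using lu[OF axis_Basis_real3[of i]] by (simp add: inner_axis)
  have T: "?T \<in> measurable (lborel \<Otimes>\<^sub>M (lborel \<Otimes>\<^sub>M lborel)) borel" by measurable
  have "?T -` box l u \<inter> space (lborel \<Otimes>\<^sub>M (lborel \<Otimes>\<^sub>M lborel)) = {l$1<..<u$1} \<times> ({l$2<..<u$2} \<times> {l$3<..<u$3})"
    by (auto simp: mem_box_cart forall_3 space_pair_measure)
  then have "emeasure (distr (lborel \<Otimes>\<^sub>M (lborel \<Otimes>\<^sub>M lborel)) borel ?T) (box l u)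
      = emeasure (lborel \<Otimes>\<^sub>M (lborel \<Otimes>\<^sub>M lborel)) ({l$1<..<u$1} \<times> ({l$2<..<u$2} \<times> {l$3<..<u$3}))"
    by (subst emeasure_distr[OF T]) auto
  also have "\<dots> = emeasure lborel {l$1<..<u$1} * emeasure (lborel \<Otimes>\<^sub>M lborel) ({l$2<..<u$2} \<times> {l$3<..<u$3})"
  proof (rule sigma_finite_measure.emeasure_pair_measure_Times)
    show "sigma_finite_measure (lborel \<Otimes>\<^sub>M lborel :: (real \<times> real) measure)"
      unfolding lborel_prod by (rule sigma_finite_lborel)
    show "{l$1<..<u$1} \<in> sets lborel" by simp
    show "{l$2<..<u$2} \<times> {l$3<..<u$3} \<in> sets (lborel \<Otimes>\<^sub>M lborel)"
      by (rule pair_measureI) simp_all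
  qed
  also have "emeasure (lborel \<Otimes>\<^sub>M lborel) ({l$2<..<u$2} \<times> {l$3<..<u$3}) = emeasure lborel {l$2<..<u$2} * emeasure lborel {l$3<..<u$3}"
    by (rule lborel.emeasure_pair_measure_Times) simp_all
  also have "emeasure lborel {l$1<..<u$1} = ennreal (u$1 - l$1)" by (rule emeasure_lborel_Ioo[OF le])
  also have "emeasure lborel {l$2<..<u$2} = ennreal (u$2 - l$2)" by (rule emeasure_lborel_Ioo[OF le])
  also have "emeasure lborel {l$3<..<u$3} = ennreal (u$3 - l$3)" by (rule emeasure_lborel_Ioo[OF le])
  also have "ennreal (u$1 - l$1) * (ennreal (u$2 - l$2) * ennreal (u$3 - l$3)) = (\<Prod>i\<in>UNIV. ennreal (u$i - l$i))"
    unfolding UNIV_3 by (subst prod.insert; simp)+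
  also have "\<dots> = ennreal (\<Prod>i\<in>UNIV. u$i - l$i)" using le by (simp add: prod_ennreal)
  also have "(\<Prod>i\<in>UNIV. u$i - l$i) = (\<Prod>b\<in>Basis. (u - l) \<bullet> b)"
  proof -
    have B: "(Basis :: (real^3) set) = (\<lambda>i. axis i 1) ` UNIV" by (auto simp: Basis_vec_def)
    show ?thesis unfolding B by (subst prod.reindex) (auto simp: inj_on_def axis_eq_axis inner_axis)
  qed
  finally show "emeasure (distr (lborel \<Otimes>\<^sub>M (lborel \<Otimes>\<^sub>M lborel)) borel ?T) (box l u) = ennreal (\<Prod>b\<in>Basis. (u - l) \<bullet> b)" .
qed simp

lemma nn_integral_real3:
  assumes [measurable]: "f \<in> borel_measurable borel"
  shows "(\<integral>\<^sup>+ x. f x \<partial>(lborel :: (real^3) measure)) = (\<integral>\<^sup>+ a. \<integral>\<^sup>+ b. \<integral>\<^sup>+ c. f (vec3 a b c) \<partial>lborel \<partial>lborel \<partial>lborel)"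
proof -
  have sf: "sigma_finite_measure (lborel \<Otimes>\<^sub>M lborel :: (real \<times> real) measure)"
    unfolding lborel_prod by (rule sigma_finite_lborel)
  have "(\<integral>\<^sup>+ x. f x \<partial>(lborel :: (real^3) measure)) = (\<integral>\<^sup>+ p. f (vec3 (fst p) (fst (snd p)) (snd (snd p))) \<partial>(lborel \<Otimes>\<^sub>M (lborel \<Otimes>\<^sub>M lborel)))"
    by (subst lborel_real3) (subst nn_integral_distr; measurable)
  also have "\<dots> = (\<integral>\<^sup>+ a. \<integral>\<^sup>+ q. f (vec3 a (fst q) (snd q)) \<partial>(lborel \<Otimes>\<^sub>M lborel) \<partial>lborel)"
  proof -
    have "(\<lambda>p. f (vec3 (fst p) (fst (snd p)) (snd (snd p)))) \<in> borel_measurable (lborel \<Otimes>\<^sub>M (lborel \<Otimes>\<^sub>M lborel))"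
      by measurable
    from sigma_finite_measure.nn_integral_fst[OF sf this] show ?thesis by simp
  qed
  also have "\<dots> = (\<integral>\<^sup>+ a. \<integral>\<^sup>+ b. \<integral>\<^sup>+ c. f (vec3 a b c) \<partial>lborel \<partial>lborel \<partial>lborel)"
    by (intro nn_integral_cong) (subst lborel.nn_integral_fst[symmetric]; measurable; simp)
  finally show ?thesis .
qed

text \<open>The Loomis-Whitney inequality is applied to square roots of functions that may be infinite.\<close>

definition esqrt :: "ennreal \<Rightarrow> ennreal" where
  "esqrt x = (if x = \<infinity> then \<infinity> else ennreal (sqrt (enn2real x)))"

lemma esqrt_sq: "(esqrt x)\<^sup>2 = x"
  by (cases x) (auto simp: esqrt_def ennreal_power)

lemma esqrt_measurable [measurable]: "esqrt \<in> borel_measurable borel"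
proof -
  have "{x \<in> space borel. x = (\<infinity>::ennreal)} = {\<infinity>}" by auto
  then have [measurable]: "{x \<in> space borel. x = (\<infinity>::ennreal)} \<in> sets borel" by simp
  show ?thesis unfolding esqrt_def[abs_def] by measurable
qed

lemma ennreal_sq_le_imp_le: "x\<^sup>2 \<le> y\<^sup>2 \<Longrightarrow> x \<le> (y::ennreal)"
  by (cases x; cases y) (auto simp: ennreal_power top_unique intro!: ennreal_leI power2_le_imp_le)

text \<open>Two applications of Cauchy-Schwarz: in c for fixed a and b, and then in the pair (a, b),
  after which the bound for D factors. Squaring both sides avoids roots of possibly infinite
  quantities.\<close>

lemma loomis_whitney:
  fixes F G H :: "real \<times> real \<Rightarrow> ennreal"
  assumes [measurable]: "F \<in> borel_measurable (lborel \<Otimes>\<^sub>M lborel)"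
    "G \<in> borel_measurable (lborel \<Otimes>\<^sub>M lborel)" "H \<in> borel_measurable (lborel \<Otimes>\<^sub>M lborel)"
  shows "(\<integral>\<^sup>+ a. \<integral>\<^sup>+ b. \<integral>\<^sup>+ c. F (b, c) * G (a, c) * H (a, b) \<partial>lborel \<partial>lborel \<partial>lborel)\<^sup>2
    \<le> (\<integral>\<^sup>+ b. \<integral>\<^sup>+ c. (F (b, c))\<^sup>2 \<partial>lborel \<partial>lborel) * (\<integral>\<^sup>+ a. \<integral>\<^sup>+ c. (G (a, c))\<^sup>2 \<partial>lborel \<partial>lborel)
      * (\<integral>\<^sup>+ a. \<integral>\<^sup>+ b. (H (a, b))\<^sup>2 \<partial>lborel \<partial>lborel)"
proof -
  define D where "D p = (\<integral>\<^sup>+ c. F (snd p, c) * G (fst p, c) \<partial>lborel)" for p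
  have [measurable]: "D \<in> borel_measurable (lborel \<Otimes>\<^sub>M lborel)" unfolding D_def by measurable
  define P where "P b = (\<integral>\<^sup>+ c. (F (b, c))\<^sup>2 \<partial>lborel)" for b
  define Q where "Q a = (\<integral>\<^sup>+ c. (G (a, c))\<^sup>2 \<partial>lborel)" for a
  have [measurable]: "P \<in> borel_measurable lborel" "Q \<in> borel_measurable lborel" unfolding P_def Q_def by measurable
  have D2: "(D (a, b))\<^sup>2 \<le> P b * Q a" for a b
    unfolding D_def P_def Q_def fst_conv snd_conv by (rule Cauchy_Schwarz_nn_integral) measurable
  have "(\<integral>\<^sup>+ c. F (b, c) * G (a, c) * H (a, b) \<partial>lborel) = H (a, b) * D (a, b)" for a b
    unfolding D_def fst_conv snd_conv by (subst nn_integral_multc) (measurable, simp add: mult.commute)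
  then have "(\<integral>\<^sup>+ a. \<integral>\<^sup>+ b. \<integral>\<^sup>+ c. F (b, c) * G (a, c) * H (a, b) \<partial>lborel \<partial>lborel \<partial>lborel)
      = (\<integral>\<^sup>+ a. \<integral>\<^sup>+ b. H (a, b) * D (a, b) \<partial>lborel \<partial>lborel)" by simp
  also have "\<dots> = (\<integral>\<^sup>+ p. H p * D p \<partial>(lborel \<Otimes>\<^sub>M lborel))"
    by (rule lborel.nn_integral_fst) measurable
  also have "\<dots>\<^sup>2 \<le> (\<integral>\<^sup>+ p. (H p)\<^sup>2 \<partial>(lborel \<Otimes>\<^sub>M lborel)) * (\<integral>\<^sup>+ p. (D p)\<^sup>2 \<partial>(lborel \<Otimes>\<^sub>M lborel))"
    by (rule Cauchy_Schwarz_nn_integral) measurable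
  also have "(\<integral>\<^sup>+ p. (H p)\<^sup>2 \<partial>(lborel \<Otimes>\<^sub>M lborel)) = (\<integral>\<^sup>+ a. \<integral>\<^sup>+ b. (H (a, b))\<^sup>2 \<partial>lborel \<partial>lborel)"
    by (rule lborel.nn_integral_fst[symmetric]) measurable
  also have "(\<integral>\<^sup>+ p. (D p)\<^sup>2 \<partial>(lborel \<Otimes>\<^sub>M lborel)) = (\<integral>\<^sup>+ a. \<integral>\<^sup>+ b. (D (a, b))\<^sup>2 \<partial>lborel \<partial>lborel)"
    by (rule lborel.nn_integral_fst[symmetric]) measurable
  also have "(\<integral>\<^sup>+ a. \<integral>\<^sup>+ b. (H (a, b))\<^sup>2 \<partial>lborel \<partial>lborel) * (\<integral>\<^sup>+ a. \<integral>\<^sup>+ b. (D (a, b))\<^sup>2 \<partial>lborel \<partial>lborel)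
      \<le> (\<integral>\<^sup>+ a. \<integral>\<^sup>+ b. (H (a, b))\<^sup>2 \<partial>lborel \<partial>lborel) * (\<integral>\<^sup>+ a. \<integral>\<^sup>+ b. P b * Q a \<partial>lborel \<partial>lborel)"
    by (intro mult_left_mono nn_integral_mono D2) simp
  also have "(\<integral>\<^sup>+ a. \<integral>\<^sup>+ b. P b * Q a \<partial>lborel \<partial>lborel) = (\<integral>\<^sup>+ b. P b \<partial>lborel) * (\<integral>\<^sup>+ a. Q a \<partial>lborel)"
    by (simp add: nn_integral_multc nn_integral_cmult)
  finally show ?thesis unfolding P_def Q_def by (simp add: mult.commute)
qed

text \<open>One integrates h' from a point further left where h vanishes. The right-hand side is an
  extended integral, so h' need not be shown integrable on the line.\<close>

lemma line_bound:
  fixes h :: "real \<Rightarrow> real"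
  assumes D: "\<And>t. (h has_real_derivative h' t) (at t)" and c: "continuous_on UNIV h'"
    and z: "\<And>t. t \<le> K \<Longrightarrow> h t = 0"
  shows "ennreal \<bar>h t\<bar> \<le> (\<integral>\<^sup>+ s. ennreal \<bar>h' s\<bar> \<partial>lborel)"
proof -
  define l where "l = min K t"
  have l: "l \<le> t" "h l = 0" using z by (auto simp: l_def)
  have c': "continuous_on {l..t} h'" using c by (rule continuous_on_subset) simp
  have "(LINT s|lborel. indicator {l..t} s *\<^sub>R h' s) = h t - h l"
    by (rule integral_FTC_Icc[OF l(1)])
      (use D c' in \<open>auto simp: has_real_derivative_iff_has_vector_derivative intro: has_vector_derivative_at_within\<close>)
  then have "\<bar>h t\<bar> = \<bar>LINT s|lborel. indicator {l..t} s * h' s\<bar>" using l by simp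
  also have "\<dots> \<le> (LINT s|lborel. \<bar>indicator {l..t} s * h' s\<bar>)" by (rule integral_abs_bound)
  finally have 1: "\<bar>h t\<bar> \<le> (LINT s|lborel. \<bar>indicator {l..t} s * h' s\<bar>)" .
  have i: "integrable lborel (\<lambda>s. indicator {l..t} s * h' s)"
    using borel_integrable_atLeastAtMost'[OF c'] by (simp add: set_integrable_def)
  have "ennreal \<bar>h t\<bar> \<le> ennreal (LINT s|lborel. \<bar>indicator {l..t} s * h' s\<bar>)" using 1 by (rule ennreal_leI)
  also have "\<dots> = (\<integral>\<^sup>+ s. ennreal \<bar>indicator {l..t} s * h' s\<bar> \<partial>lborel)"
    by (rule nn_integral_eq_integral[symmetric]) (use i in auto)
  also have "\<dots> \<le> (\<integral>\<^sup>+ s. ennreal \<bar>h' s\<bar> \<partial>lborel)"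
    by (intro nn_integral_mono ennreal_leI) (auto simp: indicator_def)
  finally show ?thesis .
qed

section \<open>The Sobolev inequality for test functions\<close>

lemma supported_integrable:
  fixes h :: "'a::euclidean_space \<Rightarrow> real"
  assumes "compact (tsupport g)" "h \<in> borel_measurable borel" "\<And>x. \<bar>h x\<bar> \<le> B" "\<And>x. x \<notin> tsupport g \<Longrightarrow> h x = 0"
  shows "integrable lborel h"
proof (rule Bochner_Integration.integrable_bound[where f = "\<lambda>x. B * indicator (tsupport g) x"])
  show "integrable lborel (\<lambda>x. B * indicator (tsupport g) x)"
    using emeasure_bounded_finite[OF compact_imp_bounded[OF assms(1)]] compact_imp_closed[OF assms(1)]
    by (intro integrable_mult_right integrable_real_indicator) (auto intro: borel_closed)
  show "AE x in lborel. norm (h x) \<le> norm (B * indicator (tsupport g) x)"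
  proof (rule AE_I2)
    fix x show "norm (h x) \<le> norm (B * indicator (tsupport g) x)"
      using assms(3)[of x] assms(4)[of x] by (auto simp: indicator_def)
  qed
qed (use assms in simp)

lemma test_fun_power_integrable: "test_fun U g \<Longrightarrow> integrable lborel (\<lambda>x. g x ^ Suc n)"
proof -
  assume g: "test_fun U g"
  obtain B where B: "B \<ge> 0" "\<And>x. \<bar>g x\<bar> \<le> B" using test_fun_bounded[OF g] by metis
  have [measurable]: "g \<in> borel_measurable borel" using test_fun_measurable[OF g] .
  show ?thesis
  proof (rule supported_integrable[of g])
    show "\<bar>g x ^ Suc n\<bar> \<le> B ^ Suc n" for x unfolding power_abs using B by (intro power_mono) auto
  qed (use g tsupport_zero[of _ g] in \<open>auto simp: test_fun_def\<close>)
qed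

lemma test_fun_grad3_integrable: "test_fun U g \<Longrightarrow> integrable lborel (\<lambda>x. (norm (grad3 g x))\<^sup>2)"
proof -
  assume g: "test_fun U g"
  obtain B where B: "B \<ge> 0" "\<And>x. norm (grad3 g x) \<le> B" using test_fun_grad3_bounded[OF g] by metis
  have [measurable]: "grad3 g \<in> borel_measurable borel" using test_fun_grad3_measurable[OF g] .
  show ?thesis
  proof (rule supported_integrable[of g])
    show "\<bar>(norm (grad3 g x))\<^sup>2\<bar> \<le> B\<^sup>2" for x using B by (simp add: power_mono)
  qed (use g grad3_outside[of _ g] in \<open>auto simp: test_fun_def\<close>)
qed

lemma vec3_axis: "vec3 a b c + s *\<^sub>R axis 1 1 = vec3 (a + s) b c" "vec3 a b c + s *\<^sub>R axis 2 1 = vec3 a (b + s) c"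
  "vec3 a b c + s *\<^sub>R axis 3 1 = vec3 a b (c + s)"
  by (simp_all add: vec_eq_iff forall_3 axis_def)

text \<open>\<open>L\<close> runs along a line parallel to the j-th axis. The fourth power is chosen
  because the square roots of three such bounds multiply to the sixth power of g.\<close>

lemma test_fun_line_bound:
  fixes L :: "real \<Rightarrow> real^3" and j :: 3
  assumes g: "test_fun U g" and L: "\<And>a s. L a + s *\<^sub>R axis j 1 = L (a + s)"
  shows "ennreal ((g (L t)) ^ 4) \<le> (\<integral>\<^sup>+ a. ennreal (4 * \<bar>g (L a)\<bar> ^ 3 * norm (grad3 g (L a))) \<partial>lborel)"
proof -
  have L0: "L a = L 0 + a *\<^sub>R axis j 1" for a using L[of 0 a] by simp
  have Lc: "continuous_on UNIV L"
    by (rule continuous_on_cong[THEN iffD2, OF refl L0]) (intro continuous_intros)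
  define h' where "h' a = 4 * g (L a) ^ 3 * pd (axis j 1) g (L a)" for a
  have "((\<lambda>a. g (L a)) has_real_derivative pd (axis j 1) g (L t)) (at t)" for t
  proof -
    have "((\<lambda>s. g (L t + s *\<^sub>R axis j 1)) has_real_derivative pd (axis j 1) g (L t)) (at 0)"
      by (rule smooth_pd_deriv[OF test_fun_imp_smooth[OF g] axis_Basis_real3])
    then show ?thesis using DERIV_shift[of "\<lambda>a. g (L a)" "pd (axis j 1) g (L t)" 0 t] by (simp add: L add.commute)
  qed
  from DERIV_power[OF this, of 4] have D: "((\<lambda>a. g (L a) ^ 4) has_real_derivative h' t) (at t)" for t
    by (simp add: h'_def algebra_simps)
  have gc: "continuous_on UNIV g" "continuous_on UNIV (pd (axis j 1) g)"
    using smooth_imp_continuous[OF test_fun_imp_smooth[OF g]]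
      smooth_imp_continuous[OF test_fun_imp_smooth[OF test_fun_pd[OF g axis_Basis_real3]]] by auto
  have c: "continuous_on UNIV h'" unfolding h'_def
    by (intro continuous_intros continuous_on_compose2[OF gc(1) Lc] continuous_on_compose2[OF gc(2) Lc]) auto
  have "bounded (tsupport g)" using g by (auto simp: test_fun_def compact_imp_bounded)
  then obtain R where R: "\<And>x. x \<in> tsupport g \<Longrightarrow> norm x \<le> R" unfolding bounded_iff by blast
  \<comment> \<open>So far out the j-th coordinate alone exceeds the radius R of a ball containing
    the support.\<close>
  have z: "g (L a) ^ 4 = 0" if "a \<le> - (R + \<bar>L 0 $ j\<bar> + 1)" for a
  proof -
    have "L a $ j = L 0 $ j + a" using L0[of a] by (simp add: axis_def)
    then have "norm (L a) > R" using component_le_norm_cart[of "L a" j] that by linarith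
    then have "L a \<notin> tsupport g" using R[of "L a"] by linarith
    then show ?thesis using tsupport_zero by simp
  qed
  have "ennreal \<bar>g (L t) ^ 4\<bar> \<le> (\<integral>\<^sup>+ s. ennreal \<bar>h' s\<bar> \<partial>lborel)"
    by (rule line_bound[OF D c z])
  also have "\<dots> \<le> (\<integral>\<^sup>+ a. ennreal (4 * \<bar>g (L a)\<bar> ^ 3 * norm (grad3 g (L a))) \<partial>lborel)"
  proof (intro nn_integral_mono ennreal_leI)
    fix a
    show "\<bar>h' a\<bar> \<le> 4 * \<bar>g (L a)\<bar> ^ 3 * norm (grad3 g (L a))"
      using component_le_norm_cart[of "grad3 g (L a)" j]
      by (simp add: h'_def abs_mult power_abs mult_left_mono)
  qed
  finally show ?thesis by simp
qed

text \<open>The Gagliardo-Nirenberg argument. Line integrals of \<open>n\<close>, which is 4 |g|^3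
  times the gradient norm, bound g^4 in all three directions, and Loomis-Whitney gives
  \<open>I\<^sup>2 \<le> N ^ 3\<close>. Cauchy-Schwarz bounds the square of N by 16 I times the
  Dirichlet integral, which closes the estimate for I.\<close>

lemma sobolev_test_fun:
  assumes g: "test_fun U g"
  shows "(LINT x|lborel. (g x) ^ 6) \<le> 4096 * (LINT x|lborel. (norm (grad3 g x))\<^sup>2) ^ 3"
proof -
  define n where "n x = ennreal (4 * \<bar>g x\<bar> ^ 3 * norm (grad3 g x))" for x
  have [measurable]: "g \<in> borel_measurable borel" "grad3 g \<in> borel_measurable borel"
    using test_fun_measurable[OF g] test_fun_grad3_measurable[OF g] by auto
  have [measurable]: "n \<in> borel_measurable borel" unfolding n_def by measurable
  define F where "F p = (\<integral>\<^sup>+ a. n (vec3 a (fst p) (snd p)) \<partial>lborel)" for p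
  define G where "G p = (\<integral>\<^sup>+ b. n (vec3 (fst p) b (snd p)) \<partial>lborel)" for p
  define H where "H p = (\<integral>\<^sup>+ c. n (vec3 (fst p) (snd p) c) \<partial>lborel)" for p
  have [measurable]: "F \<in> borel_measurable (lborel \<Otimes>\<^sub>M lborel)"
    "G \<in> borel_measurable (lborel \<Otimes>\<^sub>M lborel)" "H \<in> borel_measurable (lborel \<Otimes>\<^sub>M lborel)"
    unfolding F_def G_def H_def by measurable
  define I where "I = (\<integral>\<^sup>+ x. ennreal (g x ^ 6) \<partial>lborel)"
  define N where "N = (\<integral>\<^sup>+ x. n x \<partial>lborel)"
  have pw: "ennreal (g (vec3 a b c) ^ 6) \<le> esqrt (F (b, c)) * esqrt (G (a, c)) * esqrt (H (a, b))" for a b c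
  proof (rule ennreal_sq_le_imp_le)
    let ?y = "g (vec3 a b c)"
    have "ennreal (?y ^ 4) \<le> F (b, c)" "ennreal (?y ^ 4) \<le> G (a, c)" "ennreal (?y ^ 4) \<le> H (a, b)"
      unfolding F_def G_def H_def n_def fst_conv snd_conv
      using test_fun_line_bound[OF g, of "\<lambda>a. vec3 a b c" 1 a] test_fun_line_bound[OF g, of "\<lambda>b. vec3 a b c" 2 b]
        test_fun_line_bound[OF g, of "\<lambda>c. vec3 a b c" 3 c] by (simp_all add: vec3_axis)
    then have "ennreal (?y ^ 4) * ennreal (?y ^ 4) * ennreal (?y ^ 4) \<le> F (b, c) * G (a, c) * H (a, b)"
      by (intro mult_mono) auto
    moreover have "(ennreal (?y ^ 6))\<^sup>2 = ennreal (?y ^ 4) * ennreal (?y ^ 4) * ennreal (?y ^ 4)"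
      by (simp add: ennreal_power ennreal_mult[symmetric] power_mult[symmetric] power_add[symmetric])
    ultimately show "(ennreal (?y ^ 6))\<^sup>2 \<le> (esqrt (F (b, c)) * esqrt (G (a, c)) * esqrt (H (a, b)))\<^sup>2"
      by (simp add: power_mult_distrib esqrt_sq)
  qed
  have "I = (\<integral>\<^sup>+ a. \<integral>\<^sup>+ b. \<integral>\<^sup>+ c. ennreal (g (vec3 a b c) ^ 6) \<partial>lborel \<partial>lborel \<partial>lborel)"
    unfolding I_def by (rule nn_integral_real3) measurable
  also have "\<dots> \<le> (\<integral>\<^sup>+ a. \<integral>\<^sup>+ b. \<integral>\<^sup>+ c. esqrt (F (b, c)) * esqrt (G (a, c)) * esqrt (H (a, b)) \<partial>lborel \<partial>lborel \<partial>lborel)"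
    by (intro nn_integral_mono pw)
  finally have "I\<^sup>2 \<le> (\<integral>\<^sup>+ a. \<integral>\<^sup>+ b. \<integral>\<^sup>+ c. esqrt (F (b, c)) * esqrt (G (a, c)) * esqrt (H (a, b)) \<partial>lborel \<partial>lborel \<partial>lborel)\<^sup>2"
    by (rule power_mono) simp
  also have "\<dots> \<le> (\<integral>\<^sup>+ b. \<integral>\<^sup>+ c. F (b, c) \<partial>lborel \<partial>lborel) * (\<integral>\<^sup>+ a. \<integral>\<^sup>+ c. G (a, c) \<partial>lborel \<partial>lborel) * (\<integral>\<^sup>+ a. \<integral>\<^sup>+ b. H (a, b) \<partial>lborel \<partial>lborel)"
    using loomis_whitney[of "\<lambda>p. esqrt (F p)" "\<lambda>p. esqrt (G p)" "\<lambda>p. esqrt (H p)"]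
    by (simp add: esqrt_sq)
  also have "(\<integral>\<^sup>+ a. \<integral>\<^sup>+ b. H (a, b) \<partial>lborel \<partial>lborel) = N"
    unfolding H_def N_def fst_conv snd_conv by (rule nn_integral_real3[symmetric]) measurable
  also have "(\<integral>\<^sup>+ a. \<integral>\<^sup>+ c. G (a, c) \<partial>lborel \<partial>lborel) = N"
    unfolding G_def N_def fst_conv snd_conv by (subst nn_integral_real3) (auto intro!: nn_integral_cong lborel_pair.Fubini')
  also have "(\<integral>\<^sup>+ b. \<integral>\<^sup>+ c. F (b, c) \<partial>lborel \<partial>lborel) = N"
  proof -
    have "N = (\<integral>\<^sup>+ a. \<integral>\<^sup>+ b. \<integral>\<^sup>+ c. n (vec3 a b c) \<partial>lborel \<partial>lborel \<partial>lborel)"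
      unfolding N_def by (rule nn_integral_real3) measurable
    also have "\<dots> = (\<integral>\<^sup>+ b. \<integral>\<^sup>+ a. \<integral>\<^sup>+ c. n (vec3 a b c) \<partial>lborel \<partial>lborel \<partial>lborel)"
      by (rule lborel_pair.Fubini'[symmetric]) measurable
    also have "\<dots> = (\<integral>\<^sup>+ b. \<integral>\<^sup>+ c. F (b, c) \<partial>lborel \<partial>lborel)"
      unfolding F_def fst_conv snd_conv by (intro nn_integral_cong lborel_pair.Fubini'[symmetric]) measurable
    finally show ?thesis by simp
  qed
  finally have IN: "I\<^sup>2 \<le> N ^ 3" by (simp add: power3_eq_cube)
  define i where "i = (LINT x|lborel. g x ^ 6)"
  define d where "d = (LINT x|lborel. (norm (grad3 g x))\<^sup>2)"
  have Ii: "I = ennreal i" unfolding I_def i_def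
    using test_fun_power_integrable[OF g, of 5] by (intro nn_integral_eq_integral) auto
  have Dd: "(\<integral>\<^sup>+ x. ennreal ((norm (grad3 g x))\<^sup>2) \<partial>lborel) = ennreal d" unfolding d_def
    using test_fun_grad3_integrable[OF g] by (intro nn_integral_eq_integral) auto
  have i0: "i \<ge> 0" "d \<ge> 0" by (auto simp: i_def d_def)
  have "N\<^sup>2 \<le> (\<integral>\<^sup>+ x. (ennreal (4 * \<bar>g x\<bar> ^ 3))\<^sup>2 \<partial>lborel) * (\<integral>\<^sup>+ x. (ennreal (norm (grad3 g x)))\<^sup>2 \<partial>lborel)"
    unfolding N_def n_def by (simp only: ennreal_mult' norm_ge_zero ennreal_mult''[OF norm_ge_zero], rule Cauchy_Schwarz_nn_integral) measurable
  also have "(\<lambda>x. (ennreal (4 * \<bar>g x\<bar> ^ 3))\<^sup>2) = (\<lambda>x. 16 * ennreal (g x ^ 6))"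
  proof
    fix x
    have "(4 * \<bar>g x\<bar> ^ 3)\<^sup>2 = 16 * g x ^ 6"
      by (simp add: power_mult_distrib power_mult[symmetric] power_even_abs)
    then show "(ennreal (4 * \<bar>g x\<bar> ^ 3))\<^sup>2 = 16 * ennreal (g x ^ 6)"
      by (simp add: ennreal_power ennreal_mult)
  qed
  also have "(\<integral>\<^sup>+ x. 16 * ennreal (g x ^ 6) \<partial>lborel) = 16 * I"
    unfolding I_def by (rule nn_integral_cmult) measurable
  also have "(\<lambda>x. (ennreal (norm (grad3 g x)))\<^sup>2) = (\<lambda>x. ennreal ((norm (grad3 g x))\<^sup>2))"
    by (simp add: ennreal_power)
  also note Dd
  finally have N2: "N\<^sup>2 \<le> ennreal (16 * i * d)" using i0 by (simp add: Ii ennreal_mult)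
  have "(ennreal i) ^ 4 \<le> (N ^ 3)\<^sup>2"
    using power_mono[OF IN, of 2] by (simp add: Ii power_mult[symmetric])
  also have "\<dots> = (N\<^sup>2) ^ 3" by (simp add: power_mult[symmetric])
  also have "\<dots> \<le> (ennreal (16 * i * d)) ^ 3" by (rule power_mono[OF N2]) simp
  finally have "ennreal (i ^ 4) \<le> ennreal ((16 * i * d) ^ 3)" using i0 by (simp add: ennreal_power)
  then have 4: "i ^ 4 \<le> (16 * i * d) ^ 3" using i0 by (subst (asm) ennreal_le_iff) auto
  \<comment> \<open>Dividing by \<open>i ^ 3\<close> leaves the constant 16^3 = 4096. Compact
    support makes i a real number, so this is legitimate unless i = 0.\<close>
  have "i \<le> 4096 * d ^ 3"
  proof (cases "i = 0")
    case False
    then have "i > 0" using i0 by simp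
    have "i ^ 3 * i \<le> i ^ 3 * (4096 * d ^ 3)" using 4 by (simp add: power_mult_distrib power_numeral_reduce algebra_simps)
    then show ?thesis using \<open>i > 0\<close> by simp
  qed (use i0 in simp)
  then show ?thesis by (simp add: i_def d_def)
qed

section \<open>Functions in the Sobolev space\<close>

lemma AE_lebesgue_on_iff:
  assumes "S \<in> sets borel"
  shows "(AE x in lebesgue_on S. P x) \<longleftrightarrow> (AE x in lborel. x \<in> S \<longrightarrow> P x)"
  using assms by (subst AE_restrict_space_iff) (auto simp: AE_completion_iff)

lemma borel_measurable_lebesgue_on: "f \<in> borel_measurable borel \<Longrightarrow> f \<in> borel_measurable (lebesgue_on S)"
  by (intro measurable_restrict_space1 measurable_completion) simp

text \<open>The definitions use the completed measure on a domain, while Fubini arguments need Borel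
  measure on the whole space; extension by zero translates between the two.\<close>

lemma lebesgue_on_borel:
  fixes f :: "'a::euclidean_space \<Rightarrow> 'b::{banach, second_countable_topology}"
  assumes S: "S \<in> sets borel" and f[measurable]: "f \<in> borel_measurable borel" and z: "\<And>x. x \<notin> S \<Longrightarrow> f x = 0"
  shows "integrable (lebesgue_on S) f \<longleftrightarrow> integrable lborel f"
    "(LINT x|lebesgue_on S. f x) = (LINT x|lborel. f x)"
proof -
  have e: "(\<lambda>x. indicator S x *\<^sub>R f x) = f" using z by (auto simp: indicator_def)
  show "integrable (lebesgue_on S) f \<longleftrightarrow> integrable lborel f"
    using S by (subst integrable_restrict_space) (auto simp: e integrable_completion)
  show "(LINT x|lebesgue_on S. f x) = (LINT x|lborel. f x)"
    using S by (subst integral_restrict_space) (auto simp: e integral_completion)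
qed

lemma norm_sq_add_le: "(norm (a + b :: 'a::real_normed_vector))\<^sup>2 \<le> 2 * (norm a)\<^sup>2 + 2 * (norm b)\<^sup>2"
proof -
  have "(norm (a + b))\<^sup>2 \<le> (norm a + norm b)\<^sup>2" by (intro power_mono norm_triangle_ineq) auto
  also have "\<dots> \<le> 2 * (norm a)\<^sup>2 + 2 * (norm b)\<^sup>2"
    using zero_le_power2[of "norm a - norm b"] by (simp add: power2_eq_square algebra_simps)
  finally show ?thesis .
qed

lemma integrable_sq_add:
  fixes f g :: "'a \<Rightarrow> 'b::{banach, second_countable_topology}"
  assumes [measurable]: "f \<in> borel_measurable M" "g \<in> borel_measurable M"
    and "integrable M (\<lambda>x. (norm (f x))\<^sup>2)" "integrable M (\<lambda>x. (norm (g x))\<^sup>2)"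
  shows "integrable M (\<lambda>x. (norm (f x + g x))\<^sup>2)"
  by (rule Bochner_Integration.integrable_bound[OF Bochner_Integration.integrable_add[OF
        integrable_mult_right[OF assms(3), of 2] integrable_mult_right[OF assms(4), of 2]]])
    (auto intro!: AE_I2 norm_sq_add_le)

text \<open>The approximants themselves are part of the conclusion, because the weak equation will
  be tested with H of them. A subsequence gives convergence almost everywhere, which is what makes
  the nonlinear factor converge.\<close>

lemma H10_compose:
  assumes Om: "open \<Omega>" and H10: "H10_grad \<Omega> v w"
    and H: "smooth H" "H 0 = 0" "\<And>s. \<bar>deriv H s\<bar> \<le> K"
  obtains \<phi> where "\<And>n::nat. test_fun \<Omega> (\<phi> n)" "AE x in lebesgue_on \<Omega>. (\<lambda>n. \<phi> n x) \<longlonglongrightarrow> v x"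
    "\<And>n. integrable (lebesgue_on \<Omega>) (\<lambda>x. (norm (grad3 (\<lambda>x. H (\<phi> n x)) x - deriv H (v x) *\<^sub>R w x))\<^sup>2)"
    "(\<lambda>n. LINT x|lebesgue_on \<Omega>. (norm (grad3 (\<lambda>x. H (\<phi> n x)) x - deriv H (v x) *\<^sub>R w x))\<^sup>2) \<longlonglongrightarrow> 0"
proof -
  let ?M = "lebesgue_on \<Omega>"
  have S: "\<Omega> \<in> sets borel" using Om by simp
  have K: "K \<ge> 0" using H(3)[of 0] by linarith
  obtain f where f: "\<And>n. test_fun \<Omega> (f n)"
    and f1: "(\<lambda>n. LINT x|?M. (f n x - v x)\<^sup>2) \<longlonglongrightarrow> 0"
    and f2: "(\<lambda>n. LINT x|?M. (norm (grad3 (f n) x - w x))\<^sup>2) \<longlonglongrightarrow> 0"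
    using H10 unfolding H10_grad_def by blast
  have v[measurable]: "v \<in> borel_measurable ?M" and v2: "integrable ?M (\<lambda>x. (v x)\<^sup>2)"
    and w[measurable]: "w \<in> borel_measurable ?M" and w2: "integrable ?M (\<lambda>x. (norm (w x))\<^sup>2)"
    using H10 unfolding H10_grad_def L2_def by auto
  have fB: "f n \<in> borel_measurable borel" "grad3 (f n) \<in> borel_measurable borel" for n
    using test_fun_measurable[OF f] test_fun_grad3_measurable[OF f] by auto
  have [measurable]: "f n \<in> borel_measurable ?M" "grad3 (f n) \<in> borel_measurable ?M" for n
    using fB by (auto intro: borel_measurable_lebesgue_on)
  have fi: "integrable ?M (\<lambda>x. (f n x)\<^sup>2)" for n
  proof (subst lebesgue_on_borel(1)[OF S])
    show "integrable lborel (\<lambda>x. (f n x)\<^sup>2)" using test_fun_power_integrable[OF f[of n], of 1] by (simp add: numeral_2_eq_2)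
    show "(f n x)\<^sup>2 = 0" if "x \<notin> \<Omega>" for x using test_fun_outside[OF f that] by simp
  qed (use fB in measurable)
  have gi: "integrable ?M (\<lambda>x. (norm (grad3 (f n) x))\<^sup>2)" for n
  proof (subst lebesgue_on_borel(1)[OF S])
    show "integrable lborel (\<lambda>x. (norm (grad3 (f n) x))\<^sup>2)" by (rule test_fun_grad3_integrable[OF f])
    show "(norm (grad3 (f n) x))\<^sup>2 = 0" if "x \<notin> \<Omega>" for x
      using grad3_outside[of x "f n"] f[of n] that by (auto simp: test_fun_def)
  qed (use fB in measurable)
  have fvi: "integrable ?M (\<lambda>x. (f n x - v x)\<^sup>2)" for n
    using integrable_sq_add[of "f n" ?M "\<lambda>x. - v x"] fi v2 by simp
  have gwi: "integrable ?M (\<lambda>x. (norm (grad3 (f n) x - w x))\<^sup>2)" for n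
    using integrable_sq_add[of "grad3 (f n)" ?M "\<lambda>x. - w x"] gi w2 by simp
  have "\<exists>r::nat\<Rightarrow>nat. strict_mono r \<and> (AE x in ?M. (\<lambda>n. (f (r n) x - v x)\<^sup>2) \<longlonglongrightarrow> 0)"
    by (rule tendsto_L1_AE_subseq) (use fvi f1 in auto)
  then obtain r :: "nat \<Rightarrow> nat" where r: "strict_mono r" and rl: "AE x in ?M. (\<lambda>n. (f (r n) x - v x)\<^sup>2) \<longlonglongrightarrow> 0" by blast
  define \<phi> where "\<phi> n = f (r n)" for n
  have \<phi>: "test_fun \<Omega> (\<phi> n)" for n unfolding \<phi>_def by (rule f)
  have lim: "AE x in ?M. (\<lambda>n. \<phi> n x) \<longlonglongrightarrow> v x"
    using rl
  proof eventually_elim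
    case (elim x)
    then have "(\<lambda>n. \<phi> n x - v x) \<longlonglongrightarrow> 0"
      unfolding \<phi>_def using tendsto_real_sqrt[OF elim] by (simp add: tendsto_rabs_zero_iff)
    then show ?case by (rule LIM_zero_cancel)
  qed
  have H'c: "continuous_on UNIV (deriv H)" using smooth_imp_continuous[OF smooth_real_deriv(2)[OF H(1)]] .
  have [measurable]: "deriv H \<in> borel_measurable borel" using H'c by (rule borel_measurable_continuous_onI)
  have [measurable]: "\<phi> n \<in> borel_measurable ?M" "grad3 (\<phi> n) \<in> borel_measurable ?M" for n
    unfolding \<phi>_def by measurable
  \<comment> \<open>The first summand is small because H' is bounded and the gradients converge; the
    second tends to zero by dominated convergence, since w stays fixed.\<close>
  have eq: "grad3 (\<lambda>x. H (\<phi> n x)) x - deriv H (v x) *\<^sub>R w x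
      = deriv H (\<phi> n x) *\<^sub>R (grad3 (\<phi> n) x - w x) + (deriv H (\<phi> n x) - deriv H (v x)) *\<^sub>R w x" for n x
    unfolding test_fun_compose(2)[OF \<phi> H(1,2)] by (simp add: algebra_simps)
  have H2: "(deriv H s)\<^sup>2 \<le> K\<^sup>2" for s using power_mono[OF H(3)[of s], of 2] by simp
  have HH2: "(deriv H s - deriv H t)\<^sup>2 \<le> 4 * K\<^sup>2" for s t
  proof -
    have "\<bar>deriv H s - deriv H t\<bar> \<le> 2 * K" using H(3)[of s] H(3)[of t] by linarith
    then have "\<bar>deriv H s - deriv H t\<bar>\<^sup>2 \<le> (2 * K)\<^sup>2" by (intro power_mono) auto
    then show ?thesis by (simp add: power_mult_distrib)
  qed
  have b: "(norm (grad3 (\<lambda>x. H (\<phi> n x)) x - deriv H (v x) *\<^sub>R w x))\<^sup>2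
     \<le> 2 * K\<^sup>2 * (norm (grad3 (\<phi> n) x - w x))\<^sup>2 + 2 * ((deriv H (\<phi> n x) - deriv H (v x))\<^sup>2 * (norm (w x))\<^sup>2)" for n x
  proof -
    have "(norm (deriv H (\<phi> n x) *\<^sub>R (grad3 (\<phi> n) x - w x)))\<^sup>2 \<le> K\<^sup>2 * (norm (grad3 (\<phi> n) x - w x))\<^sup>2"
      using mult_right_mono[OF H2[of "\<phi> n x"], of "(norm (grad3 (\<phi> n) x - w x))\<^sup>2"] by (simp add: power_mult_distrib)
    then show ?thesis unfolding eq
      using norm_sq_add_le[of "deriv H (\<phi> n x) *\<^sub>R (grad3 (\<phi> n) x - w x)" "(deriv H (\<phi> n x) - deriv H (v x)) *\<^sub>R w x"]
      by (simp add: power_mult_distrib)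
  qed
  have i2: "integrable ?M (\<lambda>x. (deriv H (\<phi> n x) - deriv H (v x))\<^sup>2 * (norm (w x))\<^sup>2)" for n
    by (rule Bochner_Integration.integrable_bound[OF integrable_mult_right[OF w2, of "4 * K\<^sup>2"]])
      (use HH2 in \<open>auto intro!: AE_I2 mult_right_mono\<close>)
  have i3: "integrable ?M (\<lambda>x. (norm (grad3 (\<phi> n) x - w x))\<^sup>2)" for n unfolding \<phi>_def by (rule gwi)
  have mg: "(\<lambda>x. grad3 (\<lambda>x. H (\<phi> n x)) x) \<in> borel_measurable ?M" for n
    unfolding test_fun_compose(2)[OF \<phi> H(1,2)] by measurable
  have i4: "integrable ?M (\<lambda>x. (norm (grad3 (\<lambda>x. H (\<phi> n x)) x - deriv H (v x) *\<^sub>R w x))\<^sup>2)" for n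
    by (rule Bochner_Integration.integrable_bound[where f = "\<lambda>x. 2 * K\<^sup>2 * (norm (grad3 (\<phi> n) x - w x))\<^sup>2 + 2 * ((deriv H (\<phi> n x) - deriv H (v x))\<^sup>2 * (norm (w x))\<^sup>2)"])
      (use i2 i3 mg in \<open>auto intro!: AE_I2 order_trans[OF b]\<close>)
  have "(\<lambda>n. LINT x|?M. (deriv H (\<phi> n x) - deriv H (v x))\<^sup>2 * (norm (w x))\<^sup>2) \<longlonglongrightarrow> (LINT x|?M. 0)"
  proof (rule integral_dominated_convergence[OF _ _ integrable_mult_right[OF w2, of "4 * K\<^sup>2"]])
    show "AE x in ?M. (\<lambda>n. (deriv H (\<phi> n x) - deriv H (v x))\<^sup>2 * (norm (w x))\<^sup>2) \<longlonglongrightarrow> 0"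
      using lim
    proof eventually_elim
      case (elim x)
      have "isCont (deriv H) (v x)" using H'c by (simp add: continuous_on_eq_continuous_at)
      then have "(\<lambda>n. deriv H (\<phi> n x)) \<longlonglongrightarrow> deriv H (v x)" using elim by (rule isCont_tendsto_compose)
      then have "(\<lambda>n. (deriv H (\<phi> n x) - deriv H (v x))\<^sup>2 * (norm (w x))\<^sup>2) \<longlonglongrightarrow> (deriv H (v x) - deriv H (v x))\<^sup>2 * (norm (w x))\<^sup>2"
        by (intro tendsto_intros)
      then show ?case by simp
    qed
    show "AE x in ?M. norm ((deriv H (\<phi> n x) - deriv H (v x))\<^sup>2 * (norm (w x))\<^sup>2) \<le> 4 * K\<^sup>2 * (norm (w x))\<^sup>2" for n
      using HH2 by (auto intro!: AE_I2 mult_right_mono)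
  qed measurable
  then have l2: "(\<lambda>n. LINT x|?M. (deriv H (\<phi> n x) - deriv H (v x))\<^sup>2 * (norm (w x))\<^sup>2) \<longlonglongrightarrow> 0" by simp
  have l1: "(\<lambda>n. LINT x|?M. (norm (grad3 (\<phi> n) x - w x))\<^sup>2) \<longlonglongrightarrow> 0"
    unfolding \<phi>_def using LIMSEQ_subseq_LIMSEQ[OF f2 r] by (simp add: o_def)
  have "(\<lambda>n. LINT x|?M. (norm (grad3 (\<lambda>x. H (\<phi> n x)) x - deriv H (v x) *\<^sub>R w x))\<^sup>2) \<longlonglongrightarrow> 0"
  proof (rule tendsto_sandwich[OF _ _ tendsto_const])
    show "\<forall>\<^sub>F n in sequentially. 0 \<le> (LINT x|?M. (norm (grad3 (\<lambda>x. H (\<phi> n x)) x - deriv H (v x) *\<^sub>R w x))\<^sup>2)" by simp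
    show "\<forall>\<^sub>F n in sequentially. (LINT x|?M. (norm (grad3 (\<lambda>x. H (\<phi> n x)) x - deriv H (v x) *\<^sub>R w x))\<^sup>2)
       \<le> 2 * K\<^sup>2 * (LINT x|?M. (norm (grad3 (\<phi> n) x - w x))\<^sup>2) + 2 * (LINT x|?M. (deriv H (\<phi> n x) - deriv H (v x))\<^sup>2 * (norm (w x))\<^sup>2)"
    proof (rule always_eventually, rule allI)
      fix n
      have "(LINT x|?M. (norm (grad3 (\<lambda>x. H (\<phi> n x)) x - deriv H (v x) *\<^sub>R w x))\<^sup>2)
        \<le> (LINT x|?M. 2 * K\<^sup>2 * (norm (grad3 (\<phi> n) x - w x))\<^sup>2 + 2 * ((deriv H (\<phi> n x) - deriv H (v x))\<^sup>2 * (norm (w x))\<^sup>2))"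
        by (rule integral_mono[OF i4 _ b]) (use i2 i3 in auto)
      then show "(LINT x|?M. (norm (grad3 (\<lambda>x. H (\<phi> n x)) x - deriv H (v x) *\<^sub>R w x))\<^sup>2)
       \<le> 2 * K\<^sup>2 * (LINT x|?M. (norm (grad3 (\<phi> n) x - w x))\<^sup>2) + 2 * (LINT x|?M. (deriv H (\<phi> n x) - deriv H (v x))\<^sup>2 * (norm (w x))\<^sup>2)"
        using i2 i3 by simp
    qed
    show "(\<lambda>n. 2 * K\<^sup>2 * (LINT x|?M. (norm (grad3 (\<phi> n) x - w x))\<^sup>2) + 2 * (LINT x|?M. (deriv H (\<phi> n x) - deriv H (v x))\<^sup>2 * (norm (w x))\<^sup>2)) \<longlonglongrightarrow> 0"
      using tendsto_add[OF tendsto_mult_right_zero[OF l1, of "2 * K\<^sup>2"] tendsto_mult_right_zero[OF l2, of 2]] by simp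
  qed
  with \<phi> lim i4 show ?thesis by (rule that)
qed

text \<open>Fatou's lemma along the approximants of \<open>H10_compose\<close>. The sixth power of
  H(v) is not assumed integrable; this is part of what the limit yields.\<close>

lemma sobolev_H10:
  assumes Om: "open \<Omega>" and H10: "H10_grad \<Omega> v w"
    and H: "smooth H" "H 0 = 0" "\<And>s. \<bar>deriv H s\<bar> \<le> K"
  shows "integrable (lebesgue_on \<Omega>) (\<lambda>x. H (v x) ^ 6)"
    "(LINT x|lebesgue_on \<Omega>. H (v x) ^ 6) \<le> 32768 * (LINT x|lebesgue_on \<Omega>. (deriv H (v x))\<^sup>2 * (norm (w x))\<^sup>2) ^ 3"
proof -
  let ?M = "lebesgue_on \<Omega>"
  have S: "\<Omega> \<in> sets borel" using Om by simp
  obtain \<phi> where \<phi>: "\<And>n::nat. test_fun \<Omega> (\<phi> n)" "AE x in ?M. (\<lambda>n. \<phi> n x) \<longlonglongrightarrow> v x"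
    and i: "\<And>n. integrable ?M (\<lambda>x. (norm (grad3 (\<lambda>x. H (\<phi> n x)) x - deriv H (v x) *\<^sub>R w x))\<^sup>2)"
    and l: "(\<lambda>n. LINT x|?M. (norm (grad3 (\<lambda>x. H (\<phi> n x)) x - deriv H (v x) *\<^sub>R w x))\<^sup>2) \<longlonglongrightarrow> 0"
    using H10_compose[OF Om H10 H] by blast
  have v[measurable]: "v \<in> borel_measurable ?M"
    and w[measurable]: "w \<in> borel_measurable ?M" and w2: "integrable ?M (\<lambda>x. (norm (w x))\<^sup>2)"
    using H10 unfolding H10_grad_def L2_def by auto
  have Hc: "continuous_on UNIV H" "continuous_on UNIV (deriv H)"
    using smooth_imp_continuous[OF H(1)] smooth_imp_continuous[OF smooth_real_deriv(2)[OF H(1)]] by auto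
  have [measurable]: "H \<in> borel_measurable borel" "deriv H \<in> borel_measurable borel"
    using Hc by (auto intro: borel_measurable_continuous_onI)
  have t: "test_fun \<Omega> (\<lambda>x. H (\<phi> n x))" for n by (rule test_fun_compose(1)[OF \<phi>(1) H(1,2)])
  have tm: "(\<lambda>x. H (\<phi> n x)) \<in> borel_measurable borel" "grad3 (\<lambda>x. H (\<phi> n x)) \<in> borel_measurable borel" for n
    using test_fun_measurable[OF t] test_fun_grad3_measurable[OF t] by auto
  have [measurable]: "(\<lambda>x. H (\<phi> n x)) \<in> borel_measurable ?M" for n
    by (rule borel_measurable_lebesgue_on[OF tm(1)])
  define D where "D = (LINT x|?M. (deriv H (v x))\<^sup>2 * (norm (w x))\<^sup>2)"
  define e where "e n = (LINT x|?M. (norm (grad3 (\<lambda>x. H (\<phi> n x)) x - deriv H (v x) *\<^sub>R w x))\<^sup>2)" for n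
  have D0: "D \<ge> 0" by (simp add: D_def)
  have H2: "(deriv H s)\<^sup>2 \<le> K\<^sup>2" for s using power_mono[OF H(3)[of s], of 2] by simp
  have Di: "integrable ?M (\<lambda>x. (deriv H (v x))\<^sup>2 * (norm (w x))\<^sup>2)"
    by (rule Bochner_Integration.integrable_bound[OF integrable_mult_right[OF w2, of "K\<^sup>2"]])
      (use H2 in \<open>auto intro!: AE_I2 mult_right_mono\<close>)
  have bn: "(\<integral>\<^sup>+ x. ennreal (H (\<phi> n x) ^ 6) \<partial>?M) \<le> ennreal (4096 * (2 * D + 2 * e n) ^ 3)" for n
  proof -
    have z: "H (\<phi> n x) ^ 6 = 0" "(norm (grad3 (\<lambda>x. H (\<phi> n x)) x))\<^sup>2 = 0" if "x \<notin> \<Omega>" for x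
      using test_fun_outside[OF t that] grad3_outside[of x "\<lambda>x. H (\<phi> n x)"] t[of n] that by (auto simp: test_fun_def)
    have i6: "integrable ?M (\<lambda>x. H (\<phi> n x) ^ 6)"
      by (subst lebesgue_on_borel(1)[OF S]) (use test_fun_power_integrable[OF t[of n], of 5] z tm[of n] in auto)
    have ig: "integrable ?M (\<lambda>x. (norm (grad3 (\<lambda>x. H (\<phi> n x)) x))\<^sup>2)"
      by (subst lebesgue_on_borel(1)[OF S]) (use test_fun_grad3_integrable[OF t[of n]] z tm[of n] in auto)
    have "(\<integral>\<^sup>+ x. ennreal (H (\<phi> n x) ^ 6) \<partial>?M) = ennreal (LINT x|?M. H (\<phi> n x) ^ 6)"
      by (rule nn_integral_eq_integral[OF i6]) simp
    also have "(LINT x|?M. H (\<phi> n x) ^ 6) = (LINT x|lborel. H (\<phi> n x) ^ 6)"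
      by (rule lebesgue_on_borel(2)[OF S]) (use z tm[of n] in auto)
    also have "\<dots> \<le> 4096 * (LINT x|lborel. (norm (grad3 (\<lambda>x. H (\<phi> n x)) x))\<^sup>2) ^ 3"
      by (rule sobolev_test_fun[OF t])
    also have "(LINT x|lborel. (norm (grad3 (\<lambda>x. H (\<phi> n x)) x))\<^sup>2) = (LINT x|?M. (norm (grad3 (\<lambda>x. H (\<phi> n x)) x))\<^sup>2)"
      by (rule lebesgue_on_borel(2)[OF S, symmetric]) (use z tm[of n] in auto)
    finally have 1: "(\<integral>\<^sup>+ x. ennreal (H (\<phi> n x) ^ 6) \<partial>?M) \<le> ennreal (4096 * (LINT x|?M. (norm (grad3 (\<lambda>x. H (\<phi> n x)) x))\<^sup>2) ^ 3)"
      by (simp add: ennreal_leI)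
    \<comment> \<open>Separating the limit gradient from the error costs a factor 2, whose cube
      turns 4096 into 32768.\<close>
    have "(LINT x|?M. (norm (grad3 (\<lambda>x. H (\<phi> n x)) x))\<^sup>2)
       \<le> (LINT x|?M. 2 * ((deriv H (v x))\<^sup>2 * (norm (w x))\<^sup>2) + 2 * (norm (grad3 (\<lambda>x. H (\<phi> n x)) x - deriv H (v x) *\<^sub>R w x))\<^sup>2)"
    proof (rule integral_mono[OF ig])
      fix x show "(norm (grad3 (\<lambda>x. H (\<phi> n x)) x))\<^sup>2 \<le> 2 * ((deriv H (v x))\<^sup>2 * (norm (w x))\<^sup>2) + 2 * (norm (grad3 (\<lambda>x. H (\<phi> n x)) x - deriv H (v x) *\<^sub>R w x))\<^sup>2"
        using norm_sq_add_le[of "deriv H (v x) *\<^sub>R w x" "grad3 (\<lambda>x. H (\<phi> n x)) x - deriv H (v x) *\<^sub>R w x"]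
        by (simp add: power_mult_distrib)
    qed (use Di i in auto)
    also have "\<dots> = 2 * D + 2 * e n" using Di i by (simp add: D_def e_def)
    finally have "4096 * (LINT x|?M. (norm (grad3 (\<lambda>x. H (\<phi> n x)) x))\<^sup>2) ^ 3 \<le> 4096 * (2 * D + 2 * e n) ^ 3"
      by (intro mult_left_mono power_mono) auto
    with 1 show ?thesis by (meson ennreal_leI order_trans)
  qed
  have "(\<integral>\<^sup>+ x. ennreal (H (v x) ^ 6) \<partial>?M) = (\<integral>\<^sup>+ x. liminf (\<lambda>n. ennreal (H (\<phi> n x) ^ 6)) \<partial>?M)"
  proof (rule nn_integral_cong_AE)
    show "AE x in ?M. ennreal (H (v x) ^ 6) = liminf (\<lambda>n. ennreal (H (\<phi> n x) ^ 6))"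
      using \<phi>(2)
    proof eventually_elim
      case (elim x)
      have "isCont H (v x)" using Hc by (simp add: continuous_on_eq_continuous_at)
      then have "(\<lambda>n. ennreal (H (\<phi> n x) ^ 6)) \<longlonglongrightarrow> ennreal (H (v x) ^ 6)"
        using elim by (intro tendsto_ennrealI tendsto_power isCont_tendsto_compose[where g = H])
      from lim_imp_Liminf[OF trivial_limit_sequentially this] show ?case by (rule sym)
    qed
  qed
  also have "\<dots> \<le> liminf (\<lambda>n. \<integral>\<^sup>+ x. ennreal (H (\<phi> n x) ^ 6) \<partial>?M)"
    by (rule nn_integral_liminf) measurable
  also have "\<dots> \<le> liminf (\<lambda>n. ennreal (4096 * (2 * D + 2 * e n) ^ 3))"
    by (rule Liminf_mono) (use bn in auto)
  also have "\<dots> = ennreal (4096 * (2 * D + 2 * 0) ^ 3)"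
    by (intro lim_imp_Liminf tendsto_ennrealI tendsto_intros) (use l in \<open>auto simp: e_def\<close>)
  also have "4096 * (2 * D + 2 * 0) ^ 3 = 32768 * D ^ 3" by (simp add: power_mult_distrib)
  finally have fin: "(\<integral>\<^sup>+ x. ennreal (H (v x) ^ 6) \<partial>?M) \<le> ennreal (32768 * D ^ 3)" .
  show I: "integrable ?M (\<lambda>x. H (v x) ^ 6)"
  proof (rule integrableI_bounded)
    have "(\<integral>\<^sup>+ x. ennreal (norm (H (v x) ^ 6)) \<partial>?M) = (\<integral>\<^sup>+ x. ennreal (H (v x) ^ 6) \<partial>?M)" by simp
    also have "\<dots> < \<infinity>" using fin by (rule le_less_trans) simp
    finally show "(\<integral>\<^sup>+ x. ennreal (norm (H (v x) ^ 6)) \<partial>?M) < \<infinity>" .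
  qed measurable
  show "(LINT x|?M. H (v x) ^ 6) \<le> 32768 * (LINT x|?M. (deriv H (v x))\<^sup>2 * (norm (w x))\<^sup>2) ^ 3"
    using fin nn_integral_eq_integral[OF I] D0 by (simp add: D_def)
qed

section \<open>The du Bois-Reymond lemma on the cylinder\<close>

lemma test_fun_box:
  fixes l u :: "real^3"
  assumes "cbox l u \<subseteq> \<Omega>"
  defines "\<zeta> \<equiv> \<lambda>n x. bump (real (Suc n)) (l$1) (u$1) (x$1) * bump (real (Suc n)) (l$2) (u$2) (x$2) * bump (real (Suc n)) (l$3) (u$3) (x$3)"
  shows "test_fun \<Omega> (\<zeta> n)" "(\<lambda>n. \<zeta> n x) \<longlonglongrightarrow> indicator (box l u) x" "\<bar>\<zeta> n x\<bar> \<le> 1"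
proof -
  have sm: "smooth (\<zeta> n)" unfolding \<zeta>_def
    by (intro smooth_mult smooth_compose[OF smooth_bump] smooth_linear bounded_linear_vec_nth)
  have z: "x \<in> cbox l u" if "\<zeta> n x \<noteq> 0" for x
  proof -
    have "x $ i \<in> {l$i<..<u$i}" for i
      using that bump_zero[of "real (Suc n)" "x$i" "l$i" "u$i"] exhaust_3[of i] by (auto simp: \<zeta>_def)
    then show ?thesis by (simp add: mem_box_cart less_imp_le)
  qed
  have sub: "tsupport (\<zeta> n) \<subseteq> cbox l u"
    unfolding tsupport_def using z by (intro closure_minimal) auto
  then show "test_fun \<Omega> (\<zeta> n)"
    unfolding test_fun_def using sm assms(1) compact_tsupport[OF compact_cbox sub] by blast
  have "(\<lambda>n. \<zeta> n x) \<longlonglongrightarrow> indicator {l$1<..<u$1} (x$1) * indicator {l$2<..<u$2} (x$2) * indicator {l$3<..<u$3} (x$3)"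
    unfolding \<zeta>_def by (intro tendsto_mult bump_tendsto_indicator)
  also have "indicator {l$1<..<u$1} (x$1) * indicator {l$2<..<u$2} (x$2) * indicator {l$3<..<u$3} (x$3) = (indicator (box l u) x :: real)"
    by (auto simp: indicator_def mem_box_cart forall_3)
  finally show "(\<lambda>n. \<zeta> n x) \<longlonglongrightarrow> indicator (box l u) x" .
  show "\<bar>\<zeta> n x\<bar> \<le> 1" unfolding \<zeta>_def
    using bump_nonneg bump_le_1 by (simp add: abs_mult mult_le_one del: of_nat_Suc)
qed

lemma box_Pair_eq': "box (a, c) (b, d) = box a b \<times> box c d"
  by (force simp: box_def Basis_prod_def)

text \<open>Boxes are stable under intersection and generate the Borel sets, so a Dynkin argument
  gives vanishing integrals over all Borel sets, hence vanishing almost everywhere, on each box with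
  closure in S. Countably many such boxes cover S by the Lindelof property.\<close>

lemma AE_zero_if_box_integrals_zero:
  fixes D :: "'a::euclidean_space \<Rightarrow> real"
  assumes D: "integrable lborel D" and S: "open S"
    and z: "\<And>a b. cbox a b \<subseteq> S \<Longrightarrow> box a b \<noteq> {} \<Longrightarrow> (LINT x|lborel. indicator (box a b) x * D x) = 0"
  shows "AE x in lborel. x \<in> S \<longrightarrow> D x = 0"
proof -
  have [measurable]: "D \<in> borel_measurable borel" using D by auto
  have iA: "integrable lborel (\<lambda>x. indicator A x * D x)" if "A \<in> sets borel" for A
    by (rule Bochner_Integration.integrable_bound[OF D]) (use that in \<open>auto simp: indicator_def\<close>)
  have local: "AE x in lborel. x \<in> box p q \<longrightarrow> D x = 0" if pq: "cbox p q \<subseteq> S" for p q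
  proof -
    \<comment> \<open>Multiplying by this indicator lets arbitrary boxes serve as generators: their
      intersection with \<open>box p q\<close>, if nonempty, has its closure inside S.\<close>
    let ?f = "\<lambda>x. indicator (box p q) x * D x"
    have fi: "integrable lborel ?f" by (rule iA) simp
    have fA: "integrable lborel (\<lambda>x. indicator A x * ?f x)" if "A \<in> sets borel" for A
      by (rule Bochner_Integration.integrable_bound[OF fi]) (use that in \<open>auto simp: indicator_def\<close>)
    have IS: "Int_stable (range (\<lambda>(a, b). box a b :: 'a set))"
      unfolding Int_stable_def by (auto simp: box_Int_box)
    have PW: "range (\<lambda>(a, b). box a b :: 'a set) \<subseteq> Pow UNIV" by auto
    have "(LINT x|lborel. indicator A x * ?f x) = 0" if A: "A \<in> sets borel" for A
    proof -
      have "A \<in> sigma_sets UNIV (range (\<lambda>(a, b). box a b :: 'a set))"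
        using A unfolding borel_eq_box by (simp add: sets_measure_of)
      then show ?thesis
      proof (induction rule: sigma_sets_induct_disjoint[OF IS PW, consumes 1, case_names basic empty compl union])
        case (basic A)
        then obtain a b where A: "A = box a b" by auto
        obtain a' b' where I: "box a b \<inter> box p q = box a' b'" by (simp add: box_Int_box)
        have "(LINT x|lborel. indicator A x * ?f x) = (LINT x|lborel. indicator (box a' b') x * D x)"
          unfolding A I[symmetric] by (intro Bochner_Integration.integral_cong) (auto simp: indicator_def)
        also have "\<dots> = 0"
        proof (cases "box a' b' = {}")
          case False
          have "box a' b' \<subseteq> box p q" using I by blast
          moreover from this have "box p q \<noteq> {}" using False by blast
          ultimately have "cbox a' b' \<subseteq> cbox p q" using False closure_mono[of "box a' b'" "box p q"] by simp
          then show ?thesis using z[of a' b'] pq False by blast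
        qed simp
        finally show ?case .
      next
        case empty
        then show ?case by simp
      next
        case (compl A)
        then have A: "A \<in> sets borel" unfolding borel_eq_box by (simp add: sets_measure_of)
        have "(LINT x|lborel. indicator UNIV x * ?f x) = 0"
        proof (cases "box p q = {}")
          case False
          then show ?thesis using z[OF pq] by simp
        qed simp
        moreover have "(LINT x|lborel. indicator (UNIV - A) x * ?f x) = (LINT x|lborel. ?f x - indicator A x * ?f x)"
          by (intro Bochner_Integration.integral_cong) (auto simp: indicator_def)
        ultimately show ?case using fA[OF A] fi compl by simp
      next
        case (union A)
        then have A: "A i \<in> sets borel" for i unfolding borel_eq_box by (auto simp: sets_measure_of)
        have "set_integrable lborel (\<Union>i. A i) ?f"
          unfolding set_integrable_def using fA[of "\<Union>i. A i"] A by simp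
        then have "(LINT x:(\<Union>i. A i)|lborel. ?f x) = (\<Sum>i. (LINT x:(A i)|lborel. ?f x))"
          using A union(1) by (intro lebesgue_integral_countable_add) (auto simp: disjoint_family_on_def)
        then show ?case using union(3) by (simp add: set_lebesgue_integral_def)
      qed
    qed
    then have "AE x in lborel. ?f x = 0"
      using density_unique_real[OF fi, of "\<lambda>_. 0"] by (simp add: set_lebesgue_integral_def)
    then show ?thesis by eventually_elim auto
  qed
  define \<F> where "\<F> = {X. \<exists>p q. X = box p q \<and> cbox p q \<subseteq> S}"
  have "\<And>X. X \<in> \<F> \<Longrightarrow> open X" by (auto simp: \<F>_def open_box)
  then obtain \<F>' where F': "\<F>' \<subseteq> \<F>" "countable \<F>'" "\<Union>\<F>' = \<Union>\<F>" using Lindelof by metis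
  have cover: "S \<subseteq> \<Union>\<F>"
  proof
    fix x assume "x \<in> S"
    then obtain e where e: "e > 0" "ball x e \<subseteq> S" using S open_contains_ball by blast
    obtain p q where pq: "x \<in> box p q" "box p q \<subseteq> ball x (e/2)" using rational_boxes[of "e/2" x] e by auto
    have "box p q \<noteq> {}" using pq by auto
    then have "cbox p q = closure (box p q)" by simp
    also have "\<dots> \<subseteq> closure (ball x (e/2))" by (rule closure_mono[OF pq(2)])
    also have "\<dots> = cball x (e/2)" using e by simp
    also have "\<dots> \<subseteq> ball x e" using e by auto
    finally show "x \<in> \<Union>\<F>" using pq(1) e(2) unfolding \<F>_def by blast
  qed
  have "AE x in lborel. \<forall>X\<in>\<F>'. x \<in> X \<longrightarrow> D x = 0"
  proof (rule AE_ball_countable[THEN iffD2, OF F'(2)], rule ballI)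
    fix X assume "X \<in> \<F>'"
    then obtain p q where "X = box p q" "cbox p q \<subseteq> S" using F'(1) by (auto simp: \<F>_def)
    then show "AE x in lborel. x \<in> X \<longrightarrow> D x = 0" using local by simp
  qed
  then show ?thesis by eventually_elim (use cover F'(3) in blast)
qed

text \<open>As the steepness grows, tensor products of bumps tend boundedly to the indicator of a
  box, which reduces the claim to integrals over boxes.\<close>

lemma du_bois_reymond_cyl:
  fixes D :: "real \<times> (real^3) \<Rightarrow> real"
  assumes D: "integrable lborel D" and Om: "open \<Omega>"
    and z: "\<And>\<rho> \<zeta>. test_fun {0<..<T} \<rho> \<Longrightarrow> test_fun \<Omega> \<zeta> \<Longrightarrow> (LINT z|lborel. D z * (\<rho> (fst z) * \<zeta> (snd z))) = 0"
  shows "AE z in lborel. z \<in> cyl T \<Omega> \<longrightarrow> D z = 0"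
proof (rule AE_zero_if_box_integrals_zero[OF D])
  have [measurable]: "D \<in> borel_measurable borel" using D by auto
  show "open (cyl T \<Omega>)" unfolding cyl_def using Om by (intro open_Times) auto
  fix a b :: "real \<times> (real^3)"
  assume ab: "cbox a b \<subseteq> cyl T \<Omega>" "box a b \<noteq> {}"
  obtain \<alpha> l where a: "a = (\<alpha>, l)" by (cases a)
  obtain \<beta> u where b: "b = (\<beta>, u)" by (cases b)
  have ne: "cbox \<alpha> \<beta> \<noteq> {}" "cbox l u \<noteq> {}" using ab(2) box_subset_cbox[of \<alpha> \<beta>] box_subset_cbox[of l u]
    by (auto simp: a b box_Pair_eq')
  then have sub: "{\<alpha>..\<beta>} \<subseteq> {0<..<T}" "cbox l u \<subseteq> \<Omega>"
    using ab(1) unfolding a b cbox_Pair_eq cyl_def times_subset_iff by auto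
  define \<zeta> where "\<zeta> n x = bump (real (Suc n)) (l$1) (u$1) (x$1) * bump (real (Suc n)) (l$2) (u$2) (x$2) * bump (real (Suc n)) (l$3) (u$3) (x$3)" for n and x :: "real^3"
  note Z = test_fun_box[OF sub(2), folded \<zeta>_def]
  have tr: "test_fun {0<..<T} (bump (real (Suc n)) \<alpha> \<beta>)" for n by (rule test_fun_bump[OF _ sub(1)]) simp
  have [measurable]: "\<zeta> n \<in> borel_measurable borel" "bump (real (Suc n)) \<alpha> \<beta> \<in> borel_measurable borel" for n
    using test_fun_measurable[OF Z(1)] test_fun_measurable[OF tr] by auto
  have "(\<lambda>n. LINT z|lborel. D z * (bump (real (Suc n)) \<alpha> \<beta> (fst z) * \<zeta> n (snd z))) \<longlonglongrightarrow> (LINT z|lborel. indicator (box a b) z * D z)"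
  proof (rule integral_dominated_convergence[where w = "\<lambda>z. \<bar>D z\<bar>"])
    have "(\<lambda>n. D z * (bump (real (Suc n)) \<alpha> \<beta> (fst z) * \<zeta> n (snd z))) \<longlonglongrightarrow> D z * (indicator {\<alpha><..<\<beta>} (fst z) * indicator (box l u) (snd z))" for z
      by (intro tendsto_mult tendsto_const bump_tendsto_indicator Z(2))
    moreover have "D z * (indicator {\<alpha><..<\<beta>} (fst z) * indicator (box l u) (snd z)) = indicator (box a b) z * D z" for z
      by (cases z) (auto simp: a b box_Pair_eq' indicator_def)
    ultimately show "AE z in lborel. (\<lambda>n. D z * (bump (real (Suc n)) \<alpha> \<beta> (fst z) * \<zeta> n (snd z))) \<longlonglongrightarrow> indicator (box a b) z * D z"
      by simp
    show "AE z in lborel. norm (D z * (bump (real (Suc n)) \<alpha> \<beta> (fst z) * \<zeta> n (snd z))) \<le> \<bar>D z\<bar>" for n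
    proof (rule AE_I2)
      fix z :: "real \<times> (real^3)"
      have "\<bar>bump (real (Suc n)) \<alpha> \<beta> (fst z)\<bar> * \<bar>\<zeta> n (snd z)\<bar> \<le> 1"
        using Z(3)[of n "snd z"] bump_nonneg[of "real (Suc n)" \<alpha> \<beta> "fst z"] bump_le_1[of "real (Suc n)" \<alpha> \<beta> "fst z"]
        by (intro mult_le_one) auto
      from mult_left_mono[OF this, of "\<bar>D z\<bar>"]
      show "norm (D z * (bump (real (Suc n)) \<alpha> \<beta> (fst z) * \<zeta> n (snd z))) \<le> \<bar>D z\<bar>" by (simp add: abs_mult)
    qed
    show "(\<lambda>z. D z * (bump (real (Suc n)) \<alpha> \<beta> (fst z) * \<zeta> n (snd z))) \<in> borel_measurable lborel" for n
    proof -
      have "D \<in> borel_measurable (borel \<Otimes>\<^sub>M borel)" by (simp add: borel_prod)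
      then have "(\<lambda>z. D z * (bump (real (Suc n)) \<alpha> \<beta> (fst z) * \<zeta> n (snd z))) \<in> borel_measurable (borel \<Otimes>\<^sub>M borel)"
        by measurable
      then show ?thesis by (simp add: borel_prod)
    qed
  qed (use D in \<open>auto simp: borel_open open_box\<close>)
  then have "(\<lambda>n. 0) \<longlonglongrightarrow> (LINT z|lborel. indicator (box a b) z * D z)"
    using z[OF tr Z(1)] by simp
  then show "(LINT z|lborel. indicator (box a b) z * D z) = 0" by (simp add: LIMSEQ_const_iff)
qed

section \<open>Regularity in time\<close>

lemma AE_snd_pair:
  assumes "AE x in (lborel :: 'b::euclidean_space measure). Q x"
  shows "AE z in ((lborel :: 'a::euclidean_space measure) \<Otimes>\<^sub>M lborel). Q (snd z)"
proof -
  obtain N where N: "N \<in> null_sets lborel" "{x \<in> space lborel. \<not> Q x} \<subseteq> N"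
    using assms unfolding eventually_ae_filter by auto
  have [measurable]: "N \<in> sets borel" using N by auto
  have "AE z in ((lborel :: 'a measure) \<Otimes>\<^sub>M lborel). snd z \<notin> N"
  proof (rule lborel_pair.AE_pair_measure)
    show "{z \<in> space ((lborel :: 'a measure) \<Otimes>\<^sub>M lborel). snd z \<notin> N} \<in> sets (lborel \<Otimes>\<^sub>M lborel)" by measurable
    show "AE x in lborel. AE y in lborel. snd (x, y) \<notin> N" using AE_not_in[OF N(1)] by simp
  qed
  then show ?thesis by eventually_elim (use N in auto)
qed

lemma integrable_mult_bounded:
  fixes g h :: "'a \<Rightarrow> real"
  assumes "integrable M g" "h \<in> borel_measurable M" "\<And>x. \<bar>h x\<bar> \<le> B"
  shows "integrable M (\<lambda>x. g x * h x)"
proof (rule Bochner_Integration.integrable_bound[OF integrable_mult_left[OF assms(1), of B]])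
  show "AE x in M. norm (g x * h x) \<le> norm (g x * B)"
  proof (rule AE_I2)
    fix x
    have "\<bar>h x\<bar> \<le> \<bar>B\<bar>" using assms(3)[of x] by linarith
    then show "norm (g x * h x) \<le> norm (g x * B)" by (simp add: abs_mult mult_left_mono)
  qed
qed (use assms in measurable)

lemma integrable_section:
  fixes F :: "'a::euclidean_space \<times> 'b::euclidean_space \<Rightarrow> real"
  assumes "integrable (lborel \<Otimes>\<^sub>M lborel) F"
  shows "AE x in lborel. integrable lborel (\<lambda>t. F (t, x))" "integrable lborel (\<lambda>x. LINT t|lborel. F (t, x))"
    "(LINT z|(lborel \<Otimes>\<^sub>M lborel). F z) = (LINT x|lborel. LINT t|lborel. F (t, x))"
  using lborel_pair.AE_integrable_snd[of "\<lambda>t x. F (t, x)"] lborel_pair.integrable_snd[of "\<lambda>t x. F (t, x)"]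
    lborel_pair.integral_snd[of "\<lambda>t x. F (t, x)"] assms by (simp_all add: case_prod_beta)

text \<open>U, V, W stand for Borel versions of u, u_t and the gradient, extended by zero to the
  whole of space-time so that every slice makes sense. E collects the terms of the equation without
  derivatives of the test function, and is required only to be integrable.\<close>

locale damped_wave =
  fixes \<Omega> :: "(real^3) set" and T :: real and E U V :: "real \<times> (real^3) \<Rightarrow> real"
    and W :: "real \<times> (real^3) \<Rightarrow> real^3"
  assumes Om: "open \<Omega>" and T: "T > 0"
    and meas [measurable]: "U \<in> borel_measurable (borel \<Otimes>\<^sub>M borel)" "V \<in> borel_measurable (borel \<Otimes>\<^sub>M borel)"
      "E \<in> borel_measurable (borel \<Otimes>\<^sub>M borel)" "W \<in> borel_measurable (borel \<Otimes>\<^sub>M borel)"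
    and zero: "\<And>z. z \<notin> cyl T \<Omega> \<Longrightarrow> U z = 0" "\<And>z. z \<notin> cyl T \<Omega> \<Longrightarrow> V z = 0"
      "\<And>z. z \<notin> cyl T \<Omega> \<Longrightarrow> E z = 0" "\<And>z. z \<notin> cyl T \<Omega> \<Longrightarrow> W z = 0"
    and int: "integrable (lborel \<Otimes>\<^sub>M lborel) U" "integrable (lborel \<Otimes>\<^sub>M lborel) V" "integrable (lborel \<Otimes>\<^sub>M lborel) E"
      "integrable (lborel \<Otimes>\<^sub>M lborel) (\<lambda>z. (U z)\<^sup>2)" "integrable (lborel \<Otimes>\<^sub>M lborel) (\<lambda>z. (V z)\<^sup>2)"
      "integrable (lborel \<Otimes>\<^sub>M lborel) (\<lambda>z. (norm (W z))\<^sup>2)"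
    and H10: "AE t in lborel. t \<in> {0<..<T} \<longrightarrow> H10_grad \<Omega> (\<lambda>x. U (t, x)) (\<lambda>x. W (t, x))"
    and dt_weak: "\<And>\<rho> \<zeta>. test_fun {0<..<T} \<rho> \<Longrightarrow> test_fun \<Omega> \<zeta> \<Longrightarrow>
      (LINT z|(lborel \<Otimes>\<^sub>M lborel). U z * (deriv \<rho> (fst z) * \<zeta> (snd z))) = - (LINT z|(lborel \<Otimes>\<^sub>M lborel). V z * (\<rho> (fst z) * \<zeta> (snd z)))"
    and weak_eq: "\<And>\<rho> \<zeta>. test_fun {0<..<T} \<rho> \<Longrightarrow> test_fun \<Omega> \<zeta> \<Longrightarrow>
      (LINT z|(lborel \<Otimes>\<^sub>M lborel). E z * (\<rho> (fst z) * \<zeta> (snd z)) - V z * (deriv \<rho> (fst z) * \<zeta> (snd z))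
        + \<rho> (fst z) * (W z \<bullet> grad3 \<zeta> (snd z))) = 0"
begin

text \<open>Because V vanishes before time 0, this is the integral of u_t from 0 to t along the line
  through x.\<close>

definition Z :: "real \<times> (real^3) \<Rightarrow> real" where
  "Z z = (LINT s|lborel. indicator {..fst z} s * V (s, snd z))"

lemma Z_measurable [measurable]: "Z \<in> borel_measurable (borel \<Otimes>\<^sub>M borel)"
proof -
  have "Z = (\<lambda>z. LINT s|lborel. (if s \<le> fst z then V (s, snd z) else 0))"
    unfolding Z_def by (intro ext Bochner_Integration.integral_cong) (auto simp: indicator_def)
  moreover have "\<dots> \<in> borel_measurable (borel \<Otimes>\<^sub>M borel)" by measurable
  ultimately show ?thesis by simp
qed

text \<open>U - Z has zero distributional derivative in time, so it is independent of t for almost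
  every x. This yields a representative of u that is absolutely continuous in time, to which
  \<open>indef_chain_rule\<close> applies.\<close>

lemma ac_in_time:
  obtains A where "AE x in lborel. integrable lborel (\<lambda>t. V (t, x)) \<and>
    (AE t in lborel. t \<in> {0<..<T} \<longrightarrow> U (t, x) = A x + Z (t, x))"
proof -
  let ?M = "lborel \<Otimes>\<^sub>M lborel :: (real \<times> (real^3)) measure"
  define I where "I t = (indicator {0<..<T} t :: real)" for t
  have [measurable]: "I \<in> borel_measurable borel" unfolding I_def by measurable
  have Vx: "AE x in lborel. integrable lborel (\<lambda>t. V (t, x))"
    by (rule integrable_section(1)[OF int(2)])
  define N where "N x = (LINT s|lborel. \<bar>V (s, x)\<bar>)" for x
  have Ni: "integrable lborel N" unfolding N_def
    using integrable_section(2)[OF integrable_abs[OF int(2)]] .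
  have Ii: "integrable lborel I"
    unfolding I_def using T by (intro integrable_real_indicator) (auto simp: emeasure_lborel_Ioo)
  have Zi: "integrable ?M (\<lambda>z. I (fst z) * Z z)"
  proof (rule Bochner_Integration.integrable_bound[OF lborel_pair.integrable_prod_mult[OF Ii Ni]])
    show "AE z in ?M. norm (I (fst z) * Z z) \<le> norm (I (fst z) * N (snd z))"
      using AE_snd_pair[OF Vx, where 'a = real]
    proof eventually_elim
      case (elim z)
      have "\<bar>Z z\<bar> \<le> N (snd z)"
        unfolding Z_def N_def using indef_diff_le[OF elim, of "\<lambda>_. 0" "fst z"] by simp
      then show ?case by (auto simp: I_def indicator_def)
    qed
  qed measurable
  \<comment> \<open>A kernel of unit mass centred at T/2 that fits into the time interval.\<close>
  obtain n where n: "inverse (real (Suc n)) < T / 2" using reals_Archimedean[of "T/2"] T by auto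
  define \<psi> where "\<psi> t = moll n (t - T / 2)" for t
  have \<psi>: "test_fun {0<..<T} \<psi>" "(LINT t|lborel. \<psi> t) = 1" "integrable lborel \<psi>"
    unfolding \<psi>_def using moll_shift_test(1)[of n "T/2" T] n moll_shift[of n "T/2"] by auto
  obtain C where C: "\<And>t. \<bar>\<psi> t\<bar> \<le> C" using test_fun_bounded[OF \<psi>(1)] by metis
  have [measurable]: "\<psi> \<in> borel_measurable borel" using test_fun_measurable[OF \<psi>(1)] .
  define G where "G z = U z - I (fst z) * Z z" for z
  have [measurable]: "G \<in> borel_measurable (borel \<Otimes>\<^sub>M borel)" unfolding G_def by measurable
  have Gi: "integrable ?M G" unfolding G_def using int(1) Zi by auto
  \<comment> \<open>If G is constant in time, its average against the unit mass \<psi> must be that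
    constant.\<close>
  define A where "A x = (LINT s|lborel. G (s, x) * \<psi> s)" for x
  have G\<psi>: "integrable ?M (\<lambda>z. G z * \<psi> (fst z))"
    by (rule integrable_mult_bounded[OF Gi]) (use C in measurable)
  have Ai: "integrable lborel A"
    unfolding A_def using integrable_section(2)[OF G\<psi>] by simp
  have [measurable]: "A \<in> borel_measurable borel" using Ai by auto
  define D where "D z = I (fst z) * (U z - Z z - A (snd z))" for z
  have Deq: "D z = G z - I (fst z) * A (snd z)" for z
    using zero(1)[of z] by (cases z) (auto simp: D_def G_def I_def indicator_def cyl_def)
  have Di: "integrable ?M D"
    unfolding Deq using Gi lborel_pair.integrable_prod_mult[OF Ii Ai] by auto
  have "AE z in lborel. z \<in> cyl T \<Omega> \<longrightarrow> D z = 0"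
  proof (rule du_bois_reymond_cyl[OF _ Om])
    show "integrable lborel D" using Di by (simp add: lborel_prod)
    fix \<rho> \<zeta> assume \<rho>: "test_fun {0<..<T} \<rho>" and \<zeta>: "test_fun \<Omega> (\<zeta> :: real^3 \<Rightarrow> real)"
    have [measurable]: "\<rho> \<in> borel_measurable borel" "\<zeta> \<in> borel_measurable borel"
      using test_fun_measurable[OF \<rho>] test_fun_measurable[OF \<zeta>] by auto
    obtain R where R: "R \<ge> 0" "\<And>t. \<bar>\<rho> t\<bar> \<le> R" using test_fun_bounded[OF \<rho>] by metis
    obtain Q where Q: "Q \<ge> 0" "\<And>t. \<bar>\<zeta> t\<bar> \<le> Q" using test_fun_bounded[OF \<zeta>] by metis
    define c where "c = (LINT t|lborel. \<rho> t)"
    \<comment> \<open>Subtracting c times \<psi> leaves mean zero, so the primitive P of k is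
      compactly supported and may be inserted into the weak time derivative.\<close>
    define k where "k t = \<rho> t - c * \<psi> t" for t
    have ksm: "smooth k" unfolding k_def diff_conv_add_uminus minus_mult_left
      by (intro smooth_add smooth_mult smooth_const test_fun_imp_smooth[OF \<rho>] test_fun_imp_smooth[OF \<psi>(1)])
    have kc: "continuous_on UNIV k" by (rule smooth_imp_continuous[OF ksm])
    have [measurable]: "k \<in> borel_measurable borel" by (rule borel_measurable_continuous_onI[OF kc])
    have kB: "\<bar>k t\<bar> \<le> R + \<bar>c\<bar> * C" for t
    proof -
      have "\<bar>k t\<bar> \<le> \<bar>\<rho> t\<bar> + \<bar>c\<bar> * \<bar>\<psi> t\<bar>" unfolding k_def by (metis abs_mult abs_triangle_ineq4)
      also have "\<dots> \<le> R + \<bar>c\<bar> * C" using R C by (intro add_mono mult_left_mono) auto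
      finally show ?thesis .
    qed
    have ki: "integrable lborel k" "(LINT t|lborel. k t) = 0"
      using test_fun_integrable[OF \<rho>] \<psi> by (auto simp: k_def[abs_def] c_def)
    have "compact (tsupport \<rho> \<union> tsupport \<psi>)" "tsupport \<rho> \<union> tsupport \<psi> \<subseteq> {0<..<T}"
      using \<rho> \<psi> by (auto simp: test_fun_def)
    then obtain a b where ab: "tsupport \<rho> \<union> tsupport \<psi> \<subseteq> {a..b}" "0 < a" "b < T"
    proof (cases "tsupport \<rho> \<union> tsupport \<psi> = {}")
      case False
      assume c: "compact (tsupport \<rho> \<union> tsupport \<psi>)" and s: "tsupport \<rho> \<union> tsupport \<psi> \<subseteq> {0<..<T}"
      obtain a where a: "a \<in> tsupport \<rho> \<union> tsupport \<psi>" "\<And>t. t \<in> tsupport \<rho> \<union> tsupport \<psi> \<Longrightarrow> a \<le> t"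
        using compact_attains_inf[OF c False] by blast
      obtain b where b: "b \<in> tsupport \<rho> \<union> tsupport \<psi>" "\<And>t. t \<in> tsupport \<rho> \<union> tsupport \<psi> \<Longrightarrow> t \<le> b"
        using compact_attains_sup[OF c False] by blast
      show ?thesis using that[of a b] a b s by fastforce
    next
      case True
      then show ?thesis using that[of "T/3" "T/2"] T by auto
    qed
    have k0: "k t = 0" if "t \<notin> {a..b}" for t
    proof -
      have "t \<notin> tsupport \<rho>" "t \<notin> tsupport \<psi>" using that ab(1) by blast+
      then show ?thesis by (simp add: k_def tsupport_zero)
    qed
    define P where "P t = (LINT s|lborel. indicator {..t} s * k s)" for t
    have Pd: "(P has_real_derivative k t) (at t)" for t
    proof -
      have "(P has_real_derivative k t) (at t within {t-1..t+1})"
        unfolding P_def[abs_def] by (rule indef_has_derivative[OF ki(1) kc]) simp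
      then show ?thesis by (subst (asm) at_within_interior) auto
    qed
    have P0: "P t = 0" if "t \<notin> {a..b}" for t
    proof (cases "t < a")
      case True
      then have "indicator {..t} s * k s = 0" for s using k0[of s] by (auto simp: indicator_def)
      then have "P t = (LINT s|(lborel :: real measure). 0)"
        unfolding P_def by (intro Bochner_Integration.integral_cong refl)
      then show ?thesis by simp
    next
      case False
      then have "indicator {..t} s * k s = k s" for s using k0[of s] that by (auto simp: indicator_def)
      then have "P t = (LINT s|lborel. k s)"
        unfolding P_def by (intro Bochner_Integration.integral_cong refl)
      then show ?thesis using ki by simp
    qed
    have Psm: "smooth P" by (rule smooth_antiderivative[OF Pd ksm])
    have "{t. P t \<noteq> 0} \<subseteq> {a..b}" using P0 by blast
    then have Psub: "tsupport P \<subseteq> {a..b}" unfolding tsupport_def by (rule closure_minimal) simp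
    have P: "test_fun {0<..<T} P"
      unfolding test_fun_def using Psm compact_tsupport[OF compact_Icc Psub] Psub ab by force
    have Pk: "deriv P = k" using Pd by (auto intro: DERIV_imp_deriv)
    have [measurable]: "P \<in> borel_measurable borel" using test_fun_measurable[OF P] .
    obtain RP where RP: "RP \<ge> 0" "\<And>t. \<bar>P t\<bar> \<le> RP" using test_fun_bounded[OF P] by metis
    have bd: "\<bar>g (fst z) * \<zeta> (snd z)\<bar> \<le> K * Q" if "\<And>t. \<bar>g t\<bar> \<le> K" for g :: "real \<Rightarrow> real" and K and z :: "real \<times> (real^3)"
    proof -
      have "0 \<le> K" using that[of 0] by linarith
      then show ?thesis unfolding abs_mult using that Q by (intro mult_mono) auto
    qed
    have pint: "integrable ?M (\<lambda>z. F z * (g (fst z) * \<zeta> (snd z)))"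
      if F: "integrable ?M F" and [measurable]: "g \<in> borel_measurable borel" and g: "\<And>t. \<bar>g t\<bar> \<le> K" for F g and K :: real
      by (rule integrable_mult_bounded[OF F _ bd[OF g]]) measurable
    have km: "k \<in> borel_measurable borel" and rm: "\<rho> \<in> borel_measurable borel"
      and psm: "\<psi> \<in> borel_measurable borel" and pm: "P \<in> borel_measurable borel" by measurable
    have 1: "(LINT z|?M. U z * (k (fst z) * \<zeta> (snd z))) = - (LINT z|?M. V z * (P (fst z) * \<zeta> (snd z)))"
      using dt_weak[OF P \<zeta>] by (simp add: Pk)
    have IZk: "I t * Z (t, x) * k t = Z (t, x) * k t" for t x
    proof (cases "t \<in> {a..b}")
      case True
      then have "t \<in> {0<..<T}" using ab by auto
      then show ?thesis by (simp add: I_def)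
    qed (simp add: k0)
    have 2: "(LINT z|?M. I (fst z) * Z z * (k (fst z) * \<zeta> (snd z))) = - (LINT z|?M. V z * (P (fst z) * \<zeta> (snd z)))"
    proof -
      have "(LINT z|?M. I (fst z) * Z z * (k (fst z) * \<zeta> (snd z))) = (LINT x|lborel. LINT t|lborel. I t * Z (t, x) * (k t * \<zeta> x))"
        using integrable_section(3)[OF pint[OF Zi km kB]] by simp
      also have "\<dots> = (LINT x|lborel. LINT t|lborel. - (V (t, x) * (P t * \<zeta> x)))"
      proof (rule integral_cong_AE)
        show "AE x in lborel. (LINT t|lborel. I t * Z (t, x) * (k t * \<zeta> x)) = (LINT t|lborel. - (V (t, x) * (P t * \<zeta> x)))"
          using Vx
        proof eventually_elim
          case (elim x)
          have "(LINT t|lborel. k t * (0 + (LINT s|lborel. indicator {..t} s * V (s, x)))) = - (LINT t|lborel. P t * (1 * V (t, x)))"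
            by (rule indef_chain_rule(3)[OF elim, where \<eta> = "\<lambda>y. y" and \<kappa> = P and \<kappa>' = k and a = a and b = b])
              (use Pd kc P0 in auto)
          then have e: "(LINT t|lborel. I t * Z (t, x) * k t) = - (LINT t|lborel. V (t, x) * P t)"
            unfolding IZk by (simp add: Z_def mult.commute)
          have "(LINT t|lborel. I t * Z (t, x) * (k t * \<zeta> x)) = (LINT t|lborel. I t * Z (t, x) * k t) * \<zeta> x"
            by (simp add: mult.assoc[symmetric])
          also have "\<dots> = (LINT t|lborel. - (V (t, x) * (P t * \<zeta> x)))"
            unfolding e by (simp add: mult.assoc[symmetric])
          finally show ?case .
        qed
      qed measurable
      also have "\<dots> = (LINT z|?M. - (V z * (P (fst z) * \<zeta> (snd z))))"
        using integrable_section(3)[OF pint[OF int(2) pm RP(2)]] by simp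
      finally show ?thesis by simp
    qed
    have 3: "(LINT z|?M. G z * (k (fst z) * \<zeta> (snd z))) = 0"
      using 1 2 pint[OF int(1) km kB] pint[OF Zi km kB] by (simp add: G_def left_diff_distrib)
    have "(LINT z|?M. G z * (k (fst z) * \<zeta> (snd z))) = (LINT z|?M. G z * (\<rho> (fst z) * \<zeta> (snd z)) - c * (G z * (\<psi> (fst z) * \<zeta> (snd z))))"
      by (intro Bochner_Integration.integral_cong) (auto simp: k_def algebra_simps)
    also have "\<dots> = (LINT z|?M. G z * (\<rho> (fst z) * \<zeta> (snd z))) - c * (LINT z|?M. G z * (\<psi> (fst z) * \<zeta> (snd z)))"
      using pint[OF Gi rm R(2)] pint[OF Gi psm C] by simp
    finally have 4: "(LINT z|?M. G z * (\<rho> (fst z) * \<zeta> (snd z))) = c * (LINT z|?M. G z * (\<psi> (fst z) * \<zeta> (snd z)))"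
      using 3 by simp
    have "(LINT z|?M. G z * (\<psi> (fst z) * \<zeta> (snd z))) = (LINT x|lborel. LINT t|lborel. G (t, x) * (\<psi> t * \<zeta> x))"
      using integrable_section(3)[OF pint[OF Gi psm C]] by simp
    also have "\<dots> = (LINT x|lborel. A x * \<zeta> x)" by (simp add: A_def mult.assoc[symmetric])
    finally have 5: "(LINT z|?M. G z * (\<rho> (fst z) * \<zeta> (snd z))) = c * (LINT x|lborel. A x * \<zeta> x)" using 4 by simp
    have IA: "integrable ?M (\<lambda>z. I (fst z) * A (snd z))" by (rule lborel_pair.integrable_prod_mult[OF Ii Ai])
    have I\<rho>: "I t * \<rho> t = \<rho> t" for t using test_fun_outside[OF \<rho>, of t] by (auto simp: I_def indicator_def)
    have "(LINT z|?M. I (fst z) * A (snd z) * (\<rho> (fst z) * \<zeta> (snd z))) = (LINT x|lborel. LINT t|lborel. I t * A x * (\<rho> t * \<zeta> x))"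
      using integrable_section(3)[OF pint[OF IA rm R(2)]] by simp
    also have "\<dots> = (LINT x|lborel. LINT t|lborel. \<rho> t * (A x * \<zeta> x))"
      by (intro Bochner_Integration.integral_cong refl) (metis I\<rho> mult.assoc mult.commute)
    also have "\<dots> = c * (LINT x|lborel. A x * \<zeta> x)" by (simp add: c_def)
    finally have 6: "(LINT z|?M. I (fst z) * A (snd z) * (\<rho> (fst z) * \<zeta> (snd z))) = c * (LINT x|lborel. A x * \<zeta> x)" .
    have "(LINT z|?M. D z * (\<rho> (fst z) * \<zeta> (snd z))) = 0"
      unfolding Deq using 5 6 pint[OF Gi rm R(2)] pint[OF IA rm R(2)] by (simp add: left_diff_distrib)
    then show "(LINT z|lborel. D z * (\<rho> (fst z) * \<zeta> (snd z))) = 0" by (simp add: lborel_prod)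
  qed
  then have "AE z in ?M. z \<in> cyl T \<Omega> \<longrightarrow> D z = 0" unfolding lborel_prod .
  moreover have D0: "D (t, x) = 0" if "x \<notin> \<Omega>" for t x
    using that zero by (simp add: D_def A_def G_def Z_def cyl_def)
  moreover have DI: "D (t, x) = 0" if "t \<notin> {0<..<T}" for t x using that by (simp add: D_def I_def)
  ultimately have AE1: "AE z in ?M. D z = 0"
  proof (elim eventually_mono)
    fix z assume z: "z \<in> cyl T \<Omega> \<longrightarrow> D z = 0"
    obtain t x where tx: "z = (t, x)" by (cases z)
    show "D z = 0" using z D0[of x t] DI[of t x] unfolding tx cyl_def by blast
  qed
  have [measurable]: "D \<in> borel_measurable (borel \<Otimes>\<^sub>M borel)" unfolding D_def by measurable
  have "AE t in lborel. AE x in lborel. D (t, x) = 0"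
    using lborel_pair.AE_pair[OF AE1] .
  then have "AE x in lborel. AE t in lborel. D (t, x) = 0"
  proof (subst lborel_pair.AE_commute[symmetric])
    show "{z \<in> space ?M. D (fst z, snd z) = 0} \<in> sets ?M" by measurable
  qed
  with Vx have "AE x in lborel. integrable lborel (\<lambda>t. V (t, x)) \<and>
    (AE t in lborel. t \<in> {0<..<T} \<longrightarrow> U (t, x) = A x + Z (t, x))"
  proof eventually_elim
    case (elim x)
    have "AE t in lborel. t \<in> {0<..<T} \<longrightarrow> U (t, x) = A x + Z (t, x)"
      using elim(2) by eventually_elim (auto simp: D_def I_def)
    with elim show ?case by simp
  qed
  then show ?thesis by (rule that)
qed

end

section \<open>The energy identity\<close>

lemma deriv_moll_measurable [measurable]: "deriv (moll n) \<in> borel_measurable borel"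
  by (intro borel_measurable_continuous_onI smooth_imp_continuous smooth_real_deriv(2) smooth_moll)

lemma moll_deriv_bounded: obtains K where "K \<ge> 0" "\<And>t. \<bar>moll n t\<bar> \<le> K" "\<And>t. \<bar>deriv (moll n) t\<bar> \<le> K"
proof -
  have eq: "pd 1 (moll n) = deriv (moll n)"
  proof
    fix x
    have "((\<lambda>s. moll n (x + s *\<^sub>R 1)) has_real_derivative deriv (moll n) x) (at 0)"
      using DERIV_shift[of "moll n" "deriv (moll n) x" 0 x] smooth_real_deriv(1)[OF smooth_moll, of n x]
      by (simp add: add.commute)
    then show "pd 1 (moll n) x = deriv (moll n) x" unfolding pd_def by (rule DERIV_imp_deriv)
  qed
  obtain B where B: "\<And>t. \<bar>moll n t\<bar> \<le> B" using test_fun_bounded[OF moll_test] by metis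
  obtain B' where B': "\<And>t. \<bar>deriv (moll n) t\<bar> \<le> B'"
    using test_fun_bounded[OF test_fun_pd[OF moll_test, of 1 n]] by (auto simp: eq)
  have "0 \<le> max B B'" using B[of 0] by linarith
  then show ?thesis using that[of "max B B'"] B B' by (meson max.coboundedI1 max.coboundedI2)
qed

text \<open>The margin a keeps the support of \<theta> away from both ends, so that all kernels of
  radius below a centred in it are admissible. The bounds B, L, C serve integrability and limits
  only; they may blow up as the truncation is removed.\<close>

locale damped_wave_test = damped_wave +
  fixes \<eta> \<theta> :: "real \<Rightarrow> real" and B L C a :: real
  assumes \<eta>: "smooth \<eta>" "\<eta> 0 = 0" "\<And>s. \<bar>\<eta> s\<bar> \<le> B" "\<And>s. \<bar>deriv \<eta> s\<bar> \<le> L"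
    and \<theta>: "test_fun {0<..<T} \<theta>" "\<And>t. \<bar>\<theta> t\<bar> \<le> C" "\<And>t. \<bar>deriv \<theta> t\<bar> \<le> C"
    and a: "a > 0" "\<And>t. t \<notin> {a..T-a} \<Longrightarrow> \<theta> t = 0"
begin

abbreviation M :: "(real \<times> (real^3)) measure" where "M \<equiv> lborel \<Otimes>\<^sub>M lborel"

sublocale LM: pair_sigma_finite "lborel :: real measure" M
  unfolding pair_sigma_finite_def lborel_prod by (simp add: sigma_finite_lborel)

lemma BLC: "B \<ge> 0" "L \<ge> 0" "C \<ge> 0"
  using \<eta>(3)[of 0] \<eta>(4)[of 0] \<theta>(2)[of 0] by linarith+

lemma \<theta>_deriv: "(\<theta> has_real_derivative deriv \<theta> t) (at t)" "continuous_on UNIV (deriv \<theta>)" "continuous_on UNIV \<theta>"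
  using smooth_real_deriv[OF test_fun_imp_smooth[OF \<theta>(1)]] smooth_imp_continuous test_fun_imp_smooth[OF \<theta>(1)] by auto

lemma \<eta>_deriv: "(\<eta> has_real_derivative deriv \<eta> t) (at t)" "continuous_on UNIV (deriv \<eta>)" "continuous_on UNIV \<eta>"
  using smooth_real_deriv[OF \<eta>(1)] smooth_imp_continuous \<eta>(1) by auto

lemma multiplier_measurable [measurable]: "\<eta> \<in> borel_measurable borel" "deriv \<eta> \<in> borel_measurable borel"
  "\<theta> \<in> borel_measurable borel" "deriv \<theta> \<in> borel_measurable borel"
  using \<theta>_deriv \<eta>_deriv by (auto intro: borel_measurable_continuous_onI)

lemma \<theta>_outside: "t \<notin> {0<..<T} \<Longrightarrow> \<theta> t = 0" "t \<notin> {0<..<T} \<Longrightarrow> deriv \<theta> t = 0"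
proof -
  show z: "\<theta> t = 0" if "t \<notin> {0<..<T}" for t using test_fun_outside[OF \<theta>(1) that] .
  assume t: "t \<notin> {0<..<T}"
  have "\<forall>\<^sub>F s in nhds t. s \<in> - {a..T-a}" using t a(1) by (intro eventually_nhds_in_open) auto
  then have "\<forall>\<^sub>F s in nhds t. \<theta> s = 0" by eventually_elim (use a(2) in auto)
  then have "(\<theta> has_real_derivative 0) (at t)" by (subst DERIV_cong_ev[OF refl _ refl, where g = "\<lambda>_. 0"]) auto
  then show "deriv \<theta> t = 0" by (rule DERIV_imp_deriv)
qed

lemma \<eta>_lipschitz: "\<bar>\<eta> s\<bar> \<le> L * \<bar>s\<bar>"
proof -
  have "norm (\<eta> s - \<eta> 0) \<le> L * norm (s - 0)"
    by (rule field_differentiable_bound[of UNIV]) (use \<eta>_deriv(1) \<eta>(4) in \<open>auto intro: has_field_derivative_at_within\<close>)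
  then show ?thesis using \<eta>(2) by simp
qed

text \<open>\<open>Q\<close> is the intended test function \<theta> \<eta>(u); \<open>P\<close> is
  its formal time derivative and \<open>Y\<close> its formal gradient in space.\<close>

definition I :: "real \<Rightarrow> real" where "I t = indicator {0<..<T} t"
definition v where "v z = \<eta> (U z)"
definition P where "P z = deriv \<theta> (fst z) * v z + \<theta> (fst z) * (deriv \<eta> (U z) * V z)"
definition Y where "Y z = (\<theta> (fst z) * deriv \<eta> (U z)) *\<^sub>R W z"
definition Q where "Q z = \<theta> (fst z) * v z"

lemma localized_measurable [measurable]: "I \<in> borel_measurable borel" "v \<in> borel_measurable (borel \<Otimes>\<^sub>M borel)"
  "P \<in> borel_measurable (borel \<Otimes>\<^sub>M borel)" "Y \<in> borel_measurable (borel \<Otimes>\<^sub>M borel)" "Q \<in> borel_measurable (borel \<Otimes>\<^sub>M borel)"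
  unfolding I_def v_def P_def Y_def Q_def by measurable

lemma I_integrable: "integrable lborel I" "(LINT t|lborel. I t) = T"
proof -
  have "emeasure lborel {0<..<T} < \<infinity>" using T by (simp add: emeasure_lborel_Ioo)
  then show "integrable lborel I" unfolding I_def by (intro integrable_real_indicator) auto
  show "(LINT t|lborel. I t) = T" unfolding I_def using T by simp
qed

lemma I_simps: "0 \<le> I t" "I t \<le> 1" "I t * I t = I t"
  by (auto simp: I_def indicator_def)

lemma W_I: "I (fst z) *\<^sub>R W z = W z"
  using zero(4)[of z] by (cases z) (auto simp: I_def indicator_def cyl_def)

text \<open>The first bound lets Q multiply the merely integrable E; the second, linear in U, makes
  Q itself integrable.\<close>

lemma Q_bounds: "\<bar>Q z\<bar> \<le> C * B * I (fst z)" "\<bar>Q z\<bar> \<le> C * L * \<bar>U z\<bar>"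
proof -
  have "\<bar>\<theta> (fst z)\<bar> * \<bar>v z\<bar> \<le> C * B" using \<theta>(2) \<eta>(3) BLC by (intro mult_mono) (auto simp: v_def)
  then show "\<bar>Q z\<bar> \<le> C * B * I (fst z)"
    using \<theta>_outside(1)[of "fst z"] by (auto simp: Q_def abs_mult I_def indicator_def)
  have "\<bar>\<theta> (fst z)\<bar> * \<bar>v z\<bar> \<le> C * (L * \<bar>U z\<bar>)" using \<theta>(2) \<eta>_lipschitz BLC by (intro mult_mono) (auto simp: v_def)
  then show "\<bar>Q z\<bar> \<le> C * L * \<bar>U z\<bar>" by (simp add: Q_def abs_mult mult.assoc)
qed

lemma P_bound: "\<bar>P z\<bar> \<le> C * L * (\<bar>U z\<bar> + \<bar>V z\<bar>)"
proof -
  have 1: "\<bar>deriv \<theta> (fst z)\<bar> * \<bar>v z\<bar> \<le> C * (L * \<bar>U z\<bar>)" using \<theta>(3) \<eta>_lipschitz BLC by (intro mult_mono) (auto simp: v_def)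
  have 2: "\<bar>\<theta> (fst z)\<bar> * (\<bar>deriv \<eta> (U z)\<bar> * \<bar>V z\<bar>) \<le> C * (L * \<bar>V z\<bar>)"
    using \<theta>(2) \<eta>(4) BLC by (intro mult_mono mult_right_mono) auto
  have "\<bar>P z\<bar> \<le> \<bar>deriv \<theta> (fst z)\<bar> * \<bar>v z\<bar> + \<bar>\<theta> (fst z)\<bar> * (\<bar>deriv \<eta> (U z)\<bar> * \<bar>V z\<bar>)"
    unfolding P_def by (metis abs_mult abs_triangle_ineq)
  with 1 2 show ?thesis by (simp add: algebra_simps)
qed

lemma Y_bound: "norm (Y z) \<le> C * L * norm (W z)"
proof -
  have "\<bar>\<theta> (fst z)\<bar> * \<bar>deriv \<eta> (U z)\<bar> \<le> C * L" using \<theta>(2) \<eta>(4) BLC by (intro mult_mono) auto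
  then show ?thesis by (simp add: Y_def abs_mult mult_right_mono)
qed

lemma Y_bound2: "(norm (Y z))\<^sup>2 \<le> C\<^sup>2 * L\<^sup>2 * (norm (W z))\<^sup>2"
  using power_mono[OF Y_bound[of z], of 2] by (simp add: power_mult_distrib)

lemma Y_I: "I (fst z) * (norm (Y z))\<^sup>2 = (norm (Y z))\<^sup>2"
  using \<theta>_outside(1)[of "fst z"] by (auto simp: I_def indicator_def Y_def)

lemma int2: "integrable M P" "integrable M (\<lambda>z. (P z)\<^sup>2)" "integrable M Q" "integrable M (\<lambda>z. (norm (Y z))\<^sup>2)"
proof -
  have UV: "integrable M (\<lambda>z. C * L * (\<bar>U z\<bar> + \<bar>V z\<bar>))" using int by auto
  show "integrable M P"
    by (rule Bochner_Integration.integrable_bound[OF UV]) (use P_bound in \<open>auto intro!: AE_I2 order_trans[OF P_bound]\<close>)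
  have "integrable M (\<lambda>z. 2 * (C * L)\<^sup>2 * ((U z)\<^sup>2 + (V z)\<^sup>2))" using int by auto
  then show "integrable M (\<lambda>z. (P z)\<^sup>2)"
  proof (rule Bochner_Integration.integrable_bound)
    show "AE z in M. norm ((P z)\<^sup>2) \<le> norm (2 * (C * L)\<^sup>2 * ((U z)\<^sup>2 + (V z)\<^sup>2))"
    proof (rule AE_I2)
      fix z
      have "\<bar>P z\<bar>\<^sup>2 \<le> (C * L * (\<bar>U z\<bar> + \<bar>V z\<bar>))\<^sup>2" by (rule power_mono[OF P_bound]) simp
      also have "\<dots> = (C * L)\<^sup>2 * (\<bar>U z\<bar> + \<bar>V z\<bar>)\<^sup>2" by (simp add: power_mult_distrib)
      also have "\<dots> \<le> (C * L)\<^sup>2 * (2 * ((U z)\<^sup>2 + (V z)\<^sup>2))"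
        using zero_le_power2[of "\<bar>U z\<bar> - \<bar>V z\<bar>"] by (intro mult_left_mono) (auto simp: power2_sum power2_diff)
      finally show "norm ((P z)\<^sup>2) \<le> norm (2 * (C * L)\<^sup>2 * ((U z)\<^sup>2 + (V z)\<^sup>2))" by (simp add: algebra_simps)
    qed
  qed measurable
  have "integrable M (\<lambda>z. C * L * \<bar>U z\<bar>)" using int by auto
  then show "integrable M Q"
    by (rule Bochner_Integration.integrable_bound) (use BLC Q_bounds(2) in \<open>auto simp: abs_mult\<close>)
  have "integrable M (\<lambda>z. C\<^sup>2 * L\<^sup>2 * (norm (W z))\<^sup>2)" using int by auto
  then show "integrable M (\<lambda>z. (norm (Y z))\<^sup>2)"
    by (rule Bochner_Integration.integrable_bound) (use Y_bound2 in auto)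
qed

lemma young_inner:
  fixes x y :: "real^3"
  assumes "\<delta> > 0"
  shows "\<bar>x \<bullet> y\<bar> \<le> \<delta> * (norm x)\<^sup>2 + (norm y)\<^sup>2 / \<delta>"
proof -
  have "0 \<le> (\<delta> * norm x - norm y)\<^sup>2" "0 \<le> \<delta> * (norm x * norm y)" using assms by simp_all
  then have "\<delta> * (norm x * norm y) \<le> \<delta> * \<delta> * (norm x)\<^sup>2 + (norm y)\<^sup>2"
    unfolding power2_diff by (simp add: power2_eq_square algebra_simps)
  then have "norm x * norm y \<le> (\<delta> * \<delta> * (norm x)\<^sup>2 + (norm y)\<^sup>2) / \<delta>"
    using assms by (simp add: pos_le_divide_eq mult.commute)
  also have "\<dots> = \<delta> * (norm x)\<^sup>2 + (norm y)\<^sup>2 / \<delta>" using assms by (simp add: add_divide_distrib)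
  finally show ?thesis using Cauchy_Schwarz_ineq2[of x y] by linarith
qed

text \<open>The free weight \<delta> lets a gradient error on a single slice, tending to zero in
  L^2, be paired with the fixed space-time energy of W.\<close>

lemma W_pairing:
  fixes G :: "real^3 \<Rightarrow> real^3"
  assumes [measurable]: "G \<in> borel_measurable borel" and G2: "integrable lborel (\<lambda>x. (norm (G x))\<^sup>2)"
    and [measurable]: "\<rho> \<in> borel_measurable borel" and \<rho>: "\<And>t. \<bar>\<rho> t\<bar> \<le> K" and \<delta>: "\<delta> > 0"
  shows "integrable M (\<lambda>z. \<rho> (fst z) * (W z \<bullet> G (snd z)))"
    "\<bar>LINT z|M. \<rho> (fst z) * (W z \<bullet> G (snd z))\<bar>
      \<le> K * (\<delta> * (LINT z|M. (norm (W z))\<^sup>2) + T * (LINT x|lborel. (norm (G x))\<^sup>2) / \<delta>)"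
proof -
  let ?b = "\<lambda>z. K * (\<delta> * (norm (W z))\<^sup>2 + I (fst z) * (norm (G (snd z)))\<^sup>2 / \<delta>)"
  have K: "K \<ge> 0" using \<rho>[of 0] by linarith
  have i: "integrable M (\<lambda>z. I (fst z) * (norm (G (snd z)))\<^sup>2)"
    by (rule lborel_pair.integrable_prod_mult[OF I_integrable(1) G2])
  have bi: "integrable M ?b" using i int(6) by auto
  have b: "\<bar>\<rho> (fst z) * (W z \<bullet> G (snd z))\<bar> \<le> ?b z" for z
  proof -
    have "\<bar>W z \<bullet> G (snd z)\<bar> \<le> \<delta> * (norm (W z))\<^sup>2 + I (fst z) * (norm (G (snd z)))\<^sup>2 / \<delta>"
      using young_inner[OF \<delta>, of "W z" "G (snd z)"] W_I[of z] \<delta> by (auto simp: I_def indicator_def split: if_splits)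
    then show ?thesis unfolding abs_mult using \<rho>[of "fst z"] K by (intro mult_mono) auto
  qed
  show 1: "integrable M (\<lambda>z. \<rho> (fst z) * (W z \<bullet> G (snd z)))"
    by (rule Bochner_Integration.integrable_bound[OF bi]) (use b in \<open>auto intro!: AE_I2 order_trans[OF b]\<close>)
  have "\<bar>LINT z|M. \<rho> (fst z) * (W z \<bullet> G (snd z))\<bar> \<le> (LINT z|M. ?b z)"
    by (rule order_trans[OF integral_abs_bound integral_mono]) (use 1 bi b in auto)
  also have "\<dots> = K * (\<delta> * (LINT z|M. (norm (W z))\<^sup>2) + (LINT z|M. I (fst z) * (norm (G (snd z)))\<^sup>2) / \<delta>)"
    using i int(6) by simp
  also have "(LINT z|M. I (fst z) * (norm (G (snd z)))\<^sup>2) = T * (LINT x|lborel. (norm (G x))\<^sup>2)"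
    using integrable_section(3)[OF i] I_integrable by (simp add: mult.commute)
  finally show "\<bar>LINT z|M. \<rho> (fst z) * (W z \<bullet> G (snd z))\<bar>
      \<le> K * (\<delta> * (LINT z|M. (norm (W z))\<^sup>2) + T * (LINT x|lborel. (norm (G x))\<^sup>2) / \<delta>)" .
qed

text \<open>The integrand of the weak equation at z = (t, x), for the test function
  \<open>moll n (t - s) * Q (s, x)\<close> with s as a parameter.\<close>

definition \<Phi> :: "nat \<Rightarrow> real \<Rightarrow> real \<times> (real^3) \<Rightarrow> real" where
  "\<Phi> n s z = (moll n (fst z - s) * E z - deriv (moll n) (fst z - s) * V z) * Q (s, snd z)
     + moll n (fst z - s) * (W z \<bullet> Y (s, snd z))"

lemma H10_borel:
  assumes "H10_grad \<Omega> (\<lambda>x. U (s, x)) (\<lambda>x. W (s, x))"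
  shows "integrable lborel (\<lambda>x. (norm (W (s, x)))\<^sup>2)"
proof (subst lebesgue_on_borel(1)[symmetric])
  show "integrable (lebesgue_on \<Omega>) (\<lambda>x. (norm (W (s, x)))\<^sup>2)" using assms by (simp add: H10_grad_def)
  show "(norm (W (s, x)))\<^sup>2 = 0" if "x \<notin> \<Omega>" for x using zero(4)[of "(s, x)"] that by (simp add: cyl_def)
qed (use Om in auto)

text \<open>For fixed s the spatial factor \<eta>(u(s)) is not smooth, but it is a limit of test
  functions \<eta>(\<phi> k) by \<open>H10_compose\<close>. Smoothing in time alone is therefore
  enough, and nothing has to be mollified near the boundary of \<Omega>.\<close>

lemma \<Phi>_integral_zero:
  assumes s: "s \<in> {0<..<T} \<Longrightarrow> H10_grad \<Omega> (\<lambda>x. U (s, x)) (\<lambda>x. W (s, x))" and n: "inverse (real (Suc n)) < a"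
  shows "(LINT z|M. \<Phi> n s z) = 0"
proof (cases "\<theta> s = 0")
  case True
  then show ?thesis by (simp add: \<Phi>_def Q_def Y_def)
next
  case False
  have "s \<in> {a..T-a}" using False a(2)[of s] by blast
  \<comment> \<open>Where \<theta> does not vanish, s is at distance at least a from both ends, more
    than the radius of the kernel.\<close>
  then have sT: "inverse (real (Suc n)) < s" "s < T - inverse (real (Suc n))" "s \<in> {0<..<T}" using n a(1) by auto
  define \<rho> where "\<rho> t = moll n (t - s)" for t
  have \<rho>: "test_fun {0<..<T} \<rho>" and \<rho>': "deriv \<rho> t = deriv (moll n) (t - s)" for t
    unfolding \<rho>_def by (rule moll_shift_test[OF sT(1,2)])+
  obtain K where K: "K \<ge> 0" "\<And>t. \<bar>moll n t\<bar> \<le> K" "\<And>t. \<bar>deriv (moll n) t\<bar> \<le> K" using moll_deriv_bounded[of n] by metis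
  have \<rho>K: "\<bar>\<rho> t\<bar> \<le> K" "\<bar>deriv \<rho> t\<bar> \<le> K" for t using K unfolding \<rho>' by (auto simp: \<rho>_def)
  have [measurable]: "\<rho> \<in> borel_measurable borel" "deriv \<rho> \<in> borel_measurable borel"
  proof -
    show "\<rho> \<in> borel_measurable borel" unfolding \<rho>_def[abs_def] by measurable
    have "deriv \<rho> = (\<lambda>t. deriv (moll n) (t - s))" using \<rho>' by auto
    then show "deriv \<rho> \<in> borel_measurable borel" by simp
  qed
  have Hs: "H10_grad \<Omega> (\<lambda>x. U (s, x)) (\<lambda>x. W (s, x))" by (rule s[OF sT(3)])
  obtain \<phi> where \<phi>: "\<And>k::nat. test_fun \<Omega> (\<phi> k)" and \<phi>l: "AE x in lebesgue_on \<Omega>. (\<lambda>k. \<phi> k x) \<longlonglongrightarrow> U (s, x)"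
    and gi0: "\<And>k. integrable (lebesgue_on \<Omega>) (\<lambda>x. (norm (grad3 (\<lambda>x. \<eta> (\<phi> k x)) x - deriv \<eta> (U (s, x)) *\<^sub>R W (s, x)))\<^sup>2)"
    and gl0: "(\<lambda>k. LINT x|lebesgue_on \<Omega>. (norm (grad3 (\<lambda>x. \<eta> (\<phi> k x)) x - deriv \<eta> (U (s, x)) *\<^sub>R W (s, x)))\<^sup>2) \<longlonglongrightarrow> 0"
    using H10_compose[OF Om Hs \<eta>(1,2,4)] by blast
  define \<zeta> where "\<zeta> k x = \<eta> (\<phi> k x)" for k x
  have \<zeta>: "test_fun \<Omega> (\<zeta> k)" for k unfolding \<zeta>_def by (rule test_fun_compose(1)[OF \<phi> \<eta>(1,2)])
  have [measurable]: "\<zeta> k \<in> borel_measurable borel" "grad3 (\<zeta> k) \<in> borel_measurable borel" for k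
    using test_fun_measurable[OF \<zeta>] test_fun_grad3_measurable[OF \<zeta>] by auto
  define G where "G x = deriv \<eta> (U (s, x)) *\<^sub>R W (s, x)" for x
  define g where "g k x = grad3 (\<zeta> k) x - G x" for k x
  have [measurable]: "G \<in> borel_measurable borel" "g k \<in> borel_measurable borel" for k
    unfolding G_def g_def by measurable
  have G0: "G x = 0" if "x \<notin> \<Omega>" for x using zero(4)[of "(s, x)"] that by (simp add: cyl_def G_def)
  have g0: "g k x = 0" if "x \<notin> \<Omega>" for k x
    using grad3_outside[of x "\<zeta> k"] \<zeta>[of k] that G0[OF that] by (auto simp: g_def test_fun_def)
  have S: "\<Omega> \<in> sets borel" using Om by simp
  have gi: "integrable lborel (\<lambda>x. (norm (g k x))\<^sup>2)" for k
  proof -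
    have "integrable (lebesgue_on \<Omega>) (\<lambda>x. (norm (g k x))\<^sup>2) \<longleftrightarrow> integrable lborel (\<lambda>x. (norm (g k x))\<^sup>2)"
      by (rule lebesgue_on_borel(1)[OF S]) (use g0 in auto)
    then show ?thesis using gi0[of k] by (simp add: g_def G_def \<zeta>_def[abs_def])
  qed
  have "(LINT x|lebesgue_on \<Omega>. (norm (g k x))\<^sup>2) = (LINT x|lborel. (norm (g k x))\<^sup>2)" for k
    by (rule lebesgue_on_borel(2)[OF S]) (use g0 in auto)
  then have gl: "(\<lambda>k. LINT x|lborel. (norm (g k x))\<^sup>2) \<longlonglongrightarrow> 0"
    using gl0 by (simp add: g_def G_def \<zeta>_def[abs_def])
  have Gi: "integrable lborel (\<lambda>x. (norm (G x))\<^sup>2)"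
  proof (rule Bochner_Integration.integrable_bound[OF integrable_mult_right[OF H10_borel[OF Hs], of "L\<^sup>2"]])
    have "(deriv \<eta> y)\<^sup>2 \<le> L\<^sup>2" for y using power_mono[OF \<eta>(4)[of y], of 2] by simp
    then show "AE x in lborel. norm ((norm (G x))\<^sup>2) \<le> norm (L\<^sup>2 * (norm (W (s, x)))\<^sup>2)"
      by (auto simp: G_def power_mult_distrib intro!: AE_I2 mult_right_mono)
  qed measurable
  \<comment> \<open>These terms contain no gradient of the slice, so convergence almost everywhere
    together with the bound B on \<eta> suffices for them.\<close>
  define F where "F z = E z * \<rho> (fst z) - V z * deriv \<rho> (fst z)" for z
  have Fi: "integrable M F" unfolding F_def
    by (intro Bochner_Integration.integrable_diff integrable_mult_bounded[OF int(3)] integrable_mult_bounded[OF int(2)])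
      (use \<rho>K in measurable)
  have [measurable]: "F \<in> borel_measurable (borel \<Otimes>\<^sub>M borel)" unfolding F_def by measurable
  have F0: "F z = 0" if "snd z \<notin> \<Omega>" for z using zero(2,3)[of z] that by (cases z) (simp add: cyl_def F_def)
  have F\<zeta>i: "integrable M (\<lambda>z. F z * \<zeta> k (snd z))" for k
  proof (rule integrable_mult_bounded[OF Fi])
    show "(\<lambda>z. \<zeta> k (snd z)) \<in> borel_measurable M" by measurable
    show "\<bar>\<zeta> k (snd z)\<bar> \<le> B" for z :: "real \<times> (real^3)" by (simp add: \<zeta>_def \<eta>(3))
  qed
  have Wi: "integrable M (\<lambda>z. \<rho> (fst z) * (W z \<bullet> G (snd z)))" "integrable M (\<lambda>z. \<rho> (fst z) * (W z \<bullet> g k (snd z)))" for k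
    by (rule W_pairing(1)[of _ \<rho> K 1]; use Gi gi \<rho>K in simp)+
  have eqk: "(LINT z|M. F z * \<zeta> k (snd z)) + (LINT z|M. \<rho> (fst z) * (W z \<bullet> G (snd z))) + (LINT z|M. \<rho> (fst z) * (W z \<bullet> g k (snd z))) = 0" for k
  proof -
    have "(LINT z|M. E z * (\<rho> (fst z) * \<zeta> k (snd z)) - V z * (deriv \<rho> (fst z) * \<zeta> k (snd z)) + \<rho> (fst z) * (W z \<bullet> grad3 (\<zeta> k) (snd z)))
      = (LINT z|M. F z * \<zeta> k (snd z) + \<rho> (fst z) * (W z \<bullet> G (snd z)) + \<rho> (fst z) * (W z \<bullet> g k (snd z)))"
      by (intro Bochner_Integration.integral_cong refl) (simp add: F_def g_def inner_diff_right algebra_simps)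
    then show ?thesis using weak_eq[OF \<rho> \<zeta>, of k] F\<zeta>i[of k] Wi(1) Wi(2)[of k] by simp
  qed
  have l1: "(\<lambda>k. LINT z|M. F z * \<zeta> k (snd z)) \<longlonglongrightarrow> (LINT z|M. F z * v (s, snd z))"
  proof (rule integral_dominated_convergence[where w = "\<lambda>z. \<bar>F z\<bar> * B"])
    have "AE x in lborel. x \<in> \<Omega> \<longrightarrow> (\<lambda>k. \<phi> k x) \<longlonglongrightarrow> U (s, x)" using \<phi>l by (simp add: AE_lebesgue_on_iff[OF S])
    from AE_snd_pair[OF this] show "AE z in M. (\<lambda>k. F z * \<zeta> k (snd z)) \<longlonglongrightarrow> F z * v (s, snd z)"
    proof eventually_elim
      case (elim z)
      show ?case
      proof (cases "snd z \<in> \<Omega>")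
        case True
        have "isCont \<eta> (U (s, snd z))" using \<eta>_deriv(1) DERIV_isCont by blast
        with True elim show ?thesis unfolding \<zeta>_def v_def
          by (intro tendsto_mult tendsto_const isCont_tendsto_compose[where g = \<eta>]) auto
      qed (simp add: F0)
    qed
    show "AE z in M. norm (F z * \<zeta> k (snd z)) \<le> \<bar>F z\<bar> * B" for k
      using \<eta>(3) by (auto simp: abs_mult \<zeta>_def intro!: mult_left_mono)
  qed (use Fi in auto)
  have l2: "(\<lambda>k. LINT z|M. \<rho> (fst z) * (W z \<bullet> g k (snd z))) \<longlonglongrightarrow> 0"
  proof (rule LIMSEQ_I)
    fix e :: real assume e: "e > 0"
    define X where "X = (LINT z|M. (norm (W z))\<^sup>2)"
    have X: "X \<ge> 0" by (simp add: X_def)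
    \<comment> \<open>The weight is fixed first, making the energy part at most e/4; k is taken
      large afterwards. The added ones avoid division by zero.\<close>
    define \<delta> where "\<delta> = e / (4 * (K + 1) * (X + 1))"
    have \<delta>: "\<delta> > 0" using e K X by (simp add: \<delta>_def)
    have KX: "K * (\<delta> * X) \<le> e / 4"
    proof -
      have nz: "K + 1 \<noteq> 0" "X + 1 \<noteq> 0" using K X by linarith+
      have "K * (\<delta> * X) = \<delta> * (K * X)" by simp
      also have "\<dots> \<le> \<delta> * ((K + 1) * (X + 1))" using \<delta> K X by (intro mult_left_mono mult_mono) auto
      also have "\<dots> = e / 4"
      proof -
        have "e / (4 * D) * D = e / 4" if "D \<noteq> 0" for D :: real using that by simp
        from this[of "(K + 1) * (X + 1)"] nz show ?thesis unfolding \<delta>_def mult.assoc by simp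
      qed
      finally show ?thesis .
    qed
    have "(\<lambda>k. K * (T * (LINT x|lborel. (norm (g k x))\<^sup>2) / \<delta>)) \<longlonglongrightarrow> K * (T * 0 / \<delta>)"
      by (intro tendsto_intros gl) (use \<delta> in auto)
    then have "\<forall>\<^sub>F k in sequentially. K * (T * (LINT x|lborel. (norm (g k x))\<^sup>2) / \<delta>) < e / 4"
      using e by (intro order_tendstoD(2)) auto
    then obtain N where N: "\<And>k. k \<ge> N \<Longrightarrow> K * (T * (LINT x|lborel. (norm (g k x))\<^sup>2) / \<delta>) < e / 4"
      unfolding eventually_sequentially by blast
    show "\<exists>no. \<forall>k\<ge>no. norm ((LINT z|M. \<rho> (fst z) * (W z \<bullet> g k (snd z))) - 0) < e"
    proof (intro exI allI impI)
      fix k assume "N \<le> k"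
      have "\<bar>LINT z|M. \<rho> (fst z) * (W z \<bullet> g k (snd z))\<bar> \<le> K * (\<delta> * X + T * (LINT x|lborel. (norm (g k x))\<^sup>2) / \<delta>)"
        unfolding X_def by (rule W_pairing(2)) (use gi \<rho>K \<delta> in auto)
      also have "\<dots> = K * (\<delta> * X) + K * (T * (LINT x|lborel. (norm (g k x))\<^sup>2) / \<delta>)" by (simp add: distrib_left)
      also have "\<dots> < e" using KX N[OF \<open>N \<le> k\<close>] e by linarith
      finally show "norm ((LINT z|M. \<rho> (fst z) * (W z \<bullet> g k (snd z))) - 0) < e" by simp
    qed
  qed
  have "(\<lambda>k. (LINT z|M. F z * \<zeta> k (snd z)) + (LINT z|M. \<rho> (fst z) * (W z \<bullet> G (snd z))) + (LINT z|M. \<rho> (fst z) * (W z \<bullet> g k (snd z))))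
    \<longlonglongrightarrow> (LINT z|M. F z * v (s, snd z)) + (LINT z|M. \<rho> (fst z) * (W z \<bullet> G (snd z))) + 0"
    by (intro tendsto_add tendsto_const l1 l2)
  then have 0: "(LINT z|M. F z * v (s, snd z)) + (LINT z|M. \<rho> (fst z) * (W z \<bullet> G (snd z))) = 0"
    unfolding eqk by (simp add: LIMSEQ_const_iff)
  have Fv: "integrable M (\<lambda>z. F z * v (s, snd z))"
    by (rule integrable_mult_bounded[OF Fi, of _ B]) (use \<eta>(3) in \<open>auto simp: v_def\<close>)
  have "(LINT z|M. \<Phi> n s z) = (LINT z|M. \<theta> s * (F z * v (s, snd z) + \<rho> (fst z) * (W z \<bullet> G (snd z))))"
    by (intro Bochner_Integration.integral_cong refl)
      (simp add: \<Phi>_def F_def Q_def Y_def G_def \<rho>' \<rho>_def algebra_simps)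
  also have "\<dots> = 0" using Fv Wi(1) 0 by simp
  finally show ?thesis .
qed

end

section \<open>Removing the mollification: from the averaged weak equation to the energy
  identity\<close>

context damped_wave_test
begin

lemma \<Phi>_measurable [measurable]: "(\<lambda>p. \<Phi> n (fst p) (snd p)) \<in> borel_measurable (borel \<Otimes>\<^sub>M (borel \<Otimes>\<^sub>M borel))"
proof -
  have [measurable]: "(\<lambda>p::real \<times> (real \<times> (real^3)). (fst p, snd (snd p))) \<in> measurable (borel \<Otimes>\<^sub>M (borel \<Otimes>\<^sub>M borel)) (borel \<Otimes>\<^sub>M borel)"
    by measurable
  have [measurable]: "(\<lambda>p::real \<times> (real \<times> (real^3)). Q (fst p, snd (snd p))) \<in> borel_measurable (borel \<Otimes>\<^sub>M (borel \<Otimes>\<^sub>M borel))"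
    "(\<lambda>p::real \<times> (real \<times> (real^3)). Y (fst p, snd (snd p))) \<in> borel_measurable (borel \<Otimes>\<^sub>M (borel \<Otimes>\<^sub>M borel))"
    by measurable
  show ?thesis unfolding \<Phi>_def by measurable
qed

lemma smear_integrable: "integrable (lborel \<Otimes>\<^sub>M M) (\<lambda>p. I (fst (snd p)) * (norm (Y (fst p, snd (snd p))))\<^sup>2)"
proof (rule LM.Fubini_integrable)
  have [measurable]: "(\<lambda>p::real \<times> (real \<times> (real^3)). Y (fst p, snd (snd p))) \<in> borel_measurable (borel \<Otimes>\<^sub>M (borel \<Otimes>\<^sub>M borel))"
    by measurable
  show "(\<lambda>p. I (fst (snd p)) * (norm (Y (fst p, snd (snd p))))\<^sup>2) \<in> borel_measurable (lborel \<Otimes>\<^sub>M M)" by measurable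
  have Ys: "AE s in lborel. integrable lborel (\<lambda>x. (norm (Y (s, x)))\<^sup>2)"
    using lborel_pair.AE_integrable_fst'[OF int2(4)] .
  have e: "AE s in lborel. integrable M (\<lambda>z. I (fst z) * (norm (Y (s, snd z)))\<^sup>2) \<and>
      (LINT z|M. norm (I (fst z) * (norm (Y (s, snd z)))\<^sup>2)) = T * (LINT x|lborel. (norm (Y (s, x)))\<^sup>2)"
    using Ys
  proof eventually_elim
    case (elim s)
    have i: "integrable M (\<lambda>z. I (fst z) * (norm (Y (s, snd z)))\<^sup>2)"
      by (rule lborel_pair.integrable_prod_mult[OF I_integrable(1) elim])
    have "(LINT z|M. norm (I (fst z) * (norm (Y (s, snd z)))\<^sup>2)) = (LINT z|M. I (fst z) * (norm (Y (s, snd z)))\<^sup>2)"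
      using I_simps by (intro Bochner_Integration.integral_cong refl) (simp add: abs_mult)
    also have "\<dots> = T * (LINT x|lborel. (norm (Y (s, x)))\<^sup>2)"
      using integrable_section(3)[OF i] I_integrable by (simp add: mult.commute)
    finally show ?case using i by simp
  qed
  show "AE s in lborel. integrable M (\<lambda>z. I (fst (snd (s, z))) * (norm (Y (fst (s, z), snd (snd (s, z)))))\<^sup>2)"
    using e by simp
  have [measurable]: "(\<lambda>s. LINT z|M. norm (I (fst z) * (norm (Y (s, snd z)))\<^sup>2)) \<in> borel_measurable lborel"
    by measurable
  show "integrable lborel (\<lambda>s. LINT z|M. norm (I (fst (snd (s, z))) * (norm (Y (fst (s, z), snd (snd (s, z)))))\<^sup>2))"
  proof (rule integrable_cong_AE_imp)
    show "integrable lborel (\<lambda>s. T * (LINT x|lborel. (norm (Y (s, x)))\<^sup>2))"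
      using lborel_pair.integrable_fst'[OF int2(4)] by simp
    show "AE s in lborel. T * (LINT x|lborel. (norm (Y (s, x)))\<^sup>2) = (LINT z|M. norm (I (fst (snd (s, z))) * (norm (Y (fst (s, z), snd (snd (s, z)))))\<^sup>2))"
      using e by eventually_elim simp
  qed simp
qed

text \<open>In time, W depends on t alone and Y on s alone, so each is integrable over both times
  only with the indicator of the other one. The indicators cost nothing, as W and Y vanish outside
  the time interval.\<close>

lemma \<Phi>_integrable: "integrable (lborel \<Otimes>\<^sub>M M) (\<lambda>p. \<Phi> n (fst p) (snd p))"
proof -
  obtain K where K: "K \<ge> 0" "\<And>t. \<bar>moll n t\<bar> \<le> K" "\<And>t. \<bar>deriv (moll n) t\<bar> \<le> K" using moll_deriv_bounded[of n] by metis
  define b where "b p = K * (C * B) * (I (fst p) * (\<bar>E (snd p)\<bar> + \<bar>V (snd p)\<bar>))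
     + K * (I (fst p) * (norm (W (snd p)))\<^sup>2 + I (fst (snd p)) * (norm (Y (fst p, snd (snd p))))\<^sup>2)" for p :: "real \<times> (real \<times> (real^3))"
  have "integrable (lborel \<Otimes>\<^sub>M M) (\<lambda>p. I (fst p) * (\<bar>E (snd p)\<bar> + \<bar>V (snd p)\<bar>))"
    by (rule LM.integrable_prod_mult[OF I_integrable(1)]) (use int in auto)
  moreover have "integrable (lborel \<Otimes>\<^sub>M M) (\<lambda>p. I (fst p) * (norm (W (snd p)))\<^sup>2)"
    by (rule LM.integrable_prod_mult[OF I_integrable(1) int(6)])
  ultimately have bi: "integrable (lborel \<Otimes>\<^sub>M M) b"
    unfolding b_def using smear_integrable by auto
  have "\<bar>\<Phi> n s z\<bar> \<le> b (s, z)" for s z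
  proof -
    have "\<bar>moll n (fst z - s) * E z - deriv (moll n) (fst z - s) * V z\<bar> \<le> K * (\<bar>E z\<bar> + \<bar>V z\<bar>)"
    proof -
      have "\<bar>moll n (fst z - s) * E z\<bar> \<le> K * \<bar>E z\<bar>" "\<bar>deriv (moll n) (fst z - s) * V z\<bar> \<le> K * \<bar>V z\<bar>"
        unfolding abs_mult using K by (intro mult_right_mono; simp)+
      then show ?thesis unfolding distrib_left by linarith
    qed
    moreover have "\<bar>Q (s, snd z)\<bar> \<le> C * B * I s" using Q_bounds(1)[of "(s, snd z)"] by simp
    ultimately have 1: "\<bar>(moll n (fst z - s) * E z - deriv (moll n) (fst z - s) * V z) * Q (s, snd z)\<bar>
        \<le> K * (\<bar>E z\<bar> + \<bar>V z\<bar>) * (C * B * I s)"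
      unfolding abs_mult[of _ "Q (s, snd z)"] by (intro mult_mono) (use K in auto)
    have "\<bar>W z \<bullet> Y (s, snd z)\<bar> \<le> I s * (norm (W z))\<^sup>2 + I (fst z) * (norm (Y (s, snd z)))\<^sup>2"
    proof (cases "I s = 0 \<or> I (fst z) = 0")
      case True
      then have "W z = 0 \<or> Y (s, snd z) = 0"
        using W_I[of z] Y_I[of "(s, snd z)"] by auto
      then have "W z \<bullet> Y (s, snd z) = 0" by auto
      then show ?thesis using I_simps by simp
    next
      case False
      then have "I s = 1" "I (fst z) = 1" by (auto simp: I_def indicator_def)
      then show ?thesis using young_inner[of 1 "W z" "Y (s, snd z)"] by simp
    qed
    then have 2: "\<bar>moll n (fst z - s) * (W z \<bullet> Y (s, snd z))\<bar> \<le> K * (I s * (norm (W z))\<^sup>2 + I (fst z) * (norm (Y (s, snd z)))\<^sup>2)"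
      unfolding abs_mult[of "moll n (fst z - s)"] using K by (intro mult_mono) auto
    have "\<bar>\<Phi> n s z\<bar> \<le> \<bar>(moll n (fst z - s) * E z - deriv (moll n) (fst z - s) * V z) * Q (s, snd z)\<bar> + \<bar>moll n (fst z - s) * (W z \<bullet> Y (s, snd z))\<bar>"
      unfolding \<Phi>_def by (rule abs_triangle_ineq)
    with 1 2 show ?thesis by (simp add: b_def algebra_simps)
  qed
  then have b': "\<bar>\<Phi> n (fst p) (snd p)\<bar> \<le> \<bar>b p\<bar>" for p by (metis abs_ge_self order_trans prod.collapse)
  have "(\<lambda>p. \<Phi> n (fst p) (snd p)) \<in> borel_measurable (lborel \<Otimes>\<^sub>M M)" by measurable
  then show ?thesis
    by (rule Bochner_Integration.integrable_bound[OF bi]) (use b' in simp)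
qed

lemma \<Phi>_section: "integrable M (\<lambda>z. LINT s|lborel. \<Phi> n s z)"
  using LM.integrable_snd[of "\<Phi> n"] \<Phi>_integrable[of n] by (simp add: case_prod_beta')

text \<open>The integral over (t, x) vanishes for almost every s. Fubini moves x to the outside, so
  that what remains is analysis on a single time line.\<close>

lemma \<Phi>_total_zero:
  assumes n: "inverse (real (Suc n)) < a"
  shows "(LINT x|lborel. LINT t|lborel. LINT s|lborel. \<Phi> n s (t, x)) = 0"
proof -
  have "(LINT x|lborel. LINT t|lborel. LINT s|lborel. \<Phi> n s (t, x)) = (LINT z|M. LINT s|lborel. \<Phi> n s z)"
    using integrable_section(3)[OF \<Phi>_section[of n]] by simp
  also have "\<dots> = (LINT s|lborel. LINT z|M. \<Phi> n s z)"
    using LM.Fubini_integral[of "\<Phi> n"] \<Phi>_integrable[of n] by (simp add: case_prod_beta')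
  also have "\<dots> = (LINT s|(lborel :: real measure). 0)"
  proof (rule integral_cong_AE)
    show "(\<lambda>s. LINT z|M. \<Phi> n s z) \<in> borel_measurable lborel"
      using LM.integrable_fst[of "\<Phi> n"] \<Phi>_integrable[of n] by (simp add: case_prod_beta')
    show "AE s in lborel. (LINT z|M. \<Phi> n s z) = 0"
      using H10
    proof eventually_elim
      case (elim s)
      show ?case by (rule \<Phi>_integral_zero[OF mp[OF elim] n])
    qed
  qed simp
  finally show ?thesis by simp
qed

text \<open>The points x over whose time line u is absolutely continuous and all pairings are
  integrable; almost every x qualifies.\<close>

definition good :: "real^3 \<Rightarrow> bool" where
  "good x \<longleftrightarrow> (\<exists>A. (AE t in lborel. t \<in> {0<..<T} \<longrightarrow> U (t, x) = A + Z (t, x))) \<and>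
     integrable lborel (\<lambda>t. V (t, x)) \<and> integrable lborel (\<lambda>t. (V (t, x))\<^sup>2) \<and> integrable lborel (\<lambda>t. E (t, x)) \<and>
     integrable lborel (\<lambda>t. P (t, x)) \<and> integrable lborel (\<lambda>t. (P (t, x))\<^sup>2) \<and> integrable lborel (\<lambda>t. Q (t, x)) \<and>
     integrable lborel (\<lambda>t. (norm (W (t, x)))\<^sup>2) \<and> integrable lborel (\<lambda>t. (norm (Y (t, x)))\<^sup>2)"

lemma AE_good: "AE x in lborel. good x"
proof -
  obtain A where A: "AE x in lborel. integrable lborel (\<lambda>t. V (t, x)) \<and>
    (AE t in lborel. t \<in> {0<..<T} \<longrightarrow> U (t, x) = A x + Z (t, x))"
    by (rule ac_in_time) (rule that)
  show ?thesis
    using A integrable_section(1)[OF int(5)] integrable_section(1)[OF int(3)] integrable_section(1)[OF int2(1)]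
      integrable_section(1)[OF int2(2)] integrable_section(1)[OF int2(3)] integrable_section(1)[OF int(6)] integrable_section(1)[OF int2(4)]
    by eventually_elim (auto simp: good_def)
qed

text \<open>On the bounded time interval |w| <= 1 + |w|^2, so square integrability is
  enough.\<close>

lemma component_integrable:
  assumes w: "integrable lborel (\<lambda>t::real. (norm (w t :: real^3))\<^sup>2)" and [measurable]: "w \<in> borel_measurable borel"
    and z: "\<And>t. t \<notin> {0<..<T} \<Longrightarrow> w t = 0"
  shows "integrable lborel (\<lambda>t. w t $ j)" "integrable lborel (\<lambda>t. (w t $ j)\<^sup>2)"
proof -
  have [measurable]: "(\<lambda>t. w t $ j) \<in> borel_measurable borel"
    by (intro borel_measurable_continuous_on[of "\<lambda>y. y $ j"] continuous_intros) simp
  have c: "\<bar>w t $ j\<bar> \<le> norm (w t)" for t by (rule component_le_norm_cart)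
  have c2: "(w t $ j)\<^sup>2 \<le> (norm (w t))\<^sup>2" for t using power_mono[OF c, of t 2] by simp
  show "integrable lborel (\<lambda>t. (w t $ j)\<^sup>2)"
    by (rule Bochner_Integration.integrable_bound[OF w]) (use c2 in auto)
  have "integrable lborel (\<lambda>t. I t + (norm (w t))\<^sup>2)" using w I_integrable(1) by auto
  then show "integrable lborel (\<lambda>t. w t $ j)"
  proof (rule Bochner_Integration.integrable_bound)
    show "AE t in lborel. norm (w t $ j) \<le> norm (I t + (norm (w t))\<^sup>2)"
    proof (rule AE_I2)
      fix t
      have "norm (w t) \<le> I t + (norm (w t))\<^sup>2"
      proof (cases "t \<in> {0<..<T}")
        case True
        have "0 \<le> (norm (w t) - 1/2)\<^sup>2" by simp
        then have "norm (w t) \<le> 1 + (norm (w t))\<^sup>2" by (simp add: power2_eq_square algebra_simps)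
        then show ?thesis using True by (simp add: I_def)
      qed (simp add: z I_simps)
      then show "norm (w t $ j) \<le> norm (I t + (norm (w t))\<^sup>2)" using c[of t] I_simps(1)[of t] by simp
    qed
  qed simp
qed

lemma section_measurable [measurable]:
  "(\<lambda>t. V (t, x)) \<in> borel_measurable borel" "(\<lambda>t. E (t, x)) \<in> borel_measurable borel" "(\<lambda>t. U (t, x)) \<in> borel_measurable borel"
  "(\<lambda>t. W (t, x)) \<in> borel_measurable borel" "(\<lambda>t. P (t, x)) \<in> borel_measurable borel"
  "(\<lambda>t. Q (t, x)) \<in> borel_measurable borel" "(\<lambda>t. Y (t, x)) \<in> borel_measurable borel"
  by measurable

lemma moll_mult_integrable: "integrable lborel b \<Longrightarrow> integrable lborel (\<lambda>s. moll n (t - s) * (c * b s))"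
proof -
  assume b: "integrable lborel b"
  obtain K where K: "K \<ge> 0" "\<And>t. \<bar>moll n t\<bar> \<le> K" "\<And>t. \<bar>deriv (moll n) t\<bar> \<le> K" using moll_deriv_bounded[of n] by metis
  have "integrable lborel (\<lambda>s. (c * b s) * moll n (t - s))"
    by (rule integrable_mult_bounded[where B = K]) (use b K in auto)
  then show ?thesis by (simp add: mult.commute)
qed

lemma WY_zero: "t \<notin> {0<..<T} \<Longrightarrow> W (t, x) = 0" "t \<notin> {0<..<T} \<Longrightarrow> Y (t, x) = 0"
  using zero(4)[of "(t, x)"] by (auto simp: cyl_def Y_def)

lemma good_component:
  assumes "good x"
  shows "integrable lborel (\<lambda>t. W (t, x) $ j)" "integrable lborel (\<lambda>t. (W (t, x) $ j)\<^sup>2)"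
    "integrable lborel (\<lambda>t. Y (t, x) $ j)" "integrable lborel (\<lambda>t. (Y (t, x) $ j)\<^sup>2)"
  by (rule component_integrable; use assms WY_zero in \<open>auto simp: good_def\<close>)+

text \<open>The step that avoids a second time derivative of u: the derivative on the kernel is a
  derivative in s up to sign, and is moved onto Q, whose time derivative P contains only
  u_t.\<close>

lemma Q_ibp:
  assumes g: "good x"
  shows "integrable lborel (\<lambda>s. deriv (moll n) (t - s) * Q (s, x))"
    "(LINT s|lborel. deriv (moll n) (t - s) * Q (s, x)) = (LINT s|lborel. moll n (t - s) * P (s, x))"
proof -
  obtain A where A: "AE t in lborel. t \<in> {0<..<T} \<longrightarrow> U (t, x) = A + Z (t, x)" and V: "integrable lborel (\<lambda>t. V (t, x))"
    and Qi: "integrable lborel (\<lambda>t. Q (t, x))" and Pi: "integrable lborel (\<lambda>t. P (t, x))"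
    using g by (auto simp: good_def)
  obtain K where K: "K \<ge> 0" "\<And>t. \<bar>moll n t\<bar> \<le> K" "\<And>t. \<bar>deriv (moll n) t\<bar> \<le> K" using moll_deriv_bounded[of n] by metis
  have "integrable lborel (\<lambda>s. Q (s, x) * deriv (moll n) (t - s))"
    by (rule integrable_mult_bounded[OF Qi, where B = K]) (use K in auto)
  then show Qd: "integrable lborel (\<lambda>s. deriv (moll n) (t - s) * Q (s, x))" by (simp add: mult.commute)
  \<comment> \<open>Kernel times cut-off is the compactly supported weight of
    \<open>indef_chain_rule\<close>, so only \<eta>(U) is left to differentiate.\<close>
  define k where "k s = moll n (t - s) * \<theta> s" for s
  define k' where "k' s = moll n (t - s) * deriv \<theta> s - deriv (moll n) (t - s) * \<theta> s" for s
  have md: "((\<lambda>s. moll n (t - s)) has_real_derivative - deriv (moll n) (t - s)) (at s)" for s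
  proof -
    have "((\<lambda>s. t - s) has_real_derivative - 1) (at s)" by (auto intro!: derivative_eq_intros)
    from DERIV_chain2[where f = "moll n" and g = "\<lambda>s. t - s", OF smooth_real_deriv(1)[OF smooth_moll] this]
    show ?thesis by simp
  qed
  have kd: "(k has_real_derivative k' s) (at s)" for s
    unfolding k_def[abs_def] k'_def using DERIV_mult[OF md \<theta>_deriv(1), of s] by (simp add: algebra_simps)
  have mc: "continuous_on UNIV (moll n)" "continuous_on UNIV (deriv (moll n))"
    using smooth_imp_continuous smooth_real_deriv(2) smooth_moll by blast+
  have kc: "continuous_on UNIV k'" unfolding k'_def
    by (intro continuous_intros \<theta>_deriv continuous_on_compose2[OF mc(1)] continuous_on_compose2[OF mc(2)]) auto
  have k0: "k s = 0" "k' s = 0" if "s \<notin> {0<..<T}" for s using \<theta>_outside[OF that] by (auto simp: k_def k'_def)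
  let ?U = "\<lambda>s. A + (LINT r|lborel. indicator {..s} r * V (r, x))"
  have UA: "?U s = A + Z (s, x)" for s by (simp add: Z_def)
  have k0': "k s = 0" if "s \<notin> {0..T}" for s using k0(1)[of s] that by auto
  note ch = indef_chain_rule[where a = 0 and b = T and A = A, OF V \<eta>_deriv(1,2) kd kc k0']
  \<comment> \<open>Outside the time interval \<open>A + Z\<close> need not agree with U, but k and
    its derivative vanish there.\<close>
  have e1: "AE s in lborel. k' s * \<eta> (?U s) = k' s * v (s, x)" and e2: "AE s in lborel. k s * (deriv \<eta> (?U s) * V (s, x)) = k s * (deriv \<eta> (U (s, x)) * V (s, x))"
    using A by (eventually_elim, use k0 in \<open>force simp: UA v_def\<close>)+
  have m [measurable]: "?U \<in> borel_measurable borel" unfolding UA by measurable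
  have km [measurable]: "k \<in> borel_measurable borel" "k' \<in> borel_measurable borel" unfolding k_def k'_def by measurable
  have i1: "integrable lborel (\<lambda>s. k' s * v (s, x))"
    by (rule integrable_cong_AE_imp[OF ch(1)]) (use e1 in \<open>auto simp: v_def\<close>)
  have i2: "integrable lborel (\<lambda>s. k s * (deriv \<eta> (U (s, x)) * V (s, x)))"
    by (rule integrable_cong_AE_imp[OF ch(2)]) (use e2 in auto)
  have "(LINT s|lborel. k' s * v (s, x)) = (LINT s|lborel. k' s * \<eta> (?U s))"
    by (rule integral_cong_AE) (use e1 in \<open>auto simp: v_def\<close>)
  moreover have "(LINT s|lborel. k s * (deriv \<eta> (U (s, x)) * V (s, x))) = (LINT s|lborel. k s * (deriv \<eta> (?U s) * V (s, x)))"
    by (rule integral_cong_AE) (use e2 in auto)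
  ultimately have z: "(LINT s|lborel. k' s * v (s, x) + k s * (deriv \<eta> (U (s, x)) * V (s, x))) = 0"
    using ch(3) i1 i2 by simp
  have Pm: "integrable lborel (\<lambda>s. moll n (t - s) * P (s, x))" using moll_mult_integrable[OF Pi, of n t 1] by simp
  have "(LINT s|lborel. k' s * v (s, x) + k s * (deriv \<eta> (U (s, x)) * V (s, x)))
    = (LINT s|lborel. moll n (t - s) * P (s, x) - deriv (moll n) (t - s) * Q (s, x))"
    by (intro Bochner_Integration.integral_cong refl) (simp add: k_def k'_def P_def Q_def algebra_simps)
  then show "(LINT s|lborel. deriv (moll n) (t - s) * Q (s, x)) = (LINT s|lborel. moll n (t - s) * P (s, x))"
    using z Pm Qd by simp
qed

text \<open>Every term is now a mollified bilinear form in a function of t and a function of s. The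
  inner product is split into components because the convergence results are scalar.\<close>

lemma \<Phi>_inner:
  assumes g: "good x"
  shows "(LINT s|lborel. \<Phi> n s (t, x)) = (LINT s|lborel. moll n (t - s) * (E (t, x) * Q (s, x)))
     - (LINT s|lborel. moll n (t - s) * (V (t, x) * P (s, x)))
     + (\<Sum>j\<in>UNIV. LINT s|lborel. moll n (t - s) * (W (t, x) $ j * Y (s, x) $ j))"
proof -
  have i: "integrable lborel (\<lambda>s. moll n (t - s) * (E (t, x) * Q (s, x)))"
      "\<And>j. integrable lborel (\<lambda>s. moll n (t - s) * (W (t, x) $ j * Y (s, x) $ j))"
    using g good_component[OF g] by (auto simp: good_def intro!: moll_mult_integrable)
  have "(LINT s|lborel. \<Phi> n s (t, x)) = (LINT s|lborel. moll n (t - s) * (E (t, x) * Q (s, x)) - V (t, x) * (deriv (moll n) (t - s) * Q (s, x))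
      + (\<Sum>j\<in>UNIV. moll n (t - s) * (W (t, x) $ j * Y (s, x) $ j)))"
    by (intro Bochner_Integration.integral_cong refl)
      (simp add: \<Phi>_def inner_vec_def sum_distrib_left algebra_simps)
  also have "\<dots> = (LINT s|lborel. moll n (t - s) * (E (t, x) * Q (s, x))) - V (t, x) * (LINT s|lborel. deriv (moll n) (t - s) * Q (s, x))
      + (\<Sum>j\<in>UNIV. LINT s|lborel. moll n (t - s) * (W (t, x) $ j * Y (s, x) $ j))"
    using i Q_ibp(1)[OF g] by simp
  also have "V (t, x) * (LINT s|lborel. deriv (moll n) (t - s) * Q (s, x)) = (LINT s|lborel. moll n (t - s) * (V (t, x) * P (s, x)))"
    unfolding Q_ibp(2)[OF g] by (simp add: mult.left_commute[of _ "V (t, x)"])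
  finally show ?thesis .
qed

definition J where "J x = (LINT t|lborel. E (t, x) * Q (t, x)) - (LINT t|lborel. V (t, x) * P (t, x))
  + (\<Sum>j\<in>UNIV. LINT t|lborel. W (t, x) $ j * Y (t, x) $ j)"

text \<open>\<open>moll_conv_L1\<close> asks for a continuous bounded second factor, and the
  absolutely continuous representative of u provides it.\<close>

lemma Q_continuous_version:
  assumes g: "good x"
  obtains b where "continuous_on UNIV b" "\<And>s. \<bar>b s\<bar> \<le> C * B" "AE s in lborel. Q (s, x) = b s"
proof -
  obtain A where A: "AE t in lborel. t \<in> {0<..<T} \<longrightarrow> U (t, x) = A + Z (t, x)" and V: "integrable lborel (\<lambda>t. V (t, x))"
    using g by (auto simp: good_def)
  define b where "b s = \<theta> s * \<eta> (A + Z (s, x))" for s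
  have "continuous_on UNIV (\<lambda>s. A + Z (s, x))"
    unfolding Z_def using indef_continuous[OF V] by (intro continuous_intros) simp
  then have "continuous_on UNIV b"
    unfolding b_def by (intro continuous_on_mult \<theta>_deriv continuous_on_compose2[OF \<eta>_deriv(3)]) auto
  moreover have "\<bar>b s\<bar> \<le> C * B" for s
    unfolding b_def abs_mult using \<theta>(2) \<eta>(3) BLC by (intro mult_mono) auto
  moreover have "AE s in lborel. Q (s, x) = b s"
    using A by eventually_elim (use \<theta>_outside(1) in \<open>force simp: Q_def b_def v_def\<close>)
  ultimately show ?thesis by (rule that)
qed

text \<open>The bound is independent of n and integrable in x; it is the majorant for the dominated
  convergence over x.\<close>

lemma \<Phi>_limit:
  assumes g: "good x"
  shows "(\<lambda>n. LINT t|lborel. LINT s|lborel. \<Phi> n s (t, x)) \<longlonglongrightarrow> J x"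
    "\<bar>LINT t|lborel. LINT s|lborel. \<Phi> n s (t, x)\<bar> \<le> C * B * (LINT t|lborel. \<bar>E (t, x)\<bar>)
      + (LINT t|lborel. (V (t, x))\<^sup>2) + (LINT t|lborel. (P (t, x))\<^sup>2) + (LINT t|lborel. (norm (W (t, x)))\<^sup>2) + (LINT t|lborel. (norm (Y (t, x)))\<^sup>2)"
proof -
  have i: "integrable lborel (\<lambda>t. V (t, x))" "integrable lborel (\<lambda>t. (V (t, x))\<^sup>2)" "integrable lborel (\<lambda>t. E (t, x))"
     "integrable lborel (\<lambda>t. P (t, x))" "integrable lborel (\<lambda>t. (P (t, x))\<^sup>2)" "integrable lborel (\<lambda>t. Q (t, x))"
     "integrable lborel (\<lambda>t. (norm (W (t, x)))\<^sup>2)" "integrable lborel (\<lambda>t. (norm (Y (t, x)))\<^sup>2)"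
    using g by (auto simp: good_def)
  note c = good_component[OF g]
  obtain b where b: "continuous_on UNIV b" "\<And>s. \<bar>b s\<bar> \<le> C * B" "AE s in lborel. Q (s, x) = b s"
    using Q_continuous_version[OF g] by metis
  have [measurable]: "b \<in> borel_measurable borel" by (rule borel_measurable_continuous_onI[OF b(1)])
  have ii: "integrable lborel (\<lambda>t. LINT s|lborel. moll n (t - s) * (p t * q s))" if "integrable lborel p" "integrable lborel q" for p q n
    using lborel_pair.integrable_fst'[OF moll_prod_integrable[OF that, of n]] by simp
  have split: "(LINT t|lborel. LINT s|lborel. \<Phi> n s (t, x)) = (LINT t|lborel. LINT s|lborel. moll n (t - s) * (E (t, x) * Q (s, x)))
     - (LINT t|lborel. LINT s|lborel. moll n (t - s) * (V (t, x) * P (s, x)))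
     + (\<Sum>j\<in>UNIV. LINT t|lborel. LINT s|lborel. moll n (t - s) * (W (t, x) $ j * Y (s, x) $ j))" for n
    unfolding \<Phi>_inner[OF g] using ii[OF i(3,6), of n] ii[OF i(1,4), of n] ii[OF c(1) c(3), of n] by simp
  have Eb: "(LINT s|lborel. moll n (t - s) * (E (t, x) * Q (s, x))) = (LINT s|lborel. moll n (t - s) * (E (t, x) * b s))" for n t
    by (rule integral_cong_AE) (measurable, use b(3) in \<open>auto elim!: eventually_mono\<close>)
  have EQ: "(LINT t|lborel. E (t, x) * Q (t, x)) = (LINT t|lborel. E (t, x) * b t)"
    by (rule integral_cong_AE) (measurable, use b(3) in \<open>auto elim!: eventually_mono\<close>)
  show "(\<lambda>n. LINT t|lborel. LINT s|lborel. \<Phi> n s (t, x)) \<longlonglongrightarrow> J x"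
    unfolding split J_def Eb EQ
    by (intro tendsto_add tendsto_diff tendsto_sum moll_conv_L1[OF i(3) b(1,2)] moll_conv_L2[OF i(1,2,4,5)]
        moll_conv_L2[OF c(1) c(2) c(3) c(4)])
  have 1: "\<bar>LINT t|lborel. LINT s|lborel. moll n (t - s) * (E (t, x) * Q (s, x))\<bar> \<le> C * B * (LINT t|lborel. \<bar>E (t, x)\<bar>)"
  proof -
    have "\<bar>LINT t|lborel. LINT s|lborel. moll n (t - s) * (E (t, x) * Q (s, x))\<bar> \<le> (LINT t|lborel. C * B * \<bar>E (t, x)\<bar>)"
    proof (rule order_trans[OF integral_abs_bound integral_mono])
      fix t
      have "(LINT s|lborel. moll n (t - s) * (E (t, x) * Q (s, x))) = E (t, x) * (LINT s|lborel. moll n (t - s) * b s)"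
        unfolding Eb by (simp add: mult.left_commute[of _ "E (t, x)"])
      also have "\<bar>\<dots>\<bar> \<le> \<bar>E (t, x)\<bar> * (C * B)"
        unfolding abs_mult by (intro mult_left_mono moll_conv_pointwise(2)[OF b(1,2)]) simp
      finally show "\<bar>LINT s|lborel. moll n (t - s) * (E (t, x) * Q (s, x))\<bar> \<le> C * B * \<bar>E (t, x)\<bar>" by (simp add: mult.commute)
    qed (use i(3) ii[OF i(3,6), of n] in auto)
    then show ?thesis by simp
  qed
  have 2: "\<bar>LINT t|lborel. LINT s|lborel. moll n (t - s) * (V (t, x) * P (s, x))\<bar> \<le> (LINT t|lborel. (V (t, x))\<^sup>2) + (LINT t|lborel. (P (t, x))\<^sup>2)"
    using moll_form_bound[OF i(1,2,4,5), of 1 n] by simp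
  have "\<bar>\<Sum>j\<in>UNIV. LINT t|lborel. LINT s|lborel. moll n (t - s) * (W (t, x) $ j * Y (s, x) $ j)\<bar>
     \<le> (\<Sum>j\<in>UNIV. (LINT t|lborel. (W (t, x) $ j)\<^sup>2) + (LINT t|lborel. (Y (t, x) $ j)\<^sup>2))"
    by (rule order_trans[OF sum_abs sum_mono]) (use moll_form_bound[OF c(1) c(2) c(3) c(4), of 1 n] in simp)
  also have "\<dots> = (LINT t|lborel. (norm (W (t, x)))\<^sup>2) + (LINT t|lborel. (norm (Y (t, x)))\<^sup>2)"
    unfolding norm_grad3_sq using c by (simp add: sum.distrib)
  finally have 3: "\<bar>\<Sum>j\<in>UNIV. LINT t|lborel. LINT s|lborel. moll n (t - s) * (W (t, x) $ j * Y (s, x) $ j)\<bar>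
     \<le> (LINT t|lborel. (norm (W (t, x)))\<^sup>2) + (LINT t|lborel. (norm (Y (t, x)))\<^sup>2)" .
  show "\<bar>LINT t|lborel. LINT s|lborel. \<Phi> n s (t, x)\<bar> \<le> C * B * (LINT t|lborel. \<bar>E (t, x)\<bar>)
      + (LINT t|lborel. (V (t, x))\<^sup>2) + (LINT t|lborel. (P (t, x))\<^sup>2) + (LINT t|lborel. (norm (W (t, x)))\<^sup>2) + (LINT t|lborel. (norm (Y (t, x)))\<^sup>2)"
    unfolding split using 1 2 3 by linarith
qed

lemma EVW_integrable: "integrable M (\<lambda>z. E z * Q z)" "integrable M (\<lambda>z. V z * P z)" "integrable M (\<lambda>z. W z \<bullet> Y z)"
proof -
  have "\<bar>Q z\<bar> \<le> C * B" for z
  proof -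
    have "C * B * I (fst z) \<le> C * B * 1" using I_simps BLC by (intro mult_left_mono) auto
    then show ?thesis using Q_bounds(1)[of z] by simp
  qed
  then show "integrable M (\<lambda>z. E z * Q z)" by (intro integrable_mult_bounded[OF int(3)]) auto
  show "integrable M (\<lambda>z. V z * P z)"
  proof (rule Bochner_Integration.integrable_bound[OF Bochner_Integration.integrable_add[OF int(5) int2(2)]])
    show "AE z in M. norm (V z * P z) \<le> norm ((V z)\<^sup>2 + (P z)\<^sup>2)"
    proof (rule AE_I2)
      fix z
      have "2 * \<bar>V z * P z\<bar> \<le> (V z)\<^sup>2 + (P z)\<^sup>2"
        using sum_squares_bound[of "\<bar>V z\<bar>" "\<bar>P z\<bar>"] by (simp add: abs_mult)
      then show "norm (V z * P z) \<le> norm ((V z)\<^sup>2 + (P z)\<^sup>2)" unfolding real_norm_def by linarith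
    qed
  qed measurable
  show "integrable M (\<lambda>z. W z \<bullet> Y z)"
  proof (rule Bochner_Integration.integrable_bound[OF Bochner_Integration.integrable_add[OF int(6) int2(4)]])
    show "AE z in M. norm (W z \<bullet> Y z) \<le> norm ((norm (W z))\<^sup>2 + (norm (Y z))\<^sup>2)"
      using young_inner[of 1] by (intro AE_I2) simp
  qed measurable
qed

text \<open>Formally this is the equation multiplied by \<theta> \<eta>(u) and integrated by parts.
  The averaged integrals vanish for all large n, so their limit along almost every time line
  integrates to zero.\<close>

lemma energy_identity: "(LINT z|M. E z * Q z) - (LINT z|M. V z * P z) + (LINT z|M. W z \<bullet> Y z) = 0"
proof -
  define w where "w x = C * B * (LINT t|lborel. \<bar>E (t, x)\<bar>)
      + (LINT t|lborel. (V (t, x))\<^sup>2) + (LINT t|lborel. (P (t, x))\<^sup>2) + (LINT t|lborel. (norm (W (t, x)))\<^sup>2) + (LINT t|lborel. (norm (Y (t, x)))\<^sup>2)" for x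
  have wi: "integrable lborel w" unfolding w_def
    by (intro Bochner_Integration.integrable_add integrable_mult_right integrable_section(2)[of "\<lambda>z. \<bar>E z\<bar>"]
        integrable_section(2)[OF int(5)] integrable_section(2)[OF int2(2)] integrable_section(2)[OF int(6)] integrable_section(2)[OF int2(4)])
      (use int in auto)
  have s1: "integrable lborel (\<lambda>x. LINT t|lborel. E (t, x) * Q (t, x))" "integrable lborel (\<lambda>x. LINT t|lborel. V (t, x) * P (t, x))"
    "integrable lborel (\<lambda>x. LINT t|lborel. W (t, x) \<bullet> Y (t, x))"
    using integrable_section(2)[OF EVW_integrable(1)] integrable_section(2)[OF EVW_integrable(2)] integrable_section(2)[OF EVW_integrable(3)] by auto
  define J' where "J' x = (LINT t|lborel. E (t, x) * Q (t, x)) - (LINT t|lborel. V (t, x) * P (t, x)) + (LINT t|lborel. W (t, x) \<bullet> Y (t, x))" for x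
  have JJ': "J x = J' x" if g: "good x" for x
  proof -
    note c = good_component[OF g]
    have "integrable lborel (\<lambda>t. W (t, x) $ j * Y (t, x) $ j)" for j
    proof (rule Bochner_Integration.integrable_bound[OF Bochner_Integration.integrable_add[OF c(2)[of j] c(4)[of j]]])
      show "(\<lambda>t. W (t, x) $ j * Y (t, x) $ j) \<in> borel_measurable lborel"
        using c(1)[of j] c(3)[of j] by (intro borel_measurable_times) auto
      show "AE t in lborel. norm (W (t, x) $ j * Y (t, x) $ j) \<le> norm ((W (t, x) $ j)\<^sup>2 + (Y (t, x) $ j)\<^sup>2)"
      proof (rule AE_I2)
        fix t
        have "2 * \<bar>W (t, x) $ j * Y (t, x) $ j\<bar> \<le> (W (t, x) $ j)\<^sup>2 + (Y (t, x) $ j)\<^sup>2"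
          using sum_squares_bound[of "\<bar>W (t, x) $ j\<bar>" "\<bar>Y (t, x) $ j\<bar>"] by (simp add: abs_mult)
        then show "norm (W (t, x) $ j * Y (t, x) $ j) \<le> norm ((W (t, x) $ j)\<^sup>2 + (Y (t, x) $ j)\<^sup>2)" unfolding real_norm_def by linarith
      qed
    qed
    then show ?thesis by (simp add: J_def J'_def inner_vec_def)
  qed
  have "(\<lambda>n. LINT x|lborel. LINT t|lborel. LINT s|lborel. \<Phi> n s (t, x)) \<longlonglongrightarrow> (LINT x|lborel. J' x)"
  proof (rule integral_dominated_convergence[where w = w])
    show "J' \<in> borel_measurable lborel" unfolding J'_def using s1 by auto
    show "(\<lambda>x. LINT t|lborel. LINT s|lborel. \<Phi> n s (t, x)) \<in> borel_measurable lborel" for n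
      using integrable_section(2)[OF \<Phi>_section[of n]] by auto
    show "AE x in lborel. (\<lambda>n. LINT t|lborel. LINT s|lborel. \<Phi> n s (t, x)) \<longlonglongrightarrow> J' x"
      using AE_good
    proof eventually_elim
      case (elim x)
      show ?case using \<Phi>_limit(1)[OF elim] JJ'[OF elim] by simp
    qed
    show "AE x in lborel. norm (LINT t|lborel. LINT s|lborel. \<Phi> n s (t, x)) \<le> w x" for n
      using AE_good
    proof eventually_elim
      case (elim x)
      show ?case using \<Phi>_limit(2)[OF elim, of n] by (simp add: w_def)
    qed
  qed (rule wi)
  moreover have "\<forall>\<^sub>F n in sequentially. (LINT x|lborel. LINT t|lborel. LINT s|lborel. \<Phi> n s (t, x)) = 0"
    using order_tendstoD(2)[OF LIMSEQ_inverse_real_of_nat a(1)]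
  proof eventually_elim
    case (elim n)
    show ?case by (rule \<Phi>_total_zero[OF elim])
  qed
  ultimately have "(LINT x|lborel. J' x) = 0"
    by (rule LIMSEQ_unique[OF _ tendsto_eventually])
  then show ?thesis
    using s1 integrable_section(3)[OF EVW_integrable(1)] integrable_section(3)[OF EVW_integrable(2)] integrable_section(3)[OF EVW_integrable(3)]
    by (simp add: J'_def)
qed

end

section \<open>Growth bounds for the nonlinearities\<close>

lemma ex_antiderivative:
  fixes h :: "real \<Rightarrow> real"
  assumes "continuous_on UNIV h"
  obtains g where "\<And>x. (g has_real_derivative h x) (at x)" "g 0 = 0"
proof -
  have "\<exists>F. \<forall>x. - \<infinity> < ereal x \<longrightarrow> ereal x < \<infinity> \<longrightarrow> (F has_vector_derivative h x) (at x)"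
    by (rule einterval_antiderivative) (use assms in \<open>auto simp: continuous_on_eq_continuous_at\<close>)
  then obtain F where "\<And>x. (F has_real_derivative h x) (at x)"
    by (auto simp: has_real_derivative_iff_has_vector_derivative)
  then have "\<And>x. ((\<lambda>x. F x - F 0) has_real_derivative h x) (at x)" by (auto intro!: derivative_eq_intros)
  then show ?thesis by (rule that) simp
qed

lemma antiderivative_abs_le:
  fixes g G :: "real \<Rightarrow> real"
  assumes g: "\<And>x. (g has_real_derivative g' x) (at x)" "g 0 = 0"
    and b: "\<And>t. \<bar>t\<bar> \<le> \<bar>s\<bar> \<Longrightarrow> \<bar>g' t\<bar> \<le> K"
  shows "\<bar>g s\<bar> \<le> K * \<bar>s\<bar>"
proof -
  have "norm (g s - g 0) \<le> K * norm (s - 0)"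
    by (rule field_differentiable_bound[of "{- \<bar>s\<bar>..\<bar>s\<bar>}" g g']) (use g b in \<open>auto intro: has_field_derivative_at_within\<close>)
  then show ?thesis using g(2) by simp
qed

lemma antiderivative_nonneg_sign:
  fixes g :: "real \<Rightarrow> real"
  assumes g: "\<And>x. (g has_real_derivative g' x) (at x)" "g 0 = 0" and p: "\<And>x. g' x \<ge> 0"
  shows "s * g s \<ge> 0" "mono g"
proof -
  have m: "g x \<le> g y" if "x \<le> y" for x y
    by (rule DERIV_nonneg_imp_nondecreasing[OF that]) (use g p in blast)
  then show "mono g" by (simp add: mono_def)
  show "s * g s \<ge> 0" using m[of 0 s] m[of s 0] g(2) by (cases "s \<ge> 0") (auto simp: mult_nonpos_nonpos)
qed

text \<open>Beyond 1 the function is compared with c s^m by monotonicity of the sum and the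
  difference; the negative half-line follows by reflection, and a compactness bound covers
  [-1, 1].\<close>

lemma sigma_growth:
  fixes \<sigma> \<sigma>' :: "real \<Rightarrow> real"
  assumes d: "\<And>s. (\<sigma> has_real_derivative \<sigma>' s) (at s)"
    and b: "\<And>s. \<bar>s\<bar> \<ge> 1 \<Longrightarrow> \<bar>\<sigma>' s\<bar> \<le> c * m * \<bar>s\<bar> powr (m - 1)" and m: "m \<ge> 0"
  obtains S where "S \<ge> 0" "\<And>s. \<bar>\<sigma> s\<bar> \<le> S * (1 + \<bar>s\<bar> powr m)"
proof -
  have c: "continuous_on UNIV \<sigma>" using DERIV_isCont[OF d] continuous_at_imp_continuous_on by blast
  obtain B where B: "B \<ge> 0" "\<And>y. \<bar>y\<bar> \<le> 1 \<Longrightarrow> \<bar>\<sigma> y\<bar> \<le> B" using continuous_bounded_on_interval[OF c, of 1] by metis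
  have key: "\<bar>g s\<bar> \<le> B + \<bar>c\<bar> * s powr m" if s: "s \<ge> 1" and g: "\<And>s. (g has_real_derivative g' s) (at s)"
      and g': "\<And>s. s \<ge> 1 \<Longrightarrow> \<bar>g' s\<bar> \<le> c * m * s powr (m - 1)" and g1: "\<bar>g 1\<bar> \<le> B" for g g' s
  proof -
    have p: "((\<lambda>s. c * s powr m) has_real_derivative c * (m * x powr (m - 1))) (at x)" if "x \<ge> 1" for x
      using that by (auto intro!: derivative_eq_intros simp: powr_diff field_simps)
    have "g s - c * s powr m \<le> g 1 - c * 1 powr m"
    proof (rule DERIV_nonpos_imp_nonincreasing[OF s])
      fix x :: real assume "1 \<le> x" "x \<le> s"
      then show "\<exists>y. ((\<lambda>s. g s - c * s powr m) has_real_derivative y) (at x) \<and> y \<le> 0"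
        using g'[of x] by (intro exI[of _ "g' x - c * (m * x powr (m - 1))"] conjI DERIV_diff g p) auto
    qed
    moreover have "g 1 + c * 1 powr m \<le> g s + c * s powr m"
    proof (rule DERIV_nonneg_imp_nondecreasing[OF s])
      fix x :: real assume "1 \<le> x" "x \<le> s"
      then show "\<exists>y. ((\<lambda>s. g s + c * s powr m) has_real_derivative y) (at x) \<and> 0 \<le> y"
        using g'[of x] by (intro exI[of _ "g' x + c * (m * x powr (m - 1))"] conjI DERIV_add g p) auto
    qed
    ultimately have "\<bar>g s\<bar> \<le> \<bar>g 1\<bar> + c * s powr m - c" by simp
    \<comment> \<open>The sign of c is not known: for m = 0 the growth condition only says that the
      derivative vanishes for |s| >= 1.\<close>
    moreover have "c * s powr m - c \<le> \<bar>c\<bar> * s powr m"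
    proof -
      have "1 \<le> s powr m" using s m by (simp add: ge_one_powr_ge_zero)
      then have "0 \<le> (\<bar>c\<bar> - c) * s powr m + c \<or> c < 0" by (cases "c \<ge> 0") auto
      then show ?thesis
      proof
        assume "c < 0"
        then have "(\<bar>c\<bar> - c) * s powr m + c \<ge> (\<bar>c\<bar> - c) * 1 + c"
          using \<open>1 \<le> s powr m\<close> by (intro add_right_mono mult_left_mono) auto
        then show ?thesis using \<open>c < 0\<close> by (simp add: algebra_simps)
      qed (simp add: algebra_simps)
    qed
    ultimately show ?thesis using g1 by linarith
  qed
  have "\<bar>\<sigma> s\<bar> \<le> (B + \<bar>c\<bar>) * (1 + \<bar>s\<bar> powr m)" for s
  proof -
    have e: "(B + \<bar>c\<bar>) * (1 + \<bar>s\<bar> powr m) = B + \<bar>c\<bar> * \<bar>s\<bar> powr m + (\<bar>c\<bar> + B * \<bar>s\<bar> powr m)" by (simp add: algebra_simps)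
    have p: "0 \<le> B * \<bar>s\<bar> powr m" "0 \<le> \<bar>c\<bar> * \<bar>s\<bar> powr m" using B by simp_all
    consider "\<bar>s\<bar> \<le> 1" | "s \<ge> 1" | "s \<le> -1" by linarith
    then show ?thesis
    proof cases
      case 1
      then show ?thesis using B(2)[of s] e p by linarith
    next
      case 2
      have "\<bar>\<sigma> s\<bar> \<le> B + \<bar>c\<bar> * s powr m"
      proof (rule key[where g = \<sigma> and g' = \<sigma>'])
        show "\<bar>\<sigma>' s\<bar> \<le> c * m * s powr (m - 1)" if "1 \<le> s" for s using b[of s] that by simp
      qed (use 2 d B(2)[of 1] in auto)
      then show ?thesis using e p 2 by simp
    next
      case 3
      have "\<bar>\<sigma> (- (- s))\<bar> \<le> B + \<bar>c\<bar> * (- s) powr m"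
      proof (rule key[where g = "\<lambda>s. \<sigma> (- s)" and g' = "\<lambda>s. - \<sigma>' (- s)"])
        show "((\<lambda>s. \<sigma> (- s)) has_real_derivative - \<sigma>' (- s)) (at s)" for s
        proof -
          have "((\<lambda>s. \<sigma> (- s)) has_real_derivative \<sigma>' (- s) * - 1) (at s)"
            by (rule DERIV_chain2[where f = \<sigma> and g = uminus, OF d]) (auto intro!: derivative_eq_intros)
          then show ?thesis by simp
        qed
        show "\<bar>- \<sigma>' (- s)\<bar> \<le> c * m * s powr (m - 1)" if "1 \<le> s" for s using b[of "- s"] that by simp
      qed (use 3 B(2)[of "-1"] in auto)
      then show ?thesis using e p 3 by simp
    qed
  qed
  then show ?thesis using that[of "B + \<bar>c\<bar>"] B(1) by auto
qed

text \<open>The sixth power is the moment of u that R controls, so all growth bounds below are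
  expressed through 1 + s^6.\<close>

lemma power_le_one_plus_power6: "\<bar>s\<bar> ^ j \<le> 1 + s ^ 6" if "j \<le> 6" for s :: real
proof (cases "\<bar>s\<bar> \<le> 1")
  case True
  then have "\<bar>s\<bar> ^ j \<le> 1" by (simp add: power_le_one)
  moreover have "0 \<le> s ^ 6" by simp
  ultimately show ?thesis by linarith
next
  case False
  then have "\<bar>s\<bar> ^ j \<le> \<bar>s\<bar> ^ 6" using that by (intro power_increasing) auto
  also have "\<bar>s\<bar> ^ 6 = s ^ 6" by simp
  finally show ?thesis by linarith
qed

lemma powr_le_one_plus_power6:
  fixes s q :: real
  assumes "0 \<le> q" "q \<le> 6"
  shows "\<bar>s\<bar> powr q \<le> 1 + s ^ 6"
proof (cases "\<bar>s\<bar> \<le> 1")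
  case True
  then have "\<bar>s\<bar> powr q \<le> 1" using assms by (intro powr_le1) auto
  moreover have "0 \<le> s ^ 6" by simp
  ultimately show ?thesis by linarith
next
  case False
  then have "\<bar>s\<bar> powr q \<le> \<bar>s\<bar> powr 6" using assms by (intro powr_mono) auto
  also have "\<bar>s\<bar> powr 6 = s ^ 6" using False by (simp add: powr_numeral)
  finally show ?thesis by linarith
qed

text \<open>The majorant of the second derivative increases with |s|, so each of the two
  integrations just multiplies it by |s|.\<close>

lemma f_growth:
  fixes f f' f'' :: "real \<Rightarrow> real"
  assumes d: "\<And>s. (f has_real_derivative f' s) (at s)" "\<And>s. (f' has_real_derivative f'' s) (at s)" "f 0 = 0" "f' 0 = 0"
    and b: "\<And>s. \<bar>f'' s\<bar> \<le> c * (1 + \<bar>s\<bar> powr (p - 2))" and p: "2 \<le> p" "p \<le> 6"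
  obtains F where "F \<ge> 0" "\<And>s. \<bar>f s\<bar> \<le> F * (1 + s ^ 6)"
proof -
  \<comment> \<open>At s = 0 the hypothesis reads |f''(0)| <= c, because \<open>0 powr x = 0\<close>
    for every x.\<close>
  have c: "c \<ge> 0"
    using b[of 0] by (cases "p = 2") (auto simp: zero_le_mult_iff abs_le_iff dest: order_trans[OF abs_ge_zero])
  have mono: "c * (1 + \<bar>t\<bar> powr (p - 2)) \<le> c * (1 + \<bar>s\<bar> powr (p - 2))" if "\<bar>t\<bar> \<le> \<bar>s\<bar>" for s t :: real
    using that c p by (intro mult_left_mono add_left_mono powr_mono2) auto
  have f': "\<bar>f' s\<bar> \<le> c * (1 + \<bar>s\<bar> powr (p - 2)) * \<bar>s\<bar>" for s
    by (rule antiderivative_abs_le[OF d(2,4)]) (use b mono order_trans in blast)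
  have f: "\<bar>f s\<bar> \<le> c * (1 + \<bar>s\<bar> powr (p - 2)) * \<bar>s\<bar> * \<bar>s\<bar>" for s
  proof (rule antiderivative_abs_le[OF d(1,3)])
    fix t :: real assume t: "\<bar>t\<bar> \<le> \<bar>s\<bar>"
    have "\<bar>f' t\<bar> \<le> c * (1 + \<bar>t\<bar> powr (p - 2)) * \<bar>t\<bar>" by (rule f')
    also have "\<dots> \<le> c * (1 + \<bar>s\<bar> powr (p - 2)) * \<bar>s\<bar>" by (rule mult_mono[OF mono[OF t] t]) (use c in \<open>auto intro!: mult_nonneg_nonneg add_nonneg_nonneg\<close>)
    finally show "\<bar>f' t\<bar> \<le> c * (1 + \<bar>s\<bar> powr (p - 2)) * \<bar>s\<bar>" .
  qed
  have "\<bar>f s\<bar> \<le> (2 * c) * (1 + s ^ 6)" for s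
  proof -
    have "\<bar>s\<bar> powr (p - 2) * (\<bar>s\<bar> * \<bar>s\<bar>) = \<bar>s\<bar> powr p"
      by (cases "s = 0") (use p in \<open>auto simp: powr_diff powr_numeral power2_eq_square field_simps\<close>)
    also have "\<dots> \<le> 1 + s ^ 6" using p by (intro powr_le_one_plus_power6) auto
    finally have 1: "\<bar>s\<bar> powr (p - 2) * (\<bar>s\<bar> * \<bar>s\<bar>) \<le> 1 + s ^ 6" .
    have 2: "\<bar>s\<bar> * \<bar>s\<bar> \<le> 1 + s ^ 6" using power_le_one_plus_power6[of 2 s] by (simp add: power2_eq_square)
    have "c * (1 + \<bar>s\<bar> powr (p - 2)) * \<bar>s\<bar> * \<bar>s\<bar> = c * (\<bar>s\<bar> * \<bar>s\<bar> + \<bar>s\<bar> powr (p - 2) * (\<bar>s\<bar> * \<bar>s\<bar>))" by (simp add: algebra_simps)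
    also have "\<dots> \<le> c * ((1 + s ^ 6) + (1 + s ^ 6))" using 1 2 c by (intro mult_left_mono add_mono) auto
    finally show ?thesis using f[of s] by (simp add: algebra_simps)
  qed
  then show ?thesis using that[of "2 * c"] c by auto
qed

text \<open>Here y stands for \<eta>(s), which has the sign of s. The product f(s) \<eta>(s) may
  grow like |s|^(p + k + 1), beyond the sixth power, so only its negative part is bounded: by the
  limit inferior for large s and by compactness otherwise.\<close>

lemma f_lower:
  fixes f :: "real \<Rightarrow> real"
  assumes c: "continuous_on UNIV f" and lim: "Liminf at_infinity (\<lambda>s. ereal (f s / s)) > - ereal lam" and lam: "lam > 0"
  obtains F where "F \<ge> 0" "\<And>s y. s * y \<ge> 0 \<Longrightarrow> - f s * y \<le> F * (1 + \<bar>s\<bar>) * \<bar>y\<bar>"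
proof -
  have "eventually (\<lambda>s. - ereal lam < ereal (f s / s)) at_infinity" by (rule less_LiminfD[OF lim])
  then obtain K0 where K0: "\<And>s. \<bar>s\<bar> \<ge> K0 \<Longrightarrow> - lam < f s / s" unfolding eventually_at_infinity by auto
  define K where "K = max 1 K0"
  have K: "\<bar>s\<bar> \<ge> K \<Longrightarrow> - lam < f s / s" "K \<ge> 1" for s using K0[of s] by (auto simp: K_def)
  obtain B where B: "B \<ge> 0" "\<And>y. \<bar>y\<bar> \<le> K \<Longrightarrow> \<bar>f y\<bar> \<le> B" using continuous_bounded_on_interval[OF c, of K] by metis
  have "- f s * y \<le> (B + lam) * (1 + \<bar>s\<bar>) * \<bar>y\<bar>" if sy: "s * y \<ge> 0" for s y
  proof (cases "\<bar>s\<bar> \<le> K")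
    case True
    have "- f s * y \<le> \<bar>f s\<bar> * \<bar>y\<bar>" by (metis abs_ge_minus_self abs_mult mult_minus_left)
    also have "\<dots> \<le> B * \<bar>y\<bar>" using B(2)[OF True] by (intro mult_right_mono) auto
    also have "\<dots> \<le> (B + lam) * (1 + \<bar>s\<bar>) * \<bar>y\<bar>"
    proof (intro mult_right_mono)
      have "B * 1 \<le> (B + lam) * (1 + \<bar>s\<bar>)" using B lam by (intro mult_mono) auto
      then show "B \<le> (B + lam) * (1 + \<bar>s\<bar>)" by simp
    qed simp
    finally show ?thesis .
  next
    case False
    have nz: "s \<noteq> 0" using False K(2) by auto
      have "- f s * y = - (f s / s) * (s * y)" using nz by simp
      also have "\<dots> \<le> lam * (s * y)" using K(1)[of s] False sy by (intro mult_right_mono) auto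
      also have "\<dots> = lam * (\<bar>s\<bar> * \<bar>y\<bar>)" using sy by (simp add: abs_mult[symmetric])
      also have "\<dots> \<le> (B + lam) * ((1 + \<bar>s\<bar>) * \<bar>y\<bar>)" using B lam by (intro mult_mono mult_right_mono) auto
      finally show ?thesis by (simp add: mult.assoc)
  qed
  then show ?thesis using that[of "B + lam"] B(1) lam by auto
qed

section \<open>Smooth bounded multipliers\<close>

text \<open>
  The multiplier has derivative \<open>(mult_sqrt k n)^2\<close>. The second factor makes both the multiplier and its derivative
  bounded and disappears as \<open>n\<close> tends to infinity; the square root enters the Sobolev inequality.
\<close>

definition mult_sqrt :: "real \<Rightarrow> nat \<Rightarrow> real \<Rightarrow> real" where
  "mult_sqrt k n s = (1 + s * s) powr (k / 4) * (1 + s * s * inverse (real (Suc n))) powr (- 1)"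

lemma one_plus_pos: "1 + s * s > (0::real)" "1 + s * s * inverse (real (Suc n)) > 0"
  by (simp_all add: add_pos_nonneg)

lemma smooth_mult_sqrt: "smooth (mult_sqrt k n)"
proof -
  have id: "smooth (\<lambda>s::real. s)" using smooth_linear[OF bounded_linear_ident] .
  show ?thesis unfolding mult_sqrt_def
    by (rule smooth_mult[OF smooth_powr[OF _ one_plus_pos(1)] smooth_powr[OF _ one_plus_pos(2)]];
      intro smooth_add smooth_mult smooth_const id)
qed

lemma mult_sqrt_sq:
  "(mult_sqrt k n s)\<^sup>2 = (1 + s * s) powr (k / 2) * (1 + s * s * inverse (real (Suc n))) powr (- 2)"
proof -
  have "((1 + s * s) powr (k / 4))\<^sup>2 = (1 + s * s) powr (k / 2)"
    using one_plus_pos(1)[of s] by (simp add: power2_eq_square powr_add[symmetric])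
  moreover have "((1 + s * s * inverse (real (Suc n))) powr (- 1))\<^sup>2 = (1 + s * s * inverse (real (Suc n))) powr (- 2)"
    using one_plus_pos(2)[of s n] unfolding power2_eq_square by (subst powr_add[symmetric]) simp
  ultimately show ?thesis unfolding mult_sqrt_def power_mult_distrib by simp
qed

lemma mult_sqrt_sq_le:
  assumes "0 \<le> k"
  shows "(mult_sqrt k n s)\<^sup>2 \<le> (1 + s * s) powr (k / 2)"
proof -
  have "1 \<le> 1 + s * s * inverse (real (Suc n))" by simp
  then have "(1 + s * s * inverse (real (Suc n))) powr (- 2) \<le> 1 powr (-2)"
    by (intro powr_mono2') auto
  then show ?thesis unfolding mult_sqrt_sq by (simp add: mult_left_le)
qed

text \<open>Write N for n + 1. Since k <= 2, the weight is at most 1 + s^2 <= N (1 + s^2/N); this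
  cancels one of the two truncating factors, and the remaining one is integrable over the
  line.\<close>

lemma mult_sqrt_sq_bound:
  assumes "0 \<le> k" "k \<le> 2"
  shows "(mult_sqrt k n s)\<^sup>2 \<le> real (Suc n) / (1 + s * s * inverse (real (Suc n)))"
proof -
  let ?q = "1 + s * s * inverse (real (Suc n))"
  have q: "?q > 0" by (rule one_plus_pos)
  have "(1 + s * s) powr (k / 2) \<le> (1 + s * s) powr 1" using assms by (intro powr_mono) auto
  also have "\<dots> = 1 + s * s" using one_plus_pos(1)[of s] by simp
  also have "\<dots> \<le> real (Suc n) * ?q"
  proof -
    have "real (Suc n) * ?q = real (Suc n) + s * s" by (simp add: distrib_left del: of_nat_Suc)
    then show ?thesis by simp
  qed
  finally have 1: "(1 + s * s) powr (k / 2) \<le> real (Suc n) * ?q" .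
  have "?q powr (- 2) = 1 / (?q * ?q)" using q by (simp add: powr_minus powr_numeral power2_eq_square field_simps)
  then have "(mult_sqrt k n s)\<^sup>2 \<le> real (Suc n) * ?q * (1 / (?q * ?q))"
    unfolding mult_sqrt_sq using 1 q by (metis mult_right_mono powr_ge_zero)
  also have "\<dots> = real (Suc n) / ?q" using q by simp
  finally show ?thesis .
qed

lemma mult_sqrt_le:
  assumes "0 \<le> k" "k \<le> 2"
  shows "\<bar>mult_sqrt k n s\<bar> \<le> real (Suc n)" "(mult_sqrt k n s)\<^sup>2 \<le> real (Suc n)"
proof -
  have "real (Suc n) / (1 + s * s * inverse (real (Suc n))) \<le> real (Suc n) / 1"
    by (intro divide_left_mono) (auto simp: add_pos_nonneg)
  then show 1: "(mult_sqrt k n s)\<^sup>2 \<le> real (Suc n)" using mult_sqrt_sq_bound[OF assms, of n s] by simp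
  also have "real (Suc n) \<le> (real (Suc n))\<^sup>2" by (rule self_le_power) auto
  finally have "(mult_sqrt k n s)\<^sup>2 \<le> (real (Suc n))\<^sup>2" .
  then show "\<bar>mult_sqrt k n s\<bar> \<le> real (Suc n)" by (simp add: abs_le_square_iff[symmetric] del: of_nat_Suc)
qed

text \<open>Boundedness comes from comparison with an arctangent, the antiderivative of the bound in
  \<open>mult_sqrt_sq_bound\<close>. The growth bound that is uniform in n uses only the untruncated
  weight.\<close>

lemma ex_multiplier:
  assumes k: "0 \<le> k" "k \<le> 2"
  obtains \<eta> B where "smooth \<eta>" "\<eta> 0 = 0" "\<And>s. \<bar>\<eta> s\<bar> \<le> B" "\<And>s. deriv \<eta> s = (mult_sqrt k n s)\<^sup>2"
    "\<And>s. \<bar>\<eta> s\<bar> \<le> (1 + s * s) powr (k / 2) * \<bar>s\<bar>" "\<And>s. s * \<eta> s \<ge> 0"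
proof -
  have sm: "smooth (\<lambda>s. mult_sqrt k n s * mult_sqrt k n s)" by (intro smooth_mult smooth_mult_sqrt)
  obtain \<eta> where e: "\<And>x. (\<eta> has_real_derivative mult_sqrt k n x * mult_sqrt k n x) (at x)" "\<eta> 0 = 0"
    using ex_antiderivative[OF smooth_imp_continuous[OF sm]] by metis
  have esm: "smooth \<eta>" by (rule smooth_antiderivative[OF e(1) sm])
  have ed: "deriv \<eta> s = (mult_sqrt k n s)\<^sup>2" for s using DERIV_imp_deriv[OF e(1)] by (simp add: power2_eq_square)
  define N where "N = real (Suc n)"
  have N: "N > 0" by (simp add: N_def)
  define G where "G s = N * sqrt N * arctan (s / sqrt N)" for s
  have Gd: "(G has_real_derivative N / (1 + s * s * inverse N)) (at s)" for s
    unfolding G_def[abs_def] using N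
    by (auto intro!: derivative_eq_intros simp: power_divide power2_eq_square field_simps)
  have G0: "G 0 = 0" by (simp add: G_def)
  have sq: "\<bar>mult_sqrt k n x * mult_sqrt k n x\<bar> \<le> N / (1 + x * x * inverse N)" for x
    using mult_sqrt_sq_bound[OF k, of n x] by (simp add: N_def power2_eq_square)
  \<comment> \<open>G - \<eta> and G + \<eta> both increase and vanish at 0, which together give
    |\<eta>| <= |G|.\<close>
  have m1: "mono (\<lambda>s. G s - \<eta> s)"
    by (rule antiderivative_nonneg_sign(2)[where g' = "\<lambda>x. N / (1 + x * x * inverse N) - mult_sqrt k n x * mult_sqrt k n x"])
      (use sq in \<open>auto intro!: DERIV_diff Gd e simp: G0 abs_le_iff\<close>)
  have m2: "mono (\<lambda>s. G s + \<eta> s)"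
    by (rule antiderivative_nonneg_sign(2)[where g' = "\<lambda>x. N / (1 + x * x * inverse N) + mult_sqrt k n x * mult_sqrt k n x"])
      (use sq N in \<open>auto intro!: DERIV_add Gd e simp: G0 e(2) abs_le_iff add_nonneg_nonneg\<close>)
  have GB: "\<bar>G s\<bar> \<le> N * sqrt N * (pi / 2)" for s
  proof -
    have "\<bar>arctan (s / sqrt N)\<bar> \<le> pi / 2" using arctan_bounded[of "s / sqrt N"] by linarith
    then show ?thesis using N by (simp add: G_def abs_mult)
  qed
  have eB: "\<bar>\<eta> s\<bar> \<le> N * sqrt N * (pi / 2)" for s
  proof (cases "s \<ge> 0")
    case True
    then show ?thesis using monoD[OF m1 True] monoD[OF m2 True] e(2) G0 GB[of s] by simp
  next
    case False
    then have "s \<le> 0" by simp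
    then show ?thesis using monoD[OF m1 \<open>s \<le> 0\<close>] monoD[OF m2 \<open>s \<le> 0\<close>] e(2) G0 GB[of s] by simp
  qed
  have eb: "\<bar>\<eta> s\<bar> \<le> (1 + s * s) powr (k / 2) * \<bar>s\<bar>" for s
  proof (rule antiderivative_abs_le[OF e])
    fix t :: real assume t: "\<bar>t\<bar> \<le> \<bar>s\<bar>"
    have "\<bar>mult_sqrt k n t * mult_sqrt k n t\<bar> = (mult_sqrt k n t)\<^sup>2" by (simp add: power2_eq_square)
    also have "\<dots> \<le> (1 + t * t) powr (k / 2)" by (rule mult_sqrt_sq_le[OF k(1)])
    also have "\<dots> \<le> (1 + s * s) powr (k / 2)"
      using k t abs_le_square_iff[of t s] by (intro powr_mono2) (auto simp: power2_eq_square add_pos_nonneg)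
    finally show "\<bar>mult_sqrt k n t * mult_sqrt k n t\<bar> \<le> (1 + s * s) powr (k / 2)" .
  qed
  have es: "s * \<eta> s \<ge> 0" for s by (rule antiderivative_nonneg_sign(1)[OF e]) simp
  show ?thesis by (rule that[OF esm e(2) eB ed eb es])
qed

lemma one_plus_powr_le:
  fixes k r s :: real
  assumes "0 \<le> k" "k \<le> 2"
  shows "(1 + s * s) powr (k / 2) \<le> 1 + s * s"
    "k \<le> r \<Longrightarrow> (1 + s * s) powr (k / 2) \<le> 2 * (1 + \<bar>s\<bar> powr r)"
proof -
  have "(1 + s * s) powr (k / 2) \<le> (1 + s * s) powr 1" using assms by (intro powr_mono) auto
  then show "(1 + s * s) powr (k / 2) \<le> 1 + s * s" using one_plus_pos(1)[of s] by simp
  assume r: "k \<le> r"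
  have t: "(2::real) powr (k / 2) \<le> 2" using powr_mono[of "k/2" 1 2] assms by simp
  show "(1 + s * s) powr (k / 2) \<le> 2 * (1 + \<bar>s\<bar> powr r)"
  proof (cases "\<bar>s\<bar> \<le> 1")
    case True
    then have "s * s \<le> 1" using abs_le_square_iff[of s 1] by (simp add: power2_eq_square)
    then have "(1 + s * s) powr (k / 2) \<le> 2 powr (k / 2)" using assms by (intro powr_mono2) (auto simp: add_nonneg_nonneg)
    moreover have "0 \<le> \<bar>s\<bar> powr r" by simp
    ultimately show ?thesis using t by argo
  next
    case False
    then have "1 \<le> s * s" using abs_le_square_iff[of 1 s] by (simp add: power2_eq_square)
    then have "(1 + s * s) powr (k / 2) \<le> (2 * (\<bar>s\<bar> powr 2)) powr (k / 2)"
      using assms False by (intro powr_mono2) (auto simp: powr_numeral power2_eq_square add_nonneg_nonneg)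
    also have "\<dots> = 2 powr (k / 2) * (\<bar>s\<bar> powr 2) powr (k / 2)" by (rule powr_mult)
    also have "(\<bar>s\<bar> powr 2) powr (k / 2) = \<bar>s\<bar> powr k" by (simp only: powr_powr) simp
    also have "2 powr (k / 2) * \<bar>s\<bar> powr k \<le> 2 * \<bar>s\<bar> powr r" using t False r by (intro mult_mono powr_mono) auto
    finally show ?thesis by simp
  qed
qed

text \<open>For k <= 2 the multiplier grows at most like |s| + |s|^3. Its square thus just reaches
  the sixth power, and its product with 1 + |s| reaches only the fourth.\<close>

lemma multiplier_sq_le:
  fixes k s y :: real
  assumes k: "0 \<le> k" "k \<le> 2" and y: "\<bar>y\<bar> \<le> (1 + s * s) powr (k / 2) * \<bar>s\<bar>"
  shows "y\<^sup>2 \<le> 4 * (1 + s ^ 6)" "(1 + \<bar>s\<bar>) * \<bar>y\<bar> \<le> 4 * (1 + s ^ 6)"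
proof -
  have "\<bar>y\<bar> \<le> (1 + s * s) * \<bar>s\<bar>" using y one_plus_powr_le(1)[OF k, of s] by (meson abs_ge_zero mult_right_mono order_trans)
  also have "\<dots> = \<bar>s\<bar> + \<bar>s\<bar> ^ 3" by (simp add: algebra_simps power3_eq_cube abs_mult[symmetric])
  finally have y1: "\<bar>y\<bar> \<le> \<bar>s\<bar> + \<bar>s\<bar> ^ 3" .
  have "\<bar>y\<bar>\<^sup>2 \<le> (\<bar>s\<bar> + \<bar>s\<bar> ^ 3)\<^sup>2" using y1 by (intro power_mono) auto
  also have "\<dots> \<le> 2 * (\<bar>s\<bar> ^ 2 + \<bar>s\<bar> ^ 6)"
    using zero_le_power2[of "\<bar>s\<bar> - \<bar>s\<bar> ^ 3"] by (simp add: power2_sum power2_diff power_mult[symmetric])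
  also have "\<dots> \<le> 2 * ((1 + s ^ 6) + (1 + s ^ 6))"
    using power_le_one_plus_power6[of 2 s] power_le_one_plus_power6[of 6 s] by (intro mult_left_mono add_mono) auto
  finally show "y\<^sup>2 \<le> 4 * (1 + s ^ 6)" by simp
  have "(1 + \<bar>s\<bar>) * \<bar>y\<bar> \<le> (1 + \<bar>s\<bar>) * (\<bar>s\<bar> + \<bar>s\<bar> ^ 3)" using y1 by (intro mult_left_mono) auto
  also have "\<dots> = \<bar>s\<bar> ^ 1 + \<bar>s\<bar> ^ 2 + \<bar>s\<bar> ^ 3 + \<bar>s\<bar> ^ 4" by (simp add: algebra_simps power_numeral_reduce)
  also have "\<dots> \<le> (1 + s ^ 6) + (1 + s ^ 6) + (1 + s ^ 6) + (1 + s ^ 6)"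
    by (intro add_mono power_le_one_plus_power6) auto
  finally show "(1 + \<bar>s\<bar>) * \<bar>y\<bar> \<le> 4 * (1 + s ^ 6)" by simp
qed

text \<open>The integrand \<sigma> \<eta> grows like |s|^(m + k + 1), so the primitive has exponent
  m + k + 2 <= 6. The factor 8 comes from four monomials and the factor 2 in
  \<open>one_plus_powr_le\<close>.\<close>

lemma damping_primitive_bound:
  assumes k: "0 \<le> k" "k \<le> 2" and m: "0 \<le> m" "m + k \<le> 4" and S: "S \<ge> 0" "\<And>s. \<bar>\<sigma> s\<bar> \<le> S * (1 + \<bar>s\<bar> powr m)"
    and y: "\<And>s. \<bar>\<eta> s\<bar> \<le> (1 + s * s) powr (k / 2) * \<bar>s\<bar>"
    and G: "\<And>s. (G has_real_derivative \<sigma> s * \<eta> s) (at s)" "G 0 = 0"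
  shows "\<bar>G s\<bar> \<le> 8 * S * (1 + s ^ 6)"
proof -
  have "\<bar>G s\<bar> \<le> (S * (1 + \<bar>s\<bar> powr m) * ((1 + s * s) powr (k / 2) * \<bar>s\<bar>)) * \<bar>s\<bar>"
  proof (rule antiderivative_abs_le[OF G])
    fix t :: real assume t: "\<bar>t\<bar> \<le> \<bar>s\<bar>"
    have "\<bar>\<sigma> t\<bar> * \<bar>\<eta> t\<bar> \<le> (S * (1 + \<bar>t\<bar> powr m)) * ((1 + t * t) powr (k / 2) * \<bar>t\<bar>)"
      using S y by (intro mult_mono) auto
    also have "\<dots> \<le> (S * (1 + \<bar>s\<bar> powr m)) * ((1 + s * s) powr (k / 2) * \<bar>s\<bar>)"
    proof -
      have p1: "\<bar>t\<bar> powr m \<le> \<bar>s\<bar> powr m" using t m by (intro powr_mono2) auto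
      have "t * t \<le> s * s" using abs_le_square_iff[of t s] t by (simp add: power2_eq_square)
      then have p2: "(1 + t * t) powr (k / 2) \<le> (1 + s * s) powr (k / 2)"
        using k by (intro powr_mono2) (auto simp: add_nonneg_nonneg)
      show ?thesis
        by (intro mult_mono) (use S p1 p2 t in \<open>auto intro!: mult_nonneg_nonneg add_nonneg_nonneg\<close>)
    qed
    finally show "\<bar>\<sigma> t * \<eta> t\<bar> \<le> S * (1 + \<bar>s\<bar> powr m) * ((1 + s * s) powr (k / 2) * \<bar>s\<bar>)" by (simp add: abs_mult)
  qed
  also have "\<dots> = S * ((1 + \<bar>s\<bar> powr m) * (1 + s * s) powr (k / 2) * (\<bar>s\<bar> * \<bar>s\<bar>))" by (simp add: algebra_simps)
  also have "\<dots> \<le> S * (8 * (1 + s ^ 6))"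
  proof (intro mult_left_mono)
    have t: "(1 + s * s) powr (k / 2) \<le> 2 * (1 + \<bar>s\<bar> powr k)" by (rule one_plus_powr_le(2)[OF k]) simp
    have "(1 + \<bar>s\<bar> powr m) * (1 + s * s) powr (k / 2) * (\<bar>s\<bar> * \<bar>s\<bar>) \<le> (1 + \<bar>s\<bar> powr m) * (2 * (1 + \<bar>s\<bar> powr k)) * (\<bar>s\<bar> * \<bar>s\<bar>)"
      using t by (intro mult_right_mono mult_left_mono) auto
    also have "\<dots> = 2 * (\<bar>s\<bar> powr 2 + \<bar>s\<bar> powr (k + 2) + \<bar>s\<bar> powr (m + 2) + \<bar>s\<bar> powr (m + k + 2))"
      by (cases "s = 0") (auto simp: powr_add powr_numeral power2_eq_square algebra_simps)
    also have "\<dots> \<le> 2 * ((1 + s ^ 6) + (1 + s ^ 6) + (1 + s ^ 6) + (1 + s ^ 6))"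
      using k m by (intro mult_left_mono add_mono powr_le_one_plus_power6) auto
    finally show "(1 + \<bar>s\<bar> powr m) * (1 + s * s) powr (k / 2) * (\<bar>s\<bar> * \<bar>s\<bar>) \<le> 8 * (1 + s ^ 6)" by simp
  qed (use S in auto)
  finally show ?thesis by (simp only: mult_ac)
qed

text \<open>The squared derivative of H is that of the multiplier \<eta>, so applying Sobolev to
  H(u) produces the weighted gradient of the energy estimate. The lower bound on H recovers the
  power of u in the limit.\<close>

lemma ex_sobolev_multiplier:
  assumes k: "0 \<le> k" "k \<le> 2"
  obtains H where "smooth H" "H 0 = 0" "\<And>s. deriv H s = mult_sqrt k n s"
    "\<And>s. \<bar>s\<bar> powr (k / 2 + 1) / (2 * (1 + s * s * inverse (real (Suc n)))) \<le> \<bar>H s\<bar>"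
proof -
  obtain H where H: "\<And>x. (H has_real_derivative mult_sqrt k n x) (at x)" "H 0 = 0"
    using ex_antiderivative[OF smooth_imp_continuous[OF smooth_mult_sqrt]] by metis
  define q where "q s = 1 + s * s * inverse (real (Suc n))" for s
  have q: "q s > 0" for s unfolding q_def by (rule one_plus_pos)
  have key: "s powr (k / 2 + 1) / (2 * q s) \<le> g s"
    if g: "\<And>x. (g has_real_derivative mult_sqrt k n x) (at x)" "g 0 = 0" and s: "s > 0" for g s
  proof -
    \<comment> \<open>On (0, s) the truncating factor is at least its value 1/q(s) at the right end,
      so H' dominates the derivative of c x^(k/2 + 1). The 2 in the claim bounds k/2 + 1.\<close>
    define c where "c = 1 / ((k / 2 + 1) * q s)"
    have c: "c > 0" using q[of s] k by (simp add: c_def)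
    have "g 0 - c * 0 powr (k / 2 + 1) \<le> g s - c * s powr (k / 2 + 1)"
    proof (rule DERIV_nonneg_imp_increasing_open[OF less_imp_le[OF s]])
      fix x assume x: "0 < x" "x < s"
      have p: "((\<lambda>s. c * s powr (k / 2 + 1)) has_real_derivative c * ((k / 2 + 1) * x powr (k / 2))) (at x)"
        using x by (auto intro!: derivative_eq_intros simp: powr_add field_simps)
      have "x powr (k / 2) = (x * x) powr (k / 4)" using x by (simp add: powr_mult powr_add[symmetric])
      also have "\<dots> \<le> (1 + x * x) powr (k / 4)" using k by (intro powr_mono2) auto
      finally have 1: "x powr (k / 2) \<le> (1 + x * x) powr (k / 4)" .
      have "x * x \<le> s * s" using x by (intro mult_mono) auto
      then have "q x \<le> q s" unfolding q_def by (intro add_left_mono mult_right_mono) auto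
      then have "1 / q s \<le> 1 / q x" using q by (intro divide_left_mono) auto
      then have "c * ((k / 2 + 1) * x powr (k / 2)) \<le> mult_sqrt k n x"
      proof -
        have "k / 2 + 1 \<noteq> 0" using k by linarith
        then have "c * ((k / 2 + 1) * x powr (k / 2)) = x powr (k / 2) * (1 / q s)" by (simp add: c_def)
        also have "\<dots> \<le> (1 + x * x) powr (k / 4) * (1 / q x)"
          by (rule mult_mono[OF 1 \<open>1 / q s \<le> 1 / q x\<close>]) (use q[of s] in auto)
        also have "\<dots> = mult_sqrt k n x"
          unfolding mult_sqrt_def q_def[symmetric] using q[of x] by (simp add: powr_neg_one)
        finally show ?thesis .
      qed
      then show "\<exists>y. ((\<lambda>s. g s - c * s powr (k / 2 + 1)) has_real_derivative y) (at x) \<and> 0 \<le> y"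
        using DERIV_diff[OF g(1) p] by (intro exI conjI) auto
    next
      have "continuous_on UNIV g" using DERIV_isCont[OF g(1)] continuous_at_imp_continuous_on by blast
      then show "continuous_on {0..s} (\<lambda>s. g s - c * s powr (k / 2 + 1))"
      proof -
        assume gc: "continuous_on UNIV g"
        have pc: "continuous_on {0..s} (\<lambda>x. x powr (k / 2 + 1))"
          by (rule continuous_on_powr'[OF continuous_on_id continuous_on_const]) (use k in auto)
        show ?thesis
          by (rule continuous_on_diff[OF continuous_on_subset[OF gc] continuous_on_mult[OF continuous_on_const pc]]) auto
      qed
    qed
    then have "c * s powr (k / 2 + 1) \<le> g s" using g(2) by simp
    moreover have "s powr (k / 2 + 1) / (2 * q s) \<le> c * s powr (k / 2 + 1)"
    proof -
      have "1 / (2 * q s) \<le> c" unfolding c_def using k q[of s] by (intro divide_left_mono mult_right_mono) auto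
      from mult_right_mono[OF this, of "s powr (k / 2 + 1)"] show ?thesis by simp
    qed
    ultimately show ?thesis by linarith
  qed
  have lower: "\<bar>s\<bar> powr (k / 2 + 1) / (2 * q s) \<le> \<bar>H s\<bar>" for s
  proof -
    consider "s > 0" | "s = 0" | "s < 0" by linarith
    then show ?thesis
    proof cases
      case 1
      then show ?thesis using key[OF H 1] by simp
    next
      case 2
      then show ?thesis using k by simp
    next
      case 3
      have d: "((\<lambda>x. - H (- x)) has_real_derivative mult_sqrt k n x) (at x)" for x
      proof -
        have "((\<lambda>x. H (- x)) has_real_derivative mult_sqrt k n (- x) * - 1) (at x)"
          by (rule DERIV_chain2[where f = H and g = uminus, OF H(1)]) (auto intro!: derivative_eq_intros)
        from DERIV_minus[OF this] show ?thesis by (simp add: mult_sqrt_def)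
      qed
      have "(- s) powr (k / 2 + 1) / (2 * q (- s)) \<le> - H (- (- s))"
        by (rule key[of "\<lambda>x. - H (- x)", OF d]) (use H 3 in auto)
      then show ?thesis using 3 by (simp add: q_def)
    qed
  qed
  have "deriv H s = mult_sqrt k n s" for s by (rule DERIV_imp_deriv[OF H(1)])
  then show ?thesis
    by (rule that[OF smooth_antiderivative[OF H(1) smooth_mult_sqrt] H(2) _ lower[unfolded q_def]])
qed

section \<open>The a priori estimate\<close>

text \<open>\<theta> is the product of an increasing and a decreasing function with values in
  [0, 1], so its total variation is at most 2 whatever the steepness c. This makes the later
  estimate independent of how sharp the cut-off is.\<close>

lemma expbump_cutoff:
  assumes c: "c > 0" and ab: "0 < a" "a < T - a"
  defines "\<theta> \<equiv> bump c a (T - a)"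
  shows "test_fun {0<..<T} \<theta>" "\<And>t. 0 \<le> \<theta> t" "\<And>t. \<theta> t \<le> 1" "\<And>t. t \<notin> {a..T-a} \<Longrightarrow> \<theta> t = 0"
    "integrable lborel (\<lambda>t. \<bar>deriv \<theta> t\<bar>)" "(LINT t|lborel. \<bar>deriv \<theta> t\<bar>) \<le> 2"
proof -
  show tf: "test_fun {0<..<T} \<theta>" unfolding \<theta>_def by (rule test_fun_bump[OF c]) (use ab in auto)
  show "0 \<le> \<theta> t" "\<theta> t \<le> 1" for t unfolding \<theta>_def by (rule bump_nonneg, rule bump_le_1)
  show z: "\<theta> t = 0" if "t \<notin> {a..T-a}" for t unfolding \<theta>_def using that by (intro bump_zero[OF c]) auto
  define p where "p t = c * expbump 2 (c * (t - a))" for t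
  define q where "q t = c * expbump 2 (c * (T - a - t))" for t
  have dp: "((\<lambda>t. expbump 0 (c * (t - a))) has_real_derivative p t) (at t)" for t
  proof -
    have "((\<lambda>t. expbump 0 (c * (t - a))) has_real_derivative (expbump (0 + 2) (c * (t - a)) - real 0 * expbump (0 + 1) (c * (t - a))) * c) (at t)"
      by (rule DERIV_chain2[where f = "expbump 0", OF expbump_deriv]) (auto intro!: derivative_eq_intros)
    then show ?thesis unfolding p_def by (rule DERIV_cong) (unfold add_0 of_nat_0 mult_zero_left diff_zero, simp)
  qed
  have dq: "((\<lambda>t. expbump 0 (c * (T - a - t))) has_real_derivative - q t) (at t)" for t
  proof -
    have "((\<lambda>t. expbump 0 (c * (T - a - t))) has_real_derivative (expbump (0 + 2) (c * (T - a - t)) - real 0 * expbump (0 + 1) (c * (T - a - t))) * (- c)) (at t)"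
      by (rule DERIV_chain2[where f = "expbump 0", OF expbump_deriv]) (auto intro!: derivative_eq_intros)
    then show ?thesis unfolding q_def by (rule DERIV_cong) (unfold add_0 of_nat_0 mult_zero_left diff_zero, simp)
  qed
  have d: "deriv \<theta> t = p t * expbump 0 (c * (T - a - t)) + (- q t) * expbump 0 (c * (t - a))" for t
    unfolding \<theta>_def bump_def by (rule DERIV_imp_deriv[OF DERIV_mult[OF dp dq]])
  have pq: "0 \<le> p t" "0 \<le> q t" for t using c expbump_nonneg by (auto simp: p_def q_def)
  have le: "\<bar>deriv \<theta> t\<bar> \<le> p t + q t" for t
  proof -
    have "p t * expbump 0 (c * (T - a - t)) \<le> p t * 1" "q t * expbump 0 (c * (t - a)) \<le> q t * 1"
      using pq expbump_le_1 by (intro mult_left_mono; simp)+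
    moreover have "0 \<le> p t * expbump 0 (c * (T - a - t))" "0 \<le> q t * expbump 0 (c * (t - a))"
      using pq expbump_nonneg by simp_all
    ultimately show ?thesis unfolding d by simp
  qed
  have d0: "deriv \<theta> t = 0" if "t \<notin> {a..T-a}" for t
    unfolding d using that c by (auto simp: p_def q_def expbump_def zero_less_mult_iff)
  have ec: "continuous_on UNIV (expbump j)" for j by (rule smooth_imp_continuous[OF smooth_expbump])
  have pc: "continuous_on {a..T-a} p" "continuous_on {a..T-a} q"
    unfolding p_def q_def by (intro continuous_intros continuous_on_compose2[OF ec]; simp)+
  have ip: "integrable lborel (\<lambda>t. indicator {a..T-a} t *\<^sub>R p t)" "integrable lborel (\<lambda>t. indicator {a..T-a} t *\<^sub>R q t)"
    using borel_integrable_atLeastAtMost'[OF pc(1)] borel_integrable_atLeastAtMost'[OF pc(2)] by (auto simp: set_integrable_def)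
  have vp: "(LINT t|lborel. indicator {a..T-a} t *\<^sub>R p t) = expbump 0 (c * (T - a - a)) - expbump 0 (c * (a - a))"
    by (rule integral_FTC_Icc) (use ab pc dp in \<open>auto simp: has_real_derivative_iff_has_vector_derivative intro: has_vector_derivative_at_within\<close>)
  have vq: "(LINT t|lborel. indicator {a..T-a} t *\<^sub>R - q t) = expbump 0 (c * (T - a - (T - a))) - expbump 0 (c * (T - a - a))"
    by (rule integral_FTC_Icc) (use ab pc dq in \<open>auto simp: has_real_derivative_iff_has_vector_derivative intro: has_vector_derivative_at_within continuous_on_minus\<close>)
  have dc: "continuous_on UNIV (deriv \<theta>)"
    by (rule smooth_imp_continuous[OF smooth_real_deriv(2)[OF test_fun_imp_smooth[OF tf]]])
  have dm [measurable]: "deriv \<theta> \<in> borel_measurable borel" by (rule borel_measurable_continuous_onI[OF dc])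
  have le': "\<bar>deriv \<theta> t\<bar> \<le> indicator {a..T-a} t *\<^sub>R p t + indicator {a..T-a} t *\<^sub>R q t" for t
    using le[of t] d0[of t] by (auto simp: indicator_def)
  show i: "integrable lborel (\<lambda>t. \<bar>deriv \<theta> t\<bar>)"
    by (rule Bochner_Integration.integrable_bound[OF Bochner_Integration.integrable_add[OF ip]])
      (use le' in \<open>auto intro!: AE_I2 order_trans[OF le']\<close>)
  have "(LINT t|lborel. \<bar>deriv \<theta> t\<bar>) \<le> (LINT t|lborel. indicator {a..T-a} t *\<^sub>R p t + indicator {a..T-a} t *\<^sub>R q t)"
    by (rule integral_mono[OF i Bochner_Integration.integrable_add[OF ip] le'])
  also have "\<dots> = (LINT t|lborel. indicator {a..T-a} t *\<^sub>R p t) + (LINT t|lborel. indicator {a..T-a} t *\<^sub>R q t)"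
    by (rule Bochner_Integration.integral_add[OF ip])
  also have "(LINT t|lborel. indicator {a..T-a} t *\<^sub>R q t) = - (LINT t|lborel. indicator {a..T-a} t *\<^sub>R - q t)"
    by simp
  finally show "(LINT t|lborel. \<bar>deriv \<theta> t\<bar>) \<le> 2"
    unfolding vp vq using expbump_le_1[of "c * (T - a - a)"] expbump_nonneg[of 0 0] by (simp add: expbump_def)
qed

text \<open>The steepness grows faster than the inverse of the cut-off width, so the cut-off tends to 1 inside.\<close>

lemma cutoff_tendsto:
  assumes T: "T > 0" and t: "t \<in> {0<..<T}"
  shows "(\<lambda>n. bump ((real n + 4)\<^sup>2) (T / (real n + 4)) (T - T / (real n + 4)) t) \<longlonglongrightarrow> 1"
proof -
  have *: "(\<lambda>n. expbump 0 ((real n + 4)\<^sup>2 * (d - T / (real n + 4)))) \<longlonglongrightarrow> 1" if d: "d > 0" for d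
  proof -
    have lim: "filterlim (\<lambda>n. (real n + 4)\<^sup>2 * (d - T / (real n + 4))) at_top sequentially"
      using d T by real_asymp
    then have "(\<lambda>n. exp (- inverse ((real n + 4)\<^sup>2 * (d - T / (real n + 4))))) \<longlonglongrightarrow> exp (- 0)"
      by (intro tendsto_exp tendsto_minus tendsto_inverse_0_at_top)
    moreover have "\<forall>\<^sub>F n in sequentially. exp (- inverse ((real n + 4)\<^sup>2 * (d - T / (real n + 4)))) = expbump 0 ((real n + 4)\<^sup>2 * (d - T / (real n + 4)))"
      using filterlim_at_top_dense[THEN iffD1, rule_format, OF lim, of 0]
      by eventually_elim (simp add: expbump_def inverse_eq_divide)
    ultimately show ?thesis using Lim_transform_eventually by fastforce
  qed
  have "(\<lambda>n. expbump 0 ((real n + 4)\<^sup>2 * (t - T / (real n + 4))) * expbump 0 ((real n + 4)\<^sup>2 * ((T - t) - T / (real n + 4)))) \<longlonglongrightarrow> 1 * 1"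
    using t by (intro tendsto_mult *) auto
  then show ?thesis by (simp add: bump_def algebra_simps)
qed

section \<open>The estimate for one fixed multiplier and cut-off\<close>

context damped_wave_test
begin

text \<open>With G' = \<sigma> \<eta> this converts the damping term into \<theta>' G(u), which the
  sixth moment of u controls without any norm of u_t.\<close>

lemma chain_total:
  assumes G: "\<And>s. (G has_real_derivative g s) (at s)" "continuous_on UNIV g"
    and i1: "integrable M (\<lambda>z. deriv \<theta> (fst z) * G (U z))" and i2: "integrable M (\<lambda>z. \<theta> (fst z) * (g (U z) * V z))"
  shows "(LINT z|M. deriv \<theta> (fst z) * G (U z)) = - (LINT z|M. \<theta> (fst z) * (g (U z) * V z))"
proof -
  have Gc: "continuous_on UNIV G" using DERIV_isCont[OF G(1)] continuous_at_imp_continuous_on by blast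
  have [measurable]: "G \<in> borel_measurable borel" "g \<in> borel_measurable borel"
    using Gc G(2) by (auto intro: borel_measurable_continuous_onI)
  have "(LINT z|M. deriv \<theta> (fst z) * G (U z)) = (LINT x|lborel. LINT t|lborel. deriv \<theta> t * G (U (t, x)))"
    using integrable_section(3)[OF i1] by simp
  also have "\<dots> = (LINT x|lborel. - (LINT t|lborel. \<theta> t * (g (U (t, x)) * V (t, x))))"
  proof (rule integral_cong_AE)
    show "(\<lambda>x. LINT t|lborel. deriv \<theta> t * G (U (t, x))) \<in> borel_measurable lborel"
      using integrable_section(2)[OF i1] by auto
    show "(\<lambda>x. - (LINT t|lborel. \<theta> t * (g (U (t, x)) * V (t, x)))) \<in> borel_measurable lborel"
      using integrable_section(2)[OF i2] by auto
    show "AE x in lborel. (LINT t|lborel. deriv \<theta> t * G (U (t, x))) = - (LINT t|lborel. \<theta> t * (g (U (t, x)) * V (t, x)))"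
      using AE_good
    proof eventually_elim
      case (elim x)
      obtain A where A: "AE t in lborel. t \<in> {0<..<T} \<longrightarrow> U (t, x) = A + Z (t, x)" and V: "integrable lborel (\<lambda>t. V (t, x))"
        using elim by (auto simp: good_def)
      let ?U = "\<lambda>s. A + (LINT r|lborel. indicator {..s} r * V (r, x))"
      have UA: "?U s = A + Z (s, x)" for s by (simp add: Z_def)
      have m [measurable]: "?U \<in> borel_measurable borel" unfolding UA by measurable
      have "(LINT t|lborel. deriv \<theta> t * G (?U t)) = - (LINT t|lborel. \<theta> t * (g (?U t) * V (t, x)))"
        by (rule indef_chain_rule(3)[where a = a and b = "T - a", OF V G \<theta>_deriv(1,2) a(2)])
      moreover have e1: "AE t in lborel. deriv \<theta> t * G (U (t, x)) = deriv \<theta> t * G (?U t)"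
        and e2: "AE t in lborel. \<theta> t * (g (U (t, x)) * V (t, x)) = \<theta> t * (g (?U t) * V (t, x))"
        using A by (eventually_elim, use \<theta>_outside in \<open>force simp: UA\<close>)+
      moreover have "(LINT t|lborel. deriv \<theta> t * G (U (t, x))) = (LINT t|lborel. deriv \<theta> t * G (?U t))"
        by (rule integral_cong_AE) (use e1 in auto)
      moreover have "(LINT t|lborel. \<theta> t * (g (U (t, x)) * V (t, x))) = (LINT t|lborel. \<theta> t * (g (?U t) * V (t, x)))"
        by (rule integral_cong_AE) (use e2 in auto)
      ultimately show ?case by simp
    qed
  qed
  also have "\<dots> = - (LINT z|M. \<theta> (fst z) * (g (U z) * V z))"
    using integrable_section(3)[OF i2] by simp
  finally show ?thesis .
qed

text \<open>The energy identity bounds the weighted gradient by three groups of terms. Those with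
  \<theta>' use slice bounds and the total variation of \<theta>, the kinetic term uses the total
  dissipation, and the source uses the slice bounds integrated over time. None of B, L, C, a enters
  the result.\<close>

lemma a_priori_estimate:
  fixes \<sigma> f :: "real \<Rightarrow> real" and \<phi> :: "real^3 \<Rightarrow> real" and G :: "real \<Rightarrow> real"
  assumes E_eq: "\<And>z. E z = indicator (cyl T \<Omega>) z * (\<sigma> (U z) * V z + f (U z) - \<phi> (snd z))"
    and sig: "continuous_on UNIV \<sigma>" "\<And>s. \<sigma> s \<ge> 0" "\<And>s. 0 \<le> deriv \<eta> s" "\<And>s. deriv \<eta> s \<le> c0 * \<sigma> s" "c0 \<ge> 0"
    and sigS: "\<And>s. \<sigma> s \<le> S * (1 + s ^ 6)"
    and eta: "\<And>s. (\<eta> s)\<^sup>2 \<le> 4 * (1 + s ^ 6)" "\<And>s. (1 + \<bar>s\<bar>) * \<bar>\<eta> s\<bar> \<le> 4 * (1 + s ^ 6)" "\<And>s. s * \<eta> s \<ge> 0"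
    and f: "continuous_on UNIV f" "F \<ge> 0" "\<And>s y. s * y \<ge> 0 \<Longrightarrow> - f s * y \<le> F * (1 + \<bar>s\<bar>) * \<bar>y\<bar>"
    and G: "\<And>s. (G has_real_derivative \<sigma> s * \<eta> s) (at s)" "G 0 = 0" "KG \<ge> 0" "\<And>s. \<bar>G s\<bar> \<le> KG * (1 + s ^ 6)"
    and i: "integrable M (\<lambda>z. \<sigma> (U z) * (V z)\<^sup>2)" "integrable M (\<lambda>z. U z ^ 6)" "integrable lborel (\<lambda>x. (indicator \<Omega> x * \<phi> x)\<^sup>2)"
      "emeasure lborel \<Omega> < \<infinity>" "\<phi> \<in> borel_measurable borel"
    and th: "\<And>t. 0 \<le> \<theta> t" "\<And>t. \<theta> t \<le> 1" "integrable lborel (\<lambda>t. \<bar>deriv \<theta> t\<bar>)" "(LINT t|lborel. \<bar>deriv \<theta> t\<bar>) \<le> 2"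
    and R: "R \<ge> 1" "(LINT z|M. \<sigma> (U z) * (V z)\<^sup>2) \<le> R"
      "AE t in lborel. t \<in> {0<..<T} \<longrightarrow> (LINT x|lborel. U (t, x) ^ 6) \<le> R ^ 6"
      "AE t in lborel. t \<in> {0<..<T} \<longrightarrow> (LINT x|lborel. (V (t, x))\<^sup>2) \<le> R ^ 2"
  defines "K \<equiv> 8 + KG + 4 * F" and "vol \<equiv> measure lborel \<Omega>" and "\<phi>2 \<equiv> (LINT x|lborel. (indicator \<Omega> x * \<phi> x)\<^sup>2)"
  shows "(LINT z|M. W z \<bullet> Y z) \<le> (2 * (1 + K * (vol + 1)) + c0 + \<phi>2 + K * (vol + 1)) * (R ^ 6 * (1 + T))"
proof -
  let ?c = "\<lambda>z. indicator (cyl T \<Omega>) z :: real"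
  have K: "K \<ge> 8" using G(3) f(2) by (simp add: K_def)
  have vol: "vol \<ge> 0" "\<phi>2 \<ge> 0" by (simp_all add: vol_def \<phi>2_def)
  have Gc: "continuous_on UNIV G" using DERIV_isCont[OF G(1)] continuous_at_imp_continuous_on by blast
  have [measurable]: "G \<in> borel_measurable borel" "\<sigma> \<in> borel_measurable borel" "f \<in> borel_measurable borel" "\<phi> \<in> borel_measurable borel"
    using Gc sig(1) f(1) i(5) by (auto intro: borel_measurable_continuous_onI)
  have [measurable]: "\<Omega> \<in> sets borel" using Om by simp
  have cI: "?c z = I (fst z) * indicator \<Omega> (snd z)" for z by (cases z) (auto simp: cyl_def I_def indicator_def)
  have [measurable]: "(\<lambda>z. ?c z) \<in> borel_measurable (borel \<Otimes>\<^sub>M borel)" unfolding cI by measurable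
  have c01: "?c z = 0 \<or> ?c z = 1" for z by (auto simp: indicator_def)
  have out: "U z = 0 \<and> V z = 0" if "?c z = 0" for z using zero(1,2)[of z] that by (auto simp: indicator_def split: if_splits)
  have iO: "integrable lborel (indicator \<Omega> :: real^3 \<Rightarrow> real)" using i(4) by (intro integrable_real_indicator) auto
  have ic: "integrable M ?c" unfolding cI by (rule lborel_pair.integrable_prod_mult[OF I_integrable(1) iO])
  have i\<phi>: "integrable M (\<lambda>z. ?c z * (\<phi> (snd z))\<^sup>2)"
  proof -
    have "?c z * (\<phi> (snd z))\<^sup>2 = I (fst z) * (indicator \<Omega> (snd z) * \<phi> (snd z))\<^sup>2" for z
      by (cases "snd z \<in> \<Omega>") (simp_all add: cI power_mult_distrib)
    then show ?thesis using lborel_pair.integrable_prod_mult[OF I_integrable(1) i(3)] by simp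
  qed
  define q where "q z = ?c z * (1 + U z ^ 6)" for z
  have iq: "integrable M q"
  proof -
    have "q z = ?c z + U z ^ 6" for z using c01[of z] out[of z] by (auto simp: q_def)
    then have "q = (\<lambda>z. ?c z + U z ^ 6)" by auto
    then show ?thesis using ic i(2) by simp
  qed
  have q0: "q z \<ge> 0" for z by (simp add: q_def)
  have qm [measurable]: "q \<in> borel_measurable (borel \<Otimes>\<^sub>M borel)" unfolding q_def by measurable
  \<comment> \<open>This density dominates all coefficients of \<theta>': the kinetic product
    \<eta>(u) u_t by Young's inequality, and the damping primitive G(u).\<close>
  define D where "D z = (V z)\<^sup>2 + K * q z" for z
  have iD: "integrable M D" unfolding D_def using int(5) iq by auto
  have i\<theta>D: "integrable M (\<lambda>z. D z * \<bar>deriv \<theta> (fst z)\<bar>)"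
    by (rule integrable_mult_bounded[OF iD, where B = C]) (use \<theta>(3) in auto)
  have eq2: "(\<eta> (U z))\<^sup>2 \<le> 4 * q z" for z
    using eta(1)[of "U z"] c01[of z] out[of z] \<eta>(2) by (auto simp: q_def)
  have Gq: "\<bar>G (U z)\<bar> \<le> KG * q z" for z
    using G(4)[of "U z"] c01[of z] out[of z] G(2) by (auto simp: q_def)
  have iG: "integrable M (\<lambda>z. deriv \<theta> (fst z) * G (U z))"
  proof -
    have "integrable M (\<lambda>z. G (U z))"
      by (rule Bochner_Integration.integrable_bound[OF integrable_mult_right[OF iq, of KG]])
        (use Gq in \<open>auto intro!: AE_I2 order_trans[OF Gq]\<close>)
    then have "integrable M (\<lambda>z. G (U z) * deriv \<theta> (fst z))"
      by (rule integrable_mult_bounded[where B = C]) (use \<theta>(3) in auto)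
    then show ?thesis by (simp add: mult.commute)
  qed
  define r where "r z = ?c z * (\<theta> (fst z) * (\<eta> (U z) * (f (U z) - \<phi> (snd z))))" for z
  have EQ: "E z * Q z = \<theta> (fst z) * ((\<sigma> (U z) * \<eta> (U z)) * V z) + r z" for z
    using c01[of z] out[of z] \<eta>(2) by (auto simp: E_eq Q_def v_def r_def algebra_simps)
  define s where "s z = \<theta> (fst z) * ((\<sigma> (U z) * \<eta> (U z)) * V z)" for z
  have sm [measurable]: "s \<in> borel_measurable (borel \<Otimes>\<^sub>M borel)" unfolding s_def by measurable
  have isi: "integrable M s"
  proof -
    have b: "\<bar>s z\<bar> \<le> B * (\<sigma> (U z) * (V z)\<^sup>2) + B * (S * q z)" for z
    proof -
      \<comment> \<open>The damping pairing is integrable only because |V| <= V^2 + 1 on the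
        cylinder; the leftover \<sigma>(u) is paid for by the sixth moment.\<close>
      have V1: "\<bar>V z\<bar> \<le> (V z)\<^sup>2 + ?c z"
      proof (cases "?c z = 0")
        case False
        then have "?c z = 1" using c01[of z] by auto
        moreover have "0 \<le> (\<bar>V z\<bar> - 1/2)\<^sup>2" by simp
        ultimately show ?thesis by (simp add: power2_eq_square algebra_simps)
      qed (use out[of z] in simp)
      have c\<sigma>: "?c z * \<sigma> (U z) \<le> S * q z" using sigS[of "U z"] c01[of z] by (auto simp: q_def)
      have "\<bar>s z\<bar> = \<theta> (fst z) * (\<bar>\<eta> (U z)\<bar> * (\<sigma> (U z) * \<bar>V z\<bar>))"
        using th(1) sig(2) by (simp add: s_def abs_mult)
      also have "\<dots> \<le> 1 * (B * (\<sigma> (U z) * ((V z)\<^sup>2 + ?c z)))"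
        using \<eta>(3)[of "U z"] sig(2)[of "U z"] BLC V1 th(1,2)
        by (intro mult_mono mult_left_mono) (auto intro!: mult_nonneg_nonneg)
      also have "\<dots> = B * (\<sigma> (U z) * (V z)\<^sup>2) + B * (?c z * \<sigma> (U z))" by (simp add: algebra_simps)
      also have "\<dots> \<le> B * (\<sigma> (U z) * (V z)\<^sup>2) + B * (S * q z)"
        using c\<sigma> BLC by (intro add_left_mono mult_left_mono) auto
      finally show ?thesis .
    qed
    have "integrable M (\<lambda>z. B * (\<sigma> (U z) * (V z)\<^sup>2) + B * (S * q z))" using i(1) iq by auto
    then show ?thesis
      by (rule Bochner_Integration.integrable_bound) (use b in \<open>auto intro!: AE_I2 order_trans[OF b]\<close>)
  qed
  have ir: "integrable M r"
  proof -
    have "r = (\<lambda>z. E z * Q z - s z)" using EQ by (auto simp: s_def)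
    then show ?thesis using EVW_integrable(1) isi by simp
  qed
  have "(LINT z|M. E z * Q z) = (LINT z|M. s z) + (LINT z|M. r z)"
    unfolding EQ s_def[symmetric] using isi ir by simp
  moreover have "(LINT z|M. deriv \<theta> (fst z) * G (U z)) = - (LINT z|M. s z)"
    unfolding s_def
  proof (rule chain_total[OF G(1) _ iG])
    show "continuous_on UNIV (\<lambda>s. \<sigma> s * \<eta> s)" using sig(1) \<eta>_deriv(3) by (rule continuous_on_mult)
    show "integrable M (\<lambda>z. \<theta> (fst z) * (\<sigma> (U z) * \<eta> (U z) * V z))" using isi by (simp add: s_def[abs_def])
  qed
  ultimately have WY: "(LINT z|M. W z \<bullet> Y z) = (LINT z|M. V z * P z - r z + deriv \<theta> (fst z) * G (U z))"
    using energy_identity EVW_integrable(2) ir iG by simp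
  \<comment> \<open>\<open>K\<close> has to serve two groups at once: 8 covers the squares of \<eta>
    from both uses of Young's inequality, KG the primitive G, and 4 F the lower bound on f.\<close>
  have pw: "V z * P z - r z + deriv \<theta> (fst z) * G (U z)
      \<le> D z * \<bar>deriv \<theta> (fst z)\<bar> + c0 * (\<sigma> (U z) * (V z)\<^sup>2) + (?c z * (\<phi> (snd z))\<^sup>2 + K * q z)" for z
  proof -
    have 1: "deriv \<theta> (fst z) * \<eta> (U z) * V z + deriv \<theta> (fst z) * G (U z) \<le> D z * \<bar>deriv \<theta> (fst z)\<bar>"
    proof -
      have "2 * \<bar>\<eta> (U z) * V z\<bar> \<le> (\<eta> (U z))\<^sup>2 + (V z)\<^sup>2"
        using sum_squares_bound[of "\<bar>\<eta> (U z)\<bar>" "\<bar>V z\<bar>"] by (simp add: abs_mult)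
      then have e: "\<bar>\<eta> (U z) * V z\<bar> \<le> 4 * q z + (V z)\<^sup>2" using eq2[of z] by linarith
      have Kq: "K * q z = 8 * q z + KG * q z + 4 * F * q z" by (simp add: K_def algebra_simps)
      have "0 \<le> 4 * F * q z" using q0[of z] f(2) by simp
      then have "\<bar>\<eta> (U z) * V z + G (U z)\<bar> \<le> D z"
        using abs_triangle_ineq[of "\<eta> (U z) * V z" "G (U z)"] e Gq[of z] q0[of z] Kq unfolding D_def by linarith
      then have "\<bar>deriv \<theta> (fst z)\<bar> * \<bar>\<eta> (U z) * V z + G (U z)\<bar> \<le> \<bar>deriv \<theta> (fst z)\<bar> * D z" by (intro mult_left_mono) auto
      moreover have "deriv \<theta> (fst z) * (\<eta> (U z) * V z + G (U z)) \<le> \<bar>deriv \<theta> (fst z)\<bar> * \<bar>\<eta> (U z) * V z + G (U z)\<bar>"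
        by (metis abs_ge_self abs_mult)
      ultimately show ?thesis by (simp add: algebra_simps)
    qed
    have 2: "\<theta> (fst z) * (deriv \<eta> (U z) * (V z)\<^sup>2) \<le> c0 * (\<sigma> (U z) * (V z)\<^sup>2)"
    proof -
      have "\<theta> (fst z) * (deriv \<eta> (U z) * (V z)\<^sup>2) \<le> 1 * (c0 * \<sigma> (U z) * (V z)\<^sup>2)"
        using th(1,2) sig(3,4) by (intro mult_mono mult_right_mono) auto
      then show ?thesis by (simp add: mult.assoc)
    qed
    have 3: "- r z \<le> ?c z * (\<phi> (snd z))\<^sup>2 + K * q z"
    proof (cases "?c z = 0")
      case True
      then show ?thesis using q0[of z] K by (simp add: r_def)
    next
      case False
      then have c1: "?c z = 1" using c01[of z] by auto
      have "- f (U z) * \<eta> (U z) \<le> F * ((1 + \<bar>U z\<bar>) * \<bar>\<eta> (U z)\<bar>)" using f(3)[OF eta(3)[of "U z"]] by (simp add: mult.assoc)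
      also have "\<dots> \<le> F * (4 * (1 + U z ^ 6))" using eta(2)[of "U z"] f(2) by (intro mult_left_mono) auto
      also have "F * (4 * (1 + U z ^ 6)) = 4 * F * q z" using c1 by (simp add: q_def algebra_simps)
      finally have f1: "- f (U z) * \<eta> (U z) \<le> 4 * F * q z" .
      have "2 * (\<phi> (snd z) * \<eta> (U z)) \<le> (\<phi> (snd z))\<^sup>2 + (\<eta> (U z))\<^sup>2"
        using sum_squares_bound[of "\<phi> (snd z)" "\<eta> (U z)"] by simp
      moreover have "0 \<le> (\<phi> (snd z))\<^sup>2" "0 \<le> (\<eta> (U z))\<^sup>2" by simp_all
      ultimately have p1: "\<phi> (snd z) * \<eta> (U z) \<le> (\<phi> (snd z))\<^sup>2 + 4 * q z" using eq2[of z] by linarith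
      have n: "0 \<le> (\<phi> (snd z))\<^sup>2 + 4 * q z + 4 * F * q z" using q0[of z] f(2) by simp
      have "- r z = \<theta> (fst z) * (\<phi> (snd z) * \<eta> (U z) + - f (U z) * \<eta> (U z))" by (simp add: r_def c1 algebra_simps)
      also have "\<dots> \<le> \<theta> (fst z) * ((\<phi> (snd z))\<^sup>2 + 4 * q z + 4 * F * q z)"
        using p1 f1 th(1) by (intro mult_left_mono) auto
      also have "\<dots> \<le> 1 * ((\<phi> (snd z))\<^sup>2 + 4 * q z + 4 * F * q z)" using th(2) n by (intro mult_right_mono) auto
      also have "\<dots> \<le> (\<phi> (snd z))\<^sup>2 + K * q z"
      proof -
        have "K * q z = 8 * q z + KG * q z + 4 * F * q z" by (simp add: K_def algebra_simps)
        moreover have "0 \<le> KG * q z" using q0[of z] G(3) by simp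
        ultimately show ?thesis using q0[of z] by (simp only: mult_1)
      qed
      finally show ?thesis using c1 by simp
    qed
    have "V z * P z = deriv \<theta> (fst z) * \<eta> (U z) * V z + \<theta> (fst z) * (deriv \<eta> (U z) * (V z)\<^sup>2)"
      by (simp add: P_def v_def power2_eq_square algebra_simps)
    then show ?thesis using 1 2 3 by linarith
  qed
  have "(LINT z|M. V z * P z - r z + deriv \<theta> (fst z) * G (U z))
     \<le> (LINT z|M. D z * \<bar>deriv \<theta> (fst z)\<bar> + c0 * (\<sigma> (U z) * (V z)\<^sup>2) + (?c z * (\<phi> (snd z))\<^sup>2 + K * q z))"
    by (rule integral_mono[OF _ _ pw]) (use EVW_integrable(2) ir iG i\<theta>D i(1) i\<phi> iq in auto)
  also have "\<dots> = (LINT z|M. D z * \<bar>deriv \<theta> (fst z)\<bar>) + c0 * (LINT z|M. \<sigma> (U z) * (V z)\<^sup>2)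
     + ((LINT z|M. ?c z * (\<phi> (snd z))\<^sup>2) + K * (LINT z|M. q z))"
    using i\<theta>D i(1) i\<phi> iq by simp
  finally have tot: "(LINT z|M. W z \<bullet> Y z) \<le> (LINT z|M. D z * \<bar>deriv \<theta> (fst z)\<bar>) + c0 * (LINT z|M. \<sigma> (U z) * (V z)\<^sup>2)
     + ((LINT z|M. ?c z * (\<phi> (snd z))\<^sup>2) + K * (LINT z|M. q z))" unfolding WY .
  \<comment> \<open>The dissipation has size R, the velocity slices R^2 and the sixth moments R^6;
    as R >= 1, the last power absorbs all of them.\<close>
  have R6: "R \<le> R ^ 6" "R ^ 2 \<le> R ^ 6" "1 \<le> R ^ 6"
    using R(1) power_increasing[of 1 6 R] power_increasing[of 2 6 R] one_le_power[OF R(1), of 6] by auto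
  have qs: "AE t in lborel. t \<in> {0<..<T} \<longrightarrow> (LINT x|lborel. q (t, x)) \<le> (vol + 1) * R ^ 6"
    using R(3) lborel_pair.AE_integrable_fst'[OF i(2)]
  proof eventually_elim
    case (elim t)
    show ?case
    proof
      assume t: "t \<in> {0<..<T}"
      have "q (t, x) = indicator \<Omega> x + U (t, x) ^ 6" for x
        using out[of "(t, x)"] t by (cases "x \<in> \<Omega>") (auto simp: q_def cI I_def)
      then have "(LINT x|lborel. q (t, x)) = vol + (LINT x|lborel. U (t, x) ^ 6)"
        using elim(2) iO by (simp add: vol_def)
      also have "\<dots> \<le> vol * R ^ 6 + R ^ 6" using elim(1) t R6(3) mult_left_mono[OF R6(3) vol(1)] by (intro add_mono) auto
      finally show "(LINT x|lborel. q (t, x)) \<le> (vol + 1) * R ^ 6" by (simp add: algebra_simps)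
    qed
  qed
  have qint: "(LINT z|M. q z) \<le> T * ((vol + 1) * R ^ 6)"
  proof -
    have "(LINT z|M. q z) = (LINT t|lborel. LINT x|lborel. q (t, x))" using lborel_pair.integral_fst'[OF iq] by simp
    also have "\<dots> \<le> (LINT t|lborel. I t * ((vol + 1) * R ^ 6))"
    proof (rule integral_mono_AE)
      show "integrable lborel (\<lambda>t. LINT x|lborel. q (t, x))" using lborel_pair.integrable_fst'[OF iq] .
      show "integrable lborel (\<lambda>t. I t * ((vol + 1) * R ^ 6))" using I_integrable(1) by simp
      show "AE t in lborel. (LINT x|lborel. q (t, x)) \<le> I t * ((vol + 1) * R ^ 6)"
        using qs
      proof eventually_elim
        case (elim t)
        show ?case
        proof (cases "t \<in> {0<..<T}")
          case False
          then have "q (t, x) = 0" for x by (simp add: q_def cI I_def)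
          then show ?thesis using False by (simp add: I_def)
        qed (use elim in \<open>simp add: I_def\<close>)
      qed
    qed
    finally show ?thesis using I_integrable by simp
  qed
  have \<phi>int: "(LINT z|M. ?c z * (\<phi> (snd z))\<^sup>2) = T * \<phi>2"
  proof -
    have "?c z * (\<phi> (snd z))\<^sup>2 = I (fst z) * (indicator \<Omega> (snd z) * \<phi> (snd z))\<^sup>2" for z
      by (cases "snd z \<in> \<Omega>") (simp_all add: cI power_mult_distrib)
    then show ?thesis
      using integrable_section(3)[OF lborel_pair.integrable_prod_mult[OF I_integrable(1) i(3)]] I_integrable
      by (simp add: \<phi>2_def mult.commute)
  qed
  \<comment> \<open>Slices of D are bounded uniformly in time, so only the integral of |\<theta>'|
    enters. This group carries no factor T and does not grow as the cut-off steepens.\<close>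
  have Dint: "(LINT z|M. D z * \<bar>deriv \<theta> (fst z)\<bar>) \<le> 2 * ((1 + K * (vol + 1)) * R ^ 6)"
  proof -
    let ?A = "(1 + K * (vol + 1)) * R ^ 6"
    have A0: "0 \<le> ?A" using K vol R6 by simp
    have "(LINT z|M. D z * \<bar>deriv \<theta> (fst z)\<bar>) = (LINT t|lborel. LINT x|lborel. D (t, x) * \<bar>deriv \<theta> t\<bar>)"
      using lborel_pair.integral_fst'[OF i\<theta>D] by simp
    also have "\<dots> \<le> (LINT t|lborel. \<bar>deriv \<theta> t\<bar> * ?A)"
    proof (rule integral_mono_AE)
      show "integrable lborel (\<lambda>t. LINT x|lborel. D (t, x) * \<bar>deriv \<theta> t\<bar>)" using lborel_pair.integrable_fst'[OF i\<theta>D] by simp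
      show "integrable lborel (\<lambda>t. \<bar>deriv \<theta> t\<bar> * ?A)" using th(3) by simp
      show "AE t in lborel. (LINT x|lborel. D (t, x) * \<bar>deriv \<theta> t\<bar>) \<le> \<bar>deriv \<theta> t\<bar> * ?A"
        using qs R(4) lborel_pair.AE_integrable_fst'[OF int(5)] lborel_pair.AE_integrable_fst'[OF iq]
      proof eventually_elim
        case (elim t)
        show ?case
        proof (cases "t \<in> {0<..<T}")
          case True
          have "(LINT x|lborel. D (t, x)) = (LINT x|lborel. (V (t, x))\<^sup>2) + K * (LINT x|lborel. q (t, x))"
            using elim(3,4) by (simp add: D_def)
          also have "\<dots> \<le> R ^ 6 + K * ((vol + 1) * R ^ 6)"
            using elim(1,2) True R6(2) K by (intro add_mono mult_left_mono) auto
          finally have "(LINT x|lborel. D (t, x)) \<le> ?A" by (simp add: algebra_simps)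
          from mult_left_mono[OF this, of "\<bar>deriv \<theta> t\<bar>"] show ?thesis by (simp add: mult.commute)
        qed (use \<theta>_outside(2) in simp)
      qed
    qed
    also have "\<dots> = (LINT t|lborel. \<bar>deriv \<theta> t\<bar>) * ?A" using th(3) by simp
    also have "\<dots> \<le> 2 * ?A" by (rule mult_right_mono[OF th(4) A0])
    finally show ?thesis .
  qed
  have X: "c0 * (LINT z|M. \<sigma> (U z) * (V z)\<^sup>2) \<le> c0 * R ^ 6" using R(2) R6(1) sig(5) by (intro mult_left_mono) auto
  have Y: "K * (LINT z|M. q z) \<le> K * (T * ((vol + 1) * R ^ 6))" using qint K by (intro mult_left_mono) auto
  have Z1: "T * \<phi>2 \<le> T * (\<phi>2 * R ^ 6)"
    using mult_left_mono[OF R6(3) vol(2)] T by (intro mult_left_mono) auto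
  have "(LINT z|M. W z \<bullet> Y z) \<le> 2 * ((1 + K * (vol + 1)) * R ^ 6) + c0 * R ^ 6 + (T * (\<phi>2 * R ^ 6) + K * (T * ((vol + 1) * R ^ 6)))"
    using tot Dint X Y Z1 \<phi>int by linarith
  also have "\<dots> \<le> (2 * (1 + K * (vol + 1)) + c0 + \<phi>2 + K * (vol + 1)) * (R ^ 6 * (1 + T))"
  proof -
    \<comment> \<open>p1 gathers the terms without T and p2 those with T; then p1 + T p2 <= (p1 +
      p2)(1 + T).\<close>
    define p1 where "p1 = (2 * (1 + K * (vol + 1)) + c0) * R ^ 6"
    define p2 where "p2 = (\<phi>2 + K * (vol + 1)) * R ^ 6"
    have p: "0 \<le> p1" "0 \<le> p2" unfolding p1_def p2_def using K vol sig(5) R6 by (auto intro!: mult_nonneg_nonneg add_nonneg_nonneg)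
    have "2 * ((1 + K * (vol + 1)) * R ^ 6) + c0 * R ^ 6 + (T * (\<phi>2 * R ^ 6) + K * (T * ((vol + 1) * R ^ 6))) = p1 + T * p2"
      by (simp add: p1_def p2_def algebra_simps)
    also have "\<dots> \<le> p1 + T * p2 + (T * p1 + p2)" using p T by simp
    also have "\<dots> = (2 * (1 + K * (vol + 1)) + c0 + \<phi>2 + K * (vol + 1)) * (R ^ 6 * (1 + T))"
      by (simp add: p1_def p2_def algebra_simps)
    finally show ?thesis .
  qed
  finally show ?thesis .
qed

end

section \<open>Borel representatives\<close>

text \<open>By completeness of Lebesgue measure, a preimage that differs from a Borel set by a null
  set is still measurable.\<close>

lemma lebesgue_on_measurable_AE:
  fixes F F' :: "'a::euclidean_space \<Rightarrow> 'b::{banach, second_countable_topology}"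
  assumes S: "S \<in> sets borel" and F': "F' \<in> borel_measurable borel" and e: "AE z in lborel. z \<in> S \<longrightarrow> F z = F' z"
  shows "F \<in> borel_measurable (lebesgue_on S)"
proof (rule measurableI)
  fix A :: "'b set" assume A: "A \<in> sets borel"
  have B: "S \<inter> F' -` A \<in> sets lebesgue"
    using S measurable_sets[OF F' A] by (auto intro!: sets_completionI_sets)
  have "AE z in lebesgue. z \<in> S \<inter> F' -` A \<longleftrightarrow> z \<in> S \<inter> F -` A"
    using AE_completion[OF e] by eventually_elim auto
  then have "S \<inter> F -` A \<in> sets lebesgue"
    by (rule completion.in_sets_AE) (use B in auto)
  then show "F -` A \<inter> space (lebesgue_on S) \<in> sets (lebesgue_on S)"
    using S by (auto simp: sets_restrict_space_iff space_restrict_space Int_commute)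
qed simp

lemma lebesgue_on_transfer:
  fixes F F' :: "'a::euclidean_space \<Rightarrow> 'b::{banach, second_countable_topology}"
  assumes S: "S \<in> sets borel" and F': "F' \<in> borel_measurable borel" and z: "\<And>x. x \<notin> S \<Longrightarrow> F' x = 0"
    and e: "AE z in lborel. z \<in> S \<longrightarrow> F z = F' z"
  shows "integrable (lebesgue_on S) F \<longleftrightarrow> integrable lborel F'" "(LINT x|lebesgue_on S. F x) = (LINT x|lborel. F' x)"
proof -
  have m: "F \<in> borel_measurable (lebesgue_on S)" "F' \<in> borel_measurable (lebesgue_on S)"
    using lebesgue_on_measurable_AE[OF S F' e] borel_measurable_lebesgue_on[OF F'] .
  have a: "AE z in lebesgue_on S. F z = F' z" using e by (simp add: AE_lebesgue_on_iff[OF S])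
  show "integrable (lebesgue_on S) F \<longleftrightarrow> integrable lborel F'"
    using integrable_cong_AE[OF m a] lebesgue_on_borel(1)[OF S F' z] by simp
  show "(LINT x|lebesgue_on S. F x) = (LINT x|lborel. F' x)"
    using integral_cong_AE[OF m a] lebesgue_on_borel(2)[OF S F' z] by simp
qed

lemma ex_borel_version:
  fixes F :: "'a::euclidean_space \<Rightarrow> real"
  assumes S: "S \<in> sets borel" and F: "F \<in> borel_measurable (lebesgue_on S)"
  obtains F' where "F' \<in> borel_measurable borel" "\<And>z. z \<notin> S \<Longrightarrow> F' z = 0" "AE z in lborel. z \<in> S \<longrightarrow> F z = F' z"
proof -
  have "(\<lambda>x. indicator S x *\<^sub>R F x) \<in> borel_measurable lebesgue"
    using F S by (subst (asm) borel_measurable_restrict_space_iff) auto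
  then obtain g where g: "g \<in> borel_measurable lborel" "AE x in lborel. indicator S x *\<^sub>R F x = g x"
    using completion_ex_borel_measurable_real by blast
  show ?thesis
  proof (rule that[of "\<lambda>x. indicator S x * g x"])
    show "(\<lambda>x. indicator S x * g x) \<in> borel_measurable borel" using g(1) S by simp
    show "AE z in lborel. z \<in> S \<longrightarrow> F z = indicator S z * g z" using g(2) by eventually_elim auto
  qed simp
qed

lemma H10_cong:
  assumes Om: "open \<Omega>" and H: "H10_grad \<Omega> v w" and m: "v' \<in> borel_measurable borel" "w' \<in> borel_measurable borel"
    and e: "AE x in lborel. x \<in> \<Omega> \<longrightarrow> v x = v' x \<and> w x = w' x"
  shows "H10_grad \<Omega> v' w'"
proof -
  let ?M = "lebesgue_on \<Omega>"
  have S: "\<Omega> \<in> sets borel" using Om by simp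
  have a: "AE x in ?M. v x = v' x \<and> w x = w' x" using e unfolding AE_lebesgue_on_iff[OF S] .
  have m' [measurable]: "v' \<in> borel_measurable ?M" "w' \<in> borel_measurable ?M" using m borel_measurable_lebesgue_on by auto
  have [measurable]: "v \<in> borel_measurable ?M" "w \<in> borel_measurable ?M" using H by (auto simp: H10_grad_def L2_def)
  have "integrable ?M (\<lambda>x. (v' x)\<^sup>2) = integrable ?M (\<lambda>x. (v x)\<^sup>2)"
    by (rule integrable_cong_AE) (use a in \<open>auto elim: eventually_mono\<close>)
  moreover have "integrable ?M (\<lambda>x. (norm (w' x))\<^sup>2) = integrable ?M (\<lambda>x. (norm (w x))\<^sup>2)"
    by (rule integrable_cong_AE) (use a in \<open>auto elim: eventually_mono\<close>)
  moreover obtain f where f: "\<And>n::nat. test_fun \<Omega> (f n)" "(\<lambda>n. LINT x|?M. (f n x - v x)^2) \<longlonglongrightarrow> 0"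
     "(\<lambda>n. LINT x|?M. (norm (grad3 (f n) x - w x))^2) \<longlonglongrightarrow> 0"
    using H unfolding H10_grad_def by blast
  have [measurable]: "f n \<in> borel_measurable ?M" "grad3 (f n) \<in> borel_measurable ?M" for n
    using test_fun_measurable[OF f(1)] test_fun_grad3_measurable[OF f(1)] borel_measurable_lebesgue_on by auto
  have "(LINT x|?M. (f n x - v x)^2) = (LINT x|?M. (f n x - v' x)^2)" for n
    by (rule integral_cong_AE) (use a in \<open>auto elim: eventually_mono\<close>)
  moreover have "(LINT x|?M. (norm (grad3 (f n) x - w x))^2) = (LINT x|?M. (norm (grad3 (f n) x - w' x))^2)" for n
    by (rule integral_cong_AE) (use a in \<open>auto elim: eventually_mono\<close>)
  ultimately show ?thesis using H f m' unfolding H10_grad_def L2_def by auto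
qed

text \<open>Tonelli on a bounded time interval: uniformly bounded slice integrals suffice for
  integrability in space-time.\<close>

lemma integrable_bounded_sections:
  fixes F :: "real \<times> (real^3) \<Rightarrow> real"
  assumes [measurable]: "F \<in> borel_measurable (borel \<Otimes>\<^sub>M borel)" and nn: "\<And>z. F z \<ge> 0" and z: "\<And>t x. t \<notin> {0<..<T} \<Longrightarrow> F (t, x) = 0"
    and b: "AE t in lborel. t \<in> {0<..<T} \<longrightarrow> integrable lborel (\<lambda>x. F (t, x)) \<and> (LINT x|lborel. F (t, x)) \<le> K"
  shows "integrable (lborel \<Otimes>\<^sub>M lborel) F"
proof (rule lborel_pair.Fubini_integrable)
  show "F \<in> borel_measurable (lborel \<Otimes>\<^sub>M lborel)" by measurable
  show "AE t in lborel. integrable lborel (\<lambda>x. F (t, x))"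
    using b by eventually_elim (use z in fastforce)
  have iI: "integrable lborel (\<lambda>t. indicator {0<..<T} t * K)"
  proof (cases "0 \<le> T")
    case True
    then show ?thesis by (intro integrable_mult_left integrable_real_indicator) (auto simp: emeasure_lborel_Ioo)
  next
    case False
    then have "{0<..<T} = {}" by auto
    then show ?thesis by simp
  qed
  show "integrable lborel (\<lambda>t. LINT x|lborel. norm (F (t, x)))"
  proof (rule Bochner_Integration.integrable_bound[OF iI])
    show "AE t in lborel. norm (LINT x|lborel. norm (F (t, x))) \<le> norm (indicator {0<..<T} t * K)"
      using b
    proof eventually_elim
      case (elim t)
      have n: "norm (F (t, x)) = F (t, x)" for x using nn by simp
      have p: "0 \<le> (LINT x|lborel. F (t, x))" using nn by simp
      show ?case
      proof (cases "t \<in> {0<..<T}")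
        case True
        then show ?thesis unfolding n using elim p by simp
      qed (simp add: z)
    qed
  qed measurable
qed

lemma L2_sq_section:
  assumes S: "\<Omega> \<in> sets borel" and g: "g' \<in> borel_measurable borel" "\<And>x. x \<notin> \<Omega> \<Longrightarrow> g' x = 0"
    and e: "AE x in lborel. x \<in> \<Omega> \<longrightarrow> g x = g' x" and L: "L2 \<Omega> g"
  shows "integrable lborel (\<lambda>x. (g' x)\<^sup>2)"
proof -
  have "integrable (lebesgue_on \<Omega>) (\<lambda>x. (g x)\<^sup>2) \<longleftrightarrow> integrable lborel (\<lambda>x. (g' x)\<^sup>2)"
    by (rule lebesgue_on_transfer(1)[OF S]) (use g e in \<open>auto elim: eventually_mono\<close>)
  then show ?thesis using L by (simp add: L2_def)
qed

lemma test_fun_deriv_bounded: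
  fixes \<rho> :: "real \<Rightarrow> real"
  assumes \<rho>: "test_fun U \<rho>"
  obtains B where "B \<ge> 0" "\<And>t. \<bar>deriv \<rho> t\<bar> \<le> B"
proof -
  have "pd 1 \<rho> = deriv \<rho>"
  proof
    fix x
    have "((\<lambda>s. \<rho> (x + s *\<^sub>R 1)) has_real_derivative deriv \<rho> x) (at 0)"
      using DERIV_shift[of \<rho> "deriv \<rho> x" 0 x] smooth_real_deriv(1)[OF test_fun_imp_smooth[OF \<rho>], of x]
      by (simp add: add.commute)
    then show "pd 1 \<rho> x = deriv \<rho> x" unfolding pd_def by (rule DERIV_imp_deriv)
  qed
  then show ?thesis using test_fun_bounded[OF test_fun_pd[OF \<rho>, of 1]] that by auto
qed

text \<open>A weak solution consists of Lebesgue measurable functions that matter only on the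
  cylinder, whereas slicing, Fubini and primitives in time need jointly Borel functions everywhere.
  The obtained facts tie the Borel versions back to u on almost every slice, so that R can be
  computed from them.\<close>

lemma weak_solution_borel:
  assumes Om: "open \<Omega>" "bounded \<Omega>" and T: "T > 0"
    and sc: "continuous_on UNIV \<sigma>" "continuous_on UNIV f" and sb: "\<And>s. 0 \<le> \<sigma> s" "\<And>s. \<sigma> s \<le> S * (1 + s ^ 6)" "\<And>s. \<bar>f s\<bar> \<le> F * (1 + s ^ 6)"
    and phi: "\<phi>' \<in> borel_measurable borel" "\<And>x. x \<notin> \<Omega> \<Longrightarrow> \<phi>' x = 0" "AE x in lborel. x \<in> \<Omega> \<longrightarrow> \<phi> x = \<phi>' x"
      "integrable lborel (\<lambda>x. (\<phi>' x)\<^sup>2)"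
    and ws: "weak_solution \<Omega> \<sigma> f \<phi> T u ut"
  obtains E U V W K where "damped_wave \<Omega> T E U V W"
    "\<And>z. E z = indicator (cyl T \<Omega>) z * (\<sigma> (U z) * V z + f (U z) - \<phi>' (snd z))"
    "integrable (lborel \<Otimes>\<^sub>M lborel) (\<lambda>z. \<sigma> (U z) * (V z)\<^sup>2)" "integrable (lborel \<Otimes>\<^sub>M lborel) (\<lambda>z. U z ^ 6)"
    "(LINT z|lebesgue_on (cyl T \<Omega>). \<sigma> (u (fst z) (snd z)) * (ut (fst z) (snd z))^2) = (LINT z|(lborel \<Otimes>\<^sub>M lborel). \<sigma> (U z) * (V z)\<^sup>2)"
    "AE t in lborel. t \<in> {0<..<T} \<longrightarrow> (AE x in lborel. x \<in> \<Omega> \<longrightarrow> u t x = U (t, x) \<and> ut t x = V (t, x))"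
    "AE t in lborel. t \<in> {0<..<T} \<longrightarrow> integrable lborel (\<lambda>x. U (t, x) ^ 6) \<and> (LINT x|lborel. U (t, x) ^ 6) \<le> K"
    "AE t in lborel. t \<in> {0<..<T} \<longrightarrow> integrable lborel (\<lambda>x. (V (t, x))\<^sup>2) \<and> (LINT x|lborel. (V (t, x))\<^sup>2) \<le> K"
proof -
  let ?Q = "cyl T \<Omega>"
  let ?M = "lborel \<Otimes>\<^sub>M lborel :: (real \<times> (real^3)) measure"
  have Q: "?Q \<in> sets borel" unfolding cyl_def using Om by (intro borel_open open_Times) auto
  have S [measurable]: "\<Omega> \<in> sets borel" using Om by simp
  obtain gu where u: "(\<lambda>z. u (fst z) (snd z)) \<in> borel_measurable (lebesgue_on ?Q)"
    and ut: "(\<lambda>z. ut (fst z) (snd z)) \<in> borel_measurable (lebesgue_on ?Q)"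
    and gu: "(\<lambda>z. gu (fst z) (snd z)) \<in> borel_measurable (lebesgue_on ?Q)"
    and wdt: "weak_dt T \<Omega> u ut" and h10: "AE t in lebesgue_on {0<..<T}. H10_grad \<Omega> (u t) (gu t) \<and> L2 \<Omega> (ut t)"
    and bd: "\<exists>K. AE t in lebesgue_on {0<..<T}. (LINT x|lebesgue_on \<Omega>. (u t x)^2 + (norm (gu t x))^2 + (ut t x)^2) \<le> K"
    and sint: "integrable (lebesgue_on ?Q) (\<lambda>z. \<sigma> (u (fst z) (snd z)) * (ut (fst z) (snd z))^2)"
    and weq: "\<And>\<psi>. test_fun ?Q \<psi> \<Longrightarrow> (LINT z|lebesgue_on ?Q. - ut (fst z) (snd z) * dt \<psi> z + \<sigma> (u (fst z) (snd z)) * ut (fst z) (snd z) * \<psi> z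
            + gu (fst z) (snd z) \<bullet> gradx \<psi> z + f (u (fst z) (snd z)) * \<psi> z) = (LINT z|lebesgue_on ?Q. \<phi> (snd z) * \<psi> z)"
    using ws unfolding weak_solution_def by blast
  obtain K0 where K0: "AE t in lebesgue_on {0<..<T}. (LINT x|lebesgue_on \<Omega>. (u t x)^2 + (norm (gu t x))^2 + (ut t x)^2) \<le> K0"
    using bd by blast
  obtain U where U: "U \<in> borel_measurable borel" "\<And>z. z \<notin> ?Q \<Longrightarrow> U z = 0" "AE z in lborel. z \<in> ?Q \<longrightarrow> u (fst z) (snd z) = U z"
    proof (rule ex_borel_version[OF Q u])
    fix F' :: "real \<times> (real^3) \<Rightarrow> real"
    assume F': "F' \<in> borel_measurable borel" "\<And>z. z \<notin> ?Q \<Longrightarrow> F' z = 0" "AE z in lborel. z \<in> ?Q \<longrightarrow> u (fst z) (snd z) = F' z"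
    show thesis by (rule that[of F']; fact F')
  qed
  obtain V where V: "V \<in> borel_measurable borel" "\<And>z. z \<notin> ?Q \<Longrightarrow> V z = 0" "AE z in lborel. z \<in> ?Q \<longrightarrow> ut (fst z) (snd z) = V z"
    proof (rule ex_borel_version[OF Q ut])
    fix F' :: "real \<times> (real^3) \<Rightarrow> real"
    assume F': "F' \<in> borel_measurable borel" "\<And>z. z \<notin> ?Q \<Longrightarrow> F' z = 0" "AE z in lborel. z \<in> ?Q \<longrightarrow> ut (fst z) (snd z) = F' z"
    show thesis by (rule that[of F']; fact F')
  qed
  have guj: "(\<lambda>z. gu (fst z) (snd z) $ j) \<in> borel_measurable (lebesgue_on ?Q)" for j
    using gu by (rule measurable_compose) (intro borel_measurable_continuous_onI continuous_intros)
  \<comment> \<open>\<open>ex_borel_version\<close> treats real-valued functions, so the gradient is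
    replaced component by component and reassembled.\<close>
  have ex: "\<forall>j. \<exists>w. w \<in> borel_measurable borel \<and> (\<forall>z. z \<notin> ?Q \<longrightarrow> w z = 0) \<and> (AE z in lborel. z \<in> ?Q \<longrightarrow> gu (fst z) (snd z) $ j = w z)"
  proof
    fix j
    show "\<exists>w. w \<in> borel_measurable borel \<and> (\<forall>z. z \<notin> ?Q \<longrightarrow> w z = 0) \<and> (AE z in lborel. z \<in> ?Q \<longrightarrow> gu (fst z) (snd z) $ j = w z)"
    proof (rule ex_borel_version[OF Q guj[of j]])
      fix F' :: "real \<times> (real^3) \<Rightarrow> real"
      assume F': "F' \<in> borel_measurable borel" "\<And>z. z \<notin> ?Q \<Longrightarrow> F' z = 0" "AE z in lborel. z \<in> ?Q \<longrightarrow> gu (fst z) (snd z) $ j = F' z"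
      show ?thesis by (rule exI[of _ F']) (intro conjI allI impI; fact F' | simp add: F')
    qed
  qed
  obtain w where w': "\<forall>j. w j \<in> borel_measurable borel \<and> (\<forall>z. z \<notin> ?Q \<longrightarrow> w j z = 0) \<and>
    (AE z in lborel. z \<in> ?Q \<longrightarrow> gu (fst z) (snd z) $ j = w j z)"
  proof (rule exE[OF choice[OF ex]])
    fix F'
    assume F': "\<forall>j. F' j \<in> borel_measurable borel \<and> (\<forall>z. z \<notin> ?Q \<longrightarrow> F' j z = 0) \<and>
      (AE z in lborel. z \<in> ?Q \<longrightarrow> gu (fst z) (snd z) $ j = F' j z)"
    show thesis by (rule that[of F']) (rule F')
  qed
  have w: "w j \<in> borel_measurable borel" for j using spec[OF w', of j] by (rule conjunct1)
  have w0: "z \<notin> ?Q \<Longrightarrow> w j z = 0" for j z using spec[OF w', of j] by blast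
  have wAE: "AE z in lborel. z \<in> ?Q \<longrightarrow> gu (fst z) (snd z) $ j = w j z" for j
    using spec[OF w', of j] by (elim conjE)
  define W :: "real \<times> (real^3) \<Rightarrow> real^3" where "W z = (\<chi> j. w j z)" for z
  have W: "W \<in> borel_measurable borel" "\<And>z. z \<notin> ?Q \<Longrightarrow> W z = 0" "AE z in lborel. z \<in> ?Q \<longrightarrow> gu (fst z) (snd z) = W z"
  proof -
    show "W \<in> borel_measurable borel"
    proof (rule borel_measurable_euclidean_space[THEN iffD2], rule ballI)
      fix i :: "real^3" assume "i \<in> Basis"
      then obtain j where "i = axis j 1" by (auto simp: Basis_vec_def)
      then show "(\<lambda>x. W x \<bullet> i) \<in> borel_measurable borel" using w[of j] by (simp add: W_def inner_axis)
    qed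
    show "W z = 0" if "z \<notin> ?Q" for z using w0[OF that] by (simp add: W_def vec_eq_iff)
    have "AE z in lborel. \<forall>j. z \<in> ?Q \<longrightarrow> gu (fst z) (snd z) $ j = w j z" by (subst AE_all_countable) (rule allI, rule wAE)
    then show "AE z in lborel. z \<in> ?Q \<longrightarrow> gu (fst z) (snd z) = W z" by eventually_elim (auto simp: W_def vec_eq_iff)
  qed
  have meas [measurable]: "U \<in> borel_measurable (borel \<Otimes>\<^sub>M borel)" "V \<in> borel_measurable (borel \<Otimes>\<^sub>M borel)" "W \<in> borel_measurable (borel \<Otimes>\<^sub>M borel)"
    using U V W by (simp_all add: borel_prod)
  have [measurable]: "\<sigma> \<in> borel_measurable borel" "f \<in> borel_measurable borel" "\<phi>' \<in> borel_measurable borel"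
    using sc phi(1) by (auto intro: borel_measurable_continuous_onI)
  have eqs: "AE z in lborel. z \<in> ?Q \<longrightarrow> u (fst z) (snd z) = U z \<and> ut (fst z) (snd z) = V z \<and> gu (fst z) (snd z) = W z"
    using U(3) V(3) W(3) by eventually_elim auto
  then have eqM: "AE z in ?M. z \<in> ?Q \<longrightarrow> u (fst z) (snd z) = U z \<and> ut (fst z) (snd z) = V z \<and> gu (fst z) (snd z) = W z"
    unfolding lborel_prod .
  have sec: "AE t in lborel. AE x in lborel. (t, x) \<in> ?Q \<longrightarrow> u t x = U (t, x) \<and> ut t x = V (t, x) \<and> gu t x = W (t, x)"
    using lborel_pair.AE_pair[OF eqM] by simp
  have sec': "AE t in lborel. t \<in> {0<..<T} \<longrightarrow> (AE x in lborel. x \<in> \<Omega> \<longrightarrow> u t x = U (t, x) \<and> ut t x = V (t, x) \<and> gu t x = W (t, x))"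
    using sec
  proof eventually_elim
    case (elim t)
    show ?case
    proof
      assume t: "t \<in> {0<..<T}"
      show "AE x in lborel. x \<in> \<Omega> \<longrightarrow> u t x = U (t, x) \<and> ut t x = V (t, x) \<and> gu t x = W (t, x)"
        using elim by eventually_elim (use t in \<open>auto simp: cyl_def\<close>)
    qed
  qed
  have secm: "(\<lambda>x. U (t, x)) \<in> borel_measurable borel" "(\<lambda>x. V (t, x)) \<in> borel_measurable borel" "(\<lambda>x. W (t, x)) \<in> borel_measurable borel" for t
    by measurable
  have sec0: "U (t, x) = 0" "V (t, x) = 0" "W (t, x) = 0" if "x \<notin> \<Omega>" for t x
    using U(2)[of "(t, x)"] V(2)[of "(t, x)"] W(2)[of "(t, x)"] that by (auto simp: cyl_def)
  have tsec0: "U (t, x) = 0" "V (t, x) = 0" "W (t, x) = 0" if "t \<notin> {0<..<T}" for t x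
    using U(2)[of "(t, x)"] V(2)[of "(t, x)"] W(2)[of "(t, x)"] that by (auto simp: cyl_def)
  have I0: "{0<..<T} \<in> sets (borel :: real measure)" by simp
  have nn: "0 \<le> (LINT x|lborel. (U (t, x))\<^sup>2)" "0 \<le> (LINT x|lborel. (norm (W (t, x)))\<^sup>2)" "0 \<le> (LINT x|lborel. (V (t, x))\<^sup>2)" for t
    by simp_all
  have main: "AE t in lborel. t \<in> {0<..<T} \<longrightarrow> H10_grad \<Omega> (\<lambda>x. U (t, x)) (\<lambda>x. W (t, x)) \<and>
      integrable lborel (\<lambda>x. (U (t, x))\<^sup>2) \<and> integrable lborel (\<lambda>x. (V (t, x))\<^sup>2) \<and> integrable lborel (\<lambda>x. (norm (W (t, x)))\<^sup>2) \<and>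
      (LINT x|lborel. (U (t, x))\<^sup>2) \<le> K0 \<and> (LINT x|lborel. (norm (W (t, x)))\<^sup>2) \<le> K0 \<and> (LINT x|lborel. (V (t, x))\<^sup>2) \<le> K0"
    using sec' h10[unfolded AE_lebesgue_on_iff[OF I0]] K0[unfolded AE_lebesgue_on_iff[OF I0]]
  proof eventually_elim
    case (elim t)
    show ?case
    proof
      assume t: "t \<in> {0<..<T}"
      have e: "AE x in lborel. x \<in> \<Omega> \<longrightarrow> u t x = U (t, x) \<and> ut t x = V (t, x) \<and> gu t x = W (t, x)"
        and h: "H10_grad \<Omega> (u t) (gu t)" and l: "L2 \<Omega> (ut t)"
        and k: "(LINT x|lebesgue_on \<Omega>. (u t x)^2 + (norm (gu t x))^2 + (ut t x)^2) \<le> K0" using elim t by auto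
      have H: "H10_grad \<Omega> (\<lambda>x. U (t, x)) (\<lambda>x. W (t, x))"
        by (rule H10_cong[OF Om(1) h secm(1) secm(3)]) (use e in \<open>auto elim: eventually_mono\<close>)
      have iU: "integrable lborel (\<lambda>x. (U (t, x))\<^sup>2)"
        by (rule L2_sq_section[OF S secm(1)]) (use H sec0 in \<open>auto simp: H10_grad_def\<close>)
      have iV: "integrable lborel (\<lambda>x. (V (t, x))\<^sup>2)"
        by (rule L2_sq_section[OF S secm(2) _ _ l]) (use e sec0 in \<open>auto elim: eventually_mono\<close>)
      have iW: "integrable lborel (\<lambda>x. (norm (W (t, x)))\<^sup>2)"
        using lebesgue_on_borel(1)[OF S, of "\<lambda>x. (norm (W (t, x)))\<^sup>2"] sec0 secm(3) H by (auto simp: H10_grad_def)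
      have "(LINT x|lebesgue_on \<Omega>. (u t x)^2 + (norm (gu t x))^2 + (ut t x)^2)
        = (LINT x|lborel. (U (t, x))^2 + (norm (W (t, x)))^2 + (V (t, x))^2)"
        by (rule lebesgue_on_transfer(2)[OF S]) (use e sec0 secm in \<open>auto elim: eventually_mono\<close>)
      then have sm: "(LINT x|lborel. (U (t, x))\<^sup>2) + (LINT x|lborel. (norm (W (t, x)))\<^sup>2) + (LINT x|lborel. (V (t, x))\<^sup>2) \<le> K0" using k iU iV iW by simp
      show "H10_grad \<Omega> (\<lambda>x. U (t, x)) (\<lambda>x. W (t, x)) \<and>
        integrable lborel (\<lambda>x. (U (t, x))\<^sup>2) \<and> integrable lborel (\<lambda>x. (V (t, x))\<^sup>2) \<and> integrable lborel (\<lambda>x. (norm (W (t, x)))\<^sup>2) \<and>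
        (LINT x|lborel. (U (t, x))\<^sup>2) \<le> K0 \<and> (LINT x|lborel. (norm (W (t, x)))\<^sup>2) \<le> K0 \<and> (LINT x|lborel. (V (t, x))\<^sup>2) \<le> K0"
        using H iU iV iW sm nn[of t] by (intro conjI) (assumption | linarith)+
    qed
  qed
  have U6: "AE t in lborel. t \<in> {0<..<T} \<longrightarrow> integrable lborel (\<lambda>x. U (t, x) ^ 6) \<and> (LINT x|lborel. U (t, x) ^ 6) \<le> 32768 * K0 ^ 3"
    using main
  proof eventually_elim
    case (elim t)
    show ?case
    proof
      assume t: "t \<in> {0<..<T}"
      then have H: "H10_grad \<Omega> (\<lambda>x. U (t, x)) (\<lambda>x. W (t, x))" using elim by blast
      \<comment> \<open>Sobolev with H the identity: the energy bound K0 gives a sixth moment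
        bounded uniformly in time.\<close>
      have id: "smooth (\<lambda>s::real. s)" using smooth_linear[OF bounded_linear_ident] .
      have did: "deriv (\<lambda>s::real. s) = (\<lambda>s. 1)" by (auto intro: DERIV_imp_deriv)
      have 1: "integrable (lebesgue_on \<Omega>) (\<lambda>x. U (t, x) ^ 6)" "(LINT x|lebesgue_on \<Omega>. U (t, x) ^ 6) \<le> 32768 * (LINT x|lebesgue_on \<Omega>. (norm (W (t, x)))\<^sup>2) ^ 3"
        using sobolev_H10[OF Om(1) H id, of 1] by (simp_all add: did)
      have 2: "(LINT x|lebesgue_on \<Omega>. (norm (W (t, x)))\<^sup>2) = (LINT x|lborel. (norm (W (t, x)))\<^sup>2)"
        by (rule lebesgue_on_borel(2)[OF S]) (use secm sec0 in auto)
      have 3: "integrable (lebesgue_on \<Omega>) (\<lambda>x. U (t, x) ^ 6) \<longleftrightarrow> integrable lborel (\<lambda>x. U (t, x) ^ 6)"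
        "(LINT x|lebesgue_on \<Omega>. U (t, x) ^ 6) = (LINT x|lborel. U (t, x) ^ 6)"
        by (rule lebesgue_on_borel[OF S]; use secm sec0 in simp)+
      have "(LINT x|lborel. (norm (W (t, x)))\<^sup>2) \<le> K0" using elim t by blast
      then have "(LINT x|lborel. (norm (W (t, x)))\<^sup>2) ^ 3 \<le> K0 ^ 3" using nn(2)[of t] by (intro power_mono) auto
      then show "integrable lborel (\<lambda>x. U (t, x) ^ 6) \<and> (LINT x|lborel. U (t, x) ^ 6) \<le> 32768 * K0 ^ 3"
        using 1 2 3 by simp
    qed
  qed
  have V2: "AE t in lborel. t \<in> {0<..<T} \<longrightarrow> integrable lborel (\<lambda>x. (V (t, x))\<^sup>2) \<and> (LINT x|lborel. (V (t, x))\<^sup>2) \<le> K0"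
    using main
  proof eventually_elim
    case (elim t)
    then show ?case by blast
  qed
  have iU2: "integrable ?M (\<lambda>z. (U z)\<^sup>2)"
  proof (rule integrable_bounded_sections[where T = T and K = K0])
    show "AE t in lborel. t \<in> {0<..<T} \<longrightarrow> integrable lborel (\<lambda>x. (U (t, x))\<^sup>2) \<and> (LINT x|lborel. (U (t, x))\<^sup>2) \<le> K0"
      using main
    proof eventually_elim
      case (elim t)
      then show ?case by blast
    qed
  qed (use tsec0 in auto)
  have iV2: "integrable ?M (\<lambda>z. (V z)\<^sup>2)"
    by (rule integrable_bounded_sections[where T = T and K = K0, OF _ _ _ V2]) (use tsec0 in auto)
  have iW2: "integrable ?M (\<lambda>z. (norm (W z))\<^sup>2)"
  proof (rule integrable_bounded_sections[where T = T and K = K0])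
    show "AE t in lborel. t \<in> {0<..<T} \<longrightarrow> integrable lborel (\<lambda>x. (norm (W (t, x)))\<^sup>2) \<and> (LINT x|lborel. (norm (W (t, x)))\<^sup>2) \<le> K0"
      using main
    proof eventually_elim
      case (elim t)
      then show ?case by blast
    qed
  qed (use tsec0 in auto)
  have iU6: "integrable ?M (\<lambda>z. U z ^ 6)"
    by (rule integrable_bounded_sections[where T = T, OF _ _ _ U6]) (use tsec0 in auto)
  have Qm [measurable]: "?Q \<in> sets (borel \<Otimes>\<^sub>M borel)" unfolding borel_prod by (rule Q)
  have fin: "emeasure lborel \<Omega> < \<infinity>" by (rule emeasure_bounded_finite[OF Om(2)])
  have iO: "integrable lborel (indicator \<Omega> :: real^3 \<Rightarrow> real)" using fin by (intro integrable_real_indicator) auto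
  have iI: "integrable lborel (indicator {0<..<T} :: real \<Rightarrow> real)"
    using T by (intro integrable_real_indicator) (auto simp: emeasure_lborel_Ioo)
  have cI: "indicator ?Q z = (indicator {0<..<T} (fst z) * indicator \<Omega> (snd z) :: real)" for z
    by (cases z) (auto simp: cyl_def indicator_def)
  have iQ: "integrable ?M (indicator ?Q :: _ \<Rightarrow> real)"
    using lborel_pair.integrable_prod_mult[OF iI iO] by (simp add: cI[symmetric] cong: integrable_cong)
  have young1: "\<bar>y\<bar> \<le> 1 + y\<^sup>2" for y :: real
    using zero_le_power2[of "\<bar>y\<bar> - 1/2"] by (simp add: power2_eq_square algebra_simps)
  have int1: "integrable ?M g" if gm: "g \<in> borel_measurable (borel \<Otimes>\<^sub>M borel)" and g0: "\<And>z. z \<notin> ?Q \<Longrightarrow> g z = 0" and g2: "integrable ?M (\<lambda>z. (g z)\<^sup>2)" for g :: "real \<times> (real^3) \<Rightarrow> real"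
  proof (rule Bochner_Integration.integrable_bound[OF Bochner_Integration.integrable_add[OF iQ g2]])
    show "AE z in ?M. norm (g z) \<le> norm (indicator ?Q z + (g z)\<^sup>2)"
      using g0 young1 by (intro AE_I2) (auto simp: indicator_def)
  qed (use gm in measurable)
  have iU: "integrable ?M U" and iV: "integrable ?M V"
    using int1[OF meas(1) U(2) iU2] int1[OF meas(2) V(2) iV2] by auto
  have seqs: "AE z in lborel. z \<in> ?Q \<longrightarrow> \<sigma> (u (fst z) (snd z)) * (ut (fst z) (snd z))^2 = \<sigma> (U z) * (V z)\<^sup>2"
    using eqs by eventually_elim auto
  have sm: "(\<lambda>z. \<sigma> (U z) * (V z)\<^sup>2) \<in> borel_measurable borel" unfolding borel_prod[symmetric] by measurable
  have sV: "integrable ?M (\<lambda>z. \<sigma> (U z) * (V z)\<^sup>2)"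
    "(LINT z|lebesgue_on ?Q. \<sigma> (u (fst z) (snd z)) * (ut (fst z) (snd z))^2) = (LINT z|?M. \<sigma> (U z) * (V z)\<^sup>2)"
    using lebesgue_on_transfer[OF Q sm _ seqs] sint V(2) by (simp_all add: lborel_prod)
  define E where "E z = indicator ?Q z * (\<sigma> (U z) * V z + f (U z) - \<phi>' (snd z))" for z
  have Em [measurable]: "E \<in> borel_measurable (borel \<Otimes>\<^sub>M borel)" unfolding E_def by measurable
  define q where "q z = indicator ?Q z * (1 + U z ^ 6)" for z
  have iq: "integrable ?M q"
  proof -
    have "q z = indicator ?Q z + U z ^ 6" for z using U(2)[of z] by (auto simp: q_def indicator_def)
    then have "q = (\<lambda>z. indicator ?Q z + U z ^ 6)" by auto
    then show ?thesis using iQ iU6 by simp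
  qed
  have i\<phi>: "integrable ?M (\<lambda>z. indicator {0<..<T} (fst z) * (\<phi>' (snd z))\<^sup>2)"
    by (rule lborel_pair.integrable_prod_mult[OF iI phi(4)])
  have iE: "integrable ?M E"
  proof (rule Bochner_Integration.integrable_bound)
    show "integrable ?M (\<lambda>z. \<sigma> (U z) * (V z)\<^sup>2 + S * q z + F * q z + indicator ?Q z + indicator {0<..<T} (fst z) * (\<phi>' (snd z))\<^sup>2)"
      using sV(1) iq iQ i\<phi> by simp
    show "AE z in ?M. norm (E z) \<le> norm (\<sigma> (U z) * (V z)\<^sup>2 + S * q z + F * q z + indicator ?Q z + indicator {0<..<T} (fst z) * (\<phi>' (snd z))\<^sup>2)"
    proof (rule AE_I2)
      fix z
      have "\<bar>E z\<bar> \<le> \<sigma> (U z) * (V z)\<^sup>2 + S * q z + F * q z + indicator ?Q z + indicator {0<..<T} (fst z) * (\<phi>' (snd z))\<^sup>2"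
      proof (cases "z \<in> ?Q")
        case True
        have t: "indicator {0<..<T} (fst z) = (1::real)" using True by (auto simp: cyl_def)
        have "\<bar>\<sigma> (U z) * V z\<bar> \<le> \<sigma> (U z) * (V z)\<^sup>2 + \<sigma> (U z)"
          using mult_left_mono[OF young1[of "V z"] sb(1)[of "U z"]] sb(1)[of "U z"] by (simp add: abs_mult algebra_simps)
        moreover have "\<bar>E z\<bar> \<le> \<bar>\<sigma> (U z) * V z\<bar> + \<bar>f (U z)\<bar> + \<bar>\<phi>' (snd z)\<bar>" using True by (simp add: E_def)
        ultimately show ?thesis using sb(2,3)[of "U z"] young1[of "\<phi>' (snd z)"] True t by (simp add: q_def)
      next
        case False
        then show ?thesis using sb(1)[of "U z"] V(2)[of z] by (simp add: E_def q_def)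
      qed
      then show "norm (E z) \<le> norm (\<sigma> (U z) * (V z)\<^sup>2 + S * q z + F * q z + indicator ?Q z + indicator {0<..<T} (fst z) * (\<phi>' (snd z))\<^sup>2)" by simp
    qed
  qed measurable
  have dtw: "(LINT z|?M. U z * (deriv \<rho> (fst z) * \<zeta> (snd z))) = - (LINT z|?M. V z * (\<rho> (fst z) * \<zeta> (snd z)))"
    and weqB: "(LINT z|?M. E z * (\<rho> (fst z) * \<zeta> (snd z)) - V z * (deriv \<rho> (fst z) * \<zeta> (snd z)) + \<rho> (fst z) * (W z \<bullet> grad3 \<zeta> (snd z))) = 0"
    if \<rho>: "test_fun {0<..<T} \<rho>" and \<zeta>: "test_fun \<Omega> \<zeta>" for \<rho> \<zeta>
  proof -
    let ?\<psi> = "\<lambda>z. \<rho> (fst z) * \<zeta> (snd z)"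
    have \<psi>: "test_fun ?Q ?\<psi>" by (rule test_fun_product(1)[OF \<rho> \<zeta>])
    have dt\<psi>: "dt ?\<psi> z = deriv \<rho> (fst z) * \<zeta> (snd z)" "gradx ?\<psi> z = \<rho> (fst z) *\<^sub>R grad3 \<zeta> (snd z)" for z
      using test_fun_product(2,3)[OF \<rho> \<zeta>, of "fst z" "snd z"] by simp_all
    have dr: "deriv \<rho> \<in> borel_measurable borel"
      by (intro borel_measurable_continuous_onI smooth_imp_continuous smooth_real_deriv(2) test_fun_imp_smooth[OF \<rho>])
    have [measurable]: "\<rho> \<in> borel_measurable borel" "\<zeta> \<in> borel_measurable borel" "grad3 \<zeta> \<in> borel_measurable borel" "deriv \<rho> \<in> borel_measurable borel"
      using test_fun_measurable[OF \<rho>] test_fun_measurable[OF \<zeta>] test_fun_grad3_measurable[OF \<zeta>] dr by auto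
    have b1: "(\<lambda>z. U z * (deriv \<rho> (fst z) * \<zeta> (snd z))) \<in> borel_measurable borel"
      "(\<lambda>z. V z * (\<rho> (fst z) * \<zeta> (snd z))) \<in> borel_measurable borel"
      unfolding borel_prod[symmetric] by measurable
    have d1: "(LINT z|lebesgue_on ?Q. u (fst z) (snd z) * dt ?\<psi> z) = (LINT z|lborel. U z * (deriv \<rho> (fst z) * \<zeta> (snd z)))"
      by (rule lebesgue_on_transfer(2)[OF Q b1(1)]) (use U(2) eqs in \<open>auto elim: eventually_mono simp: dt\<psi>\<close>)
    have d2: "(LINT z|lebesgue_on ?Q. ut (fst z) (snd z) * ?\<psi> z) = (LINT z|lborel. V z * (\<rho> (fst z) * \<zeta> (snd z)))"
      by (rule lebesgue_on_transfer(2)[OF Q b1(2)]) (use V(2) eqs in \<open>auto elim: eventually_mono\<close>)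
    have d0: "(LINT z|lebesgue_on ?Q. u (fst z) (snd z) * dt ?\<psi> z) = - (LINT z|lebesgue_on ?Q. ut (fst z) (snd z) * ?\<psi> z)"
      using wdt \<psi> unfolding weak_dt_def by (elim allE impE)
    show "(LINT z|?M. U z * (deriv \<rho> (fst z) * \<zeta> (snd z))) = - (LINT z|?M. V z * (\<rho> (fst z) * \<zeta> (snd z)))"
      using d0 unfolding d1 d2 lborel_prod .
    define L where "L z = indicator ?Q z * (- V z * (deriv \<rho> (fst z) * \<zeta> (snd z)) + \<sigma> (U z) * V z * (\<rho> (fst z) * \<zeta> (snd z))
        + W z \<bullet> (\<rho> (fst z) *\<^sub>R grad3 \<zeta> (snd z)) + f (U z) * (\<rho> (fst z) * \<zeta> (snd z)))" for z
    define r where "r z = indicator ?Q z * (\<phi>' (snd z) * (\<rho> (fst z) * \<zeta> (snd z)))" for z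
    have Lm: "L \<in> borel_measurable borel" unfolding L_def borel_prod[symmetric] by measurable
    have rm: "r \<in> borel_measurable borel" unfolding r_def borel_prod[symmetric] by measurable
    have eL: "AE z in lborel. z \<in> ?Q \<longrightarrow> - ut (fst z) (snd z) * dt ?\<psi> z + \<sigma> (u (fst z) (snd z)) * ut (fst z) (snd z) * ?\<psi> z
            + gu (fst z) (snd z) \<bullet> gradx ?\<psi> z + f (u (fst z) (snd z)) * ?\<psi> z = L z"
      using eqs by eventually_elim (auto simp: L_def dt\<psi>)
    have "AE z in ?M. snd z \<in> \<Omega> \<longrightarrow> \<phi> (snd z) = \<phi>' (snd z)" by (rule AE_snd_pair[OF phi(3)])
    then have e\<phi>: "AE z in (lborel :: (real \<times> (real^3)) measure). snd z \<in> \<Omega> \<longrightarrow> \<phi> (snd z) = \<phi>' (snd z)" unfolding lborel_prod .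
    have er: "AE z in lborel. z \<in> ?Q \<longrightarrow> \<phi> (snd z) * ?\<psi> z = r z"
      using e\<phi> by eventually_elim (auto simp: r_def cyl_def)
    have "(LINT z|lborel. L z) = (LINT z|lborel. r z)"
      using weq[OF \<psi>] lebesgue_on_transfer(2)[OF Q Lm _ eL] lebesgue_on_transfer(2)[OF Q rm _ er] by (simp add: L_def r_def)
    then have LR: "(LINT z|?M. L z) = (LINT z|?M. r z)" unfolding lborel_prod .
    obtain R where R: "R \<ge> 0" "\<And>t. \<bar>\<rho> t\<bar> \<le> R" using test_fun_bounded[OF \<rho>] by metis
    obtain Z where Z: "Z \<ge> 0" "\<And>t. \<bar>\<zeta> t\<bar> \<le> Z" using test_fun_bounded[OF \<zeta>] by metis
    have ri: "integrable ?M r"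
    proof -
      have "integrable ?M (\<lambda>z. indicator ?Q z * \<phi>' (snd z))"
      proof (rule int1)
        have "(indicator ?Q z * \<phi>' (snd z))\<^sup>2 = indicator {0<..<T} (fst z) * (\<phi>' (snd z))\<^sup>2" for z :: "real \<times> (real^3)"
          using phi(2)[of "snd z"] by (cases z) (auto simp: indicator_def cyl_def)
        then show "integrable ?M (\<lambda>z. (indicator ?Q z * \<phi>' (snd z))\<^sup>2)" using i\<phi> by simp
      qed (auto)
      then have "integrable ?M (\<lambda>z. (indicator ?Q z * \<phi>' (snd z)) * (\<rho> (fst z) * \<zeta> (snd z)))"
      proof (rule integrable_mult_bounded[where B = "R * Z"])
        show "\<bar>\<rho> (fst z) * \<zeta> (snd z)\<bar> \<le> R * Z" for z :: "real \<times> (real^3)" unfolding abs_mult using R Z by (intro mult_mono) auto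
      qed measurable
      then show ?thesis by (simp add: r_def[abs_def] mult.assoc)
    qed
    have main_eq: "E z * (\<rho> (fst z) * \<zeta> (snd z)) - V z * (deriv \<rho> (fst z) * \<zeta> (snd z)) + \<rho> (fst z) * (W z \<bullet> grad3 \<zeta> (snd z)) = L z - r z" for z
      using V(2)[of z] W(2)[of z] by (cases "z \<in> ?Q") (auto simp: E_def L_def r_def algebra_simps)
    have Li: "integrable ?M L"
    proof -
      obtain R' where R'0: "R' \<ge> 0" and R': "\<And>t. \<bar>deriv \<rho> t\<bar> \<le> R'" using test_fun_deriv_bounded[OF \<rho>] by metis
      obtain Y where Y: "Y \<ge> 0" "\<And>x. norm (grad3 \<zeta> x) \<le> Y" using test_fun_grad3_bounded[OF \<zeta>] by metis
      have a1: "integrable ?M (\<lambda>z. E z * (\<rho> (fst z) * \<zeta> (snd z)))"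
      proof (rule integrable_mult_bounded[OF iE, where B = "R * Z"])
        show "\<bar>\<rho> (fst z) * \<zeta> (snd z)\<bar> \<le> R * Z" for z :: "real \<times> (real^3)" unfolding abs_mult using R Z by (intro mult_mono) auto
      qed measurable
      have a2: "integrable ?M (\<lambda>z. V z * (deriv \<rho> (fst z) * \<zeta> (snd z)))"
      proof (rule integrable_mult_bounded[OF iV, where B = "R' * Z"])
        show "\<bar>deriv \<rho> (fst z) * \<zeta> (snd z)\<bar> \<le> R' * Z" for z :: "real \<times> (real^3)" unfolding abs_mult using R' R'0 Z by (intro mult_mono) auto
      qed measurable
      have a3: "integrable ?M (\<lambda>z. \<rho> (fst z) * (W z \<bullet> grad3 \<zeta> (snd z)))"
      proof (rule Bochner_Integration.integrable_bound)
        show "integrable ?M (\<lambda>z. R * Y * (indicator ?Q z + (norm (W z))\<^sup>2))" using iQ iW2 by simp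
        show "AE z in ?M. norm (\<rho> (fst z) * (W z \<bullet> grad3 \<zeta> (snd z))) \<le> norm (R * Y * (indicator ?Q z + (norm (W z))\<^sup>2))"
        proof (rule AE_I2)
          fix z
          have n: "norm (W z) \<le> indicator ?Q z + (norm (W z))\<^sup>2" using young1[of "norm (W z)"] W(2)[of z] by (cases "z \<in> ?Q") auto
          have "\<bar>W z \<bullet> grad3 \<zeta> (snd z)\<bar> \<le> norm (W z) * norm (grad3 \<zeta> (snd z))" by (rule Cauchy_Schwarz_ineq2)
          also have "\<dots> \<le> (indicator ?Q z + (norm (W z))\<^sup>2) * Y" using n Y by (intro mult_mono) auto
          finally have "\<bar>\<rho> (fst z)\<bar> * \<bar>W z \<bullet> grad3 \<zeta> (snd z)\<bar> \<le> R * ((indicator ?Q z + (norm (W z))\<^sup>2) * Y)"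
            using R by (intro mult_mono) auto
          then show "norm (\<rho> (fst z) * (W z \<bullet> grad3 \<zeta> (snd z))) \<le> norm (R * Y * (indicator ?Q z + (norm (W z))\<^sup>2))"
            using R Y by (simp add: abs_mult mult_ac)
        qed
      qed measurable
      \<comment> \<open>L is integrable because of this regrouping, whose terms are integrable one
        by one; only then may the integral of L - r be split.\<close>
      have "L z = (E z * (\<rho> (fst z) * \<zeta> (snd z)) - V z * (deriv \<rho> (fst z) * \<zeta> (snd z)) + \<rho> (fst z) * (W z \<bullet> grad3 \<zeta> (snd z))) + r z" for z
        using main_eq[of z] by simp
      then have "L = (\<lambda>z. (E z * (\<rho> (fst z) * \<zeta> (snd z)) - V z * (deriv \<rho> (fst z) * \<zeta> (snd z)) + \<rho> (fst z) * (W z \<bullet> grad3 \<zeta> (snd z))) + r z)" by (rule ext)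
      then show ?thesis using a1 a2 a3 ri by simp
    qed
    show "(LINT z|?M. E z * (\<rho> (fst z) * \<zeta> (snd z)) - V z * (deriv \<rho> (fst z) * \<zeta> (snd z)) + \<rho> (fst z) * (W z \<bullet> grad3 \<zeta> (snd z))) = 0"
      unfolding main_eq using Li ri LR by simp
  qed
  have dw: "damped_wave \<Omega> T E U V W"
  proof
    show "AE t in lborel. t \<in> {0<..<T} \<longrightarrow> H10_grad \<Omega> (\<lambda>x. U (t, x)) (\<lambda>x. W (t, x))"
      using main by eventually_elim auto
  qed (use Om T meas Em U(2) V(2) W(2) iU iV iE iU2 iV2 iW2 dtw weqB in \<open>simp_all add: E_def\<close>)
  show ?thesis
  proof (rule that[OF dw E_def sV(1) iU6 sV(2), of "max (32768 * K0 ^ 3) K0"])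
    show "AE t in lborel. t \<in> {0<..<T} \<longrightarrow> (AE x in lborel. x \<in> \<Omega> \<longrightarrow> u t x = U (t, x) \<and> ut t x = V (t, x))"
      using sec'
    proof eventually_elim
      case (elim t)
      then show ?case by (auto elim: eventually_mono)
    qed
    show "AE t in lborel. t \<in> {0<..<T} \<longrightarrow> integrable lborel (\<lambda>x. U (t, x) ^ 6) \<and> (LINT x|lborel. U (t, x) ^ 6) \<le> max (32768 * K0 ^ 3) K0"
      using U6 by eventually_elim auto
    show "AE t in lborel. t \<in> {0<..<T} \<longrightarrow> integrable lborel (\<lambda>x. (V (t, x))\<^sup>2) \<and> (LINT x|lborel. (V (t, x))\<^sup>2) \<le> max (32768 * K0 ^ 3) K0"
      using V2 by eventually_elim auto
  qed
qed

section \<open>Removing the truncation\<close>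

text \<open>Integrability of the limit is part of the conclusion; this is how the weighted gradient
  becomes integrable once the truncation is gone.\<close>

lemma integrable_Fatou:
  fixes g :: "nat \<Rightarrow> 'a \<Rightarrow> real"
  assumes g: "\<And>n. integrable M (g n)" "\<And>n x. 0 \<le> g n x" "\<And>n. (LINT x|M. g n x) \<le> B"
    and h: "h \<in> borel_measurable M" "\<And>x. (\<lambda>n. g n x) \<longlonglongrightarrow> h x"
  shows "integrable M h" "(LINT x|M. h x) \<le> B"
proof -
  have h0: "0 \<le> h x" for x by (rule LIMSEQ_le_const[OF h(2)]) (use g(2) in blast)
  have B: "0 \<le> B" by (rule order_trans[OF Bochner_Integration.integral_nonneg g(3)]) (rule g(2))
  have "liminf (\<lambda>n. ennreal (g n x)) = ennreal (h x)" for x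
    by (rule lim_imp_Liminf) (use h(2) in \<open>auto intro!: tendsto_ennrealI\<close>)
  then have "(\<integral>\<^sup>+x. ennreal (h x) \<partial>M) = (\<integral>\<^sup>+x. liminf (\<lambda>n. ennreal (g n x)) \<partial>M)" by simp
  also have "\<dots> \<le> liminf (\<lambda>n. \<integral>\<^sup>+x. ennreal (g n x) \<partial>M)"
    by (rule nn_integral_liminf) (use borel_measurable_integrable[OF g(1)] in measurable)
  also have "\<dots> = liminf (\<lambda>n. ennreal (LINT x|M. g n x))"
    using g(1,2) by (simp add: nn_integral_eq_integral)
  also have "\<dots> \<le> liminf (\<lambda>n::nat. ennreal B)"
    by (rule Liminf_mono) (use g(3) in \<open>auto intro!: always_eventually ennreal_leI\<close>)
  also have "\<dots> = ennreal B" by (simp add: Liminf_const)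
  finally have l: "(\<integral>\<^sup>+x. ennreal (h x) \<partial>M) \<le> ennreal B" .
  show i: "integrable M h"
    by (rule integrableI_nonneg) (use h(1) h0 l in \<open>auto simp: le_less_trans\<close>)
  show "(LINT x|M. h x) \<le> B"
    using l nn_integral_eq_integral[OF i] h0 B by (simp add: ennreal_le_iff)
qed

lemma cube_powr: "(x ^ 3) powr (1 / 3) = x" if "x \<ge> 0" for x :: real
proof (cases "x = 0")
  case False
  have "(x ^ 3) powr (1 / 3) = (x powr 3) powr (1 / 3)" using that by simp
  also have "\<dots> = x powr (3 * (1 / 3))" by (rule powr_powr)
  also have "\<dots> = x" using that by simp
  finally show ?thesis .
qed simp

lemma powr_inverse_le:
  fixes x R :: real
  assumes "0 \<le> x" "x powr (1 / real n) \<le> R" "n > 0"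
  shows "x \<le> R ^ n"
proof (cases "x = 0")
  case False
  have "x = (x powr (1 / real n)) ^ n" using False assms by (subst powr_power) auto
  also have "\<dots> \<le> R ^ n" using assms by (intro power_mono) auto
  finally show ?thesis .
next
  case True
  then show ?thesis using assms by simp
qed

lemma mult_sqrt_sq_tendsto: "(\<lambda>n. (mult_sqrt k n s)\<^sup>2) \<longlonglongrightarrow> (1 + s * s) powr (k / 2)"
proof -
  have "(\<lambda>n. (1 + s * s) powr (k / 2) * (1 + s * s * inverse (real (Suc n))) powr (- 2))
      \<longlonglongrightarrow> (1 + s * s) powr (k / 2) * (1 + s * s * 0) powr (- 2)"
    by (intro tendsto_intros LIMSEQ_inverse_real_of_nat) simp
  then show ?thesis by (simp add: mult_sqrt_sq)
qed

context damped_wave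
begin

text \<open>The limit, as n tends to infinity, of the densities \<open>W z \<bullet> Y z\<close>
  that belong to the truncated multipliers.\<close>

definition grad_weight :: "real \<Rightarrow> real \<times> (real^3) \<Rightarrow> real" where
  "grad_weight k z = (1 + U z * U z) powr (k / 2) * (norm (W z))\<^sup>2"

lemma grad_weight_measurable [measurable]: "grad_weight k \<in> borel_measurable (borel \<Otimes>\<^sub>M borel)"
  unfolding grad_weight_def by measurable

lemma grad_weight_nonneg: "0 \<le> grad_weight k z"
  by (simp add: grad_weight_def)

text \<open>The right-hand side does not contain n, although the multiplier, its bounds and the
  cut-off all do.\<close>

lemma truncated_weight_bound:
  fixes \<sigma> f :: "real \<Rightarrow> real" and \<phi> :: "real^3 \<Rightarrow> real"
  assumes k: "0 \<le> k" "k \<le> 2" and m: "0 \<le> m" "m + k \<le> 4"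
    and E_eq: "\<And>z. E z = indicator (cyl T \<Omega>) z * (\<sigma> (U z) * V z + f (U z) - \<phi> (snd z))"
    and sig: "continuous_on UNIV \<sigma>" "\<And>s. \<sigma> s \<ge> 0" "\<And>s. (1 + s * s) powr (k / 2) \<le> c0 * \<sigma> s" "c0 \<ge> 0"
    and S: "S \<ge> 0" "\<And>s. \<bar>\<sigma> s\<bar> \<le> S * (1 + \<bar>s\<bar> powr m)" and S6: "\<And>s. \<sigma> s \<le> S' * (1 + s ^ 6)"
    and f: "continuous_on UNIV f" "F \<ge> 0" "\<forall>s y. s * y \<ge> 0 \<longrightarrow> - f s * y \<le> F * (1 + \<bar>s\<bar>) * \<bar>y\<bar>"
    and i: "integrable (lborel \<Otimes>\<^sub>M lborel) (\<lambda>z. \<sigma> (U z) * (V z)\<^sup>2)" "integrable (lborel \<Otimes>\<^sub>M lborel) (\<lambda>z. U z ^ 6)"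
      "integrable lborel (\<lambda>x. (indicator \<Omega> x * \<phi> x)\<^sup>2)" "emeasure lborel \<Omega> < \<infinity>" "\<phi> \<in> borel_measurable borel"
    and R: "R \<ge> 1" "(LINT z|(lborel \<Otimes>\<^sub>M lborel). \<sigma> (U z) * (V z)\<^sup>2) \<le> R"
      "AE t in lborel. t \<in> {0<..<T} \<longrightarrow> (LINT x|lborel. U (t, x) ^ 6) \<le> R ^ 6"
      "AE t in lborel. t \<in> {0<..<T} \<longrightarrow> (LINT x|lborel. (V (t, x))\<^sup>2) \<le> R ^ 2"
  defines "K \<equiv> 8 + 8 * S + 4 * F" and "vol \<equiv> measure lborel \<Omega>" and "\<phi>2 \<equiv> (LINT x|lborel. (indicator \<Omega> x * \<phi> x)\<^sup>2)"
    and "\<theta> \<equiv> \<lambda>n::nat. bump ((real n + 4)\<^sup>2) (T / (real n + 4)) (T - T / (real n + 4))"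
  shows "integrable (lborel \<Otimes>\<^sub>M lborel) (\<lambda>z. \<theta> n (fst z) * (mult_sqrt k n (U z))\<^sup>2 * (norm (W z))\<^sup>2)"
    "(LINT z|(lborel \<Otimes>\<^sub>M lborel). \<theta> n (fst z) * (mult_sqrt k n (U z))\<^sup>2 * (norm (W z))\<^sup>2)
      \<le> (2 * (1 + K * (vol + 1)) + c0 + \<phi>2 + K * (vol + 1)) * (R ^ 6 * (1 + T))"
proof -
  let ?M = "lborel \<Otimes>\<^sub>M lborel :: (real \<times> (real^3)) measure"
  \<comment> \<open>The summand 4 makes 2 a < T already for n = 0, so the cut-off interval is never
    empty.\<close>
  define a where "a = T / (real n + 4)"
  have a0: "0 < a" unfolding a_def using T by (intro divide_pos_pos) auto
  have "a * (real n + 4) = T" by (simp add: a_def)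
  moreover have "0 \<le> a * real n" using a0 by simp
  ultimately have a: "0 < a" "a < T - a" using a0 unfolding distrib_left by linarith+
  have c: "(real n + 4)\<^sup>2 > 0" by simp
  note th = expbump_cutoff[OF c a]
  have \<theta>: "\<theta> n = bump ((real n + 4)\<^sup>2) a (T - a)" by (simp add: \<theta>_def a_def)
  note th = th[folded \<theta>]
  obtain \<eta> B where \<eta>: "smooth \<eta>" "\<eta> 0 = 0" "\<And>s. \<bar>\<eta> s\<bar> \<le> B" "\<And>s. deriv \<eta> s = (mult_sqrt k n s)\<^sup>2"
    "\<And>s. \<bar>\<eta> s\<bar> \<le> (1 + s * s) powr (k / 2) * \<bar>s\<bar>" "\<And>s. s * \<eta> s \<ge> 0"
  proof (rule ex_multiplier[OF k, of n])
    fix h B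
    assume h: "smooth h" "h 0 = 0" "\<And>s. \<bar>h s\<bar> \<le> B" "\<And>s. deriv h s = (mult_sqrt k n s)\<^sup>2"
      "\<And>s. \<bar>h s\<bar> \<le> (1 + s * s) powr (k / 2) * \<bar>s\<bar>" "\<And>s. s * h s \<ge> 0"
    show thesis by (rule that[of h B]; fact h)
  qed
  have "continuous_on UNIV (\<lambda>s. \<sigma> s * \<eta> s)" by (intro continuous_intros sig(1) smooth_imp_continuous[OF \<eta>(1)])
  then obtain G where G: "\<And>s. (G has_real_derivative \<sigma> s * \<eta> s) (at s)" "G 0 = 0"
  proof (rule ex_antiderivative)
    fix h
    assume h: "\<And>s. (h has_real_derivative \<sigma> s * \<eta> s) (at s)" "h 0 = 0"
    show thesis by (rule that[of h]; fact h)
  qed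
  have Gb: "\<bar>G s\<bar> \<le> 8 * S * (1 + s ^ 6)" for s
    by (rule damping_primitive_bound[OF k m S \<eta>(5) G])
  obtain C where C: "C \<ge> 0" "\<And>t. \<bar>deriv (\<theta> n) t\<bar> \<le> C" using test_fun_deriv_bounded[OF th(1)] by metis
  have t1: "\<bar>\<theta> n t\<bar> \<le> max 1 C" for t using th(2,3)[of t] by (simp add: max_def)
  have t2: "\<bar>deriv (\<theta> n) t\<bar> \<le> max 1 C" for t using C(2)[of t] by simp
  have L: "\<bar>deriv \<eta> s\<bar> \<le> real (Suc n)" for s unfolding \<eta>(4) using mult_sqrt_le(2)[OF k, of n s] by simp
  \<comment> \<open>\<open>real (Suc n)\<close> bounds \<eta>', and \<open>max 1 C\<close> bounds
    \<theta> and \<theta>' at once. Both depend on n but disappear in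
    \<open>a_priori_estimate\<close>.\<close>
  interpret X: damped_wave_test \<Omega> T E U V W \<eta> "\<theta> n" B "real (Suc n)" "max 1 C" a
    by unfold_locales (fact \<eta>(1) \<eta>(2) \<eta>(3) L th(1) t1 t2 a(1) th(4))+
  have sd: "deriv \<eta> s \<le> c0 * \<sigma> s" for s
    using mult_sqrt_sq_le[OF k(1), of n s] sig(3)[of s] unfolding \<eta>(4) by linarith
  have dn: "0 \<le> deriv \<eta> s" for s by (simp add: \<eta>(4))
  note e = multiplier_sq_le[OF k \<eta>(5)]
  have S8: "0 \<le> 8 * S" using S(1) by simp
  have "(LINT z|?M. W z \<bullet> X.Y z) \<le> (2 * (1 + K * (vol + 1)) + c0 + \<phi>2 + K * (vol + 1)) * (R ^ 6 * (1 + T))"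
    unfolding K_def vol_def \<phi>2_def
    by (rule X.a_priori_estimate[OF E_eq sig(1,2) dn sd sig(4) S6 e \<eta>(6) f(1,2) f(3)[rule_format] G S8 Gb i th(2,3,5,6) R])
  moreover have "W z \<bullet> X.Y z = \<theta> n (fst z) * (mult_sqrt k n (U z))\<^sup>2 * (norm (W z))\<^sup>2" for z
    by (simp add: X.Y_def \<eta>(4) power2_norm_eq_inner)
  ultimately show "(LINT z|?M. \<theta> n (fst z) * (mult_sqrt k n (U z))\<^sup>2 * (norm (W z))\<^sup>2)
      \<le> (2 * (1 + K * (vol + 1)) + c0 + \<phi>2 + K * (vol + 1)) * (R ^ 6 * (1 + T))" by simp
  have [measurable]: "\<theta> n \<in> borel_measurable borel" "mult_sqrt k n \<in> borel_measurable borel"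
    using test_fun_measurable[OF th(1)] borel_measurable_continuous_onI[OF smooth_imp_continuous[OF smooth_mult_sqrt[of k n]]] by auto
  show "integrable ?M (\<lambda>z. \<theta> n (fst z) * (mult_sqrt k n (U z))\<^sup>2 * (norm (W z))\<^sup>2)"
  proof (rule Bochner_Integration.integrable_bound)
    show "integrable ?M (\<lambda>z. real (Suc n) * (norm (W z))\<^sup>2)" using int(6) by (rule integrable_mult_right)
    show "AE z in ?M. norm (\<theta> n (fst z) * (mult_sqrt k n (U z))\<^sup>2 * (norm (W z))\<^sup>2) \<le> norm (real (Suc n) * (norm (W z))\<^sup>2)"
    proof (rule AE_I2)
      fix z :: "real \<times> (real^3)"
      have "\<theta> n (fst z) * (mult_sqrt k n (U z))\<^sup>2 \<le> 1 * real (Suc n)"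
        using th(3) mult_sqrt_le(2)[OF k] by (rule mult_mono) auto
      then have "\<theta> n (fst z) * (mult_sqrt k n (U z))\<^sup>2 * (norm (W z))\<^sup>2 \<le> (1 * real (Suc n)) * (norm (W z))\<^sup>2"
        by (rule mult_right_mono) simp
      then show "norm (\<theta> n (fst z) * (mult_sqrt k n (U z))\<^sup>2 * (norm (W z))\<^sup>2) \<le> norm (real (Suc n) * (norm (W z))\<^sup>2)"
        using th(2)[of "fst z"] by (simp add: abs_mult)
    qed
  qed measurable
qed

lemma grad_weight_tendsto:
  "(\<lambda>n. bump ((real n + 4)\<^sup>2) (T / (real n + 4)) (T - T / (real n + 4)) (fst z) * (mult_sqrt k n (U z))\<^sup>2 * (norm (W z))\<^sup>2) \<longlonglongrightarrow> grad_weight k z"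
proof (cases "z \<in> cyl T \<Omega>")
  case True
  then have t: "fst z \<in> {0<..<T}" by (auto simp: cyl_def)
  show ?thesis
    using tendsto_mult[OF tendsto_mult[OF cutoff_tendsto[OF T t] mult_sqrt_sq_tendsto] tendsto_const[of "(norm (W z))\<^sup>2"]]
    by (simp add: grad_weight_def)
qed (simp add: zero(4) grad_weight_def)

text \<open>
  \<open>128^3\<close> is the product of the Sobolev constant \<open>32768\<close> and the factor \<open>2^6\<close> lost in the lower bound of
  \<open>ex_sobolev_multiplier\<close>.
\<close>

lemma section_power_bound:
  assumes k: "0 \<le> k" "k \<le> 2" and i: "integrable (lborel \<Otimes>\<^sub>M lborel) (grad_weight k)"
  shows "AE t in lborel. t \<in> {0<..<T} \<longrightarrow> integrable lborel (\<lambda>x. \<bar>U (t, x)\<bar> powr (3 * k + 6)) \<and>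
    (LINT x|lborel. \<bar>U (t, x)\<bar> powr (3 * k + 6)) \<le> (128 * (LINT x|lborel. grad_weight k (t, x))) ^ 3"
  using H10 lborel_pair.AE_integrable_fst'[OF i]
proof eventually_elim
  case (elim t)
  show ?case
  proof
    assume t: "t \<in> {0<..<T}"
    have H10t: "H10_grad \<Omega> (\<lambda>x. U (t, x)) (\<lambda>x. W (t, x))" and gi: "integrable lborel (\<lambda>x. grad_weight k (t, x))" using elim t by auto
    have z: "U (t, x) = 0" "W (t, x) = 0" if "x \<notin> \<Omega>" for x using zero(1,4)[of "(t, x)"] that by (auto simp: cyl_def)
    have S: "\<Omega> \<in> sets borel" using Om by simp
    define j where "j = (LINT x|lborel. grad_weight k (t, x))"
    \<comment> \<open>The sixth power of the lower bound for |H(u)|; since 6 (k/2 + 1) = 3 k + 6,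
      its limit contains the power of u that is wanted.\<close>
    define q where "q n x = (\<bar>U (t, x)\<bar> powr (k / 2 + 1) / (2 * (1 + U (t, x) * U (t, x) * inverse (real (Suc n))))) ^ 6" for n :: nat and x
    have qm: "q n \<in> borel_measurable lborel" for n unfolding q_def by measurable
    have pos: "1 + U (t, x) * U (t, x) * inverse (real (Suc n)) > 0" for x and n :: nat by (rule one_plus_pos)
    have q0: "0 \<le> q n x" for n x unfolding q_def by simp
    have key: "integrable lborel (q n) \<and> (LINT x|lborel. q n x) \<le> 32768 * j ^ 3" for n
    proof -
      obtain H where H: "smooth H" "H 0 = 0" "\<And>s. deriv H s = mult_sqrt k n s"
        "\<And>s. \<bar>s\<bar> powr (k / 2 + 1) / (2 * (1 + s * s * inverse (real (Suc n)))) \<le> \<bar>H s\<bar>"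
      proof (rule ex_sobolev_multiplier[OF k, of n])
        fix h
        assume h: "smooth h" "h 0 = 0" "\<And>s. deriv h s = mult_sqrt k n s"
          "\<And>s. \<bar>s\<bar> powr (k / 2 + 1) / (2 * (1 + s * s * inverse (real (Suc n)))) \<le> \<bar>h s\<bar>"
        show thesis by (rule that[of h]; fact h)
      qed
      have Hb: "\<bar>deriv H s\<bar> \<le> real (Suc n)" for s unfolding H(3) by (rule mult_sqrt_le(1)[OF k])
      note sob = sobolev_H10[OF Om H10t H(1,2) Hb]
      have [measurable]: "H \<in> borel_measurable borel" "mult_sqrt k n \<in> borel_measurable borel"
        using borel_measurable_continuous_onI[OF smooth_imp_continuous[OF H(1)]]
          borel_measurable_continuous_onI[OF smooth_imp_continuous[OF smooth_mult_sqrt[of k n]]] by auto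
      have m1: "(\<lambda>x. H (U (t, x)) ^ 6) \<in> borel_measurable borel" by measurable
      have m2: "(\<lambda>x. (deriv H (U (t, x)))\<^sup>2 * (norm (W (t, x)))\<^sup>2) \<in> borel_measurable borel" unfolding H(3) by measurable
      have i1: "integrable lborel (\<lambda>x. H (U (t, x)) ^ 6)"
        using sob(1) lebesgue_on_borel(1)[OF S m1] z H(2) by simp
      have e1: "(LINT x|lebesgue_on \<Omega>. H (U (t, x)) ^ 6) = (LINT x|lborel. H (U (t, x)) ^ 6)"
        by (rule lebesgue_on_borel(2)[OF S m1]) (simp add: z H(2))
      have e2: "(LINT x|lebesgue_on \<Omega>. (deriv H (U (t, x)))\<^sup>2 * (norm (W (t, x)))\<^sup>2) = (LINT x|lborel. (deriv H (U (t, x)))\<^sup>2 * (norm (W (t, x)))\<^sup>2)"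
        by (rule lebesgue_on_borel(2)[OF S m2]) (simp add: z)
      have le: "(deriv H (U (t, x)))\<^sup>2 * (norm (W (t, x)))\<^sup>2 \<le> grad_weight k (t, x)" for x
        unfolding grad_weight_def H(3) by (intro mult_right_mono mult_sqrt_sq_le k) simp
      have i2: "integrable lborel (\<lambda>x. (deriv H (U (t, x)))\<^sup>2 * (norm (W (t, x)))\<^sup>2)"
        by (rule Bochner_Integration.integrable_bound[OF gi]) (use m2 le grad_weight_nonneg[of k] in \<open>auto intro!: AE_I2\<close>)
      have "(LINT x|lborel. (deriv H (U (t, x)))\<^sup>2 * (norm (W (t, x)))\<^sup>2) \<le> j"
        unfolding j_def by (rule integral_mono[OF i2 gi le])
      then have "(LINT x|lborel. (deriv H (U (t, x)))\<^sup>2 * (norm (W (t, x)))\<^sup>2) ^ 3 \<le> j ^ 3"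
        by (rule power_mono) (intro Bochner_Integration.integral_nonneg mult_nonneg_nonneg zero_le_power2)
      then have b: "(LINT x|lborel. H (U (t, x)) ^ 6) \<le> 32768 * j ^ 3" using sob(2) unfolding e1 e2 by linarith
      have qH: "q n x \<le> H (U (t, x)) ^ 6" for x
      proof -
        have "q n x \<le> \<bar>H (U (t, x))\<bar> ^ 6" unfolding q_def by (rule power_mono[OF H(4)]) (use pos[of x n] in simp)
        then show ?thesis by simp
      qed
      have qi: "integrable lborel (q n)"
        by (rule Bochner_Integration.integrable_bound[OF i1 qm]) (use q0 qH in \<open>auto intro!: AE_I2 simp: abs_of_nonneg\<close>)
      show ?thesis using qi integral_mono[OF qi i1 qH] b by linarith
    qed
    have pw: "(y powr (k / 2 + 1)) ^ 6 = y powr (3 * k + 6)" for y :: real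
      by (cases "y = 0") (simp_all add: powr_power algebra_simps)
    have lim: "(\<lambda>n. q n x) \<longlonglongrightarrow> \<bar>U (t, x)\<bar> powr (3 * k + 6) / 64" for x
    proof -
      have "(\<lambda>n. q n x) \<longlonglongrightarrow> (\<bar>U (t, x)\<bar> powr (k / 2 + 1) / (2 * (1 + U (t, x) * U (t, x) * 0))) ^ 6"
        unfolding q_def by (intro tendsto_intros LIMSEQ_inverse_real_of_nat) simp
      then show ?thesis by (simp add: power_divide pw)
    qed
    have hm: "(\<lambda>x. \<bar>U (t, x)\<bar> powr (3 * k + 6) / 64) \<in> borel_measurable lborel" by measurable
    note fat = integrable_Fatou[of lborel q "32768 * j ^ 3", OF conjunct1[OF key] q0 conjunct2[OF key] hm lim]
    have "integrable lborel (\<lambda>x. \<bar>U (t, x)\<bar> powr (3 * k + 6))" using integrable_mult_right[OF fat(1), of 64] by simp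
    moreover have "(LINT x|lborel. \<bar>U (t, x)\<bar> powr (3 * k + 6)) \<le> (128 * j) ^ 3"
      using fat(2) by (simp add: power_mult_distrib)
    ultimately show "integrable lborel (\<lambda>x. \<bar>U (t, x)\<bar> powr (3 * k + 6)) \<and>
      (LINT x|lborel. \<bar>U (t, x)\<bar> powr (3 * k + 6)) \<le> (128 * (LINT x|lborel. grad_weight k (t, x))) ^ 3" by (simp add: j_def)
  qed
qed

text \<open>\<open>N t\<close> is the power k + 2 of the norm of the slice with exponent 3 k + 6,
  because (k + 2)/(3 k + 6) = 1/3. The cube in \<open>section_power_bound\<close> cancels this root,
  leaving an integral that is linear in the weighted gradient.\<close>

lemma mixed_norm_bound:
  assumes k: "0 \<le> k" "k \<le> 2" and i: "integrable (lborel \<Otimes>\<^sub>M lborel) (grad_weight k)"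
    and b: "(LINT z|(lborel \<Otimes>\<^sub>M lborel). grad_weight k z) \<le> B"
  defines "N \<equiv> \<lambda>t. (LINT x|lborel. \<bar>U (t, x)\<bar> powr (3 * k + 6)) powr (1 / 3)"
  shows "integrable lborel N" "(LINT t|lborel. N t) \<le> 128 * B" "N \<in> borel_measurable borel"
proof -
  let ?j = "\<lambda>t. LINT x|lborel. grad_weight k (t, x)"
  show Nm: "N \<in> borel_measurable borel" unfolding N_def by measurable
  have ji: "integrable lborel ?j" by (rule lborel_pair.integrable_fst'[OF i])
  have j0: "0 \<le> ?j t" for t by (rule Bochner_Integration.integral_nonneg) (rule grad_weight_nonneg)
  have jB: "(LINT t|lborel. ?j t) \<le> B" using lborel_pair.integral_fst'[OF i] b by simp
  have N0: "0 \<le> N t" for t by (simp add: N_def)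
  have Nj: "AE t in lborel. N t \<le> 128 * ?j t"
    using section_power_bound[OF k i]
  proof eventually_elim
    case (elim t)
    show ?case
    proof (cases "t \<in> {0<..<T}")
      case True
      have "N t \<le> ((128 * ?j t) ^ 3) powr (1 / 3)" unfolding N_def using elim True by (intro powr_mono2) auto
      also have "\<dots> = 128 * ?j t" by (rule cube_powr) (use j0[of t] in simp)
      finally show ?thesis .
    next
      case False
      then have "U (t, x) = 0" for x using zero(1)[of "(t, x)"] by (auto simp: cyl_def)
      then have "N t = 0" by (simp add: N_def)
      then show ?thesis using j0[of t] by simp
    qed
  qed
  show iN: "integrable lborel N"
    by (rule Bochner_Integration.integrable_bound[OF integrable_mult_right[OF ji, of 128]])
      (use Nm Nj N0 j0 in \<open>auto elim!: eventually_mono simp: abs_of_nonneg\<close>)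
  have "(LINT t|lborel. N t) \<le> (LINT t|lborel. 128 * ?j t)"
    by (rule integral_mono_AE[OF iN integrable_mult_right[OF ji] Nj])
  then show "(LINT t|lborel. N t) \<le> 128 * B" using jB by simp
qed

end

section \<open>The estimate for weak solutions\<close>

lemma powr_le_of_le_square:
  fixes X Y e :: real
  assumes "0 \<le> X" "X \<le> Y\<^sup>2" "1 \<le> Y" "0 \<le> e" "e \<le> 1 / 2"
  shows "X powr e \<le> Y"
proof -
  have "X powr e \<le> (Y\<^sup>2) powr e" using assms by (intro powr_mono2) auto
  also have "\<dots> = (Y powr 2) powr e" using assms by simp
  also have "\<dots> = Y powr (2 * e)" by (rule powr_powr)
  also have "\<dots> \<le> Y powr 1" using assms by (intro powr_mono) auto
  finally show ?thesis using assms by simp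
qed

text \<open>As 1 + T <= (1 + T)^2, the integral is at most the square of A R^3 (1 + T). An exponent
  up to 1/2 leaves at most this base, which is at least 1, and R >= 1 raises R^3 T and R^3 to the
  powers claimed.\<close>

lemma root_of_integral_bound:
  fixes X K R T e :: real
  assumes X: "0 \<le> X" "X \<le> 128 * (K * (R ^ 6 * (1 + T)))" and K: "0 \<le> K" and R: "1 \<le> R" and T: "0 < T" and e: "0 \<le> e" "e \<le> 1 / 2"
  shows "X powr e \<le> (1 + 128 * K) * (R ^ 4 * T + R ^ 5)"
proof -
  define A where "A = 1 + 128 * K"
  have A: "1 \<le> A" "128 * K \<le> A\<^sup>2"
  proof -
    show "1 \<le> A" using K by (simp add: A_def)
    then have "A * 1 \<le> A * A" by (intro mult_left_mono) auto
    then show "128 * K \<le> A\<^sup>2" by (simp add: A_def power2_eq_square)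
  qed
  have "1 + T \<le> (1 + T)\<^sup>2" using T by (simp add: power2_eq_square algebra_simps)
  then have "(128 * K) * (R ^ 6 * (1 + T)) \<le> A\<^sup>2 * (R ^ 6 * (1 + T)\<^sup>2)"
    using A R T K by (intro mult_mono) auto
  also have "\<dots> = (A * (R ^ 3 * (1 + T)))\<^sup>2" by (simp add: power_mult_distrib power_mult[symmetric])
  finally have 1: "X \<le> (A * (R ^ 3 * (1 + T)))\<^sup>2" using X(2) by (simp add: mult.assoc)
  have R3: "1 \<le> R ^ 3" using R by (rule one_le_power)
  have "1 * 1 \<le> R ^ 3 * (1 + T)" using R3 T R by (intro mult_mono) simp_all
  then have "1 * 1 \<le> A * (R ^ 3 * (1 + T))" using A by (intro mult_mono) auto
  then have "X powr e \<le> A * (R ^ 3 * (1 + T))" using powr_le_of_le_square[OF X(1) 1 _ e] by simp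
  also have "\<dots> \<le> A * (R ^ 4 * T + R ^ 5)"
  proof -
    have "R ^ 3 * T \<le> R ^ 4 * T" using R T by (intro mult_right_mono power_increasing) auto
    moreover have "R ^ 3 \<le> R ^ 5" using R by (intro power_increasing) auto
    ultimately have "R ^ 3 * (1 + T) \<le> R ^ 4 * T + R ^ 5" unfolding distrib_left by linarith
    then show ?thesis using A by (intro mult_left_mono) auto
  qed
  finally show ?thesis by (simp add: A_def)
qed

text \<open>The theorem with all growth constants supplied from outside. None of them refers to T or
  u, and this order of choice is what makes the final constant uniform.\<close>

lemma weak_solution_estimate:
  fixes \<Omega> :: "(real^3) set" and \<sigma> f :: "real \<Rightarrow> real" and \<phi> \<phi>' :: "real^3 \<Rightarrow> real" and k m c0 S F F1 :: real
  assumes dom: "open \<Omega>" "bounded \<Omega>" and T: "T > 0"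
    and k: "0 \<le> k" "k \<le> 2" and m: "0 \<le> m" "m + k \<le> 4"
    and sig: "continuous_on UNIV \<sigma>" "\<And>s. \<sigma> s \<ge> 0" "\<And>s. (1 + s * s) powr (k / 2) \<le> c0 * \<sigma> s" "c0 \<ge> 0"
    and S: "S \<ge> 0" "\<And>s. \<bar>\<sigma> s\<bar> \<le> S * (1 + \<bar>s\<bar> powr m)" and S6: "\<And>s. \<sigma> s \<le> S' * (1 + s ^ 6)"
    and f: "continuous_on UNIV f" "F \<ge> 0" "\<forall>s y. s * y \<ge> 0 \<longrightarrow> - f s * y \<le> F * (1 + \<bar>s\<bar>) * \<bar>y\<bar>"
    and f6: "\<And>s. \<bar>f s\<bar> \<le> F1 * (1 + s ^ 6)"
    and phi: "\<phi>' \<in> borel_measurable borel" "\<forall>x. x \<notin> \<Omega> \<longrightarrow> \<phi>' x = 0" "AE x in lborel. x \<in> \<Omega> \<longrightarrow> \<phi> x = \<phi>' x"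
      "integrable lborel (\<lambda>x. (\<phi>' x)\<^sup>2)"
    and ws: "weak_solution \<Omega> \<sigma> f \<phi> T u ut"
  defines "K \<equiv> 8 + 8 * S + 4 * F" and "vol \<equiv> measure lborel \<Omega>" and "\<phi>2 \<equiv> (LINT x|lborel. (indicator \<Omega> x * \<phi>' x)\<^sup>2)"
    and "R \<equiv> Rconst \<Omega> \<sigma> T u ut"
  shows "AE t in lebesgue_on {0..T}. integrable (lebesgue_on \<Omega>) (\<lambda>x. \<bar>u t x\<bar> powr (3 * k + 6))"
    "integrable (lebesgue_on {0..T}) (\<lambda>t. (Lp_norm (3 * k + 6) \<Omega> (u t)) powr (k + 2))"
    "(LINT t|lebesgue_on {0..T}. (Lp_norm (3 * k + 6) \<Omega> (u t)) powr (k + 2)) powr (1 / (k + 2))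
      \<le> (1 + 128 * (2 * (1 + K * (vol + 1)) + c0 + \<phi>2 + K * (vol + 1))) * (R ^ 4 * T + R ^ 5)"
proof -
  let ?M = "lborel \<Otimes>\<^sub>M lborel :: (real \<times> (real^3)) measure"
  have SO: "\<Omega> \<in> sets borel" using dom by simp
  have ST: "{0..T} \<in> sets borel" by simp
  obtain E U V W K6 where dw: "damped_wave \<Omega> T E U V W"
    and E_eq: "\<And>z. E z = indicator (cyl T \<Omega>) z * (\<sigma> (U z) * V z + f (U z) - \<phi>' (snd z))"
    and iS: "integrable ?M (\<lambda>z. \<sigma> (U z) * (V z)\<^sup>2)" and iU: "integrable ?M (\<lambda>z. U z ^ 6)"
    and eS: "(LINT z|lebesgue_on (cyl T \<Omega>). \<sigma> (u (fst z) (snd z)) * (ut (fst z) (snd z))^2) = (LINT z|?M. \<sigma> (U z) * (V z)\<^sup>2)"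
    and sec: "AE t in lborel. t \<in> {0<..<T} \<longrightarrow> (AE x in lborel. x \<in> \<Omega> \<longrightarrow> u t x = U (t, x) \<and> ut t x = V (t, x))"
    and U6: "AE t in lborel. t \<in> {0<..<T} \<longrightarrow> integrable lborel (\<lambda>x. U (t, x) ^ 6) \<and> (LINT x|lborel. U (t, x) ^ 6) \<le> K6"
    and V2: "AE t in lborel. t \<in> {0<..<T} \<longrightarrow> integrable lborel (\<lambda>x. (V (t, x))\<^sup>2) \<and> (LINT x|lborel. (V (t, x))\<^sup>2) \<le> K6"
  proof (rule weak_solution_borel[OF dom T sig(1) f(1) sig(2) S6 f6 phi(1) phi(2)[rule_format] phi(3,4) ws])
    fix E U V W K6
    assume h: "damped_wave \<Omega> T E U V W"
    "\<And>z. E z = indicator (cyl T \<Omega>) z * (\<sigma> (U z) * V z + f (U z) - \<phi>' (snd z))"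
    "integrable ?M (\<lambda>z. \<sigma> (U z) * (V z)\<^sup>2)" "integrable ?M (\<lambda>z. U z ^ 6)"
    "(LINT z|lebesgue_on (cyl T \<Omega>). \<sigma> (u (fst z) (snd z)) * (ut (fst z) (snd z))^2) = (LINT z|?M. \<sigma> (U z) * (V z)\<^sup>2)"
    "AE t in lborel. t \<in> {0<..<T} \<longrightarrow> (AE x in lborel. x \<in> \<Omega> \<longrightarrow> u t x = U (t, x) \<and> ut t x = V (t, x))"
    "AE t in lborel. t \<in> {0<..<T} \<longrightarrow> integrable lborel (\<lambda>x. U (t, x) ^ 6) \<and> (LINT x|lborel. U (t, x) ^ 6) \<le> K6"
    "AE t in lborel. t \<in> {0<..<T} \<longrightarrow> integrable lborel (\<lambda>x. (V (t, x))\<^sup>2) \<and> (LINT x|lborel. (V (t, x))\<^sup>2) \<le> K6"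
    show thesis by (rule that[of E U V W K6]; fact h)
  qed
  interpret damped_wave \<Omega> T E U V W by (rule dw)
  have z: "U (t, x) = 0" "V (t, x) = 0" if "x \<notin> \<Omega>" for t x using zero(1,2)[of "(t, x)"] that by (auto simp: cyl_def)
  \<comment> \<open>\<open>Rconst\<close> and the claim use the closed time interval, the locale the
    open one; the two endpoints form a null set.\<close>
  have open_Icc: "AE t in lborel. t \<in> {0..T} \<longrightarrow> P t" if "AE t in lborel. t \<in> {0<..<T} \<longrightarrow> P t" for P
    using that AE_lborel_singleton[of 0] AE_lborel_singleton[of T] by eventually_elim auto
  define N where "N t = Lp_norm 6 \<Omega> (u t) + Lp_norm 2 \<Omega> (ut t)" for t
  define N' where "N' t = (LINT x|lborel. U (t, x) ^ 6) powr (1 / 6) + (LINT x|lborel. (V (t, x))\<^sup>2) powr (1 / 2)" for t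
  have mU: "(\<lambda>x. U (t, x) ^ 6) \<in> borel_measurable borel" "(\<lambda>x. (V (t, x))\<^sup>2) \<in> borel_measurable borel"
    "(\<lambda>x. \<bar>U (t, x)\<bar> powr (3 * k + 6)) \<in> borel_measurable borel" for t by measurable
  have NN: "AE t in lborel. t \<in> {0..T} \<longrightarrow> N t = N' t"
  proof (rule open_Icc)
    show "AE t in lborel. t \<in> {0<..<T} \<longrightarrow> N t = N' t" using sec
    proof eventually_elim
      case (elim t)
      show ?case
      proof
        assume "t \<in> {0<..<T}"
        then have e: "AE x in lborel. x \<in> \<Omega> \<longrightarrow> u t x = U (t, x) \<and> ut t x = V (t, x)" using elim by blast
        have e1: "AE x in lborel. x \<in> \<Omega> \<longrightarrow> \<bar>u t x\<bar> powr 6 = U (t, x) ^ 6" and e2: "AE x in lborel. x \<in> \<Omega> \<longrightarrow> \<bar>ut t x\<bar> powr 2 = (V (t, x))\<^sup>2"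
          using e by (eventually_elim, simp)+
        have "(LINT x|lebesgue_on \<Omega>. \<bar>u t x\<bar> powr 6) = (LINT x|lborel. U (t, x) ^ 6)"
          by (rule lebesgue_on_transfer(2)[OF SO mU(1) _ e1]) (simp add: z)
        moreover have "(LINT x|lebesgue_on \<Omega>. \<bar>ut t x\<bar> powr 2) = (LINT x|lborel. (V (t, x))\<^sup>2)"
          by (rule lebesgue_on_transfer(2)[OF SO mU(2) _ e2]) (simp add: z)
        ultimately show "N t = N' t" by (simp only: N_def N'_def Lp_norm_def)
      qed
    qed
  qed
  have N'm: "N' \<in> borel_measurable borel" unfolding N'_def by measurable
  have Nm: "N \<in> borel_measurable (lebesgue_on {0..T})" by (rule lebesgue_on_measurable_AE[OF ST N'm NN])
  define e where "e = esssup (lebesgue_on {0..T}) (\<lambda>t. ereal (N t))"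
  have N0: "0 \<le> N t" for t by (simp add: N_def Lp_norm_def)
  have e0: "0 \<le> e"
  proof -
    \<comment> \<open>The essential supremum of a constant is that constant only when the space has
      positive measure, which T > 0 provides.\<close>
    have "emeasure (lebesgue_on {0..T}) (space (lebesgue_on {0..T})) \<noteq> 0"
      using T by (simp add: emeasure_restrict_space space_restrict_space)
    then have "0 = esssup (lebesgue_on {0..T}) (\<lambda>t. 0 :: ereal)" by (rule esssup_const[symmetric])
    also have "\<dots> \<le> e" unfolding e_def by (rule esssup_mono) (use N0 in auto)
    finally show ?thesis .
  qed
  have N'b: "AE t in lborel. t \<in> {0..T} \<longrightarrow> N' t \<le> K6 powr (1 / 6) + K6 powr (1 / 2)"
  proof (rule open_Icc)
    show "AE t in lborel. t \<in> {0<..<T} \<longrightarrow> N' t \<le> K6 powr (1 / 6) + K6 powr (1 / 2)" using U6 V2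
    proof eventually_elim
      case (elim t)
      show ?case unfolding N'_def
        by (intro impI add_mono powr_mono2) (use elim in auto)
    qed
  qed
  have "AE t in lborel. t \<in> {0..T} \<longrightarrow> ereal (N t) \<le> ereal (K6 powr (1 / 6) + K6 powr (1 / 2))"
    using NN N'b by eventually_elim auto
  then have "AE t in lebesgue_on {0..T}. ereal (N t) \<le> ereal (K6 powr (1 / 6) + K6 powr (1 / 2))"
    unfolding AE_lebesgue_on_iff[OF ST] .
  \<comment> \<open>Finiteness has to be shown: \<open>real_of_ereal\<close> sends an infinite value
    to 0, and R would then fail to bound the slices.\<close>
  then have "e \<le> ereal (K6 powr (1 / 6) + K6 powr (1 / 2))"
    unfolding e_def by (intro esssup_I borel_measurable_ereal Nm)
  then obtain e' where e': "e = ereal e'" "0 \<le> e'" using e0 by (cases e) auto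
  define D where "D = (LINT z|?M. \<sigma> (U z) * (V z)\<^sup>2)"
  have D0: "0 \<le> D" unfolding D_def by (intro Bochner_Integration.integral_nonneg mult_nonneg_nonneg sig(2) zero_le_power2)
  have R_eq: "R = e' + D + 1"
    unfolding R_def Rconst_def N_def[symmetric] e_def[symmetric] eS D_def[symmetric] e'(1) by simp
  have R1: "1 \<le> R" and RD: "D \<le> R" using R_eq D0 e'(2) by linarith+
  have "AE t in lebesgue_on {0..T}. ereal (N t) \<le> ereal e'" using esssup_AE[of "\<lambda>t. ereal (N t)" "lebesgue_on {0..T}"] unfolding e_def[symmetric] e'(1) .
  then have Ne: "AE t in lborel. t \<in> {0..T} \<longrightarrow> N t \<le> e'" by (simp add: AE_lebesgue_on_iff[OF ST])
  have UVR: "AE t in lborel. t \<in> {0<..<T} \<longrightarrow> (LINT x|lborel. U (t, x) ^ 6) \<le> R ^ 6 \<and> (LINT x|lborel. (V (t, x))\<^sup>2) \<le> R ^ 2"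
    using NN Ne
  proof eventually_elim
    case (elim t)
    show ?case
    proof
      assume "t \<in> {0<..<T}"
      then have "N' t \<le> e'" using elim by auto
      then have n: "N' t \<le> R" using R_eq D0 by linarith
      have p: "(LINT x|lborel. U (t, x) ^ 6) powr (1 / 6) \<le> R" "(LINT x|lborel. (V (t, x))\<^sup>2) powr (1 / 2) \<le> R"
        using n powr_ge_zero[of "LINT x|lborel. U (t, x) ^ 6" "1 / 6"] powr_ge_zero[of "LINT x|lborel. (V (t, x))\<^sup>2" "1 / 2"]
        unfolding N'_def by linarith+
      show "(LINT x|lborel. U (t, x) ^ 6) \<le> R ^ 6 \<and> (LINT x|lborel. (V (t, x))\<^sup>2) \<le> R ^ 2"
        using powr_inverse_le[of "LINT x|lborel. U (t, x) ^ 6" 6 R] powr_inverse_le[of "LINT x|lborel. (V (t, x))\<^sup>2" 2 R] p by simp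
    qed
  qed
  have UR: "AE t in lborel. t \<in> {0<..<T} \<longrightarrow> (LINT x|lborel. U (t, x) ^ 6) \<le> R ^ 6"
    and VR: "AE t in lborel. t \<in> {0<..<T} \<longrightarrow> (LINT x|lborel. (V (t, x))\<^sup>2) \<le> R ^ 2"
    using UVR by (auto elim: eventually_mono)
  have fin: "emeasure lborel \<Omega> < \<infinity>" by (rule emeasure_bounded_finite[OF dom(2)])
  have \<phi>i: "integrable lborel (\<lambda>x. (indicator \<Omega> x * \<phi>' x)\<^sup>2)"
  proof -
    have "indicator \<Omega> x * \<phi>' x = \<phi>' x" for x using phi(2)[rule_format, of x] by (cases "x \<in> \<Omega>") auto
    then show ?thesis using phi(4) by (simp only:)
  qed
  define K3 where "K3 = 2 * (1 + K * (vol + 1)) + c0 + \<phi>2 + K * (vol + 1)"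
  have K30: "0 \<le> K3"
  proof -
    have "0 \<le> K * (vol + 1)" unfolding K_def vol_def using S(1) f(2) by simp
    moreover have "0 \<le> \<phi>2" unfolding \<phi>2_def by (intro Bochner_Integration.integral_nonneg zero_le_power2)
    ultimately show ?thesis using sig(4) by (simp add: K3_def)
  qed
  define B0 where "B0 = K3 * (R ^ 6 * (1 + T))"
  note tr = truncated_weight_bound[OF k m E_eq sig S S6 f iS iU \<phi>i fin phi(1) R1 RD[unfolded D_def] UR VR,
      folded K_def vol_def \<phi>2_def, folded K3_def B0_def]
  have p0: "0 \<le> bump ((real n + 4)\<^sup>2) (T / (real n + 4)) (T - T / (real n + 4)) t * (mult_sqrt k n s)\<^sup>2 * y\<^sup>2" for n t s y
    using bump_nonneg by (intro mult_nonneg_nonneg) auto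
  have gm: "grad_weight k \<in> borel_measurable ?M" using grad_weight_measurable[of k] by (simp cong: measurable_cong_sets)
  note gw = integrable_Fatou[OF tr(1) p0 tr(2) gm grad_weight_tendsto]
  note mx = mixed_norm_bound[OF k gw]
  have pw: "AE t in lborel. t \<in> {0..T} \<longrightarrow> integrable (lebesgue_on \<Omega>) (\<lambda>x. \<bar>u t x\<bar> powr (3 * k + 6)) \<and>
      (LINT x|lebesgue_on \<Omega>. \<bar>u t x\<bar> powr (3 * k + 6)) = (LINT x|lborel. \<bar>U (t, x)\<bar> powr (3 * k + 6))"
  proof (rule open_Icc)
    show "AE t in lborel. t \<in> {0<..<T} \<longrightarrow> integrable (lebesgue_on \<Omega>) (\<lambda>x. \<bar>u t x\<bar> powr (3 * k + 6)) \<and>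
      (LINT x|lebesgue_on \<Omega>. \<bar>u t x\<bar> powr (3 * k + 6)) = (LINT x|lborel. \<bar>U (t, x)\<bar> powr (3 * k + 6))"
      using sec section_power_bound[OF k gw(1)]
    proof eventually_elim
      case (elim t)
      show ?case
      proof
        assume t: "t \<in> {0<..<T}"
        then have "AE x in lborel. x \<in> \<Omega> \<longrightarrow> u t x = U (t, x) \<and> ut t x = V (t, x)" using elim by blast
        then have e: "AE x in lborel. x \<in> \<Omega> \<longrightarrow> \<bar>u t x\<bar> powr (3 * k + 6) = \<bar>U (t, x)\<bar> powr (3 * k + 6)"
          by eventually_elim simp
        have z0: "\<bar>U (t, x)\<bar> powr (3 * k + 6) = 0" if "x \<notin> \<Omega>" for x using z(1)[OF that] by simp
        show "integrable (lebesgue_on \<Omega>) (\<lambda>x. \<bar>u t x\<bar> powr (3 * k + 6)) \<and>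
          (LINT x|lebesgue_on \<Omega>. \<bar>u t x\<bar> powr (3 * k + 6)) = (LINT x|lborel. \<bar>U (t, x)\<bar> powr (3 * k + 6))"
          using lebesgue_on_transfer[OF SO mU(3) z0 e] elim t by blast
      qed
    qed
  qed
  show "AE t in lebesgue_on {0..T}. integrable (lebesgue_on \<Omega>) (\<lambda>x. \<bar>u t x\<bar> powr (3 * k + 6))"
    unfolding AE_lebesgue_on_iff[OF ST] using pw by eventually_elim blast
  define X where "X t = (LINT x|lborel. \<bar>U (t, x)\<bar> powr (3 * k + 6)) powr (1 / 3)" for t
  have Xm: "X \<in> borel_measurable borel" "integrable lborel X" "(LINT t|lborel. X t) \<le> 128 * B0"
    using mx(3,1,2) unfolding X_def .
  have XL: "AE t in lborel. t \<in> {0..T} \<longrightarrow> (Lp_norm (3 * k + 6) \<Omega> (u t)) powr (k + 2) = X t"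
    using pw
  proof eventually_elim
    case (elim t)
    \<comment> \<open>The root in \<open>Lp_norm\<close> combines with the power k + 2 to the cube
      root in X.\<close>
    have ex: "1 / (3 * k + 6) * (k + 2) = 1 / 3" using k by (simp add: field_simps)
    show ?case using elim by (simp add: Lp_norm_def X_def powr_powr ex del: times_divide_eq_left)
  qed
  have X0: "X t = 0" if "t \<notin> {0..T}" for t
    using that zero(1)[of "(t, x)" for x] by (auto simp: X_def cyl_def)
  note fin' = lebesgue_on_transfer[OF ST Xm(1) X0 XL]
  have lint: "(LINT t|lebesgue_on {0..T}. (Lp_norm (3 * k + 6) \<Omega> (u t)) powr (k + 2)) = (LINT t|lborel. X t)"
    by (rule fin'(2))
  show "integrable (lebesgue_on {0..T}) (\<lambda>t. (Lp_norm (3 * k + 6) \<Omega> (u t)) powr (k + 2))"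
    using fin'(1) Xm(2) by blast
  have k2: "0 \<le> 1 / (k + 2)" "1 / (k + 2) \<le> 1 / 2" using k by (simp_all add: field_simps)
  have "0 \<le> (LINT t|lborel. X t)" by (intro Bochner_Integration.integral_nonneg) (simp add: X_def)
  then show "(LINT t|lebesgue_on {0..T}. (Lp_norm (3 * k + 6) \<Omega> (u t)) powr (k + 2)) powr (1 / (k + 2))
      \<le> (1 + 128 * (2 * (1 + K * (vol + 1)) + c0 + \<phi>2 + K * (vol + 1))) * (R ^ 4 * T + R ^ 5)"
    unfolding lint K3_def[symmetric] using Xm(3)[unfolded B0_def] by (intro root_of_integral_bound K30 R1 T k2)
qed

theorem theorem2p2:
  fixes \<Omega> :: "(real^3) set"
    and \<sigma> \<sigma>' f f' f'' :: "real \<Rightarrow> real"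
    and \<phi> :: "real^3 \<Rightarrow> real"
    and \<sigma>0 c1 c2 r m p lam :: real
  assumes dom: "open \<Omega>" "connected \<Omega>" "bounded \<Omega>" "\<Omega> \<noteq> {}" "smooth_boundary \<Omega>"
    and phi: "L2 \<Omega> \<phi>"
    and S1: "\<forall>s. (\<sigma> has_real_derivative \<sigma>' s) (at s)" "continuous_on UNIV \<sigma>'"
            "\<sigma>0 > 0" "\<forall>s. \<sigma> s \<ge> \<sigma>0 * (1 + \<bar>s\<bar> powr r)"
    and S2: "\<forall>s. \<bar>s\<bar> \<ge> 1 \<longrightarrow> \<bar>\<sigma>' s\<bar> \<le> c1 * m * \<bar>s\<bar> powr (m - 1)"
            "0 \<le> r" "r \<le> m" "m \<le> 4"
    and F1: "\<forall>s. (f has_real_derivative f' s) (at s)" "\<forall>s. (f' has_real_derivative f'' s) (at s)"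
            "continuous_on UNIV f''" "f 0 = 0" "f' 0 = 0"
            "\<forall>s. \<bar>f'' s\<bar> \<le> c2 * (1 + \<bar>s\<bar> powr (p - 2))"
            "2 \<le> p" "p \<le> min r (4 - m) + 3"
    and F2: "0 < lam" "lam < lambda1 \<Omega>"
            "Liminf at_infinity (\<lambda>s. ereal (f s / s)) > - ereal lam"
  shows "\<exists>C. \<forall>T u ut. T > 0 \<longrightarrow> weak_solution \<Omega> \<sigma> f \<phi> T u ut \<longrightarrow>
           (let k = min r (4 - m); R = Rconst \<Omega> \<sigma> T u ut in
             (AE t in lebesgue_on {0..T}. integrable (lebesgue_on \<Omega>) (\<lambda>x. \<bar>u t x\<bar> powr (3 * k + 6))) \<and>
             integrable (lebesgue_on {0..T}) (\<lambda>t. (Lp_norm (3 * k + 6) \<Omega> (u t)) powr (k + 2)) \<and>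
             (LINT t|lebesgue_on {0..T}. (Lp_norm (3 * k + 6) \<Omega> (u t)) powr (k + 2)) powr (1 / (k + 2))
               \<le> C * (R ^ 4 * T + R ^ 5))"
proof -
  define k where "k = min r (4 - m)"
  \<comment> \<open>k <= 2 because k is at most both m, through r, and 4 - m; then p <= k + 3 stays
    below 6.\<close>
  have k: "0 \<le> k" "k \<le> 2" and kr: "k \<le> r" and m: "0 \<le> m" "m + k \<le> 4" and p6: "p \<le> 6"
    using S2(2-4) F1(8) by (auto simp: k_def min_def split: if_splits)
  have \<sigma>c: "continuous_on UNIV \<sigma>" using S1(1) by (meson DERIV_isCont continuous_at_imp_continuous_on)
  have fc: "continuous_on UNIV f" using F1(1) by (meson DERIV_isCont continuous_at_imp_continuous_on)
  have \<sigma>d: "(\<sigma> has_real_derivative \<sigma>' s) (at s)" and fd: "(f has_real_derivative f' s) (at s)" "(f' has_real_derivative f'' s) (at s)"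
    and fb: "\<bar>f'' s\<bar> \<le> c2 * (1 + \<bar>s\<bar> powr (p - 2))" for s using S1(1) F1(1,2,6) by auto
  have \<sigma>b: "\<bar>\<sigma>' s\<bar> \<le> c1 * m * \<bar>s\<bar> powr (m - 1)" if "\<bar>s\<bar> \<ge> 1" for s using S2(1) that by auto
  have \<sigma>l: "\<sigma>0 * (1 + \<bar>s\<bar> powr r) \<le> \<sigma> s" for s using S1(4) by auto
  have \<sigma>0: "\<sigma> s \<ge> 0" for s using \<sigma>l[of s] S1(3) by (smt (verit) mult_nonneg_nonneg powr_ge_zero)
  \<comment> \<open>The weight of the multiplier is dominated by the damping, which is what absorbs
    the kinetic term; k <= r enters here.\<close>
  have \<sigma>k: "(1 + s * s) powr (k / 2) \<le> 2 / \<sigma>0 * \<sigma> s" for s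
  proof -
    have "(1 + s * s) powr (k / 2) \<le> 2 * (1 + \<bar>s\<bar> powr r)" by (rule one_plus_powr_le(2)[OF k kr])
    also have "\<dots> = 2 / \<sigma>0 * (\<sigma>0 * (1 + \<bar>s\<bar> powr r))" using S1(3) by simp
    also have "\<dots> \<le> 2 / \<sigma>0 * \<sigma> s" using \<sigma>l S1(3) by (intro mult_left_mono) auto
    finally show ?thesis .
  qed
  have c0: "0 \<le> 2 / \<sigma>0" using S1(3) by simp
  obtain S where S: "S \<ge> 0" "\<And>s. \<bar>\<sigma> s\<bar> \<le> S * (1 + \<bar>s\<bar> powr m)"
    using sigma_growth[OF \<sigma>d \<sigma>b m(1)] by metis
  have S6: "\<sigma> s \<le> (2 * S) * (1 + s ^ 6)" for s
  proof -
    have "S * (1 + \<bar>s\<bar> powr m) \<le> S * (1 + (1 + s ^ 6))"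
      using powr_le_one_plus_power6[OF m(1), of s] S2(4) S(1) by (intro mult_left_mono add_left_mono) auto
    also have "\<dots> \<le> S * (2 * (1 + s ^ 6))" by (intro mult_left_mono S(1)) (simp add: zero_le_even_power)
    also have "\<dots> = (2 * S) * (1 + s ^ 6)" by (simp only: mult_ac)
    finally show ?thesis by (rule order_trans[OF order_trans[OF abs_ge_self S(2)]])
  qed
  obtain F1' where f6: "F1' \<ge> 0" "\<And>s. \<bar>f s\<bar> \<le> F1' * (1 + s ^ 6)"
    using f_growth[OF fd F1(4,5) fb F1(7) p6] by metis
  obtain F where F: "F \<ge> 0" "\<And>s y. s * y \<ge> 0 \<Longrightarrow> - f s * y \<le> F * (1 + \<bar>s\<bar>) * \<bar>y\<bar>"
    using f_lower[OF fc F2(3,1)] by metis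
  have F': "\<forall>s y. s * y \<ge> 0 \<longrightarrow> - f s * y \<le> F * (1 + \<bar>s\<bar>) * \<bar>y\<bar>" using F(2) by blast
  have SO: "\<Omega> \<in> sets borel" using dom(1) by simp
  have \<phi>m: "\<phi> \<in> borel_measurable (lebesgue_on \<Omega>)" using phi by (simp add: L2_def)
  obtain \<phi>' where \<phi>': "\<phi>' \<in> borel_measurable borel" "\<And>x. x \<notin> \<Omega> \<Longrightarrow> \<phi>' x = 0" "AE x in lborel. x \<in> \<Omega> \<longrightarrow> \<phi> x = \<phi>' x"
  proof (rule ex_borel_version[OF SO \<phi>m])
    fix g
    assume g: "g \<in> borel_measurable borel" "\<And>x. x \<notin> \<Omega> \<Longrightarrow> g x = 0" "AE x in lborel. x \<in> \<Omega> \<longrightarrow> \<phi> x = g x"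
    show thesis by (rule that[of g]; fact g)
  qed
  have \<phi>i: "integrable lborel (\<lambda>x. (\<phi>' x)\<^sup>2)" by (rule L2_sq_section[OF SO \<phi>' phi])
  have \<phi>0: "\<forall>x. x \<notin> \<Omega> \<longrightarrow> \<phi>' x = 0" using \<phi>'(2) by blast
  \<comment> \<open>The witness C is left open by \<open>exI\<close> and fixed by unification with
    \<open>weak_solution_estimate\<close>. Its constant is built from S, F, \<sigma>0, the volume of
    \<Omega> and the norm of \<phi>', all chosen before T, u and ut.\<close>
  show ?thesis
    unfolding Let_def k_def[symmetric]
    by (intro exI allI impI conjI;
        rule weak_solution_estimate[OF dom(1,3) _ k m \<sigma>c \<sigma>0 \<sigma>k c0 S S6 fc F(1) F' f6(2) \<phi>'(1) \<phi>0 \<phi>'(3) \<phi>i])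
qed

end
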